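(* Let $Y$ be a block subspace of $\mathfrak{X}_{wh}$, i.e. the closed linear span of a normalized block sequence $(y_n)_n$ of the basis, and let $T:Y\to Y$ be a bounded linear operator. Then $T$ has the form $T=D+S$, where $D:Y\to Y$ is a diagonal operator (with respect to $(y_n)_n$) and $S:Y\to Y$ is strictly singular.
   Context: A block sequence is a sequence of finitely supported vectors $(y_n)$ with $\max\operatorname{ran}y_n<\min\operatorname{ran}y_{n+1}$ ($\operatorname{ran}$ = smallest interval containing the support). A diagonal operator with respect to $(y_n)$ is a bounded operator with $Dy_n=\lambda_ny_n$ for scalars $\lambda_n$. An operator is strictly singular if its restriction to any infinite dimensional subspace is not an isomorphism (onto its image). The space $\mathfrak{X}_{wh}$. $c_{00}$ is the space of finitely supported real sequences with unit vectors $(e_n)$; $\operatorname{supp}x$ is the support of $x$. $Ba(\ell_2)$ is the closed unit ball of $\ell_2$ (finite sequences are regarded as elements of $\ell_2$). Schreier families: $\mathcal{S}_1=\{F\subset\mathbb{N}:|F|\le\min F\}$ and $\mathcal{S}_{n+1}=\{\bigcup_{i=1}^dF_i: F_1<\dots<F_d,\ F_i\in\mathcal{S}_n,\ \{\min F_i\}_{i=1}^d\in\mathcal{S}_1\}$. A finite sequence of sets $(E_i)_{i=1}^d$ is $\mathcal{S}_n$-allowable if the $E_i$ are pairwise disjoint finite subsets of $\mathbb{N}$ and $\{\min E_i\}_{i=1}^d\in\mathcal{S}_n$; a sequence of vectors is $\mathcal{S}_n$-allowable if its supports are. Fix increasing sequences of positive integers $(m_j)_{j\ge0}$, $(n_j)_{j\ge0}$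 with $m_0=m_1=2$, $n_0=1$, and for $j\ge2$: $m_{j+1}\ge m_j^3$, and $n_j$ is such that $\ell_j(n_{j-1}+1)<n_j$, where $\ell_j=3\log_2(m_j)+1$. Fix disjoint infinite $N_1,N_2\subset\mathbb{N}$ with $\mathbb{N}=N_1\cup N_2$, and let $\Sigma$ be the set of finite sequences $(E_i,2j_i)_{i=1}^n$ with $E_i\subset\mathbb{N}$ finite and pairwise disjoint, $j_1<\dots<j_n$, $j_1\in N_1$ and $j_i\in N_2$ for $i>1$. Fix an injective $\sigma:\Sigma\to N_2$ with $m_{2\sigma((E_1,2j_1),\dots,(E_{i+1},2j_{i+1}))}>m_{2\sigma((E_1,2j_1),\dots,(E_i,2j_i))}(\max E_i)^2$ and with $m_{2\sigma((E_1,2j_1),\dots,(E_p,2j_p))}>m_{2j_p}(\max E_p)^2$. A sequence $(E_i,2j_i)_i$ is $\sigma$-special if $j_1\in N_1$ and $\sigma((E_1,2j_1),\dots,(E_i,2j_i))=j_{i+1}$ for each $i\ge1$; a finite $\sigma$-special sequence $(E_i,2j_i)_{i=1}^p$ is $\mathcal{S}_{n_{2j+1}}$ $\sigma$-special if $\{\min E_i\}_{i=1}^p\in\mathcal{S}_{n_{2j+1}}$ and $2j_1>2j+2$. A sequence $(f_i)_{i=1}^p\subset c_{00}$ is an $\mathcal{S}_{n_{2j+1}}$ $\sigma$-special sequence of functionals if there is an $\mathcal{S}_{n_{2j+1}}$ $\sigma$-special sequence $(E_i,2j_i)_{i=1}^p$ with $\operatorname{supp}f_i\subset E_i$ and $w(f_i)=m_{2j_i}$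 for all $i$. $D_{wh}\subset c_{00}$ is the smallest set such that: (1) $\pm e_n^*\in D_{wh}$ for all $n$; (2) for each $j\ge0$, $\frac1{m_{2j}}\sum_{i=1}^d\lambda_if_i\in D_{wh}$ whenever $(f_i)_{i=1}^d\subset D_{wh}$ is $\mathcal{S}_{n_{2j}}$-allowable and $(\lambda_i)\in Ba(\ell_2)$; (3) for each $j\ge 0$, $\frac1{m_{2j+1}}\sum_{i=1}^p\lambda_if_i\in D_{wh}$ whenever $(f_i)_{i=1}^p\subset D_{wh}$ is an $\mathcal{S}_{n_{2j+1}}$ $\sigma$-special sequence of functionals and $(\lambda_i)\in Ba(\ell_2)$. The weight $w(f)$ of a functional produced by (2) or (3) is $m_{2j}$ or $m_{2j+1}$ respectively. $\mathfrak{X}_{wh}$ is the completion of $c_{00}$ under $\|x\|=\sup\{f(x):f\in D_{wh}\}$. *)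

theory Defs
  imports "HOL-Analysis.Analysis"
begin

(* Coordinates are indexed by the positive integers: vectors of c_00 are functions on nat that
   vanish at 0, and all index sets are subsets of {1..}.  Starting at 1 matters, since the
   Schreier condition card F \<le> Min F excludes {0}. *)

definition supp :: "(nat \<Rightarrow> real) \<Rightarrow> nat set" where
  "supp x = {i. x i \<noteq> 0}"

definition c00 :: "(nat \<Rightarrow> real) set" where
  "c00 = {x. finite (supp x) \<and> supp x \<subseteq> {1..}}"

definition unit_vec :: "nat \<Rightarrow> nat \<Rightarrow> real" where
  "unit_vec k = (\<lambda>i. if i = k then 1 else 0)"

definition vec_ran :: "(nat \<Rightarrow> real) \<Rightarrow> nat set" where
  "vec_ran x = {Min (supp x)..Max (supp x)}"

definition block_sequence :: "(nat \<Rightarrow> nat \<Rightarrow> real) \<Rightarrow> bool" where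
  "block_sequence y \<longleftrightarrow>
     (\<forall>k. y k \<in> c00 \<and> supp (y k) \<noteq> {}) \<and>
     (\<forall>k. Max (vec_ran (y k)) < Min (vec_ran (y (Suc k))))"

(* The families of interest are S_n for n \<ge> 1; the value at 0 is the usual convention and
   is not used. *)
fun schreier :: "nat \<Rightarrow> nat set set" where
  "schreier 0 = {F. finite F \<and> F \<subseteq> {1..} \<and> card F \<le> 1}"
| "schreier (Suc 0) = {F. finite F \<and> F \<subseteq> {1..} \<and> (F = {} \<or> card F \<le> Min F)}"
| "schreier (Suc (Suc k)) =
     {(\<Union>i<d. F i) | d F.
        (\<forall>i<d. F i \<in> schreier (Suc k) \<and> F i \<noteq> {}) \<and>
        (\<forall>i. Suc i < d \<longrightarrow> Max (F i) < Min (F (Suc i))) \<and>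
        (\<lambda>i. Min (F i)) ` {..<d} \<in> schreier (Suc 0)}"

definition allowable :: "nat \<Rightarrow> nat \<Rightarrow> (nat \<Rightarrow> nat set) \<Rightarrow> bool" where
  "allowable k d E \<longleftrightarrow>
     (\<forall>i<d. finite (E i) \<and> E i \<noteq> {} \<and> E i \<subseteq> {1..}) \<and>
     disjoint_family_on E {..<d} \<and>
     (\<lambda>i. Min (E i)) ` {..<d} \<in> schreier k"

(* A list entry (E, j) encodes the pair (E, 2j). *)
definition Sigma_seqs :: "nat set \<Rightarrow> nat set \<Rightarrow> (nat set \<times> nat) list set" where
  "Sigma_seqs N1 N2 = {s. s \<noteq> [] \<and>
     (\<forall>i<length s. finite (fst (s ! i)) \<and> fst (s ! i) \<noteq> {} \<and> fst (s ! i) \<subseteq> {1..}) \<and>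
     disjoint_family_on (\<lambda>i. fst (s ! i)) {..<length s} \<and>
     sorted_wrt (<) (map snd s) \<and>
     snd (s ! 0) \<in> N1 \<and>
     (\<forall>i. 0 < i \<and> i < length s \<longrightarrow> snd (s ! i) \<in> N2)}"

locale wh_parameters =
  fixes m n :: "nat \<Rightarrow> nat"
    and N1 N2 :: "nat set"
    and \<sigma> :: "(nat set \<times> nat) list \<Rightarrow> nat"
  assumes m_0: "m 0 = 2" and m_1: "m 1 = 2"
    and m_increasing: "strict_mono_on {1..} m"
    and m_growth: "\<And>j. j \<ge> 2 \<Longrightarrow> m (Suc j) \<ge> m j ^ 3"
    and n_0: "n 0 = 1"
    and n_increasing: "strict_mono n"
    and n_growth: "\<And>j. j \<ge> 2 \<Longrightarrow>
          (3 * log 2 (real (m j)) + 1) * (real (n (j - 1)) + 1) < real (n j)"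
    and N_infinite: "infinite N1" "infinite N2"
    and N_disjoint: "N1 \<inter> N2 = {}"
    and N_union: "N1 \<union> N2 = {1..}"
    and \<sigma>_range: "\<sigma> ` Sigma_seqs N1 N2 \<subseteq> N2"
    and \<sigma>_inj: "inj_on \<sigma> (Sigma_seqs N1 N2)"
    and \<sigma>_growth_prefix: "\<And>s x. s \<noteq> [] \<Longrightarrow> s @ [x] \<in> Sigma_seqs N1 N2 \<Longrightarrow>
          m (2 * \<sigma> (s @ [x])) > m (2 * \<sigma> s) * Max (fst (last s)) ^ 2"
    and \<sigma>_growth_last: "\<And>s. s \<in> Sigma_seqs N1 N2 \<Longrightarrow>
          m (2 * \<sigma> s) > m (2 * snd (last s)) * Max (fst (last s)) ^ 2"

definition sigma_special ::
  "nat set \<Rightarrow> nat set \<Rightarrow> ((nat set \<times> nat) list \<Rightarrow> nat) \<Rightarrow> (nat set \<times> nat) list \<Rightarrow> bool" where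
  "sigma_special N1 N2 \<sigma> s \<longleftrightarrow>
     s \<in> Sigma_seqs N1 N2 \<and>
     (\<forall>i. 1 \<le> i \<and> i < length s \<longrightarrow> \<sigma> (take i s) = snd (s ! i))"

(* The S_{n_{2j+1}} sigma-special sequences. *)
definition schreier_sigma_special ::
  "(nat \<Rightarrow> nat) \<Rightarrow> nat set \<Rightarrow> nat set \<Rightarrow> ((nat set \<times> nat) list \<Rightarrow> nat) \<Rightarrow>
   nat \<Rightarrow> (nat set \<times> nat) list \<Rightarrow> bool" where
  "schreier_sigma_special n N1 N2 \<sigma> j s \<longleftrightarrow>
     sigma_special N1 N2 \<sigma> s \<and>
     (\<lambda>i. Min (fst (s ! i))) ` {..<length s} \<in> schreier (n (2 * j + 1)) \<and>
     2 * snd (s ! 0) > 2 * j + 2"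

(* The weight is not a function of the underlying vector, since one vector may be produced in
   several ways.  Hence membership in D_wh and the relation "f is produced with weight w" are
   defined simultaneously. *)
inductive wh_functional ::
    "(nat \<Rightarrow> nat) \<Rightarrow> (nat \<Rightarrow> nat) \<Rightarrow> nat set \<Rightarrow> nat set \<Rightarrow>
    ((nat set \<times> nat) list \<Rightarrow> nat) \<Rightarrow> (nat \<Rightarrow> real) \<Rightarrow> bool"
  and wh_weight ::
    "(nat \<Rightarrow> nat) \<Rightarrow> (nat \<Rightarrow> nat) \<Rightarrow> nat set \<Rightarrow> nat set \<Rightarrow>
    ((nat set \<times> nat) list \<Rightarrow> nat) \<Rightarrow> (nat \<Rightarrow> real) \<Rightarrow> nat \<Rightarrow> bool"
  for m n :: "nat \<Rightarrow> nat" and N1 N2 :: "nat set" and \<sigma> :: "(nat set \<times> nat) list \<Rightarrow> nat"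
where
  unit_pos: "k \<ge> 1 \<Longrightarrow> wh_functional m n N1 N2 \<sigma> (unit_vec k)"
| unit_neg: "k \<ge> 1 \<Longrightarrow> wh_functional m n N1 N2 \<sigma> (\<lambda>i. - unit_vec k i)"
| weighted: "wh_weight m n N1 N2 \<sigma> f w \<Longrightarrow> wh_functional m n N1 N2 \<sigma> f"
| even_weight:
    "(\<forall>i<d. wh_functional m n N1 N2 \<sigma> (f i)) \<Longrightarrow>
     allowable (n (2 * j)) d (\<lambda>i. supp (f i)) \<Longrightarrow>
     (\<Sum>i<d. (a i)\<^sup>2) \<le> 1 \<Longrightarrow>
     wh_weight m n N1 N2 \<sigma> (\<lambda>k. 1 / real (m (2 * j)) * (\<Sum>i<d. a i * f i k)) (m (2 * j))"
| odd_weight: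
    "(\<forall>i<length s. wh_functional m n N1 N2 \<sigma> (f i)) \<Longrightarrow>
     schreier_sigma_special n N1 N2 \<sigma> j s \<Longrightarrow>
     (\<forall>i<length s. supp (f i) \<subseteq> fst (s ! i) \<and>
        wh_weight m n N1 N2 \<sigma> (f i) (m (2 * snd (s ! i)))) \<Longrightarrow>
     (\<Sum>i<length s. (a i)\<^sup>2) \<le> 1 \<Longrightarrow>
     wh_weight m n N1 N2 \<sigma> (\<lambda>k. 1 / real (m (2 * j + 1)) * (\<Sum>i<length s. a i * f i k))
       (m (2 * j + 1))"

definition D_wh ::
  "(nat \<Rightarrow> nat) \<Rightarrow> (nat \<Rightarrow> nat) \<Rightarrow> nat set \<Rightarrow> nat set \<Rightarrow> ((nat set \<times> nat) list \<Rightarrow> nat) \<Rightarrow>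
   (nat \<Rightarrow> real) set" where
  "D_wh m n N1 N2 \<sigma> = {f. wh_functional m n N1 N2 \<sigma> f}"

(* All coefficients of elements of D_wh lie in [-1, 1], so for x in c_00 the supremum is taken
   over a bounded set. *)
definition wh_norm ::
  "(nat \<Rightarrow> nat) \<Rightarrow> (nat \<Rightarrow> nat) \<Rightarrow> nat set \<Rightarrow> nat set \<Rightarrow> ((nat set \<times> nat) list \<Rightarrow> nat) \<Rightarrow>
   (nat \<Rightarrow> real) \<Rightarrow> real" where
  "wh_norm m n N1 N2 \<sigma> x = (SUP f\<in>D_wh m n N1 N2 \<sigma>. \<Sum>i\<in>supp x. f i * x i)"

(* The linear map from c_00 into a vector space that sends the k-th unit vector to e k. *)
definition c00_embed :: "(nat \<Rightarrow> 'a::real_vector) \<Rightarrow> (nat \<Rightarrow> real) \<Rightarrow> 'a" where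
  "c00_embed e x = (\<Sum>i\<in>supp x. x i *\<^sub>R e i)"

(* The Banach space 'a is the completion of c_00 with respect to the given norm, with e k (k \<ge> 1)
   the image of the k-th unit vector; e 0 is irrelevant. *)
definition is_completion_of_c00 ::
  "((nat \<Rightarrow> real) \<Rightarrow> real) \<Rightarrow> (nat \<Rightarrow> 'a::banach) \<Rightarrow> bool" where
  "is_completion_of_c00 N e \<longleftrightarrow>
     (\<forall>x\<in>c00. norm (c00_embed e x) = N x) \<and> closure (c00_embed e ` c00) = UNIV"

(* Operators Y \<rightarrow> Y on a subspace Y of 'a are represented by functions on 'a of which only the
   values on Y matter. *)
definition bounded_operator_on :: "'a::real_normed_vector set \<Rightarrow> ('a \<Rightarrow> 'a) \<Rightarrow> bool" where
  "bounded_operator_on Y T \<longleftrightarrow>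
     T ` Y \<subseteq> Y \<and>
     (\<forall>u\<in>Y. \<forall>v\<in>Y. T (u + v) = T u + T v) \<and>
     (\<forall>c. \<forall>u\<in>Y. T (c *\<^sub>R u) = c *\<^sub>R T u) \<and>
     (\<exists>K. \<forall>u\<in>Y. norm (T u) \<le> K * norm u)"

definition diagonal_operator_on ::
  "'a::real_normed_vector set \<Rightarrow> (nat \<Rightarrow> 'a) \<Rightarrow> ('a \<Rightarrow> 'a) \<Rightarrow> bool" where
  "diagonal_operator_on Y y D \<longleftrightarrow>
     bounded_operator_on Y D \<and> (\<exists>c :: nat \<Rightarrow> real. \<forall>k. D (y k) = c k *\<^sub>R y k)"

definition infinite_dimensional :: "'a::real_vector set \<Rightarrow> bool" where
  "infinite_dimensional Z \<longleftrightarrow> \<not> (\<exists>B. finite B \<and> Z \<subseteq> span B)"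

definition strictly_singular_on :: "'a::real_normed_vector set \<Rightarrow> ('a \<Rightarrow> 'a) \<Rightarrow> bool" where
  "strictly_singular_on Y S \<longleftrightarrow>
     bounded_operator_on Y S \<and>
     (\<forall>Z. subspace Z \<and> Z \<subseteq> Y \<and> infinite_dimensional Z \<longrightarrow>
        \<not> (\<exists>R. homeomorphism Z (S ` Z) S R))"

end

(* Squaring linearises the norm: since the functionals of D_wh carry square summable coefficients,
   the square of the norm of x is the supremum of g applied to the sequence of squares of x, over a
   set of trees with squared weights and no coefficients. All estimates are made for such trees on
   nonnegative sequences.

   The diagonal D of T is bounded, because |lambda_k| <= ||T|| and the basis is unconditional; put
   S = T - D. If S were bounded below on an infinite dimensional subspace, a gliding hump gives
   finitely supported far out vectors w on which S is bounded below, and one can take them to be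
   averages of large complexity. As S has zero diagonal, averaging over all subsets A of the
   coordinates yields disjoint pieces u = P_B w and v = P_A S u with ||v|| >= c ||u||. Combine such
   pieces into vectors U_i and V_i, where V_i is normed by a functional of weight m_{2 j_i} supported
   in E_i, E_i is disjoint from the supports of all U_k, and (E_i, 2 j_i) is sigma-special. The
   special functional gives || sum V_i ||^2 >= c / m_{2j+1}^2 for suitable averages, while functionals
   of weight m_{2j+1} do not act on sum U_i and || sum U_i ||^2 <= C / m_{2j+1}^4. The block diagonal
   operator that sends U_i to V_i is an average of sign changes of S, hence bounded, which is a
   contradiction for large j. *)
theory Submission
  imports Defs
begin

section \<open>Schreier families\<close>

text \<open>Counting replaces them: \<open>Msm\<close> families carry no order and pull back along
  injections, and a disjoint family whose members all meet \<open>{..<Q}\<close> has at most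
  \<open>Q\<close> members, hence complexity 1 beyond \<open>Q\<close>. So on the k-th vector of a
  rapid sequence only a family of complexity 1 has to be estimated, apart from a set of k to which a
  basic average gives negligible mass. This is \<open>core_average\<close>; every upper estimate of
  a long combination goes through it, each time with another notion of exceptional index.

  The growth of \<open>n\<close> enters only through \<open>truncation_depth\<close>: a tree stopped
  at all weights of index at least L can be cut after about 2 log_2 (m L) levels, where the
  coefficients have dropped to \<open>\<theta> L ^ 2\<close> while the complexity spent is still
  below \<open>n L\<close>. Both the existence of averages and the estimates on them rest on this.
  The gap \<open>m (Suc j) \<ge> m j ^ 3\<close> gives
  \<open>\<theta> J \<le> \<theta> L ^ 3\<close> for J > L, so that a functional of the wrong weight
  gains the square of \<open>\<theta>\<close>, one factor more than the special functional
  loses.\<close>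

lemma schreier_finite:
  assumes "B \<in> schreier k"
  shows "finite B" "B \<subseteq> {1..}"
proof -
  have "finite B \<and> B \<subseteq> {1..}"
    using assms
  proof (induction k arbitrary: B rule: schreier.induct)
    case (3 k)
    then obtain d :: nat and F where B: "B = (\<Union>i<d. F i)" and F: "\<And>i. i < d \<Longrightarrow> F i \<in> schreier (Suc k)"
      unfolding schreier.simps mem_Collect_eq by metis
    have "finite (F i) \<and> F i \<subseteq> {1..}" if "i < d" for i
      using 3(1)[of 0 1, OF _ F[OF that]] by simp
    then show ?case unfolding B by blast
  qed auto
  then show "finite B" "B \<subseteq> {1..}" by auto
qed

lemma schreier_empty [simp]: "{} \<in> schreier k"
  by (induction k rule: schreier.induct) (auto intro!: exI[of _ 0])

text \<open>Colouring \<open>b\<close> by its rank in \<open>B\<close> uses \<open>card B\<close>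
  colours and has classes with at most one element. This is the step from the cardinality condition
  to colourings in the base case below.\<close>

lemma schreier_one_colouring:
  assumes "finite B" "B \<subseteq> {1..}" "\<And>b. b \<in> B \<Longrightarrow> card B \<le> b"
  shows "\<exists>d c. mono_on B c \<and> c ` B \<subseteq> {..<d} \<and> (\<forall>b\<in>B. d \<le> b) \<and>
           (\<forall>x<d. {b\<in>B. c b = x} \<in> schreier 0)"
proof -
  define c where "c b = card {b' \<in> B. b' < b}" for b
  have strict: "c b < c b'" if "b \<in> B" "b' \<in> B" "b < b'" for b b'
    unfolding c_def using that assms(1) by (intro psubset_card_mono) auto
  have "mono_on B c"
    using strict by (intro mono_onI) (metis le_eq_less_or_eq less_imp_le)
  moreover have "c ` B \<subseteq> {..<card B}"
    unfolding c_def using assms(1) by (auto intro!: psubset_card_mono)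
  moreover have "{b\<in>B. c b = x} \<in> schreier 0" for x
  proof -
    have "b = b'" if "b \<in> B" "b' \<in> B" "c b = c b'" for b b'
      using strict that by (metis less_irrefl linorder_neqE_nat)
    then have "card {b\<in>B. c b = x} \<le> 1"
      using assms(1) by (intro card_le_Suc0_iff_eq[THEN iffD2, unfolded One_nat_def[symmetric]]) auto
    then show ?thesis using assms by auto
  qed
  ultimately show ?thesis using assms(3) by blast
qed

text \<open>Indexed unions of successive blocks are awkward to restrict and to transport; a monotone
  colouring does both by composition. Empty classes are allowed and \<open>d\<close> is only an
  upper bound for the number of colours, so subsets inherit the colouring unchanged. The condition
  on the minima of the blocks becomes \<open>d \<le> b\<close> for all \<open>b\<close>, because the
  least of these minima is the least element of \<open>B\<close>.\<close>

lemma schreier_Suc_iff: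
  "B \<in> schreier (Suc k) \<longleftrightarrow> finite B \<and> B \<subseteq> {1..} \<and>
     (\<exists>d c. mono_on B c \<and> c ` B \<subseteq> {..<d} \<and> (\<forall>b\<in>B. d \<le> b) \<and>
        (\<forall>x<d. {b\<in>B. c b = x} \<in> schreier k))" (is "?L \<longleftrightarrow> ?R")
proof (cases k)
  case 0
  show ?thesis
  proof
    assume L: ?L
    then have "card B \<le> b" if "b \<in> B" for b
      using 0 that order_trans[OF _ Min_le[of B b]] by auto
    then show ?R using schreier_one_colouring[of B] L 0 by auto
  next
    assume R: ?R
    then obtain d c where c: "c ` B \<subseteq> {..<d}" "\<forall>b\<in>B. d \<le> b"
        "\<forall>x<d. {b\<in>B. c b = x} \<in> schreier 0" and B: "finite B" "B \<subseteq> {1..}"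
      using 0 by auto
    have "inj_on c B"
    proof (rule inj_onI)
      fix b b' assume bb: "b \<in> B" "b' \<in> B" "c b = c b'"
      then have "card {z\<in>B. c z = c b} \<le> 1" using c by auto
      moreover have "finite {z\<in>B. c z = c b}" using B by auto
      ultimately show "b = b'"
        using bb card_le_Suc0_iff_eq[of "{z\<in>B. c z = c b}"] by auto
    qed
    then have "card B \<le> d" using c(1) card_inj_on_le[of c B "{..<d}"] by auto
    then have "card B \<le> Min B" if "B \<noteq> {}" using c(2) Min_in[OF B(1) that] le_trans by blast
    then show ?L unfolding 0 schreier.simps mem_Collect_eq using B by blast
  qed
next
  case (Suc k')
  show ?thesis
  proof
    assume L: ?L
    then obtain d F where BF: "B = (\<Union>i<d. F i)"
      and F: "\<And>i. i < d \<Longrightarrow> F i \<in> schreier k" "\<And>i. i < d \<Longrightarrow> F i \<noteq> {}"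
      and suc: "\<And>i. Suc i < d \<Longrightarrow> Max (F i) < Min (F (Suc i))"
      and mins: "(\<lambda>i. Min (F i)) ` {..<d} \<in> schreier (Suc 0)"
      unfolding Suc by auto
    have fin: "finite (F i)" if "i < d" for i using F(1) that schreier_finite by blast
    have lt: "Max (F i) < Min (F j)" if "i < j" "j < d" for i j
      using that
    proof (induction j)
      case (Suc j)
      then show ?case
      proof (cases "i = j")
        case False
        then have "Max (F i) < Min (F j)" using Suc by auto
        also have "Min (F j) \<le> Max (F j)" using F(2)[of j] fin[of j] Suc by auto
        also have "Max (F j) < Min (F (Suc j))" using suc Suc by auto
        finally show ?thesis .
      qed (use suc in auto)
    qed auto
    have ord: "b < b'" if "b \<in> F i" "b' \<in> F j" "i < j" "j < d" for b b' i j
      using lt[OF that(3,4)] Max_ge[OF fin[of i] that(1)] Min_le[OF fin[of j] that(2)] that by linarith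
    have uniq: "i = j" if "b \<in> F i" "b \<in> F j" "i < d" "j < d" for b i j
      using ord that by (metis less_irrefl linorder_neqE_nat)
    define c where "c b = (THE i. i < d \<and> b \<in> F i)" for b
    have c: "c b = i" if "b \<in> F i" "i < d" for b i
      unfolding c_def using that uniq by blast
    have minF: "Min (F i) < Min (F j)" if "i < j" "j < d" for i j
    proof -
      have "Min (F i) \<le> Max (F i)" using F(2)[of i] fin[of i] that by auto
      then show ?thesis using lt[OF that] by linarith
    qed
    have "inj_on (\<lambda>i. Min (F i)) {..<d}"
      by (intro inj_onI) (metis lessThan_iff less_irrefl linorder_neqE_nat minF)
    then have card: "card ((\<lambda>i. Min (F i)) ` {..<d}) = d" by (simp add: card_image)
    have "d \<le> b" if b: "b \<in> B" for b
    proof -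
      obtain i where i: "i < d" "b \<in> F i" using b BF by auto
      have "d \<le> Min ((\<lambda>i. Min (F i)) ` {..<d})" using mins card i by auto
      also have "\<dots> \<le> Min (F i)" using i by auto
      also have "\<dots> \<le> b" using Min_le[OF fin] i by auto
      finally show ?thesis .
    qed
    moreover have "mono_on B c"
    proof (rule mono_onI)
      fix b b' assume b: "b \<in> B" "b' \<in> B" "b \<le> b'"
      then obtain i j where ij: "i < d" "b \<in> F i" "j < d" "b' \<in> F j" using BF by auto
      then have "\<not> j < i" using ord[of b' j b i] b by auto
      then show "c b \<le> c b'" using c ij by auto
    qed
    moreover have "c ` B \<subseteq> {..<d}" using c BF by auto
    moreover have "{b\<in>B. c b = x} \<in> schreier k" if "x < d" for x
    proof -
      have "{b\<in>B. c b = x} = F x" using c BF that by auto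
      then show ?thesis using F(1) that by simp
    qed
    ultimately show ?R using schreier_finite[OF L] by blast
  next
    assume R: ?R
    then obtain d c where mono: "mono_on B c" and cB: "c ` B \<subseteq> {..<d}" and db: "\<forall>b\<in>B. d \<le> b"
        and fib: "\<forall>x<d. {b\<in>B. c b = x} \<in> schreier k" and B: "finite B" "B \<subseteq> {1..}"
      by auto
    \<comment> \<open>The colours that occur, in increasing order: this drops the empty classes and
      turns monotonicity of \<open>c\<close> into the order of the blocks.\<close>
    define xs where "xs = sorted_list_of_set (c ` B)"
    define F where "F i = {b\<in>B. c b = xs ! i}" for i
    have xs: "set xs = c ` B" "sorted_wrt (<) xs" "distinct xs"
      unfolding xs_def using B by auto
    have "length xs = card (c ` B)" using xs distinct_card by metis
    then have len: "length xs \<le> d" using card_mono[OF _ cB] by auto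
    have FB: "B = (\<Union>i<length xs. F i)"
    proof
      show "B \<subseteq> (\<Union>i<length xs. F i)"
      proof
        fix b assume b: "b \<in> B"
        then obtain i where "i < length xs" "xs ! i = c b"
          using xs(1) by (metis imageI in_set_conv_nth)
        then show "b \<in> (\<Union>i<length xs. F i)" using b unfolding F_def by force
      qed
    qed (auto simp: F_def)
    have finF: "finite (F i)" for i unfolding F_def using B by auto
    have F: "F i \<in> schreier (Suc k')" "F i \<noteq> {}" if "i < length xs" for i
    proof -
      have *: "xs ! i \<in> c ` B" using that xs(1) nth_mem by metis
      then show "F i \<noteq> {}" unfolding F_def by auto
      show "F i \<in> schreier (Suc k')" using * cB fib unfolding F_def Suc by auto
    qed
    have FM: "Max (F i) < Min (F (Suc i))" if "Suc i < length xs" for i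
    proof -
      have "Max (F i) \<in> F i" "Min (F (Suc i)) \<in> F (Suc i)"
        using Max_in[OF finF F(2)[of i]] Min_in[OF finF F(2)[of "Suc i"]] that by auto
      moreover have "xs ! i < xs ! Suc i"
        using xs(2) that by (simp add: sorted_wrt_iff_nth_less)
      ultimately show ?thesis
        using mono unfolding F_def mono_on_def
        by (smt (verit) leD linorder_le_less_linear mem_Collect_eq)
    qed
    have mins: "(\<lambda>i. Min (F i)) ` {..<length xs} \<in> schreier (Suc 0)"
    proof -
      have minB: "Min (F i) \<in> B" if "i < length xs" for i
        using Min_in[OF finF F(2)[OF that]] FB that by auto
      have "card ((\<lambda>i. Min (F i)) ` {..<length xs}) \<le> d"
        using card_image_le[of "{..<length xs}" "\<lambda>i. Min (F i)"] len by auto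
      moreover have "d \<le> Min (F i)" if "i < length xs" for i using minB that db by auto
      ultimately have "card ((\<lambda>i. Min (F i)) ` {..<length xs}) \<le> b"
        if "b \<in> (\<lambda>i. Min (F i)) ` {..<length xs}" for b using that le_trans by blast
      moreover have "(\<lambda>i. Min (F i)) ` {..<length xs} \<subseteq> {1..}" using B(2) minB by blast
      ultimately show ?thesis unfolding schreier.simps mem_Collect_eq by (metis Min_in finite_imageI finite_lessThan)
    qed
    show ?L unfolding Suc schreier.simps(3) mem_Collect_eq
      by (intro exI[of _ "length xs"] exI[of _ F]) (use FB F FM mins in simp)
  qed
qed

section \<open>Monotonicity, spreading and composition of Schreier families\<close>

lemma schreier_Suc_mono: "B \<in> schreier k \<Longrightarrow> B \<in> schreier (Suc k)"
proof (cases "B = {}")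
  case False
  assume B: "B \<in> schreier k"
  have "mono_on B (\<lambda>_. 0::nat)" by (simp add: mono_on_def)
  moreover have "{b \<in> B. (0::nat) = x} \<in> schreier k" if "x < 1" for x
    using B that by simp
  moreover have "\<forall>b\<in>B. 1 \<le> b" using schreier_finite(2)[OF B] by auto
  ultimately show ?thesis
    unfolding schreier_Suc_iff using schreier_finite[OF B]
    by (intro conjI exI[of _ "1::nat"] exI[of _ "\<lambda>_. 0::nat"]) auto
qed simp

lemma schreier_mono: "B \<in> schreier k \<Longrightarrow> k \<le> l \<Longrightarrow> B \<in> schreier l"
  using schreier_Suc_mono lift_Suc_mono_le[of schreier k l] by blast

text \<open>The colouring of \<open>A\<close> pulls back along \<open>g\<close>; since
  \<open>g b \<le> b\<close>, a number of colours admissible at \<open>g b\<close> is admissible at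
  \<open>b\<close>.\<close>

lemma schreier_spread_mono:
  assumes "A \<in> schreier k" "finite B" "B \<subseteq> {1..}" "g ` B \<subseteq> A" "inj_on g B" "mono_on B g"
    "\<And>b. b \<in> B \<Longrightarrow> g b \<le> b"
  shows "B \<in> schreier k"
  using assms
proof (induction k arbitrary: A B)
  case 0
  then show ?case using card_inj_on_le[of g B A] by auto
next
  case (Suc k)
  from Suc.prems(1) obtain d c where c: "mono_on A c" "c ` A \<subseteq> {..<d}" "\<forall>b\<in>A. d \<le> b"
      "\<forall>x<d. {b\<in>A. c b = x} \<in> schreier k"
    unfolding schreier_Suc_iff by auto
  have "mono_on B (c \<circ> g)"
    using c(1) Suc.prems(4,6) unfolding mono_on_def by (auto simp: image_subset_iff)
  moreover have "(c \<circ> g) ` B \<subseteq> {..<d}" using c(2) Suc.prems(4) by auto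
  moreover have "\<forall>b\<in>B. d \<le> b" using c(3) Suc.prems(4,7) by (meson image_subset_iff le_trans)
  moreover have "\<forall>x<d. {b\<in>B. (c \<circ> g) b = x} \<in> schreier k"
  proof (intro allI impI)
    fix x assume x: "x < d"
    show "{b\<in>B. (c \<circ> g) b = x} \<in> schreier k"
    proof (rule Suc.IH[of "{b\<in>A. c b = x}"])
      show "mono_on {b \<in> B. (c \<circ> g) b = x} g"
        using Suc.prems(6) by (auto simp: mono_on_def)
      show "inj_on g {b \<in> B. (c \<circ> g) b = x}"
        using Suc.prems(5) by (rule inj_on_subset) auto
    qed (use c(4) x Suc.prems in auto)
  qed
  ultimately show ?case unfolding schreier_Suc_iff using Suc.prems(2,3) by blast
qed

text \<open>Needed because supports may interlace: a map from new starting points to old ones is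
  injective and lies below the identity, but need not be increasing. The induction matches the
  largest point with the largest value.\<close>

lemma mono_on_matching:
  fixes g :: "nat \<Rightarrow> nat"
  assumes "finite B" "inj_on g B" "\<And>b. b \<in> B \<Longrightarrow> g b \<le> b"
  shows "\<exists>g'. g' ` B \<subseteq> g ` B \<and> inj_on g' B \<and> mono_on B g' \<and> (\<forall>b\<in>B. g' b \<le> b)"
  using assms
proof (induction "card B" arbitrary: B g)
  case 0
  then show ?case by (auto simp: mono_on_def)
next
  case (Suc k)
  then have ne: "B \<noteq> {}" by auto
  define M where "M = Max B"
  have M: "M \<in> B" "\<And>b. b \<in> B \<Longrightarrow> b \<le> M"
    unfolding M_def using Suc.prems(1) ne by auto
  define N where "N = Max (g ` B)"
  have N: "N \<in> g ` B" "\<And>b. b \<in> B \<Longrightarrow> g b \<le> N"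
    unfolding N_def using Suc.prems(1) ne by (auto simp del: Max_in intro!: Max_in)
  then obtain b0 where b0: "b0 \<in> B" "g b0 = N" by auto
  define B' where "B' = B - {M}"
  \<comment> \<open>Exchange the values at M and at the point where g is largest, then drop M.\<close>
  define g1 where "g1 b = (if b = b0 then g M else g b)" for b
  have img: "g1 ` B' \<subseteq> g ` B - {N}" and inj1: "inj_on g1 B'"
    using Suc.prems(2) b0 M(1) unfolding g1_def B'_def inj_on_def by (auto split: if_splits)+
  have le1: "g1 b \<le> b" if "b \<in> B'" for b
  proof (cases "b = b0")
    case True
    then show ?thesis using N(2)[OF M(1)] b0 Suc.prems(3)[OF b0(1)] by (simp add: g1_def)
  next
    case False
    then show ?thesis using Suc.prems(3)[of b] that by (auto simp: g1_def B'_def)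
  qed
  have "k = card B'" using Suc.hyps(2) M(1) Suc.prems(1) unfolding B'_def by auto
  then obtain g' where g': "g' ` B' \<subseteq> g1 ` B'" "inj_on g' B'" "mono_on B' g'" "\<forall>b\<in>B'. g' b \<le> b"
    using Suc.hyps(1)[of B' g1] inj1 le1 Suc.prems(1) unfolding B'_def by auto
  define h where "h b = (if b = M then N else g' b)" for b
  have lt: "g' b < N" if "b \<in> B'" for b
  proof -
    have "g' b \<in> g ` B - {N}" using g'(1) img that by blast
    then show ?thesis using N(2) by (metis DiffE imageE insertI1 le_neq_implies_less)
  qed
  have NM: "N \<le> M" using b0 Suc.prems(3) M(2) le_trans by metis
  have "h ` B \<subseteq> g ` B" using g'(1) img N(1) unfolding h_def B'_def by auto
  moreover have "inj_on h B"
    using g'(2) lt unfolding inj_on_def h_def B'_def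
    by (metis DiffI less_irrefl singletonD)
  moreover have "mono_on B h"
  proof (rule mono_onI)
    fix r s assume rs: "r \<in> B" "s \<in> B" "r \<le> s"
    show "h r \<le> h s"
    proof (cases "s = M")
      case True
      then show ?thesis using lt[of r] rs unfolding h_def B'_def by (cases "r = M") auto
    next
      case False
      then have "r \<noteq> M" using M(2)[OF rs(2)] rs by auto
      then show ?thesis using g'(3) False rs unfolding h_def B'_def mono_on_def by auto
    qed
  qed
  moreover have "\<forall>b\<in>B. h b \<le> b" using g'(4) NM unfolding h_def B'_def by auto
  ultimately show ?case by blast
qed

lemma schreier_spread:
  assumes "A \<in> schreier k" "finite B" "B \<subseteq> {1..}" "g ` B \<subseteq> A" "inj_on g B"
    "\<And>b. b \<in> B \<Longrightarrow> g b \<le> b"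
  shows "B \<in> schreier k"
proof -
  obtain g' where "g' ` B \<subseteq> g ` B" "inj_on g' B" "mono_on B g'" "\<forall>b\<in>B. g' b \<le> b"
    using mono_on_matching[of B g] assms by blast
  then show ?thesis using schreier_spread_mono[of A k B g'] assms by blast
qed

lemma schreier_subset: "A \<in> schreier k \<Longrightarrow> B \<subseteq> A \<Longrightarrow> B \<in> schreier k"
  using schreier_finite[of A k] finite_subset[of B A]
  by (intro schreier_spread[of A k B "\<lambda>x. x"]) auto

text \<open>By the order conditions \<open>F a\<close> starts at \<open>a\<close> or later and ends
  before the next point of \<open>A\<close>, so a colouring of \<open>A\<close> lifts to the union:
  a point of \<open>F a\<close> gets the colour of \<open>a\<close>. This adds up the complexities
  of nested basic averages.\<close>

lemma schreier_compose:
  assumes "A \<in> schreier s" "\<And>a. a \<in> A \<Longrightarrow> F a \<in> schreier r"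
    "\<And>a b. a \<in> A \<Longrightarrow> b \<in> F a \<Longrightarrow> a \<le> b"
    "\<And>a a' b. a \<in> A \<Longrightarrow> a' \<in> A \<Longrightarrow> a < a' \<Longrightarrow> b \<in> F a \<Longrightarrow> b < a'"
  shows "(\<Union>a\<in>A. F a) \<in> schreier (r + s)"
  using assms
proof (induction s arbitrary: A)
  case 0
  show ?case
  proof (cases "A = {}")
    case False
    then have "card A \<noteq> 0" "card A \<le> 1" using 0 by auto
    then have "card A = 1" by linarith
    then obtain a where "A = {a}" using card_1_singletonE by blast
    then show ?thesis using 0 by auto
  qed simp
next
  case (Suc s)
  from Suc.prems(1) obtain d c where c: "mono_on A c" "c ` A \<subseteq> {..<d}" "\<forall>b\<in>A. d \<le> b"
      "\<forall>x<d. {b\<in>A. c b = x} \<in> schreier s" and finA: "finite A"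
    unfolding schreier_Suc_iff by auto
  let ?B = "\<Union>a\<in>A. F a"
  have uniq: "a = a'" if "a \<in> A" "a' \<in> A" "b \<in> F a" "b \<in> F a'" for a a' b
  proof (rule ccontr)
    assume "a \<noteq> a'"
    then consider "a < a'" | "a' < a" by linarith
    then show False
      using that Suc.prems(3)[of a b] Suc.prems(3)[of a' b] Suc.prems(4)[of a a' b] Suc.prems(4)[of a' a b]
      by cases auto
  qed
  define p where "p b = (THE a. a \<in> A \<and> b \<in> F a)" for b
  have p: "p b = a" if "a \<in> A" "b \<in> F a" for a b
    unfolding p_def using that uniq by blast
  have "mono_on ?B (c \<circ> p)"
  proof (rule mono_onI)
    fix b b' assume "b \<in> ?B" "b' \<in> ?B" "b \<le> b'"
    then obtain a a' where a: "a \<in> A" "b \<in> F a" "a' \<in> A" "b' \<in> F a'" by auto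
    have "\<not> a' < a" using Suc.prems(4)[of a' a b'] Suc.prems(3)[of a b] a \<open>b \<le> b'\<close> by auto
    then show "(c \<circ> p) b \<le> (c \<circ> p) b'" using p a c(1) by (auto simp: mono_on_def)
  qed
  moreover have "(c \<circ> p) ` ?B \<subseteq> {..<d}" using p c(2) by auto
  moreover have "\<forall>b\<in>?B. d \<le> b"
  proof
    fix b assume "b \<in> ?B"
    then obtain a where "a \<in> A" "b \<in> F a" by auto
    then show "d \<le> b" using Suc.prems(3) c(3) le_trans by metis
  qed
  moreover have "\<forall>x<d. {b\<in>?B. (c \<circ> p) b = x} \<in> schreier (r + s)"
  proof (intro allI impI)
    fix x assume x: "x < d"
    have "{b\<in>?B. (c \<circ> p) b = x} = (\<Union>a\<in>{a\<in>A. c a = x}. F a)" using p by auto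
    also have "\<dots> \<in> schreier (r + s)"
      using Suc.prems c(4) x by (intro Suc.IH) auto
    finally show "{b\<in>?B. (c \<circ> p) b = x} \<in> schreier (r + s)" .
  qed
  moreover have "finite ?B" using finA Suc.prems(2) schreier_finite(1) by (intro finite_UN_I) blast+
  moreover have "?B \<subseteq> {1..}" using Suc.prems(2) schreier_finite(2) by blast
  ultimately show ?case unfolding add_Suc_right schreier_Suc_iff by blast
qed

section \<open>Families without order restrictions\<close>

text \<open>In a tree of splittings of depth r every node splits into at most as many pieces as the
  smallest starting point below it. Unlike for the Schreier families, the pieces may be interlaced.\<close>

primrec Msm :: "nat \<Rightarrow> 'i set \<Rightarrow> ('i \<Rightarrow> nat) \<Rightarrow> bool" where
  "Msm 0 I st \<longleftrightarrow> finite I \<and> card I \<le> 1"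
| "Msm (Suc r) I st \<longleftrightarrow> (\<exists>d (c::'i \<Rightarrow> nat). c ` I \<subseteq> {..<d} \<and> (\<forall>x<d. Msm r {i\<in>I. c i = x} st) \<and>
     (\<forall>i\<in>I. d \<le> st i))"

lemma schreier_Msm: "A \<in> schreier k \<Longrightarrow> Msm k A (\<lambda>x. x)"
proof (induction k arbitrary: A)
  case (Suc k)
  then show ?case unfolding schreier_Suc_iff Msm.simps by metis
qed auto

lemma Msm_finite: "Msm r I st \<Longrightarrow> finite I"
proof (induction r arbitrary: I)
  case (Suc r)
  then obtain d and c :: "'a \<Rightarrow> nat"
    where c: "c ` I \<subseteq> {..<d}" "\<forall>x<d. Msm r {i\<in>I. c i = x} st"
    unfolding Msm.simps by blast
  then have "I = (\<Union>x<d. {i\<in>I. c i = x})" by auto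
  moreover have "finite (\<Union>x<d. {i\<in>I. c i = x})" using c Suc.IH by auto
  ultimately show ?case by metis
qed auto

text \<open>The form in which complexity is counted later: if every \<open>k\<close> in
  \<open>G\<close> can choose its own member of a family, starting no later than \<open>p k\<close>,
  then \<open>G\<close> inherits the complexity of the family.\<close>

lemma Msm_inj:
  assumes "Msm r I st" "inj_on f G" "f ` G \<subseteq> I" "\<And>k. k \<in> G \<Longrightarrow> st (f k) \<le> p k"
  shows "Msm r G p"
  using assms
proof (induction r arbitrary: I G)
  case 0
  then show ?case using card_inj_on_le[of f G I] finite_imageD[of f G] finite_subset[of "f ` G" I] by auto
next
  case (Suc r)
  then obtain d c where c: "c ` I \<subseteq> {..<d}" "\<forall>x<d. Msm r {i\<in>I. c i = x} st" "\<forall>i\<in>I. d \<le> st i"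
    by auto
  have "Msm r {i\<in>G. (c \<circ> f) i = x} p" if "x < d" for x
    using Suc.prems(2,3,4) c(2) that
    by (intro Suc.IH[of "{i\<in>I. c i = x}"]) (auto simp: inj_on_def)
  moreover have "(c \<circ> f) ` G \<subseteq> {..<d}" using c(1) Suc.prems(3) by auto
  moreover have "\<forall>k\<in>G. d \<le> p k" using c(3) Suc.prems(3,4) by (meson image_subset_iff le_trans)
  ultimately show ?case unfolding Msm.simps by blast
qed

lemma Msm_subset: "Msm r I st \<Longrightarrow> J \<subseteq> I \<Longrightarrow> Msm r J st"
  by (rule Msm_inj[where f="\<lambda>x. x"]) auto

lemma Msm_Suc: "Msm r I st \<Longrightarrow> (\<And>i. i \<in> I \<Longrightarrow> 1 \<le> st i) \<Longrightarrow> Msm (Suc r) I st"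
  unfolding Msm.simps by (intro exI[of _ "1::nat"] exI[of _ "\<lambda>_. 0::nat"]) auto

lemma Msm_mono:
  assumes "Msm r I st" "\<And>i. i \<in> I \<Longrightarrow> 1 \<le> st i" "r \<le> s"
  shows "Msm s I st"
  using assms(3,1) by (induction rule: dec_induct) (auto simp del: Msm.simps intro!: Msm_Suc assms(2))

text \<open>Grafting: the children of all members are indexed by pairs, and no order has to be
  checked. Children must not start before their parent, so that the bounds \<open>d\<close> of the
  upper levels still lie below the starts of the leaves.\<close>

lemma Msm_Sigma:
  assumes "Msm r I st" "\<And>i. i \<in> I \<Longrightarrow> Msm s (J i) (st' i)"
    "\<And>i j. i \<in> I \<Longrightarrow> j \<in> J i \<Longrightarrow> st i \<le> st' i j"
  shows "Msm (r + s) (Sigma I J) (\<lambda>(i, j). st' i j)"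
  using assms
proof (induction r arbitrary: I)
  case 0
  show ?case
  proof (cases "I = {}")
    case True
    have "Msm s {} (\<lambda>(i, j). st' i j)" for s by (induction s) auto
    then show ?thesis using True by simp
  next
    case False
    then have "card I \<noteq> 0" "card I \<le> 1" using 0 by auto
    then have "card I = 1" by linarith
    then obtain i where i: "I = {i}" using card_1_singletonE by blast
    show ?thesis unfolding add_0
      by (rule Msm_inj[of s "J i" "st' i" snd]) (use i 0 in \<open>auto simp: inj_on_def\<close>)
  qed
next
  case (Suc r)
  then obtain d c where c: "c ` I \<subseteq> {..<d}" "\<forall>x<d. Msm r {i\<in>I. c i = x} st" "\<forall>i\<in>I. d \<le> st i"
    by auto
  have "Msm (r + s) {z \<in> Sigma I J. (c \<circ> fst) z = x} (\<lambda>(i, j). st' i j)" if "x < d" for x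
  proof -
    have "{z \<in> Sigma I J. (c \<circ> fst) z = x} = Sigma {i\<in>I. c i = x} J" by auto
    then show ?thesis using Suc.IH[of "{i\<in>I. c i = x}"] Suc.prems(2,3) c(2) that by simp
  qed
  moreover have "(c \<circ> fst) ` Sigma I J \<subseteq> {..<d}" using c(1) by auto
  moreover have "\<forall>z\<in>Sigma I J. d \<le> (\<lambda>(i, j). st' i j) z"
    using c(3) Suc.prems(3) le_trans by (fastforce)
  ultimately show ?case unfolding add_Suc Msm.simps by blast
qed

lemma Msm_card:
  assumes "finite I" "\<And>i. i \<in> I \<Longrightarrow> card I \<le> st i"
  shows "Msm 1 I st"
proof -
  obtain c where c: "bij_betw c I {..<card I}"
    using assms(1) ex_bij_betw_finite_nat lessThan_atLeast0 by metis
  have "card {i \<in> I. c i = x} \<le> 1" for x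
  proof -
    have "i = j" if "i \<in> I" "j \<in> I" "c i = c j" for i j
      using c that by (auto simp: bij_betw_def inj_on_def)
    then show ?thesis using assms(1) card_le_Suc0_iff_eq[of "{i \<in> I. c i = x}"] by auto
  qed
  then show ?thesis
    using assms c unfolding One_nat_def Msm.simps bij_betw_def
    by (intro exI[of _ "card I"] exI[of _ c]) auto
qed

section \<open>Basic averages\<close>

text \<open>The intervals \<open>{q k..p k}\<close> will contain the supports of successive vectors.
  The square in the gap yields \<open>rapid_doubling\<close>: a splitting into at most
  \<open>p i\<close> pieces is outweighed by the left end \<open>q j\<close> of a later interval,
  with a geometric gain in \<open>j - i\<close>.\<close>

definition rapid :: "(nat \<Rightarrow> nat) \<Rightarrow> (nat \<Rightarrow> nat) \<Rightarrow> bool" where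
  "rapid q p \<longleftrightarrow> (\<forall>k. 1 \<le> q k \<and> q k \<le> p k \<and> (p k)\<^sup>2 < q (Suc k))"

lemma rapid_less:
  assumes "rapid q p" "i < j"
  shows "p i < q j" "(p i)\<^sup>2 < q j"
proof -
  have sq: "x \<le> x\<^sup>2" for x :: nat by (cases x) (auto simp: power2_eq_square)
  show 1: "(p i)\<^sup>2 < q j"
    using assms(2)
  proof (induction j)
    case (Suc j)
    show ?case
    proof (cases "i = j")
      case False
      then have "(p i)\<^sup>2 < q j" using Suc by auto
      also have "q j \<le> p j" using assms(1) by (auto simp: rapid_def)
      also have "p j \<le> (p j)\<^sup>2" by (rule sq)
      also have "(p j)\<^sup>2 < q (Suc j)" using assms(1) by (auto simp: rapid_def)
      finally show ?thesis .
    qed (use assms(1) in \<open>auto simp: rapid_def\<close>)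
  qed auto
  then show "p i < q j" using sq[of "p i"] by linarith
qed

lemma rapid_mono:
  assumes "rapid q p" "i \<le> j"
  shows "q i \<le> q j" "p i \<le> p j"
  using assms rapid_less(1)[OF assms(1), of i j] unfolding rapid_def
  by (cases "i = j"; metis le_eq_less_or_eq less_imp_le order_trans)+

lemma rapid_doubling:
  assumes "rapid q p" "i < j"
  shows "p i * 2 ^ (j - i) \<le> q j"
  using assms(2)
proof (induction j)
  case (Suc j)
  have step: "2 * x \<le> y" if "1 \<le> x" "x\<^sup>2 < y" for x y :: nat
  proof (cases "x = 1")
    case False
    then have "2 * x \<le> x * x" using that(1) by (intro mult_right_mono) auto
    then show ?thesis using that(2) unfolding power2_eq_square by linarith
  qed (use that in auto)
  have p1: "1 \<le> p j" using assms(1) unfolding rapid_def by (meson le_trans)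
  show ?case
  proof (cases "i = j")
    case True
    then show ?thesis using step[of "p j" "q (Suc j)"] p1 assms(1) by (auto simp: rapid_def mult.commute)
  next
    case False
    then have "p i * 2 ^ (j - i) \<le> q j" "i < j" using Suc by auto
    moreover have "2 * p j \<le> q (Suc j)" "q j \<le> p j"
      using step[of "p j" "q (Suc j)"] p1 assms(1) by (auto simp: rapid_def)
    ultimately show ?thesis by (simp add: Suc_diff_le)
  qed
qed auto

lemma sum_over_blocks:
  fixes f :: "nat \<Rightarrow> 'b::comm_monoid_add"
  assumes "\<And>i. i < d \<Longrightarrow> Nf i \<le> Nf (Suc i)"
  shows "(\<Sum>k=Nf 0..<Nf d. f k) = (\<Sum>i<d. \<Sum>k=Nf i..<Nf (Suc i). f k)"
  using assms
proof (induction d)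
  case (Suc d)
  have "i \<le> d \<Longrightarrow> Nf 0 \<le> Nf i" for i
  proof (induction i)
    case (Suc i)
    then show ?case using Suc.prems \<open>\<And>i. i < Suc d \<Longrightarrow> Nf i \<le> Nf (Suc i)\<close>[of i] by simp
  qed simp
  then have "Nf 0 \<le> Nf d" by simp
  moreover have "Nf d \<le> Nf (Suc d)" using Suc.prems by simp
  ultimately have "(\<Sum>k=Nf 0..<Nf (Suc d). f k) = (\<Sum>k=Nf 0..<Nf d. f k) + (\<Sum>k=Nf d..<Nf (Suc d). f k)"
    by (simp add: sum.atLeastLessThan_concat)
  then show ?case using Suc by simp
qed simp

text \<open>The weights of an average at level r + 1 are the averages of weights at level r over q N
  successive blocks; a family of complexity r + 1 that starts in block i splits into at most p k
  pieces (k in that block), and the later blocks begin beyond the square of p k.\<close>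

lemma basic_average:
  assumes qp: "rapid q p"
  shows "\<exists>M \<beta>. N < M \<and> (\<forall>k. (0::real) \<le> \<beta> k) \<and> (\<Sum>k=N..<M. \<beta> k) = 1 \<and>
     q ` {N..<M} \<in> schreier (Suc r) \<and>
     (\<forall>G\<subseteq>{N..<M}. Msm r G p \<longrightarrow> (\<Sum>k\<in>G. \<beta> k) \<le> (real r + 1) / q N)"
proof (induction r arbitrary: N)
  case 0
  have q1: "1 \<le> q k" for k using qp by (auto simp: rapid_def)
  define M where "M = N + q N"
  have "inj_on q {N..<M}"
  proof (intro inj_onI)
    fix i j assume "q i = q j"
    have *: "q i < q j" if "i < j" for i j
      using rapid_less(1)[OF qp that] qp by (metis le_less_trans rapid_def)
    then show "i = j" using \<open>q i = q j\<close> by (metis linorder_neqE_nat order_less_irrefl)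
  qed
  then have "card (q ` {N..<M}) = q N" by (simp add: card_image M_def)
  moreover have "q N \<le> b" if "b \<in> q ` {N..<M}" for b
    using that rapid_mono(1)[OF qp] by auto
  moreover have "q ` {N..<M} \<subseteq> {1..}" using q1 by auto
  ultimately have "q ` {N..<M} \<in> schreier (Suc 0)"
    unfolding schreier.simps mem_Collect_eq by (metis Min_in finite_imageI finite_atLeastLessThan)
  moreover have "(\<Sum>k\<in>G. 1 / real (q N)) \<le> (real 0 + 1) / q N" if "Msm 0 G p" for G
    using that by (auto simp: divide_right_mono)
  ultimately show ?case
    using q1[of N] by (intro exI[of _ M] exI[of _ "\<lambda>_. 1 / real (q N)"]) (auto simp: M_def)
next
  case (Suc r)
  have q1: "1 \<le> q k" for k using qp by (auto simp: rapid_def)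
  obtain next_end wt where ne: "\<And>N. N < next_end N" and wt0: "\<And>N k. (0::real) \<le> wt N k"
    and wt1: "\<And>N. (\<Sum>k=N..<next_end N. wt N k) = 1"
    and wtS: "\<And>N. q ` {N..<next_end N} \<in> schreier (Suc r)"
    and wtM: "\<And>N G. G \<subseteq> {N..<next_end N} \<Longrightarrow> Msm r G p \<Longrightarrow> (\<Sum>k\<in>G. wt N k) \<le> (real r + 1) / q N"
    using Suc.IH by metis
  define Nf where "Nf i = (next_end ^^ i) N" for i
  have Nf0: "Nf 0 = N" and NfS: "Nf (Suc i) = next_end (Nf i)" for i by (auto simp: Nf_def)
  have NfL: "Nf i < Nf (Suc i)" for i using ne NfS by auto
  have Nfm: "Nf i < Nf j" if "i < j" for i j using lift_Suc_mono_less[of Nf i j] NfL that by auto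
  have Nfm': "Nf i \<le> Nf j" if "i \<le> j" for i j using Nfm that by (metis le_eq_less_or_eq)
  define d where "d = q N"
  define M where "M = Nf d"
  have d1: "1 \<le> d" using q1 d_def by auto
  have blk: "\<exists>i<d. Nf i \<le> k \<and> k < Nf (Suc i)" if k: "N \<le> k" "k < M" for k
  proof -
    define i where "i = (LEAST j. k < Nf (Suc j))"
    have ex: "k < Nf (Suc (d - 1))" using k d1 by (simp add: M_def)
    then have "k < Nf (Suc i)" unfolding i_def by (rule LeastI)
    moreover have "i \<le> d - 1" unfolding i_def using ex by (rule Least_le)
    moreover have "Nf i \<le> k"
    proof (cases i)
      case (Suc i')
      then have "\<not> k < Nf (Suc i')" using not_less_Least[of i' "\<lambda>j. k < Nf (Suc j)"] by (simp add: i_def)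
      then show ?thesis using Suc by auto
    qed (use k Nf0 in auto)
    ultimately show ?thesis using d1 by (intro exI[of _ i]) auto
  qed
  have uniq: "i = j" if "Nf i \<le> k" "k < Nf (Suc i)" "Nf j \<le> k" "k < Nf (Suc j)" for i j k
    using that Nfm'[of "Suc i" j] Nfm'[of "Suc j" i] by (metis leD le_less_trans not_less_eq_eq le_trans linorder_neqE_nat Suc_leI)
  define b where "b k = (THE i. Nf i \<le> k \<and> k < Nf (Suc i))" for k
  have b: "b k = i" if "Nf i \<le> k" "k < Nf (Suc i)" for i k
    unfolding b_def using that uniq by blast
  define \<beta> where "\<beta> k = wt (Nf (b k)) k / d" for k
  have \<beta>0: "0 \<le> \<beta> k" for k using wt0 by (simp add: \<beta>_def)
  have \<beta>sum: "(\<Sum>k\<in>G. \<beta> k) = (\<Sum>k\<in>G. wt (Nf i) k) / d" if "G \<subseteq> {Nf i..<Nf (Suc i)}" for G i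
  proof -
    have "b k = i" if "k \<in> G" for k using b \<open>G \<subseteq> _\<close> that by force
    then show ?thesis unfolding \<beta>_def sum_divide_distrib by (intro sum.cong) auto
  qed
  have blk1: "(\<Sum>k=Nf i..<Nf (Suc i). \<beta> k) = 1 / d" for i
    using \<beta>sum[of "{Nf i..<Nf (Suc i)}" i] wt1[of "Nf i"] NfS by simp
  have tot: "(\<Sum>k=N..<M. \<beta> k) = 1"
    using sum_over_blocks[of d Nf \<beta>] NfL blk1 d1 Nf0 by (simp add: M_def less_imp_le)
  have NM: "N < M" using Nfm[of 0 d] d1 Nf0 by (auto simp: M_def)
  have qinj: "i < j \<Longrightarrow> q i < q j" for i j
    using rapid_less(1)[OF qp, of i j] qp by (metis le_less_trans rapid_def)
  have sch: "q ` {N..<M} \<in> schreier (Suc (Suc r))"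
  proof -
    define c where "c x = b (THE k. q k = x)" for x
    have c: "c (q k) = b k" for k
    proof -
      have "(THE l. q l = q k) = k"
        by (rule the_equality) (metis linorder_neqE_nat less_irrefl qinj)+
      then show ?thesis by (simp add: c_def)
    qed
    have bm: "b k \<le> b l" if kl: "k \<in> {N..<M}" "l \<in> {N..<M}" "k \<le> l" for k l
    proof -
      obtain i j where ij: "Nf i \<le> k" "k < Nf (Suc i)" "Nf j \<le> l" "l < Nf (Suc j)"
        using blk kl by (metis atLeastLessThan_iff)
      have "\<not> j < i" using Nfm'[of "Suc j" i] ij kl by auto
      then show ?thesis using b ij by (metis leI)
    qed
    have "mono_on (q ` {N..<M}) c"
    proof (rule mono_onI)
      fix x y assume xy: "x \<in> q ` {N..<M}" "y \<in> q ` {N..<M}" "x \<le> y"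
      then obtain k l where kl: "x = q k" "y = q l" "k \<in> {N..<M}" "l \<in> {N..<M}" by auto
      then have "k \<le> l" using xy qinj by (metis leD leI)
      then show "c x \<le> c y" using kl c bm by simp
    qed
    moreover have "c ` q ` {N..<M} \<subseteq> {..<d}" using c blk b by fastforce
    moreover have "\<forall>x\<in>q ` {N..<M}. d \<le> x" using rapid_mono(1)[OF qp] by (auto simp: d_def)
    moreover have "\<forall>i<d. {x \<in> q ` {N..<M}. c x = i} \<in> schreier (Suc r)"
    proof (intro allI impI)
      fix i assume "i < d"
      have "{x \<in> q ` {N..<M}. c x = i} \<subseteq> q ` {Nf i..<next_end (Nf i)}"
      proof
        fix x assume "x \<in> {x \<in> q ` {N..<M}. c x = i}"
        then obtain k where k: "x = q k" "N \<le> k" "k < M" "b k = i" using c by auto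
        then obtain j where "Nf j \<le> k" "k < Nf (Suc j)" using blk by blast
        then show "x \<in> q ` {Nf i..<next_end (Nf i)}" using b k NfS by auto
      qed
      then show "{x \<in> q ` {N..<M}. c x = i} \<in> schreier (Suc r)"
        using wtS schreier_subset by blast
    qed
    moreover have "finite (q ` {N..<M})" "q ` {N..<M} \<subseteq> {1..}" using q1 by auto
    ultimately show ?thesis unfolding schreier_Suc_iff[of _ "Suc r"] by blast
  qed
  have small: "(\<Sum>k\<in>G. \<beta> k) \<le> (real (Suc r) + 1) / q N" if G: "G \<subseteq> {N..<M}" and GM: "Msm (Suc r) G p" for G
  proof (cases "G = {}")
    case True
    then show ?thesis by simp
  next
    case False
    have finG: "finite G" using G finite_subset by blast
    define k0 where "k0 = Min G"
    have k0: "k0 \<in> G" "\<And>k. k \<in> G \<Longrightarrow> k0 \<le> k" unfolding k0_def using finG False by auto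
    obtain i0 where i0: "i0 < d" "Nf i0 \<le> k0" "k0 < Nf (Suc i0)" using blk k0 G by (meson atLeastLessThan_iff subsetD)
    obtain D c where D: "c ` G \<subseteq> {..<D}" "\<forall>x<D. Msm r {i\<in>G. c i = x} p" "\<forall>i\<in>G. D \<le> p i"
      using GM by (auto simp del: image_subset_iff)
    have Dp: "D \<le> p k0" using D k0 by auto
    define B where "B i = G \<inter> {Nf i..<Nf (Suc i)}" for i
    have Gsum: "(\<Sum>k\<in>G. \<beta> k) = (\<Sum>i<d. \<Sum>k\<in>B i. \<beta> k)"
    proof -
      have "(\<Sum>k\<in>G. \<beta> k) = (\<Sum>k=N..<M. if k \<in> G then \<beta> k else 0)"
        using G by (simp add: sum.inter_restrict[symmetric] Int_absorb1)
      also have "\<dots> = (\<Sum>i<d. \<Sum>k=Nf i..<Nf (Suc i). if k \<in> G then \<beta> k else 0)"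
        using sum_over_blocks[of d Nf] NfL Nf0 by (simp add: M_def less_imp_le)
      also have "\<dots> = (\<Sum>i<d. \<Sum>k\<in>B i. \<beta> k)"
        by (simp add: sum.inter_restrict[symmetric] B_def Int_commute)
      finally show ?thesis .
    qed
    \<comment> \<open>\<open>G\<close> splits into \<open>D \<le> p k0\<close> pieces of complexity
      \<open>r\<close>. The block of its first element \<open>k0\<close> contributes at most its
      mass \<open>1 / d\<close>. In a later block \<open>i\<close> each piece has weight at most
      \<open>(r + 1) / q (Nf i)\<close> before division by \<open>d\<close>, and
      \<open>D / q (Nf i)\<close> is at most \<open>(1/2) ^ (i - i0)\<close>; the geometric series
      leaves \<open>(r + 1) / d\<close> for all later blocks together.\<close>
    have before: "(\<Sum>k\<in>B i. \<beta> k) = 0" if "i < i0" for i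
    proof -
      have "B i = {}" using k0(2) i0(2) Nfm'[of "Suc i" i0] that unfolding B_def by fastforce
      then show ?thesis by simp
    qed
    have at0: "(\<Sum>k\<in>B i0. \<beta> k) \<le> 1 / d"
    proof -
      have "(\<Sum>k\<in>B i0. \<beta> k) \<le> (\<Sum>k=Nf i0..<Nf (Suc i0). \<beta> k)"
        using \<beta>0 by (intro sum_mono2) (auto simp: B_def)
      then show ?thesis using blk1 by simp
    qed
    have after: "(\<Sum>k\<in>B i. \<beta> k) \<le> (real r + 1) / d * (1/2) ^ (i - i0)" if "i0 < i" "i < d" for i
    proof -
      have fB: "finite (B i)" using finG by (simp add: B_def)
      have "(\<Sum>k\<in>B i. wt (Nf i) k) = (\<Sum>x<D. \<Sum>k\<in>{k \<in> B i. c k = x}. wt (Nf i) k)"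
        using D(1) by (intro sum.group[symmetric] fB) (auto simp: B_def)
      also have "\<dots> \<le> (\<Sum>x<D. (real r + 1) / q (Nf i))"
      proof (rule sum_mono)
        fix x assume "x \<in> {..<D}"
        then have "Msm r {k \<in> B i. c k = x} p"
          using D(2) by (auto intro: Msm_subset simp: B_def)
        then show "(\<Sum>k\<in>{k \<in> B i. c k = x}. wt (Nf i) k) \<le> (real r + 1) / q (Nf i)"
          by (intro wtM) (auto simp: B_def NfS)
      qed
      also have "\<dots> = (real r + 1) * (D / q (Nf i))" by simp
      also have "\<dots> \<le> (real r + 1) * (1/2) ^ (i - i0)"
      proof (rule mult_left_mono)
        have lt: "k0 < Nf i" using i0(3) Nfm'[of "Suc i0" i] that by linarith
        have gap: "i - i0 \<le> Nf i - k0"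
          using that
        proof (induction i)
          case (Suc i)
          show ?case
          proof (cases "i = i0")
            case True
            then show ?thesis using i0 by auto
          next
            case False
            then have "i - i0 \<le> Nf i - k0" "k0 < Nf i"
              using Suc i0(3) Nfm'[of "Suc i0" i] by auto
            then show ?thesis using NfL[of i] by linarith
          qed
        qed simp
        have "D * 2 ^ (i - i0) \<le> p k0 * 2 ^ (Nf i - k0)"
          using Dp gap by (intro mult_mono power_increasing) auto
        also have "\<dots> \<le> q (Nf i)" using rapid_doubling[OF qp lt] .
        finally have "real (D * 2 ^ (i - i0)) \<le> real (q (Nf i))" by (simp only: of_nat_le_iff)
        then have "real D * 2 ^ (i - i0) \<le> q (Nf i)" by simp
        then show "real D / q (Nf i) \<le> (1/2) ^ (i - i0)"
          using q1[of "Nf i"] by (simp add: divide_simps power_one_over)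
      qed simp
      finally show ?thesis
        using \<beta>sum[of "B i" i] d1 by (simp add: B_def divide_right_mono)
    qed
    have "(\<Sum>i<d. \<Sum>k\<in>B i. \<beta> k) \<le>
        (\<Sum>i<d. (if i = i0 then 1 / d else 0) + (if i0 < i then (real r + 1) / d * (1/2) ^ (i - i0) else 0))"
      using before at0 after by (intro sum_mono) (auto simp: not_less)
    also have "\<dots> = 1 / d + (real r + 1) / d * (\<Sum>i\<in>{i0<..<d}. (1/2) ^ (i - i0))"
    proof -
      have "(\<Sum>i<d. (if i0 < i then (real r + 1) / d * (1/2) ^ (i - i0) else 0))
          = (\<Sum>i\<in>{i0<..<d}. (real r + 1) / d * (1/2) ^ (i - i0))"
        by (intro sum.mono_neutral_cong_right) auto
      then show ?thesis using i0(1) by (simp add: sum.distrib sum_distrib_left)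
    qed
    also have "\<dots> \<le> 1 / d + (real r + 1) / d * 1"
    proof (intro add_left_mono mult_left_mono)
      have "(\<Sum>i\<in>{i0<..<d}. (1/2::real) ^ (i - i0)) = (\<Sum>i<d - i0 - 1. (1/2) ^ Suc i)"
        by (rule sum.reindex_bij_witness[of _ "\<lambda>i. i + i0 + 1" "\<lambda>i. i - i0 - 1"]) (auto simp: Suc_diff_Suc)
      also have "\<dots> = 1 - (1/2) ^ (d - i0 - 1)"
        using sum_gp_strict[of "1/2::real" "d - i0 - 1"] by (simp add: sum_divide_distrib[symmetric])
      finally show "(\<Sum>i\<in>{i0<..<d}. (1/2::real) ^ (i - i0)) \<le> 1" by simp
    qed simp
    finally have "(\<Sum>k\<in>G. \<beta> k) \<le> 1 / d + (real r + 1) / d * 1" unfolding Gsum .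
    then show ?thesis by (simp add: d_def add_divide_distrib)
  qed
  show ?case
  proof (intro exI conjI allI impI)
    fix G assume "G \<subseteq> {N..<M}" "Msm (Suc r) G p"
    then show "(\<Sum>k\<in>G. \<beta> k) \<le> (real (Suc r) + 1) / q N" by (rule small)
  qed (fact NM \<beta>0 tot sch)+
qed

section \<open>Pairings and squares\<close>

definition rst :: "nat set \<Rightarrow> (nat \<Rightarrow> real) \<Rightarrow> nat \<Rightarrow> real" where
  "rst A x = (\<lambda>k. if k \<in> A then x k else 0)"

definition pr :: "(nat \<Rightarrow> real) \<Rightarrow> (nat \<Rightarrow> real) \<Rightarrow> real" where
  "pr g a = (\<Sum>k\<in>supp a. g k * a k)"

definition sq :: "(nat \<Rightarrow> real) \<Rightarrow> nat \<Rightarrow> real" where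
  "sq x = (\<lambda>k. (x k)\<^sup>2)"

lemma supp_rst: "supp (rst A x) = supp x \<inter> A"
  by (auto simp: supp_def rst_def)

lemma supp_sq [simp]: "supp (sq x) = supp x"
  by (auto simp: supp_def sq_def)

lemma sq_rst: "sq (rst A x) = rst A (sq x)"
  by (auto simp: sq_def rst_def)

lemma supp_zero [simp]: "supp (\<lambda>_. 0) = {}"
  by (simp add: supp_def)

lemma supp_unit_vec [simp]: "supp (unit_vec k) = {k}"
  by (auto simp: supp_def unit_vec_def)

lemma supp_sum_subset: "supp (\<lambda>k. \<Sum>i\<in>I. a i k) \<subseteq> (\<Union>i\<in>I. supp (a i))"
  unfolding supp_def using sum.not_neutral_contains_not_neutral by fastforce

lemma supp_scale_subset: "supp (\<lambda>k. c * x k) \<subseteq> supp x"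
  by (auto simp: supp_def)

lemma supp_scale_sum_subset: "supp (\<lambda>k. c * (\<Sum>i\<in>I. a i k)) \<subseteq> (\<Union>i\<in>I. supp (a i))"
  using supp_scale_subset[of c "\<lambda>k. \<Sum>i\<in>I. a i k"] supp_sum_subset[of a I] by (rule subset_trans)

lemma pr_eq: "finite F \<Longrightarrow> supp a \<subseteq> F \<Longrightarrow> pr g a = (\<Sum>k\<in>F. g k * a k)"
  unfolding pr_def by (intro sum.mono_neutral_left) (auto simp: supp_def)

lemma pr_sum_left: "pr (\<lambda>k. \<Sum>i\<in>I. g i k) a = (\<Sum>i\<in>I. pr (g i) a)"
  unfolding pr_def by (simp add: sum_distrib_right sum.swap[of _ "supp a"])

lemma pr_scale_left: "pr (\<lambda>k. c * g k) a = c * pr g a"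
  unfolding pr_def by (simp add: sum_distrib_left mult.assoc)

lemma pr_scale_right: "pr g (\<lambda>k. c * a k) = c * pr g a"
proof (cases "c = 0")
  case False
  then have "supp (\<lambda>k. c * a k) = supp a" by (auto simp: supp_def)
  then show ?thesis unfolding pr_def by (simp add: sum_distrib_left mult.left_commute)
qed (simp add: pr_def)

lemma pr_sum_right:
  assumes "finite I" "\<And>i. i \<in> I \<Longrightarrow> finite (supp (a i))"
  shows "pr g (\<lambda>k. \<Sum>i\<in>I. a i k) = (\<Sum>i\<in>I. pr g (a i))"
proof -
  define F where "F = (\<Union>i\<in>I. supp (a i))"
  have F: "finite F" "\<And>i. i \<in> I \<Longrightarrow> supp (a i) \<subseteq> F" using assms by (auto simp: F_def)
  have "pr g (\<lambda>k. \<Sum>i\<in>I. a i k) = (\<Sum>k\<in>F. \<Sum>i\<in>I. g k * a i k)"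
    using pr_eq[OF F(1) supp_sum_subset[of a I, folded F_def], of g] by (simp add: sum_distrib_left)
  also have "\<dots> = (\<Sum>i\<in>I. \<Sum>k\<in>F. g k * a i k)" by (rule sum.swap)
  also have "\<dots> = (\<Sum>i\<in>I. pr g (a i))" using pr_eq[OF F(1) F(2)] by (intro sum.cong) auto
  finally show ?thesis .
qed

lemma pr_add_right:
  assumes "finite (supp a)" "finite (supp b)"
  shows "pr g (\<lambda>k. a k + b k) = pr g a + pr g b"
proof -
  have "supp (\<lambda>k. a k + b k) \<subseteq> supp a \<union> supp b" by (auto simp: supp_def)
  then have "pr g (\<lambda>k. a k + b k) = (\<Sum>k\<in>supp a \<union> supp b. g k * (a k + b k))"
    using assms by (intro pr_eq) auto
  then show ?thesis
    using pr_eq[of "supp a \<union> supp b" a g] pr_eq[of "supp a \<union> supp b" b g] assms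
    by (simp add: distrib_left sum.distrib)
qed

lemma pr_rst:
  assumes "finite (supp a)"
  shows "pr (rst A g) a = pr g (rst A a)"
proof -
  have "pr g (rst A a) = (\<Sum>k\<in>supp a. g k * rst A a k)"
    using assms by (intro pr_eq) (auto simp: supp_rst)
  then show ?thesis unfolding pr_def[of "rst A g"] by (auto simp: rst_def intro!: sum.cong)
qed

lemma pr_nonneg: "(\<And>k. 0 \<le> g k) \<Longrightarrow> (\<And>k. 0 \<le> a k) \<Longrightarrow> 0 \<le> pr g a"
  unfolding pr_def by (intro sum_nonneg) auto

lemma pr_mono_right:
  assumes "finite (supp b)" "\<And>k. 0 \<le> g k" "\<And>k. 0 \<le> a k" "\<And>k. a k \<le> b k"
  shows "pr g a \<le> pr g b"
proof -
  have "supp a \<subseteq> supp b" using assms(3,4) unfolding supp_def by (metis (mono_tags) Collect_mono antisym)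
  then have "pr g a = (\<Sum>k\<in>supp b. g k * a k)" by (intro pr_eq assms(1))
  then show ?thesis unfolding pr_def[of g b] using assms by (auto intro!: sum_mono mult_left_mono)
qed

lemma pr_disjoint: "supp g \<inter> supp a = {} \<Longrightarrow> pr g a = 0"
  unfolding pr_def by (intro sum.neutral) (auto simp: supp_def)

lemma pr_cong: "(\<And>k. k \<in> supp a \<Longrightarrow> g k = h k) \<Longrightarrow> pr g a = pr h a"
  unfolding pr_def by (intro sum.cong) auto

text \<open>The start \<open>st i\<close> is a lower bound for the support, not its minimum:
  restricting a function shrinks or even empties its support, while the starts, and with them the
  complexity, are kept.\<close>

definition fam :: "nat \<Rightarrow> 'i set \<Rightarrow> ('i \<Rightarrow> nat \<Rightarrow> real) \<Rightarrow> ('i \<Rightarrow> nat) \<Rightarrow> bool" where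
  "fam r I h st \<longleftrightarrow> Msm r I st \<and> (\<forall>i\<in>I. 1 \<le> st i \<and> supp (h i) \<subseteq> {st i..}) \<and>
     disjoint_family_on (\<lambda>i. supp (h i)) I"

lemma fam_finite: "fam r I h st \<Longrightarrow> finite I"
  unfolding fam_def using Msm_finite by blast

lemma fam_mono: "fam r I h st \<Longrightarrow> r \<le> s \<Longrightarrow> fam s I h st"
  unfolding fam_def using Msm_mono by metis

lemma fam_subset: "fam r I h st \<Longrightarrow> J \<subseteq> I \<Longrightarrow> fam r J h st"
  unfolding fam_def using Msm_subset[of r I st J] disjoint_family_on_mono[of J I] by blast

lemma fam_reindex:
  assumes "fam r I h st" "inj_on f G" "f ` G \<subseteq> I"
  shows "fam r G (h \<circ> f) (st \<circ> f)"
proof -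
  have "Msm r G (st \<circ> f)"
    using assms Msm_inj[OF _ assms(2,3), of r st "st \<circ> f"] by (auto simp: fam_def)
  moreover have "disjoint_family_on (\<lambda>i. supp ((h \<circ> f) i)) G"
    unfolding disjoint_family_on_def
  proof (intro ballI impI)
    fix x y assume "x \<in> G" "y \<in> G" "x \<noteq> y"
    then have "f x \<in> I" "f y \<in> I" "f x \<noteq> f y" using assms(2,3) by (auto simp: inj_on_def)
    then show "supp ((h \<circ> f) x) \<inter> supp ((h \<circ> f) y) = {}"
      using assms(1) by (simp add: fam_def disjoint_family_on_def)
  qed
  ultimately show ?thesis using assms(1,3) by (auto simp: fam_def image_subset_iff)
qed

text \<open>The start of a child is raised to that of its parent, as \<open>Msm_Sigma\<close>
  requires. This is harmless because the support of a child lies inside that of its parent.\<close>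

lemma fam_Sigma:
  assumes "fam r I h st" "\<And>i. i \<in> I \<Longrightarrow> fam s (J i) (c i) (st' i)"
    "\<And>i j. i \<in> I \<Longrightarrow> j \<in> J i \<Longrightarrow> supp (c i j) \<subseteq> supp (h i)"
  shows "fam (r + s) (Sigma I J) (\<lambda>(i, j). c i j) (\<lambda>(i, j). max (st i) (st' i j))"
proof -
  have m: "Msm s (J i) (\<lambda>j. max (st i) (st' i j))" if "i \<in> I" for i
    using assms(2)[OF that] Msm_inj[of s "J i" "st' i" "\<lambda>x. x" "J i"] unfolding fam_def by auto
  have "Msm (r + s) (Sigma I J) (\<lambda>(i, j). max (st i) (st' i j))"
    using assms(1) by (intro Msm_Sigma[of r I st] m) (auto simp: fam_def)
  moreover have "supp (c i j) \<subseteq> {max (st i) (st' i j)..}" if "i \<in> I" "j \<in> J i" for i j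
    using assms(1,2,3) that unfolding fam_def by fastforce
  moreover have "supp (c i j) \<inter> supp (c i' j') = {}"
    if "i \<in> I" "j \<in> J i" "i' \<in> I" "j' \<in> J i'" "(i, j) \<noteq> (i', j')" for i j i' j'
  proof (cases "i = i'")
    case True
    then show ?thesis using assms(2)[of i] that unfolding fam_def disjoint_family_on_def by auto
  next
    case False
    then have "supp (h i) \<inter> supp (h i') = {}"
      using assms(1) that unfolding fam_def disjoint_family_on_def by auto
    then show ?thesis using assms(3)[of i j] assms(3)[of i' j'] that by blast
  qed
  moreover have "\<forall>i\<in>I. 1 \<le> st i" using assms(1) by (auto simp: fam_def)
  ultimately show ?thesis
    unfolding fam_def disjoint_family_on_def by (auto simp: max_def le_trans split: prod.splits)
qed

text \<open>Pigeonhole: disjoint sets that all meet \<open>{..<Q}\<close> are at most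
  \<open>Q\<close> in number, so their parts beyond \<open>Q\<close> form a family of complexity 1,
  whatever \<open>r\<close> was. For this reason long families are harmless on a single far out
  vector.\<close>

lemma fam_old:
  assumes "fam r I h st" "J \<subseteq> I" "\<And>i. i \<in> J \<Longrightarrow> supp (h i) \<inter> {..<Q} \<noteq> {}" "1 \<le> Q"
  shows "fam 1 J (\<lambda>i. rst {Q..} (h i)) (\<lambda>_. Q)"
proof -
  have finJ: "finite J" using fam_finite[OF assms(1)] assms(2) finite_subset by blast
  define f where "f i = (SOME x. x \<in> supp (h i) \<inter> {..<Q})" for i
  have f: "f i \<in> supp (h i) \<inter> {..<Q}" if "i \<in> J" for i
    unfolding f_def using assms(3)[OF that] by (metis some_in_eq)
  have "inj_on f J"
    using f assms(1,2) unfolding fam_def disjoint_family_on_def inj_on_def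
    by (metis IntD1 disjoint_iff subsetD)
  then have "card J \<le> Q" using f card_inj_on_le[of f J "{..<Q}"] by auto
  then have "Msm 1 J (\<lambda>_. Q)" using finJ by (intro Msm_card) auto
  moreover have "disjoint_family_on (\<lambda>i. supp (rst {Q..} (h i))) J"
    using assms(1,2) unfolding fam_def disjoint_family_on_def supp_rst by blast
  ultimately show ?thesis using assms(4) by (auto simp: fam_def supp_rst)
qed

section \<open>The squared norming set\<close>

text \<open>The norm is the 2-convexification of a mixed Tsirelson type norm: its square is the supremum
  of pr g (sq x) over the functionals g below, in which the weights of the trees defining D_wh are
  squared and the square summable coefficients have disappeared. In kw J g the weight is recorded by
  its index J, because m 0 = m 1.\<close>

context wh_parameters
begin

definition \<theta> :: "nat \<Rightarrow> real" where "\<theta> J = 1 / (real (m J))\<^sup>2"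

inductive kf :: "(nat \<Rightarrow> real) \<Rightarrow> bool" and kw :: "nat \<Rightarrow> (nat \<Rightarrow> real) \<Rightarrow> bool" where
  kf_unit: "1 \<le> k \<Longrightarrow> kf (unit_vec k)"
| kf_kw: "kw J g \<Longrightarrow> kf g"
| kw_even: "(\<forall>i<d. kf (g i)) \<Longrightarrow> allowable (n (2 * j)) d E \<Longrightarrow> (\<forall>i<d. supp (g i) \<subseteq> E i) \<Longrightarrow>
    kw (2 * j) (\<lambda>k. \<theta> (2 * j) * (\<Sum>i<d. g i k))"
| kw_odd: "schreier_sigma_special n N1 N2 \<sigma> j s \<Longrightarrow>
    (\<forall>i<length s. kw (2 * snd (s ! i)) (g i)) \<Longrightarrow> (\<forall>i<length s. supp (g i) \<subseteq> fst (s ! i)) \<Longrightarrow>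
    kw (2 * j + 1) (\<lambda>k. \<theta> (2 * j + 1) * (\<Sum>i<length s. g i k))"

lemma m_strict: "1 \<le> i \<Longrightarrow> i < j \<Longrightarrow> m i < m j"
  using m_increasing by (auto simp: strict_mono_on_def)

lemma m_ge2: "2 \<le> m j"
  using m_0 m_1 m_strict[of 1 j] by (cases "j \<le> 1") (auto simp: le_Suc_eq)

lemma m_mono: "i \<le> j \<Longrightarrow> m i \<le> m j"
  using m_strict[of i j] m_0 m_ge2[of j] by (cases "i = 0"; cases "i = j") auto

lemma \<theta>_pos: "0 < \<theta> J"
  using m_ge2[of J] by (auto simp: \<theta>_def)

lemma \<theta>_mono: "i \<le> j \<Longrightarrow> \<theta> j \<le> \<theta> i"
  using m_mono[of i j] m_ge2[of i] unfolding \<theta>_def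
  by (intro divide_left_mono power_mono) (auto simp: zero_less_mult_iff)

lemma \<theta>_0: "\<theta> 0 = 1/4"
  by (simp add: \<theta>_def m_0)

lemma \<theta>_le: "\<theta> J \<le> 1/4"
  using \<theta>_mono[of 0 J] \<theta>_0 by simp

lemma \<theta>_cube:
  assumes "2 \<le> L" "L < J"
  shows "\<theta> J \<le> \<theta> L ^ 3"
proof -
  have "m L ^ 3 \<le> m J" using m_growth[OF assms(1)] m_mono[of "Suc L" J] assms(2) by simp
  then have "real (m L) ^ 3 \<le> real (m J)" by (metis of_nat_le_iff of_nat_power)
  then have "(real (m L) ^ 3)\<^sup>2 \<le> (real (m J))\<^sup>2" by (intro power_mono) auto
  then have "1 / (real (m J))\<^sup>2 \<le> 1 / (real (m L) ^ 3)\<^sup>2"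
    using m_ge2[of L] by (intro divide_left_mono) (auto simp: m_ge2 order_less_le_trans[OF _ m_ge2])
  also have "\<dots> = \<theta> L ^ 3" by (simp add: \<theta>_def power_divide power_mult[symmetric])
  finally show ?thesis by (simp add: \<theta>_def)
qed

lemma \<theta>_cube_le: "\<theta> L ^ 3 \<le> \<theta> L ^ 2" "\<theta> L ^ 2 \<le> \<theta> L"
  using \<theta>_le[of L] \<theta>_pos[of L] power_decreasing[of 2 3 "\<theta> L"] power_decreasing[of 1 2 "\<theta> L"] by auto

lemma \<theta>_tendsto: "\<theta> \<longlonglongrightarrow> 0"
proof -
  have mj: "j \<le> m j" for j
  proof (induction j)
    case (Suc j)
    then show ?case using m_strict[of j "Suc j"] m_1 by (cases "j = 0") auto
  qed simp
  have "norm (\<theta> j) \<le> inverse (real j)" if "1 \<le> j" for j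
  proof -
    have "real j \<le> real (m j)" using mj by simp
    also have "\<dots> \<le> (real (m j))\<^sup>2" using m_ge2[of j] by (simp add: power2_eq_square)
    finally show ?thesis using that m_ge2[of j] by (simp add: \<theta>_def inverse_eq_divide frac_le)
  qed
  then show ?thesis
    by (intro Lim_null_comparison[OF _ LIMSEQ_inverse_real_of_nat_add_minus[of 0, simplified]]
      Lim_null_comparison[OF _ lim_inverse_n])
      (auto intro!: eventually_sequentiallyI[of 1])
qed

lemma n_less: "i < j \<Longrightarrow> n i < n j"
  using n_increasing by (auto simp: strict_mono_def)

lemma n_mono: "i \<le> j \<Longrightarrow> n i \<le> n j"
  using n_less by (metis le_eq_less_or_eq)

lemma n_ge1: "1 \<le> n j"
  using n_mono[of 0 j] n_0 by simp

lemma special_entries: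
  assumes "schreier_sigma_special n N1 N2 \<sigma> j s"
  shows "allowable (n (2 * j + 1)) (length s) (\<lambda>i. fst (s ! i))"
  using assms unfolding schreier_sigma_special_def sigma_special_def Sigma_seqs_def allowable_def by simp

lemma kf_zero: "kf (\<lambda>_. 0)"
  using kf_kw[OF kw_even[of 0 "\<lambda>_ _. 0" 0 "\<lambda>_. {}"]]
  by (simp add: allowable_def disjoint_family_on_def)

text \<open>A special sequence is in particular allowable for the same index, so odd weights can be
  opened in the same way as even ones.\<close>

lemma kw_expand:
  assumes "kw J g"
  obtains d c E where "g = (\<lambda>k. \<theta> J * (\<Sum>i<d. c i k))" "\<forall>i<d. kf (c i) \<and> supp (c i) \<subseteq> E i"
    "allowable (n J) d E"
  using assms
proof (cases rule: kw.cases)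
  case (kw_even d g' j E)
  then show ?thesis using that[of g' d E] by auto
next
  case (kw_odd j s g')
  have "allowable (n J) (length s) (\<lambda>i. fst (s ! i))" using special_entries kw_odd by simp
  then show ?thesis
    using kw_odd kf_kw by (intro that[of g' "length s" "\<lambda>i. fst (s ! i)"]) blast+
qed

lemma allowable_sum_le:
  assumes "allowable r d E" "\<And>i. i < d \<Longrightarrow> supp (c i) \<subseteq> E i"
    "\<And>i. i < d \<Longrightarrow> 0 \<le> c i k \<and> c i k \<le> (1::real)"
  shows "(\<Sum>i<d. c i k) \<le> 1" "0 \<le> (\<Sum>i<d. c i k)"
proof -
  show "0 \<le> (\<Sum>i<d. c i k)" using assms(3) by (intro sum_nonneg) auto
  show "(\<Sum>i<d. c i k) \<le> 1"
  proof (cases "\<exists>i<d. k \<in> E i")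
    case True
    then obtain i where i: "i < d" "k \<in> E i" by blast
    have "c l k = 0" if "l < d" "l \<noteq> i" for l
    proof -
      have "E i \<inter> E l = {}"
        using assms(1) i that unfolding allowable_def disjoint_family_on_def by (metis lessThan_iff)
      then have "k \<notin> E l" using i by auto
      then show ?thesis using assms(2)[OF that(1)] by (auto simp: supp_def)
    qed
    then have "(\<Sum>l<d. c l k) = (\<Sum>l\<in>{i}. c l k)" using i by (intro sum.mono_neutral_right) auto
    then show ?thesis using assms(3)[OF i(1)] by simp
  next
    case False
    then have "c i k = 0" if "i < d" for i using assms(2)[OF that] that by (auto simp: supp_def)
    then show ?thesis by simp
  qed
qed

lemma kf_bounds_aux:
  shows "kf g \<Longrightarrow> (\<forall>k. 0 \<le> g k \<and> g k \<le> 1) \<and> finite (supp g) \<and> supp g \<subseteq> {1..}"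
    and "kw J g \<Longrightarrow> (\<forall>k. 0 \<le> g k \<and> g k \<le> \<theta> J) \<and> finite (supp g) \<and> supp g \<subseteq> {1..}"
proof (induction rule: kf_kw.inducts)
  case (kf_unit k)
  moreover have "0 \<le> unit_vec k i \<and> unit_vec k i \<le> 1" for i by (simp add: unit_vec_def)
  ultimately show ?case by simp
next
  case (kf_kw J g)
  have "\<theta> J \<le> 1" using \<theta>_le[of J] by simp
  then show ?case using kf_kw by (meson order_trans)
next
  case (kw_even d g j E)
  have b: "0 \<le> (\<Sum>i<d. g i k)" "(\<Sum>i<d. g i k) \<le> 1" for k
    using allowable_sum_le[of "n (2 * j)" d E g k] kw_even by auto
  have "supp (\<lambda>k. \<theta> (2 * j) * (\<Sum>i<d. g i k)) \<subseteq> (\<Union>i<d. supp (g i))"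
    by (rule supp_scale_sum_subset)
  moreover have "finite (\<Union>i<d. supp (g i))" "(\<Union>i<d. supp (g i)) \<subseteq> {1..}" using kw_even by auto
  ultimately show ?case
  proof -
    have "0 \<le> \<theta> (2 * j) * (\<Sum>i<d. g i k) \<and> \<theta> (2 * j) * (\<Sum>i<d. g i k) \<le> \<theta> (2 * j)" for k
      using b[of k] \<theta>_pos[of "2 * j"] by (simp add: mult_left_le)
    then show ?thesis
      using \<open>supp _ \<subseteq> _\<close> \<open>finite (\<Union>i<d. supp (g i))\<close> \<open>(\<Union>i<d. supp (g i)) \<subseteq> {1..}\<close>
      by (meson finite_subset subset_trans)
  qed
next
  case (kw_odd j s g)
  have "0 \<le> g i k \<and> g i k \<le> 1" if "i < length s" for i k
  proof -
    have "0 \<le> g i k \<and> g i k \<le> \<theta> (2 * snd (s ! i))" using kw_odd(2) that by blast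
    then show ?thesis using \<theta>_le[of "2 * snd (s ! i)"] by linarith
  qed
  then have b: "0 \<le> (\<Sum>i<length s. g i k)" "(\<Sum>i<length s. g i k) \<le> 1" for k
    using allowable_sum_le[OF special_entries, of j s g k] kw_odd by auto
  have "supp (\<lambda>k. \<theta> (2 * j + 1) * (\<Sum>i<length s. g i k)) \<subseteq> (\<Union>i<length s. supp (g i))"
    by (rule supp_scale_sum_subset)
  moreover have "finite (\<Union>i<length s. supp (g i))" "(\<Union>i<length s. supp (g i)) \<subseteq> {1..}"
    using kw_odd by auto
  ultimately show ?case
  proof -
    have "0 \<le> \<theta> (2 * j + 1) * (\<Sum>i<length s. g i k) \<and> \<theta> (2 * j + 1) * (\<Sum>i<length s. g i k) \<le> \<theta> (2 * j + 1)" for k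
      using b[of k] \<theta>_pos[of "2 * j + 1"] by (simp add: mult_left_le)
    then show ?thesis
      using \<open>supp _ \<subseteq> _\<close> \<open>finite (\<Union>i<length s. supp (g i))\<close> \<open>(\<Union>i<length s. supp (g i)) \<subseteq> {1..}\<close>
      by (meson finite_subset subset_trans)
  qed
qed

lemma kf_nonneg: "kf g \<Longrightarrow> 0 \<le> g k" and kf_le1: "kf g \<Longrightarrow> g k \<le> 1"
  and kf_supp: "kf g \<Longrightarrow> finite (supp g)" "kf g \<Longrightarrow> supp g \<subseteq> {1..}"
  using kf_bounds_aux(1) by auto

lemma kw_le: "kw J g \<Longrightarrow> g k \<le> \<theta> J"
  using kf_bounds_aux(2) by auto

lemma rst_scale_sum: "rst A (\<lambda>k. c * (\<Sum>i\<in>I. g i k)) = (\<lambda>k. c * (\<Sum>i\<in>I. rst A (g i) k))"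
  by (auto simp: rst_def)

text \<open>The clauses of \<open>kw\<close> ask only that supports be contained in the sets of the
  allowable or special sequence. So a restricted tree keeps its sets and its weights.\<close>

lemma rst_aux:
  shows "kf g \<Longrightarrow> kf (rst A g)" and "kw J g \<Longrightarrow> kw J (rst A g)"
proof (induction rule: kf_kw.inducts)
  case (kf_unit k)
  have "rst A (unit_vec k) = (if k \<in> A then unit_vec k else (\<lambda>_. 0))"
    by (auto simp: rst_def unit_vec_def)
  then show ?case using kf_unit kf_zero by (auto intro: kf_kw.intros)
next
  case (kf_kw J g)
  then show ?case by (auto intro: kf_kw.intros)
next
  case (kw_even d g j E)
  then show ?case unfolding rst_scale_sum by (intro kf_kw.kw_even[where E=E]) (auto simp: supp_rst)
next
  case (kw_odd j s g)
  then show ?case unfolding rst_scale_sum by (intro kf_kw.kw_odd) (auto simp: supp_rst)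
qed

lemmas kf_rst = rst_aux(1) and kw_rst = rst_aux(2)

section \<open>Building and opening functionals along allowable families\<close>

lemma Min_disjoint_inj:
  assumes "disjoint_family_on F X" "\<And>x. x \<in> X \<Longrightarrow> finite (F x) \<and> F x \<noteq> {}"
  shows "inj_on (\<lambda>x. Min (F x)) X"
proof (rule inj_onI)
  fix x y assume xy: "x \<in> X" "y \<in> X" "Min (F x) = Min (F y)"
  then have "Min (F x) \<in> F x \<inter> F y" using assms(2)[of x] assms(2)[of y] Min_in by force
  then show "x = y" using assms(1) xy by (auto simp: disjoint_family_on_def)
qed

lemma allowable_fam:
  assumes "allowable r d E" "\<And>i. i < d \<Longrightarrow> supp (c i) \<subseteq> E i"
  shows "fam r {..<d} c (\<lambda>i. Min (E i))"
proof -
  have E: "\<And>i. i < d \<Longrightarrow> finite (E i) \<and> E i \<noteq> {} \<and> E i \<subseteq> {1..}" "disjoint_family_on E {..<d}"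
    "(\<lambda>i. Min (E i)) ` {..<d} \<in> schreier r"
    using assms(1) by (auto simp: allowable_def)
  have "inj_on (\<lambda>i. Min (E i)) {..<d}" using E by (intro Min_disjoint_inj) auto
  then have "Msm r {..<d} (\<lambda>i. Min (E i))"
    by (rule Msm_inj[OF schreier_Msm[OF E(3)]]) simp_all
  moreover have "1 \<le> Min (E i)" "supp (c i) \<subseteq> {Min (E i)..}" if "i < d" for i
  proof -
    have "Min (E i) \<in> E i" using E(1)[OF that] by (intro Min_in) auto
    then show "1 \<le> Min (E i)" using E(1)[OF that] by auto
    have "E i \<subseteq> {Min (E i)..}" using E(1)[OF that] Min_le[of "E i"] by auto
    then show "supp (c i) \<subseteq> {Min (E i)..}" using assms(2) that by blast
  qed
  moreover have "disjoint_family_on (\<lambda>i. supp (c i)) {..<d}"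
    using E(2) assms(2) unfolding disjoint_family_on_def by (meson disjoint_iff lessThan_iff subsetD)
  ultimately show ?thesis by (auto simp: fam_def)
qed

lemma supp_child:
  fixes d :: nat
  assumes "i < d" "\<And>i k. i < d \<Longrightarrow> (0::real) \<le> g i k"
  shows "supp (g i) \<subseteq> supp (\<lambda>k. \<theta> J * (\<Sum>i<d. g i k))"
proof
  fix k assume "k \<in> supp (g i)"
  then have "0 < g i k" using assms(2)[OF assms(1), of k] by (auto simp: supp_def less_eq_real_def)
  then have "0 < (\<Sum>i<d. g i k)" using assms by (intro sum_pos2[of _ i]) auto
  then show "k \<in> supp (\<lambda>k. \<theta> J * (\<Sum>i<d. g i k))" using \<theta>_pos[of J] by (auto simp: supp_def)
qed

lemma kw_expand_fam:
  assumes "kw J g"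
  shows "\<exists>c d st. g = (\<lambda>k. \<theta> J * (\<Sum>i<d. c i k)) \<and> (\<forall>i<d. kf (c i)) \<and>
    fam (n J) {..<d::nat} c st \<and> (\<forall>i<d. supp (c i) \<subseteq> supp g)"
proof -
  obtain c d E where g: "g = (\<lambda>k. \<theta> J * (\<Sum>i<d. c i k))" and c: "\<forall>i<d. kf (c i) \<and> supp (c i) \<subseteq> E i"
    and E: "allowable (n J) d E" by (rule kw_expand[OF assms])
  have "fam (n J) {..<d} c (\<lambda>i. Min (E i))" using c by (intro allowable_fam[OF E]) blast
  moreover have "\<forall>i<d. supp (c i) \<subseteq> supp g"
    unfolding g using c kf_nonneg supp_child[of _ d c J] by blast
  moreover have "\<forall>i<d. kf (c i)" using c by blast
  ultimately show ?thesis using g by blast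
qed

lemma kw_even_set:
  assumes "finite X" "\<And>x. x \<in> X \<Longrightarrow> kf (g x)" "disjoint_family_on (\<lambda>x. supp (g x)) X"
    "(\<lambda>x. Min (supp (g x))) ` {x\<in>X. supp (g x) \<noteq> {}} \<in> schreier (n (2 * j))"
  shows "kw (2 * j) (\<lambda>k. \<theta> (2 * j) * (\<Sum>x\<in>X. g x k))"
proof -
  define X' where "X' = {x\<in>X. supp (g x) \<noteq> {}}"
  have "finite X'" using assms(1) by (auto simp: X'_def)
  then obtain f where f: "bij_betw f {..<card X'} X'"
    using ex_bij_betw_nat_finite lessThan_atLeast0 by metis
  have fX: "f i \<in> X" "supp (g (f i)) \<noteq> {}" if "i < card X'" for i
    using f that by (auto simp: bij_betw_def X'_def)
  have img: "f ` {..<card X'} = X'" and inj: "inj_on f {..<card X'}" using f by (auto simp: bij_betw_def)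
  have "(\<Sum>x\<in>X. g x k) = (\<Sum>i<card X'. g (f i) k)" for k
  proof -
    have "(\<Sum>x\<in>X. g x k) = (\<Sum>x\<in>X'. g x k)"
      using assms(1) by (intro sum.mono_neutral_right) (auto simp: X'_def supp_def)
    then show ?thesis using sum.reindex[OF inj, of "\<lambda>x. g x k"] img by simp
  qed
  moreover have "kw (2 * j) (\<lambda>k. \<theta> (2 * j) * (\<Sum>i<card X'. g (f i) k))"
  proof (rule kw_even[where E="\<lambda>i. supp (g (f i))"])
    have "(\<lambda>x. Min (supp (g x))) ` f ` {..<card X'} = (\<lambda>x. Min (supp (g x))) ` X'"
      using img by simp
    then have "(\<lambda>i. Min (supp (g (f i)))) ` {..<card X'} = (\<lambda>x. Min (supp (g x))) ` X'"
      by (simp only: image_image)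
    moreover have "disjoint_family_on (\<lambda>i. supp (g (f i))) {..<card X'}"
      using assms(3) inj fX unfolding disjoint_family_on_def inj_on_def by (meson lessThan_iff)
    ultimately show "allowable (n (2 * j)) (card X') (\<lambda>i. supp (g (f i)))"
      using assms(2,4) fX kf_supp unfolding allowable_def X'_def by simp
  qed (use assms(2) fX in auto)
  ultimately show ?thesis by simp
qed

text \<open>Members with empty support are dropped, and the minima of the other supports lie to the
  right of their starts, possibly in another order. \<open>schreier_spread\<close> makes up for
  both.\<close>

lemma kw_even_start:
  assumes "finite X" "\<And>x. x \<in> X \<Longrightarrow> kf (g x)" "disjoint_family_on (\<lambda>x. supp (g x)) X"
    "inj_on st X" "st ` X \<in> schreier (n (2 * j))" "\<And>x. x \<in> X \<Longrightarrow> supp (g x) \<subseteq> {st x..}"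
  shows "kw (2 * j) (\<lambda>k. \<theta> (2 * j) * (\<Sum>x\<in>X. g x k))"
proof (rule kw_even_set[OF assms(1-3)])
  define X' where "X' = {x\<in>X. supp (g x) \<noteq> {}}"
  define mn where "mn x = Min (supp (g x))" for x
  have X': "X' \<subseteq> X" "finite X'" using assms(1) by (auto simp: X'_def)
  have mn: "mn x \<in> supp (g x)" if "x \<in> X'" for x
    unfolding mn_def using that assms(2) kf_supp by (intro Min_in) (auto simp: X'_def)
  have inj: "inj_on mn X'"
    unfolding mn_def using assms(2,3) kf_supp X'
    by (intro Min_disjoint_inj disjoint_family_on_mono[OF X'(1)]) (auto simp: X'_def)
  define f where "f = st \<circ> inv_into X' mn"
  have f: "f (mn x) = st x" if "x \<in> X'" for x using inv_into_f_f[OF inj that] by (simp add: f_def)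
  have "mn ` X' \<in> schreier (n (2 * j))"
  proof (rule schreier_spread[OF assms(5), of _ f])
    show "mn ` X' \<subseteq> {1..}" using mn kf_supp(2) assms(2) X'(1) by blast
    show "f ` mn ` X' \<subseteq> st ` X" using f X'(1) by auto
    show "inj_on f (mn ` X')"
    proof (rule inj_onI)
      fix a b assume "a \<in> mn ` X'" "b \<in> mn ` X'" "f a = f b"
      then obtain x y where "x \<in> X'" "y \<in> X'" "a = mn x" "b = mn y" "st x = st y" using f by auto
      then show "a = b" using assms(4) X'(1) by (metis inj_onD subsetD)
    qed
    show "f b \<le> b" if "b \<in> mn ` X'" for b using that f mn assms(6) X'(1) by fastforce
  qed (use X' in auto)
  then show "(\<lambda>x. Min (supp (g x))) ` {x\<in>X. supp (g x) \<noteq> {}} \<in> schreier (n (2 * j))"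
    by (simp add: mn_def X'_def)
qed

text \<open>The weight \<open>m 0 = 2\<close> with complexity \<open>n 0 = 1\<close> has squared
  weight 1/4 and admits every disjoint family whose supports do not begin before the number of its
  members. So each level of an \<open>Msm\<close> family can be rebuilt inside the norming set at
  the price of a factor 1/4.\<close>

lemma kf_sum_quarter:
  assumes "finite X" "\<And>x. x \<in> X \<Longrightarrow> kf (g x)" "disjoint_family_on (\<lambda>x. supp (g x)) X"
    "\<And>x. x \<in> X \<Longrightarrow> supp (g x) \<subseteq> {card X..}"
  shows "kf (\<lambda>k. 1/4 * (\<Sum>x\<in>X. g x k))"
proof -
  define B where "B = (\<lambda>x. Min (supp (g x))) ` {x\<in>X. supp (g x) \<noteq> {}}"
  have "card B \<le> card {x\<in>X. supp (g x) \<noteq> {}}"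
    unfolding B_def using assms(1) by (intro card_image_le) auto
  also have "\<dots> \<le> card X" using assms(1) by (intro card_mono) auto
  finally have cB: "card B \<le> card X" .
  have mem: "card X \<le> b \<and> 1 \<le> b" if bB: "b \<in> B" for b
  proof -
    obtain x where "x \<in> X" "b \<in> supp (g x)" using bB assms(2) kf_supp(1) Min_in unfolding B_def by blast
    then show ?thesis using assms(4) kf_supp(2)[OF assms(2)] by fastforce
  qed
  have "finite B" unfolding B_def using assms(1) by auto
  moreover have "card B \<le> Min B" if "B \<noteq> {}"
    using mem[OF Min_in[OF \<open>finite B\<close> that]] cB by linarith
  moreover have "B \<subseteq> {1..}" using mem by auto
  ultimately have "B \<in> schreier (n (2 * 0))" unfolding mult_0_right n_0 One_nat_def schreier.simps(2) by blast
  then show ?thesis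
    using kw_even_set[OF assms(1-3), of 0] \<theta>_0 unfolding B_def by (auto intro: kf_kw)
qed

lemma kf_sum_fam:
  assumes "fam r I h st" "\<And>i. i \<in> I \<Longrightarrow> kf (h i)"
  shows "kf (\<lambda>k. (1/4) ^ r * (\<Sum>i\<in>I. h i k))"
  using assms
proof (induction r arbitrary: I)
  case 0
  then have "finite I" "card I \<le> 1" by (auto simp: fam_def)
  show ?case
  proof (cases "I = {}")
    case False
    then have "card I = 1" using \<open>finite I\<close> \<open>card I \<le> 1\<close> card_0_eq[of I] by linarith
    then obtain i where "I = {i}" using card_1_singletonE by blast
    then show ?thesis using 0 by simp
  qed (simp add: kf_zero)
next
  case (Suc r)
  then obtain d and c :: "'a \<Rightarrow> nat" where c: "c ` I \<subseteq> {..<d}" "\<forall>x<d. Msm r {i\<in>I. c i = x} st" "\<forall>i\<in>I. d \<le> st i"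
    unfolding fam_def Msm.simps by blast
  have finI: "finite I" using fam_finite[OF Suc.prems(1)] .
  define G where "G x = (\<lambda>k. (1/4) ^ r * (\<Sum>i\<in>{i\<in>I. c i = x}. h i k))" for x
  have Gsupp: "supp (G x) \<subseteq> (\<Union>i\<in>{i\<in>I. c i = x}. supp (h i))" for x
    unfolding G_def by (rule supp_scale_sum_subset)
  have kfG: "kf (G x)" if "x < d" for x
  proof -
    have "fam r {i\<in>I. c i = x} h st"
      using Suc.prems(1) c(2) that unfolding fam_def disjoint_family_on_def by auto
    then show ?thesis unfolding G_def using Suc.prems(2) by (intro Suc.IH) auto
  qed
  have "kf (\<lambda>k. 1/4 * (\<Sum>x\<in>{..<d}. G x k))"
  proof (rule kf_sum_quarter)
    show "disjoint_family_on (\<lambda>x. supp (G x)) {..<d}"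
      unfolding disjoint_family_on_def
    proof (intro ballI impI)
      fix x y :: nat assume "x \<noteq> y"
      have disj: "supp (h i) \<inter> supp (h i') = {}" if "i \<in> I" "i' \<in> I" "c i = x" "c i' = y" for i i'
        using Suc.prems(1) that \<open>x \<noteq> y\<close> unfolding fam_def disjoint_family_on_def by metis
      have "k \<notin> supp (G y)" if "k \<in> supp (G x)" for k
      proof
        assume "k \<in> supp (G y)"
        then obtain i i' where "i \<in> I" "c i = x" "k \<in> supp (h i)" "i' \<in> I" "c i' = y" "k \<in> supp (h i')"
          using \<open>k \<in> supp (G x)\<close> Gsupp[of x] Gsupp[of y] by blast
        then show False using disj by blast
      qed
      then show "supp (G x) \<inter> supp (G y) = {}" by blast
    qed
    show "supp (G x) \<subseteq> {card {..<d}..}" for x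
    proof
      fix k assume "k \<in> supp (G x)"
      then obtain i where "i \<in> I" "k \<in> supp (h i)" using Gsupp[of x] by auto
      then have "st i \<le> k" "d \<le> st i" using c(3) Suc.prems(1) by (auto simp: fam_def)
      then show "k \<in> {card {..<d}..}" by simp
    qed
  qed (use kfG in auto)
  also have "(\<lambda>k. 1/4 * (\<Sum>x\<in>{..<d}. G x k)) = (\<lambda>k. (1/4) ^ Suc r * (\<Sum>i\<in>I. h i k))"
  proof
    fix k
    have "(\<Sum>x<d. \<Sum>i\<in>{i\<in>I. c i = x}. h i k) = (\<Sum>i\<in>I. h i k)"
      using c(1) by (intro sum.group finI) auto
    then show "1/4 * (\<Sum>x\<in>{..<d}. G x k) = (1/4) ^ Suc r * (\<Sum>i\<in>I. h i k)"
      by (simp add: G_def sum_distrib_left[symmetric])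
  qed
  finally show ?case .
qed

text \<open>If all single functionals are at most 1 on \<open>a\<close>, the sum over a family of
  complexity \<open>r\<close> is in general only bounded by \<open>4 ^ r\<close>, see
  \<open>fam_bound\<close>; averages are the vectors for which a bound chosen independently of
  \<open>r\<close> is available. The index type is fixed to \<open>nat\<close> because a definition
  cannot quantify over types; \<open>avg_fam\<close> recovers the other index types.\<close>

definition avg :: "nat \<Rightarrow> real \<Rightarrow> (nat \<Rightarrow> real) \<Rightarrow> bool" where
  "avg r C a \<longleftrightarrow> (\<forall>(I :: nat set) h st. fam r I h st \<and> (\<forall>i\<in>I. kf (h i)) \<longrightarrow> (\<Sum>i\<in>I. pr (h i) a) \<le> C)"

lemma avg_fam:
  assumes "avg r C a" "fam s I h st" "\<And>i. i \<in> I \<Longrightarrow> kf (h i)" "s \<le> r"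
  shows "(\<Sum>i\<in>I. pr (h i) a) \<le> C"
proof -
  obtain f where f: "bij_betw f {..<card I} I"
    using ex_bij_betw_nat_finite[OF fam_finite[OF assms(2)]] lessThan_atLeast0 by metis
  have fam: "fam r I h st" using fam_mono assms(2,4) by blast
  have "fam r {..<card I} (h \<circ> f) (st \<circ> f)"
    using f by (intro fam_reindex[OF fam]) (auto simp: bij_betw_def)
  then have "(\<Sum>i<card I. pr ((h \<circ> f) i) a) \<le> C"
  proof -
    have "\<forall>i\<in>{..<card I}. kf ((h \<circ> f) i)" using assms(3) f by (auto simp: bij_betw_def)
    then show ?thesis using assms(1) \<open>fam r {..<card I} (h \<circ> f) (st \<circ> f)\<close> unfolding avg_def by blast
  qed
  also have "(\<Sum>i<card I. pr ((h \<circ> f) i) a) = (\<Sum>i\<in>I. pr (h i) a)"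
    using sum.reindex_bij_betw[OF f, of "\<lambda>i. pr (h i) a"] by simp
  finally show ?thesis .
qed

lemma avg_kf: "avg r C a \<Longrightarrow> kf g \<Longrightarrow> pr g a \<le> C"
  using avg_fam[of r C a 0 "{()}" "\<lambda>_. g" "\<lambda>_. 1"] kf_supp(2)[of g]
  by (simp add: fam_def disjoint_family_on_def)

lemma avg_nonneg: "avg r C a \<Longrightarrow> 0 \<le> C"
  using avg_kf[OF _ kf_zero, of r C a] by (simp add: pr_def)

lemma avg_le:
  assumes "avg r C b" "finite (supp b)" "\<And>k. 0 \<le> a k" "\<And>k. a k \<le> b k"
  shows "avg r C a"
  unfolding avg_def
proof (intro allI impI)
  fix I :: "nat set" and h st assume I: "fam r I h st \<and> (\<forall>i\<in>I. kf (h i))"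
  then have "(\<Sum>i\<in>I. pr (h i) a) \<le> (\<Sum>i\<in>I. pr (h i) b)"
    using assms(2-4) kf_nonneg by (intro sum_mono pr_mono_right) auto
  then show "(\<Sum>i\<in>I. pr (h i) a) \<le> C" using assms(1) I unfolding avg_def by (meson order_trans)
qed

text \<open>Crude, but sufficient for \<open>r = 1\<close>, and wherever the result is multiplied by
  the small mass of an exceptional set.\<close>

lemma fam_bound:
  assumes "fam r I h st" "\<And>i. i \<in> I \<Longrightarrow> kf (h i)" "\<And>g. kf g \<Longrightarrow> pr g a \<le> C"
  shows "(\<Sum>i\<in>I. pr (h i) a) \<le> 4 ^ r * C"
proof -
  have "(1/4) ^ r * (\<Sum>i\<in>I. pr (h i) a) \<le> C"
    using assms(3)[OF kf_sum_fam[OF assms(1,2)]] by (simp add: pr_scale_left pr_sum_left)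
  then show ?thesis by (simp add: power_one_over field_simps)
qed

end

section \<open>Comparison with the norm\<close>

lemma pr_unit: "finite (supp x) \<Longrightarrow> pr (unit_vec k) x = x k"
proof -
  assume "finite (supp x)"
  then have "pr (unit_vec k) x = (\<Sum>i\<in>insert k (supp x). unit_vec k i * x i)" by (intro pr_eq) auto
  also have "\<dots> = (\<Sum>i\<in>insert k (supp x). if i = k then x i else 0)"
    by (intro sum.cong) (auto simp: unit_vec_def)
  also have "\<dots> = x k" using \<open>finite (supp x)\<close> by (simp add: sum.delta')
  finally show ?thesis .
qed

context wh_parameters
begin

abbreviation "Dfun \<equiv> wh_functional m n N1 N2 \<sigma>"
abbreviation "Dwt \<equiv> wh_weight m n N1 N2 \<sigma>"
abbreviation "nrm \<equiv> wh_norm m n N1 N2 \<sigma>"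

lemma m_eq: "m i = m j \<Longrightarrow> 2 \<le> j \<Longrightarrow> i = j"
  using m_strict[of i j] m_strict[of j i] m_strict[of 1 j] m_0 m_1
  by (cases "i = 0"; cases i j rule: linorder_cases) auto

lemma special_index_pos:
  assumes "schreier_sigma_special n N1 N2 \<sigma> j s" "i < length s"
  shows "1 \<le> snd (s ! i)"
proof -
  have "s \<in> Sigma_seqs N1 N2" using assms by (auto simp: schreier_sigma_special_def sigma_special_def)
  then have "snd (s ! i) \<in> N1 \<union> N2"
    using assms(2) unfolding Sigma_seqs_def by (cases "i = 0") auto
  then show ?thesis using N_union by auto
qed

lemma squared_pairing_le:
  assumes "finite (supp x)" "(\<Sum>i<d. (a i)\<^sup>2) \<le> 1" "\<And>i. i < d \<Longrightarrow> (pr (f i) x)\<^sup>2 \<le> pr (g i) (sq x)"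
  shows "(pr (\<lambda>k. 1 / real (m J) * (\<Sum>i<d. a i * f i k)) x)\<^sup>2 \<le> pr (\<lambda>k. \<theta> J * (\<Sum>i<d. g i k)) (sq x)"
proof -
  have "pr (\<lambda>k. 1 / real (m J) * (\<Sum>i<d. a i * f i k)) x = 1 / real (m J) * (\<Sum>i<d. a i * pr (f i) x)"
    unfolding pr_scale_left pr_sum_left pr_scale_left ..
  then have "(pr (\<lambda>k. 1 / real (m J) * (\<Sum>i<d. a i * f i k)) x)\<^sup>2 = \<theta> J * (\<Sum>i<d. a i * pr (f i) x)\<^sup>2"
    by (simp add: \<theta>_def power_divide)
  also have "\<dots> \<le> \<theta> J * ((\<Sum>i<d. (a i)\<^sup>2) * (\<Sum>i<d. (pr (f i) x)\<^sup>2))"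
    using \<theta>_pos[of J] by (intro mult_left_mono Cauchy_Schwarz_ineq_sum) auto
  also have "\<dots> \<le> \<theta> J * (1 * (\<Sum>i<d. pr (g i) (sq x)))"
    using \<theta>_pos[of J] assms(2,3) by (intro mult_left_mono mult_mono sum_mono) (auto intro: sum_nonneg)
  also have "\<dots> = pr (\<lambda>k. \<theta> J * (\<Sum>i<d. g i k)) (sq x)"
    unfolding pr_scale_left pr_sum_left by simp
  finally show ?thesis .
qed

text \<open>A vanishing coefficient can make the support of a functional smaller than that of the
  tree dominating it. The parent is built over the supports of the functionals, so the tree is cut
  back to them.\<close>

lemma squared_pairing_rst:
  assumes "finite (supp x)" "\<And>x. finite (supp x) \<Longrightarrow> (pr f x)\<^sup>2 \<le> pr g (sq x)"
  shows "(pr f x)\<^sup>2 \<le> pr (rst (supp f) g) (sq x)"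
proof -
  have "rst (supp f) f = f" by (auto simp: rst_def supp_def)
  then have "pr f x = pr f (rst (supp f) x)" using pr_rst[OF assms(1), of "supp f" f] by simp
  also have "(pr f (rst (supp f) x))\<^sup>2 \<le> pr g (sq (rst (supp f) x))"
    using assms(1) by (intro assms(2)) (simp add: supp_rst)
  finally show ?thesis using pr_rst[of "sq x" "supp f" g] assms(1) by (simp add: sq_rst)
qed

lemma functional_dominated:
  shows "Dfun f \<Longrightarrow> \<exists>g. kf g \<and> supp g \<subseteq> supp f \<and> (\<forall>x. finite (supp x) \<longrightarrow> (pr f x)\<^sup>2 \<le> pr g (sq x))"
    and "Dwt f w \<Longrightarrow> \<exists>J g. w = m J \<and> kw J g \<and> supp g \<subseteq> supp f \<and>
           (\<forall>x. finite (supp x) \<longrightarrow> (pr f x)\<^sup>2 \<le> pr g (sq x))"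
proof (induction rule: wh_functional_wh_weight.inducts)
  case (unit_pos k)
  then show ?case
    by (intro exI[of _ "unit_vec k"]) (simp add: kf_unit pr_unit, simp add: sq_def)
next
  case (unit_neg k)
  have "supp (\<lambda>i. - unit_vec k i) = {k}" by (auto simp: supp_def unit_vec_def)
  moreover have "pr (\<lambda>i. - unit_vec k i) x = - x k" if "finite (supp x)" for x
    using pr_scale_left[of "-1" "unit_vec k" x] pr_unit[OF that, of k] by simp
  ultimately show ?case using unit_neg
    by (intro exI[of _ "unit_vec k"]) (simp add: kf_unit pr_unit, simp add: sq_def)
next
  case (weighted f w)
  then show ?case using kf_kw by blast
next
  case (even_weight d f j a)
  then have "\<forall>i<d. \<exists>g. kf g \<and> supp g \<subseteq> supp (f i) \<and> (\<forall>x. finite (supp x) \<longrightarrow> (pr (f i) x)\<^sup>2 \<le> pr g (sq x))"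
    by blast
  then obtain g where g: "\<And>i. i < d \<Longrightarrow> kf (g i) \<and> supp (g i) \<subseteq> supp (f i)"
    "\<And>i x. i < d \<Longrightarrow> finite (supp x) \<Longrightarrow> (pr (f i) x)\<^sup>2 \<le> pr (g i) (sq x)" by metis
  let ?f = "\<lambda>k. 1 / real (m (2 * j)) * (\<Sum>i<d. a i * f i k)"
  let ?g = "\<lambda>k. \<theta> (2 * j) * (\<Sum>i<d. g i k)"
  have "kw (2 * j) ?g" using g even_weight by (intro kw_even[where E="\<lambda>i. supp (f i)"]) auto
  moreover have "(pr ?f x)\<^sup>2 \<le> pr ?g (sq x)" if "finite (supp x)" for x
    using squared_pairing_le[of x a d f g] g(2) that even_weight by blast
  ultimately show ?case
    using squared_pairing_rst[of _ ?f ?g]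
    by (intro exI[of _ "2 * j"] exI[of _ "rst (supp ?f) ?g"]) (simp add: kw_rst supp_rst)
next
  case (odd_weight s f j a)
  have "\<exists>g. kw (2 * snd (s ! i)) g \<and> supp g \<subseteq> supp (f i) \<and>
      (\<forall>x. finite (supp x) \<longrightarrow> (pr (f i) x)\<^sup>2 \<le> pr g (sq x))" if i: "i < length s" for i
  proof -
    obtain J g where J: "m (2 * snd (s ! i)) = m J" and g: "kw J g" "supp g \<subseteq> supp (f i)"
      "\<forall>x. finite (supp x) \<longrightarrow> (pr (f i) x)\<^sup>2 \<le> pr g (sq x)"
      using odd_weight i by blast
    \<comment> \<open>\<open>m 0 = m 1\<close> is the only coincidence of weights. The indices of a
      special sequence are positive, so the index here is at least 2 and the weight determines
      it.\<close>
    have "2 * snd (s ! i) = J"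
      using m_eq[of J "2 * snd (s ! i)"] J special_index_pos[OF odd_weight(2) i] by simp
    then show ?thesis using g by blast
  qed
  then obtain g where g: "\<And>i. i < length s \<Longrightarrow> kw (2 * snd (s ! i)) (g i) \<and> supp (g i) \<subseteq> supp (f i)"
    "\<And>i x. i < length s \<Longrightarrow> finite (supp x) \<Longrightarrow> (pr (f i) x)\<^sup>2 \<le> pr (g i) (sq x)" by metis
  let ?f = "\<lambda>k. 1 / real (m (2 * j + 1)) * (\<Sum>i<length s. a i * f i k)"
  let ?g = "\<lambda>k. \<theta> (2 * j + 1) * (\<Sum>i<length s. g i k)"
  have "kw (2 * j + 1) ?g"
  proof (rule kw_odd)
    show "\<forall>i<length s. supp (g i) \<subseteq> fst (s ! i)" using g odd_weight(3) by (meson subset_trans)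
  qed (use g odd_weight in auto)
  moreover have "(pr ?f x)\<^sup>2 \<le> pr ?g (sq x)" if "finite (supp x)" for x
    using squared_pairing_le[of x a "length s" f g] g(2) that odd_weight by blast
  ultimately show ?case
    using squared_pairing_rst[of _ ?f ?g]
    by (intro exI[of _ "2 * j + 1"] exI[of _ "rst (supp ?f) ?g"]) (simp add: kw_rst supp_rst)
qed

text \<open>The coefficients below are the ones for which the Cauchy-Schwarz inequality is an equality;
  if T = 0 they vanish because of x / 0 = 0.\<close>

lemma realised_pairing:
  assumes "T = (\<Sum>i<d. t i)" "\<And>i. i < d \<Longrightarrow> 0 \<le> t i" "\<And>i. i < d \<Longrightarrow> pr (f i) x = sqrt (t i)"
  shows "pr (\<lambda>k. 1 / real (m J) * (\<Sum>i<d. sqrt (t i) / sqrt T * f i k)) x = sqrt (\<theta> J * T)"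
    "(\<Sum>i<d. (sqrt (t i) / sqrt T)\<^sup>2) \<le> 1"
proof -
  have T: "0 \<le> T" using assms by (auto intro: sum_nonneg)
  have "pr (\<lambda>k. 1 / real (m J) * (\<Sum>i<d. sqrt (t i) / sqrt T * f i k)) x =
      1 / real (m J) * (\<Sum>i<d. sqrt (t i) / sqrt T * pr (f i) x)"
    unfolding pr_scale_left pr_sum_left pr_scale_left ..
  also have "(\<Sum>i<d. sqrt (t i) / sqrt T * pr (f i) x) = (\<Sum>i<d. t i) / sqrt T"
    using assms(2,3) unfolding sum_divide_distrib by (intro sum.cong) auto
  also have "(\<Sum>i<d. t i) / sqrt T = sqrt T" using assms(1) T by (simp add: real_div_sqrt)
  also have "1 / real (m J) * sqrt T = sqrt (\<theta> J * T)"
    using m_ge2[of J] by (simp add: \<theta>_def real_sqrt_mult real_sqrt_divide)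
  finally show "pr (\<lambda>k. 1 / real (m J) * (\<Sum>i<d. sqrt (t i) / sqrt T * f i k)) x = sqrt (\<theta> J * T)" .
  have "(\<Sum>i<d. (sqrt (t i) / sqrt T)\<^sup>2) = (\<Sum>i<d. t i) / T"
    using assms(2) T unfolding sum_divide_distrib by (intro sum.cong) (auto simp: power_divide)
  then show "(\<Sum>i<d. (sqrt (t i) / sqrt T)\<^sup>2) \<le> 1" using assms(1) by (cases "T = 0") auto
qed

text \<open>The converse holds vector by vector, since the optimal coefficients depend on
  \<open>x\<close>. The functionals chosen for the children may have smaller supports than the sets
  \<open>E i\<close>, even empty ones. The empty ones are discarded, and the minima of the others
  are a spread of the old minima.\<close>

lemma functional_realised:
  assumes x: "finite (supp x)"
  shows "kf g \<Longrightarrow> \<exists>f. Dfun f \<and> supp f \<subseteq> supp g \<and> pr f x = sqrt (pr g (sq x))"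
    and "kw J g \<Longrightarrow> \<exists>f. Dwt f (m J) \<and> supp f \<subseteq> supp g \<and> pr f x = sqrt (pr g (sq x))"
proof (induction rule: kf_kw.inducts)
  case (kf_unit k)
  have sk: "pr (unit_vec k) (sq x) = (x k)\<^sup>2"
    using pr_unit[of "sq x" k] x unfolding supp_sq by (simp only: sq_def)
  show ?case
  proof (cases "0 \<le> x k")
    case True
    then show ?thesis using kf_unit sk pr_unit[OF x, of k]
      by (intro exI[of _ "unit_vec k"]) (simp add: wh_functional_wh_weight.unit_pos)
  next
    case False
    have "pr (\<lambda>i. - unit_vec k i) x = - x k"
      using pr_scale_left[of "-1" "unit_vec k" x] pr_unit[OF x, of k] by simp
    moreover have "supp (\<lambda>i. - unit_vec k i) = {k}" by (auto simp: supp_def unit_vec_def)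
    ultimately show ?thesis using kf_unit sk False
      by (intro exI[of _ "\<lambda>i. - unit_vec k i"]) (simp add: wh_functional_wh_weight.unit_neg)
  qed
next
  case (kf_kw J g)
  then show ?case using wh_functional_wh_weight.weighted by blast
next
  case (kw_even d g j E)
  then obtain f where f: "\<And>i. i < d \<Longrightarrow> Dfun (f i)" "\<And>i. i < d \<Longrightarrow> supp (f i) \<subseteq> supp (g i)"
    "\<And>i. i < d \<Longrightarrow> pr (f i) x = sqrt (pr (g i) (sq x))" by metis
  have kg: "\<And>i. i < d \<Longrightarrow> kf (g i)" using kw_even by blast
  have g0: "0 \<le> g i k" if "i < d" for i k using kf_nonneg kg that by blast
  have fin: "finite (supp (f i))" if "i < d" for i
    using f(2)[OF that] kf_supp(1)[OF kg[OF that]] finite_subset by blast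
  have E: "\<And>i. i < d \<Longrightarrow> finite (E i) \<and> E i \<noteq> {} \<and> E i \<subseteq> {1..}" "disjoint_family_on E {..<d}"
    "(\<lambda>i. Min (E i)) ` {..<d} \<in> schreier (n (2 * j))"
    using kw_even(2) by (auto simp: allowable_def)
  have fE: "supp (f i) \<subseteq> E i" if "i < d" for i using f(2) kw_even(3) that by blast
  define X where "X = {i. i < d \<and> supp (f i) \<noteq> {}}"
  have finX: "finite X" by (auto simp: X_def)
  obtain e where e: "bij_betw e {..<card X} X"
    using ex_bij_betw_nat_finite[OF finX] lessThan_atLeast0 by metis
  have eX: "e i < d" "supp (f (e i)) \<noteq> {}" if "i < card X" for i
    using e that by (auto simp: bij_betw_def X_def)
  have einj: "inj_on e {..<card X}" and eimg: "e ` {..<card X} = X" using e by (auto simp: bij_betw_def)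
  define t where "t i = pr (g i) (sq x)" for i
  have t0: "0 \<le> t i" if "i < d" for i
    unfolding t_def using g0[OF that] by (intro pr_nonneg) (auto simp: sq_def)
  define T where "T = (\<Sum>i<d. t i)"
  have "t i = 0" if "i < d" "i \<notin> X" for i
  proof -
    have "pr (f i) x = 0" using that by (intro pr_disjoint) (auto simp: X_def)
    then show ?thesis using f(3)[OF that(1)] by (simp add: t_def)
  qed
  then have "T = (\<Sum>i\<in>X. t i)" unfolding T_def by (intro sum.mono_neutral_right) (auto simp: X_def)
  then have T: "T = (\<Sum>i<card X. t (e i))"
    using sum.reindex_bij_betw[OF e, of t] by simp
  let ?f = "\<lambda>k. 1 / real (m (2 * j)) * (\<Sum>i<card X. sqrt (t (e i)) / sqrt T * f (e i) k)"
  let ?g = "\<lambda>k. \<theta> (2 * j) * (\<Sum>i<d. g i k)"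
  note real = realised_pairing[of T "\<lambda>i. t (e i)" "card X" "\<lambda>i. f (e i)" x, OF T]
  have "Dwt ?f (m (2 * j))"
  proof (rule even_weight)
    show "(\<Sum>i<card X. (sqrt (t (e i)) / sqrt T)\<^sup>2) \<le> 1"
      using real(2) t0 eX f(3) by (simp add: t_def)
    define mn where "mn i = Min (supp (f i))" for i
    have mn: "mn i \<in> supp (f i)" if "i \<in> X" for i
      unfolding mn_def using that fin by (intro Min_in) (auto simp: X_def)
    have inj: "inj_on mn X"
      unfolding mn_def
    proof (rule Min_disjoint_inj)
      show "disjoint_family_on (\<lambda>i. supp (f i)) X"
        unfolding disjoint_family_on_def
      proof (intro ballI impI)
        fix a b assume "a \<in> X" "b \<in> X" "a \<noteq> b"
        then have "E a \<inter> E b = {}" using E(2) unfolding disjoint_family_on_def by (simp add: X_def)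
        then show "supp (f a) \<inter> supp (f b) = {}"
          using fE[of a] fE[of b] \<open>a \<in> X\<close> \<open>b \<in> X\<close> unfolding X_def by blast
      qed
    qed (use fin in \<open>auto simp: X_def\<close>)
    define me where "me = (\<lambda>i. Min (E i)) \<circ> inv_into X mn"
    have me: "me (mn i) = Min (E i)" if "i \<in> X" for i using inv_into_f_f[OF inj that] by (simp add: me_def)
    have injE: "inj_on (\<lambda>i. Min (E i)) {..<d}" using E by (intro Min_disjoint_inj) auto
    have "mn ` X \<in> schreier (n (2 * j))"
    proof (rule schreier_spread[OF E(3), of _ me])
      show "mn ` X \<subseteq> {1..}" using mn fE E(1) unfolding X_def by fastforce
      show "me ` mn ` X \<subseteq> (\<lambda>i. Min (E i)) ` {..<d}" using me by (auto simp: X_def)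
      show "inj_on me (mn ` X)"
      proof (rule inj_onI)
        fix a b assume "a \<in> mn ` X" "b \<in> mn ` X" "me a = me b"
        then obtain i l where "i \<in> X" "l \<in> X" "a = mn i" "b = mn l" "Min (E i) = Min (E l)"
          using me by auto
        then show "a = b" using injE unfolding X_def by (auto dest: inj_onD)
      qed
      show "me b \<le> b" if b: "b \<in> mn ` X" for b
      proof -
        obtain i where i: "i \<in> X" "b = mn i" using b by auto
        then have "b \<in> E i" using mn fE unfolding X_def by blast
        then show ?thesis using i me[OF i(1)] E(1)[of i] by (simp add: X_def)
      qed
    qed (use finX in auto)
    moreover have "(\<lambda>i. Min (supp (f (e i)))) ` {..<card X} = mn ` X"
      using eimg by (metis (no_types, lifting) image_cong image_image mn_def)
    moreover have "disjoint_family_on (\<lambda>i. supp (f (e i))) {..<card X}"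
      unfolding disjoint_family_on_def
    proof (intro ballI impI)
      fix a b assume ab: "a \<in> {..<card X}" "b \<in> {..<card X}" "a \<noteq> b"
      then have "e a \<noteq> e b" using einj by (auto dest: inj_onD)
      then have "E (e a) \<inter> E (e b) = {}"
        using E(2) eX(1) ab unfolding disjoint_family_on_def by simp
      then show "supp (f (e a)) \<inter> supp (f (e b)) = {}"
        using fE[of "e a"] fE[of "e b"] eX(1) ab by blast
    qed
    moreover have "finite (supp (f (e i))) \<and> supp (f (e i)) \<noteq> {} \<and> supp (f (e i)) \<subseteq> {1..}"
      if "i < card X" for i using fin eX[OF that] fE E(1) by (meson subset_trans)
    ultimately show "allowable (n (2 * j)) (card X) (\<lambda>i. supp (f (e i)))"
      unfolding allowable_def by simp
  qed (use f(1) eX in auto)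
  moreover have "supp ?f \<subseteq> supp ?g"
  proof -
    have "supp (\<lambda>k. sqrt (t (e i)) / sqrt T * f (e i) k) \<subseteq> supp ?g" if i: "i < card X" for i
    proof -
      have "supp (f (e i)) \<subseteq> supp ?g"
        using f(2)[OF eX(1)[OF i]] supp_child[where g=g, OF eX(1)[OF i] g0] by (rule subset_trans)
      then show ?thesis using supp_scale_subset[of "sqrt (t (e i)) / sqrt T" "f (e i)"] by blast
    qed
    then show ?thesis by (intro subset_trans[OF supp_scale_sum_subset] UN_least) auto
  qed
  moreover have "pr ?f x = sqrt (pr ?g (sq x))"
    using real(1) t0 eX f(3) T by (simp add: t_def pr_scale_left pr_sum_left T_def)
  ultimately show ?case by blast
next
  case (kw_odd j s g)
  then obtain f where f: "\<And>i. i < length s \<Longrightarrow> Dwt (f i) (m (2 * snd (s ! i)))"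
    "\<And>i. i < length s \<Longrightarrow> supp (f i) \<subseteq> supp (g i)"
    "\<And>i. i < length s \<Longrightarrow> pr (f i) x = sqrt (pr (g i) (sq x))" by metis
  have g0: "0 \<le> g i k" if "i < length s" for i k using kf_nonneg kf_kw.kf_kw kw_odd(2) that by blast
  define t where "t i = pr (g i) (sq x)" for i
  have t0: "0 \<le> t i" if "i < length s" for i
    unfolding t_def using g0[OF that] by (intro pr_nonneg) (auto simp: sq_def)
  define T where "T = (\<Sum>i<length s. t i)"
  let ?f = "\<lambda>k. 1 / real (m (2 * j + 1)) * (\<Sum>i<length s. sqrt (t i) / sqrt T * f i k)"
  let ?g = "\<lambda>k. \<theta> (2 * j + 1) * (\<Sum>i<length s. g i k)"
  note real = realised_pairing[of T t "length s" f x, OF T_def]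
  have "Dwt ?f (m (2 * j + 1))"
  proof (rule odd_weight)
    show "(\<Sum>i<length s. (sqrt (t i) / sqrt T)\<^sup>2) \<le> 1" using real(2) t0 f(3) by (simp add: t_def)
    show "\<forall>i<length s. supp (f i) \<subseteq> fst (s ! i) \<and> Dwt (f i) (m (2 * snd (s ! i)))"
      using f kw_odd(3) by (meson subset_trans)
    show "\<forall>i<length s. Dfun (f i)" using f(1) weighted by blast
  qed (use kw_odd in auto)
  moreover have "supp ?f \<subseteq> supp ?g"
  proof -
    have "supp (\<lambda>k. sqrt (t i) / sqrt T * f i k) \<subseteq> supp ?g" if i: "i < length s" for i
    proof -
      have "supp (f i) \<subseteq> supp ?g"
        using f(2)[OF i] supp_child[where g=g, OF i g0] by (rule subset_trans)
      then show ?thesis using supp_scale_subset[of "sqrt (t i) / sqrt T" "f i"] by blast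
    qed
    then show ?thesis by (intro subset_trans[OF supp_scale_sum_subset] UN_least) auto
  qed
  moreover have "pr ?f x = sqrt (pr ?g (sq x))"
    using real(1) t0 f(3) by (simp add: t_def pr_scale_left pr_sum_left T_def)
  ultimately show ?case by blast
qed

lemma wh_norm_pr: "nrm x = (SUP f\<in>Collect Dfun. pr f x)"
  unfolding wh_norm_def D_wh_def pr_def ..

lemma functional_le:
  assumes "Dfun f" "finite (supp x)" "0 \<le> C" "\<And>g. kf g \<Longrightarrow> pr g (sq x) \<le> C\<^sup>2"
  shows "pr f x \<le> C"
proof -
  obtain g where "kf g" "(pr f x)\<^sup>2 \<le> pr g (sq x)" using functional_dominated(1)[OF assms(1)] assms(2) by blast
  then have "(pr f x)\<^sup>2 \<le> C\<^sup>2" using assms(4) by (meson order_trans)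
  then show ?thesis using assms(3) power2_le_imp_le by blast
qed

lemma wh_norm_le:
  assumes "finite (supp x)" "0 \<le> C" "\<And>g. kf g \<Longrightarrow> pr g (sq x) \<le> C\<^sup>2"
  shows "nrm x \<le> C"
  unfolding wh_norm_pr
proof (rule cSUP_least)
  show "Collect Dfun \<noteq> {}" using wh_functional_wh_weight.unit_pos[of 1] by blast
qed (use functional_le assms in auto)

lemma wh_norm_ge:
  assumes "finite (supp x)" "kf g"
  shows "pr g (sq x) \<le> (nrm x)\<^sup>2" "0 \<le> nrm x"
proof -
  have "bdd_above ((\<lambda>f. pr f x) ` Collect Dfun)"
  proof (rule bdd_aboveI)
    fix y assume "y \<in> (\<lambda>f. pr f x) ` Collect Dfun"
    then obtain f where f: "Dfun f" "y = pr f x" by auto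
    have "pr h (sq x) \<le> (sqrt (\<Sum>k\<in>supp x. (x k)\<^sup>2))\<^sup>2" if "kf h" for h
      unfolding pr_def supp_sq using kf_le1[OF that] kf_nonneg[OF that]
      by (auto simp: sq_def sum_nonneg intro!: sum_mono mult_left_le_one_le)
    then show "y \<le> sqrt (\<Sum>k\<in>supp x. (x k)\<^sup>2)"
      using functional_le[OF f(1) assms(1)] f(2) by (simp add: sum_nonneg)
  qed
  then have up: "pr f x \<le> nrm x" if "Dfun f" for f
    unfolding wh_norm_pr using that by (intro cSUP_upper) auto
  obtain f where f: "Dfun f" "pr f x = sqrt (pr g (sq x))"
    using functional_realised(1)[OF assms] by blast
  have g0: "0 \<le> pr g (sq x)" using kf_nonneg[OF assms(2)] by (intro pr_nonneg) (auto simp: sq_def)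
  then show "0 \<le> nrm x" using up[OF f(1)] f(2) real_sqrt_ge_zero[OF g0] by linarith
  show "pr g (sq x) \<le> (nrm x)\<^sup>2" using up[OF f(1)] f(2) g0 by (simp add: sqrt_le_D)
qed

text \<open>Unconditionality with constant 1: on squares the norming functionals are nonnegative, so
  their pairings are monotone.\<close>

lemma wh_norm_mono:
  assumes "finite (supp y)" "\<And>k. \<bar>x k\<bar> \<le> \<bar>y k\<bar>"
  shows "nrm x \<le> nrm y"
proof -
  have "supp x \<subseteq> supp y" using assms(2) unfolding supp_def by (metis (mono_tags) Collect_mono abs_le_zero_iff abs_zero)
  then have fx: "finite (supp x)" using assms(1) finite_subset by blast
  have "pr g (sq x) \<le> (nrm y)\<^sup>2" if "kf g" for g
  proof -
    have "pr g (sq x) \<le> pr g (sq y)"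
    proof (rule pr_mono_right)
      show "sq x k \<le> sq y k" "0 \<le> sq x k" for k using assms(2)[of k] by (simp_all add: sq_def abs_le_square_iff)
    qed (use assms(1) kf_nonneg[OF that] in auto)
    then show ?thesis using wh_norm_ge(1)[OF assms(1) that] by linarith
  qed
  then show ?thesis using wh_norm_le[OF fx] wh_norm_ge(2)[OF assms(1) kf_zero] by blast
qed

end

section \<open>Estimates on averages\<close>

text \<open>For fixed \<open>k\<close> a member of the family is old, if it meets
  \<open>{..<q k}\<close>, or new. The old ones have complexity 1 beyond \<open>q k\<close> by
  \<open>fam_old\<close>, and are bounded by \<open>\<rho>\<close> if none of them is bad for
  \<open>k\<close>. The other \<open>k\<close> form two sets: in \<open>G1\<close> a new member acts
  on \<open>a k\<close>, in \<open>G2\<close> an old one is bad. Both have mass at most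
  \<open>\<epsilon>\<close>, so the trivial bound \<open>B\<close> is enough there.\<close>

lemma core_average:
  fixes h :: "'i \<Rightarrow> nat \<Rightarrow> real" and a :: "nat \<Rightarrow> nat \<Rightarrow> real" and N M :: nat
  assumes qp: "rapid q p" and fam: "fam R I h st"
    and h0: "\<And>i k. i \<in> I \<Longrightarrow> 0 \<le> h i k" and \<tau>: "\<And>i. i \<in> I \<Longrightarrow> 0 \<le> \<tau> i \<and> \<tau> i \<le> (1::real)"
    and a: "\<And>k. k \<in> {N..<M} \<Longrightarrow> supp (a k) \<subseteq> {q k..p k}" "\<And>k x. k \<in> {N..<M} \<Longrightarrow> 0 \<le> a k x"
    and \<beta>: "\<And>k. 0 \<le> \<beta> k" "(\<Sum>k=N..<M. \<beta> k) = 1"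
    and small: "\<And>G. G \<subseteq> {N..<M} \<Longrightarrow> Msm R G p \<Longrightarrow> (\<Sum>k\<in>G. \<beta> k) \<le> \<epsilon>"
    and bad: "\<And>i k l. i \<in> I \<Longrightarrow> bad i k \<Longrightarrow> bad i l \<Longrightarrow> k = l"
    and old: "\<And>k J. k \<in> {N..<M} \<Longrightarrow> J \<subseteq> I \<Longrightarrow> fam 1 J (\<lambda>i. rst {q k..} (h i)) (\<lambda>_. q k) \<Longrightarrow>
      (\<And>i. i \<in> J \<Longrightarrow> \<not> bad i k \<and> supp (h i) \<inter> {..<q k} \<noteq> {}) \<Longrightarrow>
      (\<Sum>i\<in>J. \<tau> i * pr (rst {q k..} (h i)) (a k)) \<le> \<rho>"
    and total: "\<And>k. k \<in> {N..<M} \<Longrightarrow> (\<Sum>i\<in>I. pr (h i) (a k)) \<le> B"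
    and \<rho>: "0 \<le> \<rho>"
  shows "(\<Sum>i\<in>I. \<tau> i * pr (h i) (\<lambda>x. \<Sum>k=N..<M. \<beta> k * a k x)) \<le> \<rho> + 2 * \<epsilon> * B"
proof -
  define S where "S k = (\<Sum>i\<in>I. \<tau> i * pr (h i) (a k))" for k
  define G1 where "G1 = {k\<in>{N..<M}. \<exists>i\<in>I. supp (h i) \<inter> {..<q k} = {} \<and> supp (h i) \<inter> supp (a k) \<noteq> {}}"
  define G2 where "G2 = {k\<in>{N..<M}. \<exists>i\<in>I. bad i k \<and> supp (h i) \<inter> {..<q k} \<noteq> {}}"
  have finI: "finite I" by (rule fam_finite[OF fam])
  have fina: "finite (supp (a k))" if "k \<in> {N..<M}" for k using a(1)[OF that] finite_subset by blast
  have Msm: "Msm R I st" and st: "\<And>i. i \<in> I \<Longrightarrow> supp (h i) \<subseteq> {st i..}" using fam by (auto simp: fam_def)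
  have pr0: "0 \<le> pr (h i) (a k)" if "i \<in> I" "k \<in> {N..<M}" for i k
    using h0[OF that(1)] a(2)[OF that(2)] by (rule pr_nonneg)
  have B0: "0 \<le> B" if "k \<in> {N..<M}" for k
    using total[OF that] pr0 that by (meson order_trans sum_nonneg)
  have SB: "S k \<le> B" if "k \<in> {N..<M}" for k
  proof -
    have "S k \<le> (\<Sum>i\<in>I. pr (h i) (a k))"
      unfolding S_def using \<tau> pr0 that by (intro sum_mono mult_left_le_one_le) auto
    then show ?thesis using total[OF that] by linarith
  qed
  have S\<rho>: "S k \<le> \<rho>" if k: "k \<in> {N..<M}" "k \<notin> G1" "k \<notin> G2" for k
  proof -
    define J where "J = {i\<in>I. supp (h i) \<inter> {..<q k} \<noteq> {}}"
    have "S k = (\<Sum>i\<in>J. \<tau> i * pr (h i) (a k))"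
      unfolding S_def
    proof (rule sum.mono_neutral_right)
      show "\<forall>i\<in>I - J. \<tau> i * pr (h i) (a k) = 0"
        using k(1,2) pr_disjoint unfolding J_def G1_def by fastforce
    qed (use finI in \<open>auto simp: J_def\<close>)
    also have "\<dots> = (\<Sum>i\<in>J. \<tau> i * pr (rst {q k..} (h i)) (a k))"
    proof -
      have "pr (rst {q k..} (h i)) (a k) = pr (h i) (a k)" for i
        using a(1)[OF k(1)] by (intro pr_cong) (auto simp: rst_def)
      then show ?thesis by simp
    qed
    also have "\<dots> \<le> \<rho>"
    proof (rule old[OF k(1)])
      show "J \<subseteq> I" by (auto simp: J_def)
      have "1 \<le> q k" using qp by (auto simp: rapid_def)
      then show "fam 1 J (\<lambda>i. rst {q k..} (h i)) (\<lambda>_. q k)"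
        by (intro fam_old[OF fam]) (auto simp: J_def)
      show "\<not> bad i k \<and> supp (h i) \<inter> {..<q k} \<noteq> {}" if "i \<in> J" for i
        using that k unfolding J_def G2_def by blast
    qed
    finally show ?thesis .
  qed
  \<comment> \<open>A member that is new for \<open>l\<close> cannot meet the interval of an earlier
    \<open>k\<close>. So no member acts as a new one on two vectors, and choosing one for every
    \<open>k\<close> in \<open>G1\<close> is injective.\<close>
  have newlast: False if "i \<in> I" "k \<in> {N..<M}" "k < l" "supp (h i) \<inter> supp (a k) \<noteq> {}"
    "supp (h i) \<inter> {..<q l} = {}" for i k l
    using that a(1)[OF that(2)] rapid_less(1)[OF qp that(3)] by fastforce
  have "Msm R G1 p"
  proof -
    have "\<forall>k\<in>G1. \<exists>i. i \<in> I \<and> supp (h i) \<inter> {..<q k} = {} \<and> supp (h i) \<inter> supp (a k) \<noteq> {}"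
      by (auto simp: G1_def)
    then obtain f where f: "\<And>k. k \<in> G1 \<Longrightarrow> f k \<in> I" "\<And>k. k \<in> G1 \<Longrightarrow> supp (h (f k)) \<inter> {..<q k} = {}"
      "\<And>k. k \<in> G1 \<Longrightarrow> supp (h (f k)) \<inter> supp (a k) \<noteq> {}" by metis
    have G1: "k \<in> {N..<M}" if "k \<in> G1" for k using that by (simp add: G1_def)
    have "inj_on f G1"
    proof (rule inj_onI)
      fix k l assume kl: "k \<in> G1" "l \<in> G1" "f k = f l"
      have "\<not> k < l" using newlast[of "f k" k l] f[OF kl(1)] f[OF kl(2)] G1[OF kl(1)] kl(3) by metis
      moreover have "\<not> l < k" using newlast[of "f l" l k] f[OF kl(1)] f[OF kl(2)] G1[OF kl(2)] kl(3) by metis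
      ultimately show "k = l" by linarith
    qed
    moreover have "st (f k) \<le> p k" if "k \<in> G1" for k
      using f[OF that] st[OF f(1)[OF that]] a(1)[OF G1[OF that]] by fastforce
    ultimately show ?thesis using f(1) by (intro Msm_inj[OF Msm]) auto
  qed
  then have G1: "(\<Sum>k\<in>G1. \<beta> k) \<le> \<epsilon>" by (intro small) (auto simp: G1_def)
  have "Msm R G2 p"
  proof -
    have "\<forall>k\<in>G2. \<exists>i. i \<in> I \<and> bad i k \<and> supp (h i) \<inter> {..<q k} \<noteq> {}"
      by (auto simp: G2_def)
    then obtain f where f: "\<And>k. k \<in> G2 \<Longrightarrow> f k \<in> I" "\<And>k. k \<in> G2 \<Longrightarrow> bad (f k) k"
      "\<And>k. k \<in> G2 \<Longrightarrow> supp (h (f k)) \<inter> {..<q k} \<noteq> {}" by metis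
    have "inj_on f G2" using bad f by (intro inj_onI) metis
    moreover have "st (f k) \<le> p k" if "k \<in> G2" for k
    proof -
      note k = \<open>k \<in> G2\<close>
      obtain x where "x \<in> supp (h (f k))" "x < q k" using f(3)[OF k] by auto
      then have "st (f k) < q k" using st[OF f(1)[OF that]] by fastforce
      then show ?thesis using qp unfolding rapid_def by (meson less_imp_le order_trans)
    qed
    ultimately show ?thesis using f(1) by (intro Msm_inj[OF Msm]) auto
  qed
  then have G2: "(\<Sum>k\<in>G2. \<beta> k) \<le> \<epsilon>" by (intro small) (auto simp: G2_def)
  have ne: "{N..<M} \<noteq> {}" using \<beta>(2) by (metis sum.empty zero_neq_one)
  then have Bnn: "0 \<le> B" using B0 by blast
  have "(\<Sum>i\<in>I. \<tau> i * pr (h i) (\<lambda>x. \<Sum>k=N..<M. \<beta> k * a k x)) = (\<Sum>i\<in>I. \<Sum>k=N..<M. \<beta> k * (\<tau> i * pr (h i) (a k)))"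
  proof (rule sum.cong[OF refl])
    fix i
    have "pr (h i) (\<lambda>x. \<Sum>k=N..<M. \<beta> k * a k x) = (\<Sum>k=N..<M. pr (h i) (\<lambda>x. \<beta> k * a k x))"
      using fina finite_subset[OF supp_scale_subset] by (intro pr_sum_right) auto
    then show "\<tau> i * pr (h i) (\<lambda>x. \<Sum>k=N..<M. \<beta> k * a k x) = (\<Sum>k=N..<M. \<beta> k * (\<tau> i * pr (h i) (a k)))"
      by (simp add: pr_scale_right sum_distrib_left mult.left_commute)
  qed
  also have "\<dots> = (\<Sum>k=N..<M. \<beta> k * S k)"
    unfolding S_def by (subst sum.swap) (simp add: sum_distrib_left)
  also have "\<dots> \<le> (\<Sum>k=N..<M. \<beta> k * \<rho> + (if k \<in> G1 then \<beta> k * B else 0) + (if k \<in> G2 then \<beta> k * B else 0))"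
  proof (rule sum_mono)
    fix k assume k: "k \<in> {N..<M}"
    show "\<beta> k * S k \<le> \<beta> k * \<rho> + (if k \<in> G1 then \<beta> k * B else 0) + (if k \<in> G2 then \<beta> k * B else 0)"
    proof (cases "k \<in> G1 \<or> k \<in> G2")
      case True
      have "\<beta> k * S k \<le> \<beta> k * B" using SB[OF k] \<beta>(1) by (intro mult_left_mono)
      moreover have "0 \<le> \<beta> k * \<rho>" "0 \<le> \<beta> k * B" using \<beta>(1) \<rho> Bnn by auto
      moreover define z where "z = \<beta> k * B"
      ultimately show ?thesis using True unfolding z_def[symmetric] by auto
    next
      case False
      then have "\<beta> k * S k \<le> \<beta> k * \<rho>" using S\<rho>[OF k] \<beta>(1) by (intro mult_left_mono) auto
      then show ?thesis using False by auto
    qed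
  qed
  also have "\<dots> = \<rho> + (\<Sum>k\<in>G1. \<beta> k) * B + (\<Sum>k\<in>G2. \<beta> k) * B"
  proof -
    have "(\<Sum>k=N..<M. if k \<in> G then \<beta> k * B else 0) = (\<Sum>k\<in>G. \<beta> k) * B" if "G \<subseteq> {N..<M}" for G
      using that unfolding sum_distrib_right
      by (simp add: sum.inter_restrict[symmetric] Int_absorb1)
    moreover have "G1 \<subseteq> {N..<M}" "G2 \<subseteq> {N..<M}" by (auto simp: G1_def G2_def)
    ultimately show ?thesis using \<beta>(2) by (simp add: sum.distrib sum_distrib_right[symmetric])
  qed
  also have "\<dots> \<le> \<rho> + 2 * \<epsilon> * B"
    using mult_right_mono[OF G1 Bnn] mult_right_mono[OF G2 Bnn] by linarith
  finally show ?thesis .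
qed

lemma sum_cover3:
  fixes f :: "'i \<Rightarrow> real"
  assumes "finite J" "\<And>i. i \<in> J \<Longrightarrow> 0 \<le> f i" "\<And>i. i \<in> J \<Longrightarrow> P i \<or> Q i \<or> R i"
  shows "sum f J \<le> sum f {i\<in>J. P i} + sum f {i\<in>J. Q i} + sum f {i\<in>J. R i}"
proof -
  have "sum f J \<le> (\<Sum>i\<in>J. (if P i then f i else 0) + (if Q i then f i else 0) + (if R i then f i else 0))"
    using assms(2,3) by (intro sum_mono) fastforce
  then show ?thesis using assms(1) by (simp add: sum.distrib sum.inter_filter)
qed

section \<open>Trees cut at a given weight, and families of weighted functionals acting on
  averages\<close>

context wh_parameters
begin

text \<open>A branch is stopped at a unit vector, at a weight of index above \<open>L\<close>, or at
  depth \<open>N\<close>. Every split that is carried out has index at most \<open>L\<close>, hence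
  complexity at most \<open>n L\<close>, and multiplies the coefficient by at most 1/4.\<close>

lemma truncated_tree:
  assumes "kf g"
  shows "\<exists>(I :: nat set) \<tau> h st. fam (N * n L) I h st \<and>
    (\<forall>i\<in>I. kf (h i) \<and> 0 \<le> \<tau> i \<and> \<tau> i \<le> 1 \<and> supp (h i) \<subseteq> supp g \<and>
      (\<tau> i \<le> (1/4) ^ N \<or> (\<exists>k. h i = unit_vec k) \<or> (\<exists>J>L. kw J (h i)))) \<and>
    g = (\<lambda>k. \<Sum>i\<in>I. \<tau> i * h i k)"
  using assms
proof (induction N arbitrary: g)
  case 0
  have "fam 0 {0::nat} (\<lambda>_. g) (\<lambda>_. 1)"
    using kf_supp(2)[OF 0] by (auto simp: fam_def disjoint_family_on_def)
  then show ?case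
    using 0 by (intro exI[of _ "{0}"] exI[of _ "\<lambda>_. 1"] exI[of _ "\<lambda>_. g"] exI[of _ "\<lambda>_. 1"]) auto
next
  case (Suc N)
  have single: ?case if "(\<exists>k. g = unit_vec k) \<or> (\<exists>J>L. kw J g)"
  proof -
    have "fam 0 {0::nat} (\<lambda>_. g) (\<lambda>_. 1)"
      using kf_supp(2)[OF Suc.prems] by (auto simp: fam_def disjoint_family_on_def)
    then have "fam (Suc N * n L) {0::nat} (\<lambda>_. g) (\<lambda>_. 1)" by (rule fam_mono) simp
    then show ?thesis using Suc.prems that
      by (intro exI[of _ "{0}"] exI[of _ "\<lambda>_. 1"] exI[of _ "\<lambda>_. g"] exI[of _ "\<lambda>_. 1"]) simp
  qed
  show ?case
    using Suc.prems
  proof (cases rule: kf.cases)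
    case (kf_unit k)
    then show ?thesis using single by blast
  next
    case (kf_kw J)
    show ?thesis
    proof (cases "J > L")
      case True
      then show ?thesis using single kf_kw by blast
    next
      case False
      obtain c and d :: nat and st where g: "g = (\<lambda>k. \<theta> J * (\<Sum>i<d. c i k))" and kc: "\<And>i. i < d \<Longrightarrow> kf (c i)"
        and fc: "fam (n J) {..<d} c st" and sc: "\<And>i. i < d \<Longrightarrow> supp (c i) \<subseteq> supp g"
        using kw_expand_fam[OF kf_kw] by metis
      have fc: "fam (n L) {..<d} c st" using fam_mono[OF fc] n_mono False by simp
      define P where "P i I \<tau> h st \<longleftrightarrow> fam (N * n L) I h st \<and>
        (\<forall>l\<in>I. kf (h l) \<and> 0 \<le> \<tau> l \<and> \<tau> l \<le> 1 \<and> supp (h l) \<subseteq> supp (c i) \<and>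
          (\<tau> l \<le> (1/4) ^ N \<or> (\<exists>k. h l = unit_vec k) \<or> (\<exists>J>L. kw J (h l)))) \<and>
        c i = (\<lambda>k. \<Sum>l\<in>I. \<tau> l * h l k)" for i and I :: "nat set" and \<tau> h st
      have "\<forall>i. \<exists>I \<tau> h st. i < d \<longrightarrow> P i I \<tau> h st" using Suc.IH[OF kc] unfolding P_def by blast
      then obtain I \<tau> h st' where P: "\<And>i. i < d \<Longrightarrow> P i (I i) (\<tau> i) (h i) (st' i)" by metis
      have hc: "supp (h i l) \<subseteq> supp (c i)" if "i < d" "l \<in> I i" for i l
        using P[OF that(1)] that(2) unfolding P_def by blast
      let ?S = "Sigma {..<d} I"
      have fS: "fam (n L + N * n L) ?S (\<lambda>(i, l). h i l) (\<lambda>(i, l). max (st i) (st' i l))"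
        using P hc by (intro fam_Sigma[OF fc]) (auto simp: P_def)
      have finS: "finite ?S" using fam_finite[OF fS] .
      \<comment> \<open>The leaves are coded back into \<open>nat\<close>, because the induction
        needs one fixed index type.\<close>
      define K where "K = prod_encode ` ?S"
      have inj: "inj_on prod_decode K" and img: "prod_decode ` K = ?S"
        by (auto simp: K_def image_image intro!: inj_on_subset[OF inj_prod_decode])
      define h' where "h' = (\<lambda>(i, l). h i l) \<circ> prod_decode"
      define \<tau>' where "\<tau>' = (\<lambda>(i, l). \<theta> J * \<tau> i l) \<circ> prod_decode"
      have fK: "fam (Suc N * n L) K h' ((\<lambda>(i, l). max (st i) (st' i l)) \<circ> prod_decode)"
        unfolding h'_def using fam_reindex[OF fS inj] img by simp
      moreover have "kf (h' x) \<and> 0 \<le> \<tau>' x \<and> \<tau>' x \<le> 1 \<and> supp (h' x) \<subseteq> supp g \<and>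
          (\<tau>' x \<le> (1/4) ^ Suc N \<or> (\<exists>k. h' x = unit_vec k) \<or> (\<exists>J>L. kw J (h' x)))" if x: "x \<in> K" for x
      proof -
        obtain i l where il: "prod_decode x = (i, l)" by fastforce
        then have il': "i < d" "l \<in> I i" using img x by (auto simp: set_eq_iff image_iff) (metis mem_Sigma_iff lessThan_iff)+
        have p: "kf (h i l)" "0 \<le> \<tau> i l" "\<tau> i l \<le> 1"
          "\<tau> i l \<le> (1/4) ^ N \<or> (\<exists>k. h i l = unit_vec k) \<or> (\<exists>J>L. kw J (h i l))"
          using P[OF il'(1)] il'(2) by (auto simp: P_def)
        have "\<theta> J * \<tau> i l \<le> 1/4 * \<tau> i l" using \<theta>_le p(2) by (intro mult_right_mono)
        then have "\<theta> J * \<tau> i l \<le> 1" "\<tau> i l \<le> (1/4) ^ N \<Longrightarrow> \<theta> J * \<tau> i l \<le> (1/4) ^ Suc N" using p(3) by auto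
        moreover have "0 \<le> \<theta> J * \<tau> i l" using \<theta>_pos[of J] p(2) by simp
        moreover have "supp (h i l) \<subseteq> supp g" using hc[OF il'] sc[OF il'(1)] by blast
        ultimately show ?thesis using p by (auto simp: h'_def \<tau>'_def il)
      qed
      moreover have "g = (\<lambda>k. \<Sum>x\<in>K. \<tau>' x * h' x k)"
      proof
        fix k
        have "c i k = (\<Sum>l\<in>I i. \<tau> i l * h i l k)" if "i < d" for i
          using P[OF that] unfolding P_def by metis
        then have "g k = (\<Sum>i<d. \<Sum>l\<in>I i. \<theta> J * \<tau> i l * h i l k)"
          unfolding g by (simp add: sum_distrib_left mult.assoc)
        also have "\<dots> = (\<Sum>z\<in>?S. (case z of (i, l) \<Rightarrow> \<theta> J * \<tau> i l * h i l k))"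
        proof (subst sum.Sigma)
          show "\<forall>i\<in>{..<d}. finite (I i)"
          proof
            fix i assume "i \<in> {..<d}"
            then have "fam (N * n L) (I i) (h i) (st' i)" using P[of i] by (simp add: P_def)
            then show "finite (I i)" by (rule fam_finite)
          qed
        qed simp_all
        also have "\<dots> = (\<Sum>x\<in>K. \<tau>' x * h' x k)"
          using sum.reindex[OF inj, of "\<lambda>z. case z of (i, l) \<Rightarrow> \<theta> J * \<tau> i l * h i l k"] img
          by (simp add: \<tau>'_def h'_def case_prod_beta)
        finally show "g k = (\<Sum>x\<in>K. \<tau>' x * h' x k)" .
      qed
      ultimately show ?thesis by blast
    qed
  qed
qed

text \<open>With \<open>l = log 2 (m L)\<close>, a depth \<open>N\<close> of about
  \<open>2 * l\<close> gives \<open>4 ^ N \<ge> m L ^ 4\<close>, and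
  \<open>N + 2 \<le> 2 * l + 3 \<le> 3 * l + 1\<close> once \<open>l \<ge> 2\<close>, which
  \<open>3 \<le> L\<close> guarantees. The two spare levels leave room for grafting cut trees onto
  another family.\<close>

lemma truncation_depth:
  assumes "3 \<le> L"
  shows "\<exists>N. (1/4) ^ N \<le> \<theta> L ^ 2 \<and> (N + 2) * (n (L - 1) + 1) < n L"
proof -
  have "m 2 ^ 3 \<le> m 3" using m_growth[of 2] by simp
  moreover have "2 ^ 3 \<le> m 2 ^ 3" using m_ge2[of 2] by (intro power_mono) auto
  ultimately have m4: "4 \<le> m L" using m_mono[of 3 L] assms by simp
  define l where "l = log 2 (real (m L))"
  have l2: "2 \<le> l" unfolding l_def using m4 by (subst le_log_iff) auto
  define N where "N = nat \<lceil>2 * l\<rceil>"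
  have N: "2 * l \<le> N" "real N \<le> 2 * l + 1" using l2 unfolding N_def by linarith+
  have "2 powr l = real (m L)" using m4 by (simp add: l_def)
  then have "(real (m L))\<^sup>2 = 2 powr (2 * l)"
    unfolding power2_eq_square mult_2 powr_add by simp
  also have "\<dots> \<le> 2 powr N" using N(1) by simp
  finally have "(real (m L))\<^sup>2 \<le> 2 ^ N" by (simp add: powr_realpow)
  then have "((real (m L))\<^sup>2)\<^sup>2 \<le> (2 ^ N)\<^sup>2" by (intro power_mono) auto
  also have "(2 ^ N)\<^sup>2 = (4::real) ^ N" using power_mult_distrib[of "2::real" 2 N] by (simp add: power2_eq_square)
  finally have "1 / 4 ^ N \<le> 1 / ((real (m L))\<^sup>2)\<^sup>2" using m4 by (intro divide_left_mono) auto
  then have 1: "(1/4) ^ N \<le> \<theta> L ^ 2" by (simp add: \<theta>_def power_one_over power_divide)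
  have "(real N + 2) * (real (n (L - 1)) + 1) \<le> (3 * l + 1) * (real (n (L - 1)) + 1)"
    using N(2) l2 by (intro mult_right_mono) auto
  also have "\<dots> < real (n L)" using n_growth[of L] assms unfolding l_def by simp
  finally have "real ((N + 2) * (n (L - 1) + 1)) < real (n L)" by (simp add: algebra_simps)
  then have "(N + 2) * (n (L - 1) + 1) < n L" by (simp only: of_nat_less_iff)
  then show ?thesis using 1 by blast
qed

text \<open>The functionals are opened once: their children form a family of complexity
  \<open>r + n Jm\<close>, on which the average is still bounded by \<open>C\<close>, and the
  squared weights remain as the factor \<open>\<eta>\<close>.\<close>

lemma weight_fam_avg:
  fixes g :: "'i \<Rightarrow> nat \<Rightarrow> real"
  assumes fam: "fam r I g st" and kw: "\<And>i. i \<in> I \<Longrightarrow> kw (Jf i) (g i)"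
    and J: "\<And>i. i \<in> I \<Longrightarrow> Jf i \<le> Jm" "\<And>i. i \<in> I \<Longrightarrow> \<theta> (Jf i) \<le> \<eta>" "0 \<le> \<eta>"
    and a: "avg r' C a" "r + n Jm \<le> r'" "\<And>k. 0 \<le> a k"
  shows "(\<Sum>i\<in>I. pr (g i) a) \<le> \<eta> * C"
proof -
  define Q where "Q i c d st' \<longleftrightarrow> g i = (\<lambda>k. \<theta> (Jf i) * (\<Sum>l<d. c l k)) \<and> (\<forall>l<d. kf (c l)) \<and>
      fam (n (Jf i)) {..<d::nat} c st' \<and> (\<forall>l<d. supp (c l) \<subseteq> supp (g i))" for i c d st'
  have "\<forall>i\<in>I. \<exists>c d st'. Q i c d st'" unfolding Q_def using kw_expand_fam[OF kw] by blast
  then obtain c d st' where "\<And>i. i \<in> I \<Longrightarrow> Q i (c i) (d i) (st' i)" by metis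
  then have e: "\<And>i. i \<in> I \<Longrightarrow> g i = (\<lambda>k. \<theta> (Jf i) * (\<Sum>l<d i. c i l k))"
    "\<And>i l. i \<in> I \<Longrightarrow> l < d i \<Longrightarrow> kf (c i l)" "\<And>i. i \<in> I \<Longrightarrow> fam (n (Jf i)) {..<d i} (c i) (st' i)"
    "\<And>i l. i \<in> I \<Longrightarrow> l < d i \<Longrightarrow> supp (c i l) \<subseteq> supp (g i)" unfolding Q_def by blast+
  let ?S = "Sigma I (\<lambda>i. {..<d i})"
  have fS: "fam (r + n Jm) ?S (\<lambda>(i, l). c i l) (\<lambda>(i, l). max (st i) (st' i l))"
  proof (rule fam_Sigma[OF fam])
    show "fam (n Jm) {..<d i} (c i) (st' i)" if "i \<in> I" for i
      using e(3)[OF that] n_mono[OF J(1)[OF that]] by (rule fam_mono)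
  qed (use e(4) in auto)
  have "(\<Sum>i\<in>I. pr (g i) a) = (\<Sum>i\<in>I. \<theta> (Jf i) * (\<Sum>l<d i. pr (c i l) a))"
    using e(1) by (intro sum.cong) (simp_all add: pr_scale_left pr_sum_left)
  also have "\<dots> \<le> (\<Sum>i\<in>I. \<eta> * (\<Sum>l<d i. pr (c i l) a))"
    using J(2) kf_nonneg[OF e(2)] a(3) by (intro sum_mono mult_right_mono sum_nonneg pr_nonneg) auto
  also have "\<dots> = \<eta> * (\<Sum>z\<in>?S. pr (case z of (i, l) \<Rightarrow> c i l) a)"
    using fam_finite[OF fam] by (simp add: sum_distrib_left[symmetric] sum.Sigma case_prod_unfold)
  also have "\<dots> \<le> \<eta> * C"
    using J(3) e(2) by (intro mult_left_mono avg_fam[OF a(1) fS _ a(2)]) auto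
  finally show ?thesis .
qed

text \<open>Meant for weights whose complexity is beyond the reach of the average. The supports are
  disjoint, so the sum of the functionals is at most \<open>\<eta>\<close> at every
  coordinate.\<close>

lemma weight_fam_l1:
  assumes fin: "finite I" and disj: "disjoint_family_on (\<lambda>i. supp (g i)) I"
    and kw: "\<And>i. i \<in> I \<Longrightarrow> kw (Jf i) (g i)" and J: "\<And>i. i \<in> I \<Longrightarrow> \<theta> (Jf i) \<le> \<eta>" "0 \<le> \<eta>"
    and a: "\<And>k. 0 \<le> a k"
  shows "(\<Sum>i\<in>I. pr (g i) a) \<le> \<eta> * (\<Sum>k\<in>supp a. a k)"
proof -
  have "(\<Sum>i\<in>I. g i k) \<le> \<eta>" for k
  proof (cases "\<exists>i\<in>I. k \<in> supp (g i)")
    case True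
    then obtain i where i: "i \<in> I" "k \<in> supp (g i)" by blast
    have "g l k = 0" if "l \<in> I - {i}" for l
      using disj i that unfolding disjoint_family_on_def supp_def by blast
    then have "(\<Sum>l\<in>I. g l k) = (\<Sum>l\<in>{i}. g l k)" using i fin by (intro sum.mono_neutral_right) auto
    then show ?thesis using kw_le[OF kw[OF i(1)], of k] J(1)[OF i(1)] by simp
  next
    case False
    then have "(\<Sum>l\<in>I. g l k) = 0" by (intro sum.neutral) (auto simp: supp_def)
    then show ?thesis using J(2) by simp
  qed
  then have "(\<Sum>k\<in>supp a. (\<Sum>i\<in>I. g i k) * a k) \<le> (\<Sum>k\<in>supp a. \<eta> * a k)"
    using a by (intro sum_mono mult_right_mono)
  then show ?thesis
    unfolding pr_sum_left[symmetric] by (simp add: pr_def sum_distrib_left)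
qed

text \<open>The \<open>a k\<close> are a rapidly increasing sequence with respect to the indices
  \<open>Jk k\<close>. Among the old members, a weight index up to \<open>Jk k\<close> is handled by
  the average and one from \<open>Jk (Suc k)\<close> on by the \<open>l_1\<close> bound; an index
  strictly between is bad, which happens for one \<open>k\<close> only because \<open>Jk\<close>
  increases. The remaining old members have coefficient at most \<open>t\<close>, or are unit
  vectors before \<open>q k\<close> and do not act.\<close>

lemma ris_estimate:
  fixes h :: "'i \<Rightarrow> nat \<Rightarrow> real"
  assumes qp: "rapid q p" and Jk: "strict_mono Jk"
    and a: "\<And>k. supp (a k) \<subseteq> {q k..p k}" "\<And>k x. 0 \<le> a k x" "\<And>k. avg (n (Jk k) + 1) C (a k)"
      "\<And>k. \<theta> (Jk (Suc k)) * (\<Sum>x\<in>supp (a k). a k x) \<le> \<rho>"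
    and \<beta>: "\<And>k. 0 \<le> \<beta> k" "(\<Sum>k=N..<M. \<beta> k) = 1"
      "\<And>G. G \<subseteq> {N..<M} \<Longrightarrow> Msm R G p \<Longrightarrow> (\<Sum>k\<in>G. \<beta> k) \<le> \<epsilon>"
    and fam: "fam R I h st" and h: "\<And>i. i \<in> I \<Longrightarrow> kf (h i)" "\<And>i. i \<in> I \<Longrightarrow> 0 \<le> \<tau> i \<and> \<tau> i \<le> 1"
      "\<And>i. i \<in> I \<Longrightarrow> \<tau> i \<le> t \<or> (\<exists>k. h i = unit_vec k) \<or> (\<exists>J\<ge>L. kw J (h i))"
    and t: "0 \<le> t" and \<rho>: "0 \<le> \<rho>"
  shows "(\<Sum>i\<in>I. \<tau> i * pr (h i) (\<lambda>x. \<Sum>k=N..<M. \<beta> k * a k x)) \<le>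
    (t * C + \<theta> L * C + \<rho>) + 2 * \<epsilon> * (4 ^ R * C)"
proof -
  define W where "W i \<longleftrightarrow> (\<exists>J\<ge>L. kw J (h i))" for i
  define Jf where "Jf i = (SOME J. L \<le> J \<and> kw J (h i))" for i
  have Jf: "L \<le> Jf i" "kw (Jf i) (h i)" if "W i" for i
    using someI_ex[of "\<lambda>J. L \<le> J \<and> kw J (h i)"] that unfolding W_def Jf_def by auto
  define bad where "bad i k \<longleftrightarrow> W i \<and> Jk k < Jf i \<and> Jf i < Jk (Suc k)" for i k
  have C0: "0 \<le> C" using avg_nonneg[OF a(3)] .
  have mono: "Jk i \<le> Jk j" if "i \<le> j" for i j using Jk that by (simp add: strict_mono_less_eq)
  show ?thesis
  proof (rule core_average[OF qp fam, where bad=bad and a=a and N=N and M=M])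
    show "k = l" if "bad i k" "bad i l" for i k l
      using that mono[of "Suc k" l] mono[of "Suc l" k] unfolding bad_def
      by (cases k l rule: linorder_cases) auto
    show "(\<Sum>i\<in>I. pr (h i) (a k)) \<le> 4 ^ R * C" for k
      using avg_kf[OF a(3)] h(1) by (intro fam_bound[OF fam]) auto
    show "0 \<le> t * C + \<theta> L * C + \<rho>" using t C0 \<rho> \<theta>_pos[of L] by simp
  next
    fix k J
    assume "k \<in> {N..<M}" and JI: "J \<subseteq> I" and famJ: "fam 1 J (\<lambda>i. rst {q k..} (h i)) (\<lambda>_. q k)"
      and JJ: "\<And>i. i \<in> J \<Longrightarrow> \<not> bad i k \<and> supp (h i) \<inter> {..<q k} \<noteq> {}"
    let ?g = "\<lambda>i. rst {q k..} (h i)"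
    let ?f = "\<lambda>i. \<tau> i * pr (?g i) (a k)"
    have finJ: "finite J" using fam_finite[OF famJ] .
    have kg: "kf (?g i)" if "i \<in> J" for i using h(1) JI that by (intro kf_rst) auto
    have \<tau>: "0 \<le> \<tau> i" "\<tau> i \<le> 1" if "i \<in> J" for i using h(2) JI that by auto
    have g0: "0 \<le> pr (?g i) (a k)" if "i \<in> J" for i using kf_nonneg[OF kg[OF that]] a(2) by (rule pr_nonneg)
    define P1 where "P1 i \<longleftrightarrow> \<tau> i \<le> t \<or> (\<exists>k. h i = unit_vec k)" for i
    define P2 where "P2 i \<longleftrightarrow> W i \<and> Jf i \<le> Jk k" for i
    define P3 where "P3 i \<longleftrightarrow> W i \<and> Jk (Suc k) \<le> Jf i" for i
    have "sum ?f J \<le> sum ?f {i\<in>J. P1 i} + sum ?f {i\<in>J. P2 i} + sum ?f {i\<in>J. P3 i}"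
    proof (rule sum_cover3[OF finJ])
      show "P1 i \<or> P2 i \<or> P3 i" if "i \<in> J" for i
        using h(3)[of i] JI JJ[OF that] that unfolding P1_def P2_def P3_def bad_def W_def by auto
    qed (use \<tau> g0 in auto)
    also have "sum ?f {i\<in>J. P1 i} \<le> t * C"
    proof -
      have "?f i \<le> t * pr (?g i) (a k)" if i: "i \<in> J" "P1 i" for i
      proof (cases "\<tau> i \<le> t")
        case True
        then show ?thesis using g0[OF i(1)] by (intro mult_right_mono)
      next
        case False
        then obtain x where x: "h i = unit_vec x" using i by (auto simp: P1_def)
        then have "x < q k" using JJ[OF i(1)] by simp
        then have "pr (?g i) (a k) = 0" using x by (intro pr_disjoint) (auto simp: supp_rst)
        then show ?thesis by simp
      qed
      then have "sum ?f {i\<in>J. P1 i} \<le> t * (\<Sum>i\<in>{i\<in>J. P1 i}. pr (?g i) (a k))"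
        unfolding sum_distrib_left by (intro sum_mono) auto
      also have "\<dots> \<le> t * C"
      proof (rule mult_left_mono[OF avg_fam[OF a(3)[of k]] t])
        show "fam 1 {i\<in>J. P1 i} ?g (\<lambda>_. q k)" using famJ by (rule fam_subset) auto
      qed (use kg in auto)
      finally show ?thesis .
    qed
    also have "sum ?f {i\<in>J. P2 i} \<le> \<theta> L * C"
    proof -
      have "sum ?f {i\<in>J. P2 i} \<le> (\<Sum>i\<in>{i\<in>J. P2 i}. pr (?g i) (a k))"
        using \<tau> g0 by (intro sum_mono mult_left_le_one_le) auto
      also have "\<dots> \<le> \<theta> L * C"
      proof (rule weight_fam_avg[where Jf=Jf and Jm="Jk k" and r=1])
        show "fam 1 {i\<in>J. P2 i} ?g (\<lambda>_. q k)" using famJ by (rule fam_subset) auto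
        show "kw (Jf i) (?g i)" "Jf i \<le> Jk k" "\<theta> (Jf i) \<le> \<theta> L" if "i \<in> {i\<in>J. P2 i}" for i
          using that Jf[of i] by (auto simp: P2_def intro: kw_rst \<theta>_mono)
      qed (use a(2,3) \<theta>_pos[of L] in auto)
      finally show ?thesis .
    qed
    also have "sum ?f {i\<in>J. P3 i} \<le> \<rho>"
    proof -
      have "sum ?f {i\<in>J. P3 i} \<le> (\<Sum>i\<in>{i\<in>J. P3 i}. pr (?g i) (a k))"
        using \<tau> g0 by (intro sum_mono mult_left_le_one_le) auto
      also have "\<dots> \<le> \<theta> (Jk (Suc k)) * (\<Sum>x\<in>supp (a k). a k x)"
      proof (rule weight_fam_l1[where Jf=Jf])
        have "fam 1 {i\<in>J. P3 i} ?g (\<lambda>_. q k)" using famJ by (rule fam_subset) auto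
        then show "disjoint_family_on (\<lambda>i. supp (?g i)) {i\<in>J. P3 i}" by (simp add: fam_def)
        show "kw (Jf i) (?g i)" "\<theta> (Jf i) \<le> \<theta> (Jk (Suc k))" if "i \<in> {i\<in>J. P3 i}" for i
          using that Jf[of i] by (auto simp: P3_def intro: kw_rst \<theta>_mono)
      qed (use finJ a(2) \<theta>_pos[of "Jk (Suc k)"] in auto)
      also have "\<dots> \<le> \<rho>" by (rule a(4))
      finally show ?thesis .
    qed
    finally show "(\<Sum>i\<in>J. \<tau> i * pr (?g i) (a k)) \<le> t * C + \<theta> L * C + \<rho>" by simp
  qed (use a \<beta> h kf_nonneg in auto)
qed

end

section \<open>Averages in block subspaces\<close>

lemma rapid_sequence:
  assumes "\<And>N. N \<le> pp N" "1 \<le> N"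
  shows "\<exists>q. q 0 = N \<and> rapid q (\<lambda>k. pp (q k))"
proof -
  define q where "q = rec_nat N (\<lambda>_ x. (pp x)\<^sup>2 + 1)"
  have q: "q 0 = N" "q (Suc k) = (pp (q k))\<^sup>2 + 1" for k by (simp_all add: q_def)
  have "1 \<le> q k" for k using assms(2) q by (cases k) auto
  then have "rapid q (\<lambda>k. pp (q k))" using assms(1) q(2) by (auto simp: rapid_def)
  then show ?thesis using q(1) by blast
qed

lemma rapid_inj:
  assumes "rapid q p"
  shows "inj_on q A"
proof -
  have "q i < q j" if "i < j" for i j
    using rapid_less(1)[OF assms that] assms unfolding rapid_def by (meson le_less_trans)
  then show ?thesis by (intro inj_onI) (metis less_irrefl linorder_neqE_nat)
qed

lemma rapid_disjoint:
  assumes "rapid q p" "i \<noteq> j" "A \<subseteq> {q i..p i}" "B \<subseteq> {q j..p j}"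
  shows "A \<inter> B = {}"
  using assms(2-4) rapid_less(1)[OF assms(1), of i j] rapid_less(1)[OF assms(1), of j i]
  by (cases i j rule: linorder_cases) fastforce+

lemma pr_rapid_sum:
  assumes "rapid q p" "\<And>k. k \<in> {0..<M} \<Longrightarrow> supp (a k) \<subseteq> {q k..p k}" "l \<in> {0..<M}"
    "supp g \<subseteq> {q l..p l}"
  shows "pr g (\<lambda>x. \<Sum>k=0..<M. c k * a k x) = c l * pr g (a l)"
proof -
  have "pr g (\<lambda>x. \<Sum>k=0..<M. c k * a k x) = (\<Sum>k=0..<M. pr g (\<lambda>x. c k * a k x))"
    using finite_subset[OF assms(2)] finite_subset[OF supp_scale_subset]
    by (intro pr_sum_right) auto
  also have "\<dots> = (\<Sum>k=0..<M. if k = l then c l * pr g (a l) else 0)"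
  proof (rule sum.cong[OF refl])
    fix k assume "k \<in> {0..<M}"
    then show "pr g (\<lambda>x. c k * a k x) = (if k = l then c l * pr g (a l) else 0)"
      using rapid_disjoint[OF assms(1) _ assms(4) assms(2), of k] by (auto simp: pr_scale_right pr_disjoint)
  qed
  also have "\<dots> = c l * pr g (a l)" using assms(3) by simp
  finally show ?thesis .
qed

lemma sq_rapid_sum:
  assumes "rapid q p" "\<And>k. k \<in> {0..<M} \<Longrightarrow> supp (x k) \<subseteq> {q k..p k}" "\<And>k. 0 \<le> \<beta> k"
  shows "sq (\<lambda>i. \<Sum>k=0..<M. sqrt (\<beta> k) * x k i) = (\<lambda>i. \<Sum>k=0..<M. \<beta> k * sq (x k) i)"
proof
  fix i
  show "sq (\<lambda>i. \<Sum>k=0..<M. sqrt (\<beta> k) * x k i) i = (\<Sum>k=0..<M. \<beta> k * sq (x k) i)"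
  proof (cases "\<exists>l\<in>{0..<M}. i \<in> supp (x l)")
    case True
    then obtain l where l: "l \<in> {0..<M}" "i \<in> supp (x l)" by blast
    have z: "x k i = 0" if "k \<in> {0..<M}" "k \<noteq> l" for k
      using rapid_disjoint[OF assms(1) that(2) assms(2)[OF that(1)] assms(2)[OF l(1)]] l(2)
      by (auto simp: supp_def)
    have "(\<Sum>k=0..<M. sqrt (\<beta> k) * x k i) = (\<Sum>k\<in>{l}. sqrt (\<beta> k) * x k i)"
      using l z by (intro sum.mono_neutral_right) auto
    moreover have "(\<Sum>k=0..<M. \<beta> k * sq (x k) i) = (\<Sum>k\<in>{l}. \<beta> k * sq (x k) i)"
      using l z by (intro sum.mono_neutral_right) (auto simp: sq_def)
    ultimately show ?thesis using assms(3) by (simp add: sq_def power_mult_distrib)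
  next
    case False
    then have "x k i = 0" if "k \<in> {0..<M}" for k using that by (auto simp: supp_def)
    then show ?thesis by (simp add: sq_def)
  qed
qed

context wh_parameters
begin

lemma nrm_pos:
  assumes "finite (supp x)" "supp x \<subseteq> {1..}" "supp x \<noteq> {}"
  shows "0 < nrm x"
proof -
  obtain k where k: "k \<in> supp x" using assms(3) by blast
  then have "kf (unit_vec k)" using assms(2) by (intro kf_unit) auto
  then have "pr (unit_vec k) (sq x) \<le> (nrm x)\<^sup>2" "0 \<le> nrm x" using wh_norm_ge[OF assms(1)] by auto
  moreover have "pr (unit_vec k) (sq x) = (x k)\<^sup>2"
    using pr_unit[of "sq x" k] assms(1) unfolding supp_sq by (simp only: sq_def)
  moreover have "0 < (x k)\<^sup>2" using k by (simp add: supp_def)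
  ultimately show ?thesis by (cases "nrm x = 0") auto
qed

lemma sq_scale: "sq (\<lambda>k. c * x k) = (\<lambda>k. c\<^sup>2 * sq x k)"
  by (simp add: sq_def power_mult_distrib)

lemma nrm_attained_half:
  assumes "finite (supp x)" "0 < nrm x"
  shows "\<exists>g. kf g \<and> (nrm x)\<^sup>2 / 2 \<le> pr g (sq x)"
proof (rule ccontr)
  assume "\<not> ?thesis"
  then have "pr g (sq x) \<le> (nrm x / sqrt 2)\<^sup>2" if "kf g" for g
    using that by (auto simp: power_divide not_le intro: less_imp_le)
  then have "nrm x \<le> nrm x / sqrt 2" using assms by (intro wh_norm_le) auto
  then show False using assms(2) by (simp add: field_simps)
qed

lemma nrm_scale_le:
  assumes "finite (supp x)"
  shows "nrm (\<lambda>k. c * x k) \<le> \<bar>c\<bar> * nrm x"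
proof (rule wh_norm_le)
  show "finite (supp (\<lambda>k. c * x k))" using supp_scale_subset assms by (rule finite_subset)
  show "0 \<le> \<bar>c\<bar> * nrm x" using wh_norm_ge(2)[OF assms kf_zero] by simp
  show "pr g (sq (\<lambda>k. c * x k)) \<le> (\<bar>c\<bar> * nrm x)\<^sup>2" if "kf g" for g
    using wh_norm_ge(1)[OF assms that] by (simp add: sq_scale pr_scale_right power_mult_distrib mult_left_mono)
qed

lemma nrm_normalise:
  assumes "finite (supp x)" "0 < nrm x"
  shows "nrm (\<lambda>k. 1 / nrm x * x k) = 1"
proof (rule antisym)
  show "nrm (\<lambda>k. 1 / nrm x * x k) \<le> 1"
    using nrm_scale_le[OF assms(1), of "1 / nrm x"] assms(2) by simp
  have fin: "finite (supp (\<lambda>k. 1 / nrm x * x k))" using supp_scale_subset assms(1) by (rule finite_subset)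
  have "nrm x = nrm (\<lambda>k. nrm x * (1 / nrm x * x k))" using assms(2) by simp
  also have "\<dots> \<le> \<bar>nrm x\<bar> * nrm (\<lambda>k. 1 / nrm x * x k)" by (rule nrm_scale_le[OF fin])
  finally show "1 \<le> nrm (\<lambda>k. 1 / nrm x * x k)" using assms(2) by simp
qed

text \<open>If no vector of V were an average, then each passage to a basic average of normalised far out
  vectors would divide the square of the norm by 4, while the lower estimate of allowable families
  of complexity n L only allows a loss of the factor theta L.\<close>

lemma average_exists:
  fixes V :: "(nat \<Rightarrow> real) set"
  assumes V: "\<And>x. x \<in> V \<Longrightarrow> finite (supp x) \<and> supp x \<subseteq> {1..}"
    and scale: "\<And>c x. x \<in> V \<Longrightarrow> (\<lambda>k. c * x k) \<in> V"
    and add: "\<And>x y. x \<in> V \<Longrightarrow> y \<in> V \<Longrightarrow> (\<lambda>k. x k + y k) \<in> V"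
    and far: "\<And>N. \<exists>x\<in>V. supp x \<noteq> {} \<and> supp x \<subseteq> {N..}"
  shows "\<exists>x\<in>V. supp x \<subseteq> {N0..} \<and> nrm x = 1 \<and> avg (n J + 1) 20 (sq x)"
proof (rule ccontr)
  assume no: "\<not> ?thesis"
  define R where "R = n J + 1"
  \<comment> \<open>\<open>x\<close> is a basic average iterated \<open>s\<close> times, with
    squared norm at most \<open>(1/4) ^ s\<close>; nevertheless the functionals \<open>h f\<close>,
    starting at the points of the Schreier set \<open>F\<close>, together still give 1/2. Each
    iteration adds \<open>R + 1\<close> to the complexity of \<open>F\<close>.\<close>
  define stage where "stage s N x F h \<longleftrightarrow> x \<in> V \<and> supp x \<subseteq> {N..} \<and> (\<forall>g. kf g \<longrightarrow> pr g (sq x) \<le> (1/4) ^ s) \<and>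
    F \<in> schreier (s * (R + 1)) \<and> F \<subseteq> {N..} \<and> (\<forall>f\<in>F. kf (h f) \<and> supp (h f) \<subseteq> {f..}) \<and>
    disjoint_family_on (\<lambda>f. supp (h f)) F \<and> 1/2 \<le> (\<Sum>f\<in>F. pr (h f) (sq x))" for s N x and F :: "nat set" and h
  have unit: "\<exists>x\<in>V. supp x \<subseteq> {N..} \<and> nrm x = 1" for N
  proof -
    obtain x where x: "x \<in> V" "supp x \<noteq> {}" "supp x \<subseteq> {N..}" using far by blast
    have "0 < nrm x" using nrm_pos V[OF x(1)] x(2) by blast
    then have "nrm (\<lambda>k. 1 / nrm x * x k) = 1" using nrm_normalise V[OF x(1)] by blast
    then show ?thesis using scale[OF x(1), of "1 / nrm x"] supp_scale_subset[of "1 / nrm x" x] x(3) by blast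
  qed
  have "\<forall>N\<ge>N0. \<exists>x F h. stage s N x F h" for s
  proof (induction s)
    case 0
    show ?case
    proof (intro allI impI)
      fix N
      obtain x where x: "x \<in> V" "supp x \<subseteq> {N..}" "nrm x = 1" using unit by blast
      have fx: "finite (supp x)" "supp x \<subseteq> {1..}" using V[OF x(1)] by auto
      obtain g where g: "kf g" "1/2 \<le> pr g (sq x)" using nrm_attained_half[OF fx(1)] x(3) by auto
      define N1 where "N1 = max N 1"
      have "supp x \<subseteq> {N1..}" using x(2) fx(2) by (auto simp: N1_def)
      then have "pr (rst {N1..} g) (sq x) = pr g (sq x)" by (intro pr_cong) (auto simp: rst_def)
      moreover have "pr h (sq x) \<le> 1" if "kf h" for h using wh_norm_ge(1)[OF fx(1) that] x(3) by simp
      ultimately have "stage 0 N x {N1} (\<lambda>_. rst {N1..} g)"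
        using x g kf_rst unfolding stage_def by (auto simp: supp_rst disjoint_family_on_def N1_def)
      then show "\<exists>x F h. stage 0 N x F h" by blast
    qed
  next
    case (Suc s)
    show ?case
    proof (intro allI impI)
      fix N assume N: "N0 \<le> N"
      obtain xx FF hh where st: "\<And>N. N0 \<le> N \<Longrightarrow> stage s N (xx N) (FF N) (hh N)"
        using Suc.IH by metis
      define S where "S N = (if N0 \<le> N then supp (xx N) \<union> FF N else {})" for N
      define pp where "pp N = Max (insert N (S N))" for N
      have finS: "finite (insert N (S N))" for N
        using st[of N] V schreier_finite(1) unfolding stage_def S_def by auto
      have pp: "N \<le> pp N" "S N \<subseteq> {..pp N}" for N
        using Max_ge[OF finS[of N]] unfolding pp_def by auto
      \<comment> \<open>A start beyond this bound makes the contribution of the exceptional indices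
        at most \<open>(1/4) ^ s\<close>. With \<open>4 * (1/4) ^ s\<close> from families of
        complexity 1 this yields the constant 5.\<close>
      define N1 where "N1 = max N (max 1 (nat \<lceil>2 * 4 ^ R * (real R + 1)\<rceil>))"
      have "1 \<le> N1" by (simp add: N1_def)
      then obtain q where q0: "q 0 = N1" and rap: "rapid q (\<lambda>k. pp (q k))"
        using rapid_sequence[of pp, OF pp(1)] by blast
      define p where "p k = pp (q k)" for k
      have rap: "rapid q p" using rap unfolding p_def[abs_def] .
      have qN: "N \<le> q k" for k using rapid_mono(1)[OF rap, of 0 k] q0 by (simp add: N1_def)
      have qN0: "N0 \<le> q k" for k using qN N le_trans by blast
      define y where "y k = xx (q k)" for k
      define a where "a k = sq (y k)" for k
      have sk: "stage s (q k) (y k) (FF (q k)) (hh (q k))" for k using st[OF qN0] by (simp add: y_def)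
      have yV: "y k \<in> V" for k using sk by (simp add: stage_def)
      have ysup: "supp (y k) \<subseteq> {q k..p k}" "FF (q k) \<subseteq> {q k..p k}" for k
        using sk[of k] pp(2)[of "q k"] qN0[of k] unfolding stage_def S_def y_def p_def by auto
      have a0: "0 \<le> a k i" for k i by (simp add: a_def sq_def)
      have asup: "supp (a k) \<subseteq> {q k..p k}" for k using ysup(1) by (simp add: a_def)
      have ale: "pr g (a k) \<le> (1/4) ^ s" if "kf g" for g k using sk that by (simp add: stage_def a_def)
      obtain M \<beta> where M: "0 < M" and \<beta>0: "\<And>k. (0::real) \<le> \<beta> k" and \<beta>1: "(\<Sum>k=0..<M. \<beta> k) = 1"
        and qS: "q ` {0..<M} \<in> schreier (Suc R)"
        and small: "\<And>G. G \<subseteq> {0..<M} \<Longrightarrow> Msm R G p \<Longrightarrow> (\<Sum>k\<in>G. \<beta> k) \<le> (real R + 1) / q 0"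
        using basic_average[OF rap, of 0 R] by metis
      define x where "x = (\<lambda>i. \<Sum>k=0..<M. sqrt (\<beta> k) * y k i)"
      have "(\<lambda>i. \<Sum>k=0..<K. sqrt (\<beta> k) * y k i) \<in> V" if "0 < K" for K
        using that
      proof (induction K)
        case (Suc K)
        then show ?case
          using add[OF _ scale[OF yV[of K], of "sqrt (\<beta> K)"]] scale[OF yV[of 0], of "sqrt (\<beta> 0)"]
          by (cases "K = 0") auto
      qed simp
      then have xV: "x \<in> V" using M by (simp add: x_def)
      have sqx: "sq x = (\<lambda>i. \<Sum>k=0..<M. \<beta> k * a k i)"
        unfolding x_def a_def by (rule sq_rapid_sum[OF rap ysup(1) \<beta>0])
      have xsup: "supp x \<subseteq> {N..}"
      proof -
        have "supp (\<lambda>i. sqrt (\<beta> k) * y k i) \<subseteq> {N..}" for k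
          using supp_scale_subset[of "sqrt (\<beta> k)" "y k"] ysup(1)[of k] qN[of k] by fastforce
        then show ?thesis unfolding x_def by (intro subset_trans[OF supp_sum_subset] UN_least)
      qed
      have avgx: "avg R (5 * (1/4) ^ s) (sq x)"
        unfolding avg_def
      proof (intro allI impI)
        fix I :: "nat set" and h st' assume I: "fam R I h st' \<and> (\<forall>i\<in>I. kf (h i))"
        have "(\<Sum>i\<in>I. 1 * pr (h i) (\<lambda>x. \<Sum>k=0..<M. \<beta> k * a k x)) \<le>
            4 ^ 1 * (1/4) ^ s + 2 * ((real R + 1) / q 0) * (4 ^ R * (1/4) ^ s)"
        proof (rule core_average[OF rap, where bad="\<lambda>_ _. False"])
          show "(\<Sum>i\<in>I. pr (h i) (a k)) \<le> 4 ^ R * (1/4) ^ s" for k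
            using I ale by (intro fam_bound[where st=st']) auto
          show "(\<Sum>i\<in>K. 1 * pr (rst {q k..} (h i)) (a k)) \<le> 4 ^ 1 * (1/4) ^ s"
            if K: "K \<subseteq> I" "fam 1 K (\<lambda>i. rst {q k..} (h i)) (\<lambda>_. q k)" for k K
            unfolding mult_1 using I K(1) ale by (intro fam_bound[OF K(2)] kf_rst) auto
        qed (use I asup a0 \<beta>0 \<beta>1 small kf_nonneg in auto)
        also have "\<dots> \<le> 5 * (1/4) ^ s"
        proof -
          have "2 * 4 ^ R * (real R + 1) \<le> real (nat \<lceil>2 * 4 ^ R * (real R + 1)\<rceil>)" by (rule real_nat_ceiling_ge)
          also have "\<dots> \<le> q 0" unfolding q0 N1_def of_nat_le_iff by (meson max.cobounded2 order_trans)
          finally have "(2 * 4 ^ R * (real R + 1)) / q 0 \<le> 1"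
            using \<open>1 \<le> N1\<close> q0 by (subst divide_le_eq_1_pos) auto
          moreover have "2 * ((real R + 1) / q 0) * 4 ^ R = (2 * 4 ^ R * (real R + 1)) / q 0" by simp
          ultimately have "2 * ((real R + 1) / q 0) * 4 ^ R \<le> 1" by linarith
          then have "2 * ((real R + 1) / q 0) * 4 ^ R * (1/4) ^ s \<le> 1 * (1/4) ^ s" by (intro mult_right_mono) auto
          then show ?thesis by (simp add: mult.assoc)
        qed
        finally show "(\<Sum>i\<in>I. pr (h i) (sq x)) \<le> 5 * (1/4) ^ s" by (simp add: sqx)
      qed
      have fx: "finite (supp x)" using V[OF xV] by blast
      have nx0: "0 \<le> nrm x" using wh_norm_ge(2)[OF fx kf_zero] .
      \<comment> \<open>Otherwise normalising divides the bound \<open>5 * (1/4) ^ s\<close> by more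
        than \<open>(1/4) ^ Suc s\<close>, and the result is an average with constant 20, contrary
        to the assumption.\<close>
      have nx: "(nrm x)\<^sup>2 \<le> (1/4) ^ Suc s"
      proof (rule ccontr)
        assume "\<not> ?thesis"
        then have big: "(1/4) ^ Suc s < (nrm x)\<^sup>2" by simp
        then have nxp: "0 < nrm x"
          using nx0 by (metis less_eq_real_def less_irrefl order_less_trans power_zero_numeral zero_less_divide_1_iff zero_less_numeral zero_less_power)
        define z where "z = (\<lambda>i. 1 / nrm x * x i)"
        have "avg R 20 (sq z)"
          unfolding avg_def
        proof (intro allI impI)
          fix I :: "nat set" and h st' assume I: "fam R I h st' \<and> (\<forall>i\<in>I. kf (h i))"
          have "(\<Sum>i\<in>I. pr (h i) (sq z)) = (\<Sum>i\<in>I. pr (h i) (sq x)) / (nrm x)\<^sup>2"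
            unfolding z_def sq_scale pr_scale_right by (simp add: power_divide sum_divide_distrib)
          also have "\<dots> \<le> (5 * (1/4) ^ s) / (nrm x)\<^sup>2"
            using avgx I unfolding avg_def by (intro divide_right_mono) auto
          also have "\<dots> \<le> 20" using big nxp by (subst pos_divide_le_eq) auto
          finally show "(\<Sum>i\<in>I. pr (h i) (sq z)) \<le> 20" .
        qed
        moreover have "z \<in> V" unfolding z_def by (rule scale[OF xV])
        moreover have "nrm z = 1" unfolding z_def by (rule nrm_normalise[OF fx nxp])
        moreover have "supp z \<subseteq> {N0..}"
          using supp_scale_subset[of "1 / nrm x" x] xsup N unfolding z_def by fastforce
        ultimately show False using no by (auto simp: R_def)
      qed
      define F where "F = (\<Union>a\<in>q ` {0..<M}. FF a)"
      have FS: "F \<in> schreier (s * (R + 1) + Suc R)"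
        unfolding F_def
      proof (rule schreier_compose[OF qS])
        fix b assume b: "b \<in> q ` {0..<M}"
        then obtain k where k: "b = q k" by blast
        show "FF b \<in> schreier (s * (R + 1))" using sk k by (simp add: stage_def)
        show "b \<le> c" if "c \<in> FF b" for c using ysup(2)[of k] k that by auto
        show "c < b'" if b': "b' \<in> q ` {0..<M}" and lt: "b < b'" and c: "c \<in> FF b" for b' c
        proof -
          obtain l where l: "b' = q l" using b' by blast
          have "k < l" using lt rapid_mono(1)[OF rap, of l k] k l by (metis leD leI)
          then have "p k < q l" by (rule rapid_less(1)[OF rap])
          then show ?thesis using ysup(2)[of k] c k l by auto
        qed
      qed
      have disjF: "FF (q k) \<inter> FF (q l) = {}" if "k \<noteq> l" for k l
        using rapid_disjoint[OF rap that ysup(2) ysup(2)] .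
      define ix where "ix f = (SOME k. f \<in> FF (q k))" for f
      have ix: "ix f = k" if "f \<in> FF (q k)" for f k
      proof -
        have "f \<in> FF (q (ix f))" unfolding ix_def using that by (rule someI)
        then show ?thesis using disjF[of "ix f" k] that by blast
      qed
      \<comment> \<open>Cut down to its own interval, a functional of the previous stage does not
        see the other summands of \<open>x\<close>.\<close>
      define H where "H f = rst {q (ix f)..p (ix f)} (hh (q (ix f)) f)" for f
      have kH: "kf (H f) \<and> supp (H f) \<subseteq> {f..} \<and> supp (H f) \<subseteq> {q k..p k}" if "f \<in> FF (q k)" for f k
        using sk[of k] that ix[OF that] unfolding stage_def H_def by (auto simp: supp_rst intro: kf_rst)
      have "stage (Suc s) N x F H"
        unfolding stage_def
      proof (intro conjI allI impI ballI)
        show "pr g (sq x) \<le> (1/4) ^ Suc s" if "kf g" for g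
          using wh_norm_ge(1)[OF fx that] nx by linarith
        show "F \<in> schreier (Suc s * (R + 1))" using FS by (simp add: algebra_simps)
        show "F \<subseteq> {N..}"
        proof
          fix f assume "f \<in> F"
          then obtain k where "f \<in> FF (q k)" unfolding F_def by blast
          then have "q k \<le> f" using ysup(2)[of k] by auto
          then show "f \<in> {N..}" using qN[of k] by auto
        qed
        show "kf (H f)" "supp (H f) \<subseteq> {f..}" if "f \<in> F" for f using that kH unfolding F_def by blast+
        show "disjoint_family_on (\<lambda>f. supp (H f)) F"
          unfolding disjoint_family_on_def
        proof (intro ballI impI)
          fix f g assume fg: "f \<in> F" "g \<in> F" "f \<noteq> g"
          obtain k l where kl: "f \<in> FF (q k)" "g \<in> FF (q l)" using fg unfolding F_def by blast
          show "supp (H f) \<inter> supp (H g) = {}"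
          proof (cases "k = l")
            case True
            then have "supp (hh (q k) f) \<inter> supp (hh (q k) g) = {}"
              using sk[of k] kl fg(3) unfolding stage_def disjoint_family_on_def by blast
            moreover have "supp (H f) \<subseteq> supp (hh (q k) f)" "supp (H g) \<subseteq> supp (hh (q k) g)"
              using ix[OF kl(1)] ix[OF kl(2)] True by (auto simp: H_def supp_rst)
            ultimately show ?thesis by blast
          next
            case False
            then show ?thesis using rapid_disjoint[OF rap False, of "supp (H f)" "supp (H g)"]
              kH[OF kl(1)] kH[OF kl(2)] by simp
          qed
        qed
        have "(\<Sum>f\<in>F. pr (H f) (sq x)) = (\<Sum>k=0..<M. \<Sum>f\<in>FF (q k). pr (H f) (sq x))"
        proof -
          have "F = (\<Union>k\<in>{0..<M}. FF (q k))" by (auto simp: F_def)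
          moreover have "finite (FF (q k))" for k using finite_subset[OF ysup(2)] by blast
          ultimately show ?thesis using disjF by (simp add: sum.UNION_disjoint)
        qed
        also have "\<dots> = (\<Sum>k=0..<M. \<beta> k * (\<Sum>f\<in>FF (q k). pr (hh (q k) f) (a k)))"
        proof (rule sum.cong[OF refl])
          fix k assume k: "k \<in> {0..<M}"
          have "pr (H f) (sq x) = \<beta> k * pr (hh (q k) f) (a k)" if f: "f \<in> FF (q k)" for f
          proof -
            have "pr (H f) (sq x) = \<beta> k * pr (H f) (a k)"
              unfolding sqx using kH[OF f] by (intro pr_rapid_sum[OF rap asup k]) blast
            also have "pr (H f) (a k) = pr (hh (q k) f) (a k)"
              using asup[of k] ix[OF f] by (intro pr_cong) (auto simp: H_def rst_def)
            finally show ?thesis .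
          qed
          then show "(\<Sum>f\<in>FF (q k). pr (H f) (sq x)) = \<beta> k * (\<Sum>f\<in>FF (q k). pr (hh (q k) f) (a k))"
            by (simp add: sum_distrib_left)
        qed
        also have "\<dots> \<ge> (\<Sum>k=0..<M. \<beta> k * (1/2))"
          using \<beta>0 sk unfolding a_def by (intro sum_mono mult_left_mono) (auto simp: stage_def)
        also have "(\<Sum>k=0..<M. \<beta> k * (1/2)) = 1/2" unfolding sum_distrib_right[symmetric] \<beta>1 by simp
        finally show "1/2 \<le> (\<Sum>f\<in>F. pr (H f) (sq x))" .
      qed (use xV xsup in auto)
      then show "\<exists>x F h. stage (Suc s) N x F h" by blast
    qed
  qed
  \<comment> \<open>\<open>L\<close> is even, so that \<open>\<theta> L\<close> times the sum of the
    \<open>h f\<close> is a functional, and large enough for \<open>n (L - 1)\<close> to exceed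
    \<open>n J\<close>. At the truncation depth \<open>s\<close> this functional gives at least
    \<open>\<theta> L / 2\<close>, but no functional gives more than
    \<open>\<theta> L ^ 2\<close>.\<close>
  moreover define L where "L = 2 * (J + 2)"
  obtain s where s: "(1/4) ^ s \<le> \<theta> L ^ 2" "(s + 2) * (n (L - 1) + 1) < n L"
    using truncation_depth[of L] by (auto simp: L_def)
  ultimately obtain x F h where st: "stage s N0 x F h" by blast
  have "R + 1 \<le> n (L - 1) + 1" using n_less[of J "L - 1"] by (simp add: R_def L_def)
  then have "s * (R + 1) \<le> (s + 2) * (n (L - 1) + 1)" by (intro mult_mono) auto
  then have F: "F \<in> schreier (n L)" using st s(2) schreier_mono[of F "s * (R + 1)" "n L"] by (simp add: stage_def)
  have "kw L (\<lambda>k. \<theta> L * (\<Sum>f\<in>F. h f k))"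
    using st F schreier_finite(1)[OF F] unfolding L_def
    by (intro kw_even_start[where st="\<lambda>f. f"]) (auto simp: stage_def)
  then have "pr (\<lambda>k. \<theta> L * (\<Sum>f\<in>F. h f k)) (sq x) \<le> \<theta> L ^ 2"
    using st kf_kw s(1) unfolding stage_def by (meson order_trans)
  moreover have "\<theta> L * (1/2) \<le> pr (\<lambda>k. \<theta> L * (\<Sum>f\<in>F. h f k)) (sq x)"
    unfolding pr_scale_left pr_sum_left using st \<theta>_pos[of L] by (intro mult_left_mono) (auto simp: stage_def)
  ultimately have "\<theta> L * (1/2) \<le> \<theta> L * \<theta> L" by (simp add: power2_eq_square)
  then show False using \<theta>_pos[of L] \<theta>_le[of L] by simp
qed

end

section \<open>Dependent sequences\<close>

context wh_parameters
begin

text \<open>The indices \<open>Jf i\<close> may vary with \<open>i\<close>; only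
  \<open>L < Jf i\<close> is asked. The index type is \<open>nat\<close> for the same reason as in
  \<open>avg\<close>.\<close>

definition heavy :: "nat \<Rightarrow> nat \<Rightarrow> real \<Rightarrow> (nat \<Rightarrow> real) \<Rightarrow> bool" where
  "heavy r L c a \<longleftrightarrow> (\<forall>(I :: nat set) h st Jf. fam r I h st \<and> (\<forall>i\<in>I. L < Jf i \<and> kw (Jf i) (h i)) \<longrightarrow>
     (\<Sum>i\<in>I. pr (h i) a) \<le> c)"

lemma heavy_fam:
  assumes "heavy r L c a" "fam s I h st" "\<And>i. i \<in> I \<Longrightarrow> L < Jf i \<and> kw (Jf i) (h i)" "s \<le> r"
  shows "(\<Sum>i\<in>I. pr (h i) a) \<le> c"
proof -
  obtain f where f: "bij_betw f {..<card I} I"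
    using ex_bij_betw_nat_finite[OF fam_finite[OF assms(2)]] lessThan_atLeast0 by metis
  have fam: "fam r I h st" using fam_mono assms(2,4) by blast
  have "fam r {..<card I} (h \<circ> f) (st \<circ> f)"
    using f by (intro fam_reindex[OF fam]) (auto simp: bij_betw_def)
  moreover have "\<forall>i\<in>{..<card I}. L < (Jf \<circ> f) i \<and> kw ((Jf \<circ> f) i) ((h \<circ> f) i)"
    using assms(3) f by (auto simp: bij_betw_def)
  ultimately have "(\<Sum>i<card I. pr ((h \<circ> f) i) a) \<le> c" using assms(1) unfolding heavy_def by blast
  also have "(\<Sum>i<card I. pr ((h \<circ> f) i) a) = (\<Sum>i\<in>I. pr (h i) a)"
    using sum.reindex_bij_betw[OF f, of "\<lambda>i. pr (h i) a"] by simp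
  finally show ?thesis .
qed

text \<open>Weights of index below \<open>L\<close> are opened and averaged, those above
  \<open>L\<close> are covered by \<open>heavy\<close>. Index \<open>L\<close> itself is excluded:
  it is the weight at which the vectors of \<open>level_one\<close> are large. Below
  \<open>L\<close> the squared weight is at most \<open>\<theta> J0 ^ 3\<close>, as
  \<open>Jf i > J0\<close>; only the square is kept.\<close>

lemma mixed_weights:
  fixes h :: "'i \<Rightarrow> nat \<Rightarrow> real"
  assumes a: "avg (2 * n (L - 1) + 1) C a" "heavy (n (L - 1) + 1) L (C * \<theta> L ^ 2) a" "\<And>k. 0 \<le> a k"
    and J0: "2 \<le> J0" "J0 < L"
    and fam: "fam r I h st" "r \<le> n (L - 1) + 1"
    and kw: "\<And>i. i \<in> I \<Longrightarrow> J0 < Jf i \<and> Jf i \<noteq> L \<and> kw (Jf i) (h i)"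
  shows "(\<Sum>i\<in>I. pr (h i) a) \<le> 2 * C * \<theta> J0 ^ 2"
proof -
  have C0: "0 \<le> C" using avg_nonneg a(1) .
  have finI: "finite I" using fam_finite[OF fam(1)] .
  have "(\<Sum>i\<in>I. pr (h i) a) = (\<Sum>i\<in>{i\<in>I. Jf i < L}. pr (h i) a) + (\<Sum>i\<in>{i\<in>I. L < Jf i}. pr (h i) a)"
  proof -
    have "I = {i\<in>I. Jf i < L} \<union> {i\<in>I. L < Jf i}" using kw by fastforce
    then show ?thesis using finI by (subst sum.union_disjoint[symmetric]) auto
  qed
  also have "(\<Sum>i\<in>{i\<in>I. Jf i < L}. pr (h i) a) \<le> \<theta> J0 ^ 2 * C"
  proof (rule weight_fam_avg[where Jf=Jf and Jm="L - 1" and r=r, OF _ _ _ _ _ a(1)])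
    show "fam r {i\<in>I. Jf i < L} h st" using fam(1) by (rule fam_subset) auto
    show "\<theta> (Jf i) \<le> \<theta> J0 ^ 2" if "i \<in> {i\<in>I. Jf i < L}" for i
      using \<theta>_cube[OF J0(1), of "Jf i"] kw that \<theta>_cube_le(1)[of J0] by fastforce
  qed (use kw fam(2) a(3) in auto)
  also have "(\<Sum>i\<in>{i\<in>I. L < Jf i}. pr (h i) a) \<le> C * \<theta> L ^ 2"
  proof (rule heavy_fam[OF a(2) _ _ fam(2), where Jf=Jf])
    show "fam r {i\<in>I. L < Jf i} h st" using fam(1) by (rule fam_subset) auto
  qed (use kw in auto)
  also have "C * \<theta> L ^ 2 \<le> C * \<theta> J0 ^ 2"
    using \<theta>_mono[of J0 L] \<theta>_pos[of L] J0(2) C0 by (intro mult_left_mono power_mono) auto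
  finally show ?thesis by (simp add: mult.commute)
qed

lemma kw_odd_cases:
  assumes "kw (2 * j + 1) g"
  shows "\<exists>s c. schreier_sigma_special n N1 N2 \<sigma> j s \<and>
    (\<forall>i<length s. kw (2 * snd (s ! i)) (c i) \<and> supp (c i) \<subseteq> fst (s ! i)) \<and>
    g = (\<lambda>k. \<theta> (2 * j + 1) * (\<Sum>i<length s. c i k))"
  using assms
proof (cases rule: kw.cases)
  case (kw_even d g' j' E)
  then show ?thesis by presburger
next
  case (kw_odd j' s c)
  then have "j' = j" by simp
  then show ?thesis using kw_odd by blast
qed

end

text \<open>A pair P a b E F stands for a = sq u, b = sq v, where u is a vector of the block subspace,
  v is the part of S u on a set E of coordinates disjoint from the support of u, and F contains
  E and the support of u.\<close>

locale wh_pairs = wh_parameters +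
  fixes P :: "(nat \<Rightarrow> real) \<Rightarrow> (nat \<Rightarrow> real) \<Rightarrow> nat set \<Rightarrow> nat set \<Rightarrow> bool" and C \<delta> K :: real
  assumes P_nonneg: "P a b E F \<Longrightarrow> 0 \<le> a k \<and> 0 \<le> b k"
    and P_sets: "P a b E F \<Longrightarrow> finite F \<and> F \<subseteq> {1..} \<and> E \<subseteq> F \<and> supp a \<subseteq> F - E \<and> supp b \<subseteq> E"
    and P_scale: "0 \<le> c \<Longrightarrow> P a b E F \<Longrightarrow> P (\<lambda>k. c * a k) (\<lambda>k. c * b k) E F"
    and P_add: "P a b E F \<Longrightarrow> P a' b' E' F' \<Longrightarrow> F \<inter> F' = {} \<Longrightarrow>
      P (\<lambda>k. a k + a' k) (\<lambda>k. b k + b' k) (E \<union> E') (F \<union> F')"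
    and P_bound: "P a b E F \<Longrightarrow> (\<And>g. kf g \<Longrightarrow> pr g a \<le> c) \<Longrightarrow> kf g \<Longrightarrow> pr g b \<le> K * c"
    and \<delta>_pos: "0 < \<delta>"
    and P_exists: "\<exists>a b E F. P a b E F \<and> F \<subseteq> {N..} \<and> avg (n J + 1) C a \<and> (\<exists>g. kf g \<and> \<delta> \<le> pr g b)"
begin

lemma P_sum:
  assumes "rapid q p" "\<And>k. P (a k) (b k) (E k) (F k)" "\<And>k. F k \<subseteq> {q k..p k}" "\<And>k. 0 \<le> c k" "0 < M"
  shows "P (\<lambda>x. \<Sum>k=0..<M. c k * a k x) (\<lambda>x. \<Sum>k=0..<M. c k * b k x) (\<Union>k\<in>{0..<M}. E k) (\<Union>k\<in>{0..<M}. F k)"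
  using assms(5)
proof (induction M)
  case (Suc M)
  have one: "P (\<lambda>x. c M * a M x) (\<lambda>x. c M * b M x) (E M) (F M)" using assms(2,4) by (intro P_scale)
  show ?case
  proof (cases "M = 0")
    case False
    have "F M \<inter> F k = {}" if "k < M" for k
      using rapid_disjoint[OF assms(1) _ assms(3) assms(3), of M k] that by simp
    then have "(\<Union>k\<in>{0..<M}. F k) \<inter> F M = {}" by fastforce
    then have "P (\<lambda>x. (\<Sum>k=0..<M. c k * a k x) + c M * a M x) (\<lambda>x. (\<Sum>k=0..<M. c k * b k x) + c M * b M x)
      ((\<Union>k\<in>{0..<M}. E k) \<union> E M) ((\<Union>k\<in>{0..<M}. F k) \<union> F M)"
      using Suc.IH False by (intro P_add one) auto
    then show ?thesis by (simp add: atLeast0_lessThan_Suc Un_commute add.commute)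
  qed (use one in simp)
qed simp

lemma C_nonneg: "0 \<le> C"
  using P_exists[of 0 0] avg_nonneg by blast

text \<open>A basic average over a rapidly increasing sequence of pairs, divided by
  \<open>\<theta> L\<close>. A functional of index \<open>L\<close> still gives
  \<open>\<delta>\<close> on the second vector, while families of heavier functionals gain
  \<open>\<theta> L ^ 2\<close> on the first. The error terms \<open>\<theta> L ^ 2 * C\<close>,
  \<open>\<theta> L * C\<close> and \<open>2 * \<rho>\<close> are together at most
  \<open>(2 * C + 2) * \<theta> L\<close>, whence the constant.\<close>

lemma level_one:
  assumes L: "3 \<le> L" "even L"
  shows "\<exists>a b E F. P a b E F \<and> F \<subseteq> {N..} \<and> avg (2 * n (L - 1) + 1) (2 * C + 2) a \<and>
    heavy (n (L - 1) + 1) L ((2 * C + 2) * \<theta> L ^ 2) a \<and> (\<exists>g. kw L g \<and> supp g \<subseteq> E \<and> \<delta> \<le> pr g b)"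
proof -
  have \<theta>p: "0 < \<theta> L" by (rule \<theta>_pos)
  \<comment> \<open>The cube, because division by \<open>\<theta> L\<close> must leave an error of
    order \<open>\<theta> L ^ 2\<close> in the \<open>heavy\<close> estimate.\<close>
  define \<rho> where "\<rho> = \<theta> L ^ 3"
  have \<rho>0: "0 < \<rho>" using \<theta>p by (simp add: \<rho>_def)
  define Q where "Q N J a b E F g J' \<longleftrightarrow> P a b E F \<and> F \<subseteq> {N..} \<and> avg (n J + 1) C a \<and> kf g \<and> \<delta> \<le> pr g b \<and>
      J < J' \<and> \<theta> J' * (\<Sum>x\<in>supp a. a x) \<le> \<rho>" for N J a b E F g and J' :: nat
  have "\<exists>a b E F g J'. Q N J a b E F g J'" for N J
  proof -
    obtain a b E F g where P: "P a b E F" "F \<subseteq> {N..}" "avg (n J + 1) C a" "kf g" "\<delta> \<le> pr g b"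
      using P_exists by blast
    have "(\<lambda>j. \<theta> j * (\<Sum>x\<in>supp a. a x)) \<longlonglongrightarrow> 0" using tendsto_mult_left_zero[OF \<theta>_tendsto] .
    then have "eventually (\<lambda>j. \<theta> j * (\<Sum>x\<in>supp a. a x) < \<rho>) sequentially"
      using \<rho>0 by (rule order_tendstoD(2))
    then obtain J1 where "\<And>j. J1 \<le> j \<Longrightarrow> \<theta> j * (\<Sum>x\<in>supp a. a x) < \<rho>"
      unfolding eventually_sequentially by blast
    from this[of "max J1 (Suc J)"]
    have "Q N J a b E F g (max J1 (Suc J))" using P unfolding Q_def by simp
    then show ?thesis by blast
  qed
  then obtain fa fb fE fF fg fJ where Q: "\<And>N J. Q N J (fa N J) (fb N J) (fE N J) (fF N J) (fg N J) (fJ N J)"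
    by metis
  \<comment> \<open>\<open>basic_average\<close> at \<open>R\<close> gives a set in
    \<open>schreier (Suc R)\<close>, here \<open>schreier (n L)\<close>, and smallness along
    families of complexity \<open>R\<close>, one less.\<close>
  define R where "R = n L - 1"
  have nL: "Suc R = n L" using n_ge1[of L] by (simp add: R_def)
  define N1 where "N1 = max N (max 1 (nat \<lceil>2 * real (n L) * 4 ^ R * C / \<rho>\<rceil>))"
  have N1: "N \<le> N1" "1 \<le> N1" by (auto simp: N1_def)
  define p1 where "p1 z = Max (insert (fst z) (fF (fst z) (snd z)))" for z
  \<comment> \<open>Position and weight index are chosen together: the next start lies beyond the
    square of the last coordinate of the current pair, and the next index makes the
    \<open>l_1\<close> norm of the current vector negligible.\<close>
  define z where "z = rec_nat (N1, 0) (\<lambda>_ z. ((p1 z)\<^sup>2 + 1, fJ (fst z) (snd z)))"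
  have z0: "z 0 = (N1, 0)" and zS: "z (Suc k) = ((p1 (z k))\<^sup>2 + 1, fJ (fst (z k)) (snd (z k)))" for k
    by (simp_all add: z_def)
  define q where "q k = fst (z k)" for k
  define p where "p k = p1 (z k)" for k
  define Jk where "Jk k = snd (z k)" for k
  define a where "a k = fa (q k) (Jk k)" for k
  define b where "b k = fb (q k) (Jk k)" for k
  define E where "E k = fE (q k) (Jk k)" for k
  define F where "F k = fF (q k) (Jk k)" for k
  define g where "g k = fg (q k) (Jk k)" for k
  have Qk: "Q (q k) (Jk k) (a k) (b k) (E k) (F k) (g k) (Jk (Suc k))" for k
    using Q[of "q k" "Jk k"] zS[of k] by (simp add: a_def b_def E_def F_def g_def Jk_def q_def)
  have Pk: "P (a k) (b k) (E k) (F k)" for k using Qk by (simp add: Q_def)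
  have finF: "finite (F k)" for k using P_sets[OF Pk] by blast
  have qp: "q k \<le> p k" "F k \<subseteq> {..p k}" for k
    using Max_ge[of "insert (q k) (F k)"] finF[of k] unfolding p_def p1_def F_def q_def Jk_def by auto
  have Fqp: "F k \<subseteq> {q k..p k}" for k using Qk[of k] qp[of k] by (auto simp: Q_def)
  have qS: "q (Suc k) = (p k)\<^sup>2 + 1" and q0: "q 0 = N1" for k by (simp_all add: q_def p_def zS z0)
  have "1 \<le> q k" for k using N1 q0 qS by (cases k) auto
  then have rap: "rapid q p" using qp qS by (auto simp: rapid_def)
  have Jmono: "strict_mono Jk" using Qk by (auto simp: strict_mono_Suc_iff Q_def)
  have qN: "N \<le> q k" for k using rapid_mono(1)[OF rap, of 0 k] q0 N1 by simp
  have a0: "0 \<le> a k x" for k x using P_nonneg[OF Pk] by blast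
  have asup: "supp (a k) \<subseteq> {q k..p k}" for k using P_sets[OF Pk] Fqp by blast
  have bsup: "supp (b k) \<subseteq> {q k..p k}" for k using P_sets[OF Pk] Fqp by blast
  obtain M \<beta> where M: "0 < M" and \<beta>0: "\<And>k. (0::real) \<le> \<beta> k" and \<beta>1: "(\<Sum>k=0..<M. \<beta> k) = 1"
    and qSch: "q ` {0..<M} \<in> schreier (Suc R)"
    and small: "\<And>G. G \<subseteq> {0..<M} \<Longrightarrow> Msm R G p \<Longrightarrow> (\<Sum>k\<in>G. \<beta> k) \<le> (real R + 1) / q 0"
    using basic_average[OF rap, of 0 R] by metis
  have eps: "2 * ((real R + 1) / q 0) * (4 ^ R * C) \<le> \<rho>"
  proof -
    have "2 * real (n L) * 4 ^ R * C / \<rho> \<le> real (nat \<lceil>2 * real (n L) * 4 ^ R * C / \<rho>\<rceil>)" by (rule real_nat_ceiling_ge)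
    also have "\<dots> \<le> q 0" unfolding q0 N1_def of_nat_le_iff by (meson max.cobounded2 order_trans)
    finally have "2 * real (n L) * 4 ^ R * C \<le> \<rho> * q 0" using \<rho>0 by (simp add: divide_simps mult.commute)
    moreover have "real R + 1 = real (n L)" using nL by linarith
    ultimately show ?thesis using N1 q0 by (simp add: divide_simps mult_ac)
  qed
  define \<alpha> where "\<alpha> = (\<lambda>x. \<Sum>k=0..<M. \<beta> k * a k x)"
  \<comment> \<open>Pairs serve as indices since a local fact has one fixed index type: grafted
    trees have such indices anyway, and the plain families of \<open>heavy\<close> are coded with
    second component 0.\<close>
  have ris: "(\<Sum>i\<in>I. \<tau> i * pr (h i) \<alpha>) \<le> t * C + \<theta> L' * C + 2 * \<rho>"
    if "fam r I h st" "r \<le> R" "\<And>i. i \<in> I \<Longrightarrow> kf (h i)" "\<And>i. i \<in> I \<Longrightarrow> 0 \<le> \<tau> i \<and> \<tau> i \<le> 1"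
      "\<And>i. i \<in> I \<Longrightarrow> \<tau> i \<le> t \<or> (\<exists>k. h i = unit_vec k) \<or> (\<exists>J\<ge>L'. kw J (h i))" "0 \<le> t"
    for I :: "(nat \<times> nat) set" and h st \<tau> t L' r
  proof -
    have "(\<Sum>i\<in>I. \<tau> i * pr (h i) \<alpha>) \<le> (t * C + \<theta> L' * C + \<rho>) + 2 * ((real R + 1) / q 0) * (4 ^ R * C)"
      unfolding \<alpha>_def
    proof (rule ris_estimate[OF rap Jmono asup a0])
      show "avg (n (Jk k) + 1) C (a k)" for k using Qk by (simp add: Q_def)
      show "\<theta> (Jk (Suc k)) * (\<Sum>x\<in>supp (a k). a k x) \<le> \<rho>" for k using Qk by (simp add: Q_def)
      show "fam R I h st" using fam_mono that(1,2) by blast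
    qed (use that \<beta>0 \<beta>1 small \<rho>0 in auto)
    then show ?thesis using eps by linarith
  qed
  have \<theta>le: "\<theta> L ^ 3 \<le> \<theta> L" using \<theta>_cube_le[of L] by linarith
  obtain N' where N': "(1/4) ^ N' \<le> \<theta> L ^ 2" "(N' + 2) * (n (L - 1) + 1) < n L"
    using truncation_depth[OF L(1)] by blast
  have avg\<alpha>: "(\<Sum>i\<in>I. pr (h i) \<alpha>) \<le> (2 * C + 2) * \<theta> L"
    if I: "fam (2 * n (L - 1) + 1) I h st" "\<forall>i\<in>I. kf (h i)" for I :: "nat set" and h st
  proof -
    define T where "T i J \<tau> h' st' \<longleftrightarrow> fam (N' * n (L - 1)) J h' st' \<and>
      (\<forall>l\<in>J. kf (h' l) \<and> 0 \<le> \<tau> l \<and> \<tau> l \<le> 1 \<and> supp (h' l) \<subseteq> supp (h i) \<and>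
        (\<tau> l \<le> (1/4) ^ N' \<or> (\<exists>k. h' l = unit_vec k) \<or> (\<exists>J>L - 1. kw J (h' l)))) \<and>
      h i = (\<lambda>k. \<Sum>l\<in>J. \<tau> l * h' l k)" for i and J :: "nat set" and \<tau> h' st'
    have "\<forall>i\<in>I. \<exists>J \<tau> h' st'. T i J \<tau> h' st'" unfolding T_def using truncated_tree I(2) by blast
    then obtain Ji \<tau> h' st' where T: "\<And>i. i \<in> I \<Longrightarrow> T i (Ji i) (\<tau> i) (h' i) (st' i)" by metis
    have fS: "fam (2 * n (L - 1) + 1 + N' * n (L - 1)) (Sigma I Ji) (\<lambda>(i, l). h' i l) (\<lambda>(i, l). max (st i) (st' i l))"
    proof (rule fam_Sigma[OF I(1)])
      show "fam (N' * n (L - 1)) (Ji i) (h' i) (st' i)" if "i \<in> I" for i using T[OF that] unfolding T_def by blast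
      show "supp (h' i l) \<subseteq> supp (h i)" if "i \<in> I" "l \<in> Ji i" for i l
        using T[OF that(1)] that(2) unfolding T_def by blast
    qed
    have "(\<Sum>i\<in>I. pr (h i) \<alpha>) = (\<Sum>i\<in>I. \<Sum>l\<in>Ji i. \<tau> i l * pr (h' i l) \<alpha>)"
    proof (rule sum.cong[OF refl])
      fix i assume "i \<in> I"
      then have "h i = (\<lambda>k. \<Sum>l\<in>Ji i. \<tau> i l * h' i l k)" using T unfolding T_def by blast
      then have "pr (h i) \<alpha> = pr (\<lambda>k. \<Sum>l\<in>Ji i. \<tau> i l * h' i l k) \<alpha>" by (rule arg_cong)
      then show "pr (h i) \<alpha> = (\<Sum>l\<in>Ji i. \<tau> i l * pr (h' i l) \<alpha>)"
        unfolding pr_sum_left pr_scale_left .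
    qed
    also have "\<dots> = (\<Sum>z\<in>Sigma I Ji. (case z of (i, l) \<Rightarrow> \<tau> i l) * pr (case z of (i, l) \<Rightarrow> h' i l) \<alpha>)"
    proof (subst sum.Sigma)
      show "\<forall>i\<in>I. finite (Ji i)" using T fam_finite unfolding T_def by blast
    qed (use fam_finite[OF I(1)] in \<open>auto intro!: sum.cong\<close>)
    also have "\<dots> \<le> \<theta> L ^ 2 * C + \<theta> L * C + 2 * \<rho>"
    proof (rule ris[OF fS])
      \<comment> \<open>Here the two spare levels are used: \<open>2 * n (L - 1) + 1\<close> for the
        given family and \<open>N' * n (L - 1)\<close> for the trees together stay below
        \<open>n L\<close>.\<close>
      have "(N' + 2) * (n (L - 1) + 1) = 2 * n (L - 1) + 1 + N' * n (L - 1) + N' + 1" by (simp add: algebra_simps)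
      then show "2 * n (L - 1) + 1 + N' * n (L - 1) \<le> R" using N'(2) by (simp add: R_def)
      fix z assume "z \<in> Sigma I Ji"
      then obtain i l where z: "z = (i, l)" "i \<in> I" "l \<in> Ji i" by blast
      then have t: "kf (h' i l)" "0 \<le> \<tau> i l" "\<tau> i l \<le> 1"
        "\<tau> i l \<le> (1/4) ^ N' \<or> (\<exists>k. h' i l = unit_vec k) \<or> (\<exists>J>L - 1. kw J (h' i l))"
        using T[OF z(2)] unfolding T_def by blast+
      show "kf (case z of (i, l) \<Rightarrow> h' i l)" "0 \<le> (case z of (i, l) \<Rightarrow> \<tau> i l) \<and> (case z of (i, l) \<Rightarrow> \<tau> i l) \<le> 1"
        using t z by auto
      show "(case z of (i, l) \<Rightarrow> \<tau> i l) \<le> \<theta> L ^ 2 \<or> (\<exists>k. (case z of (i, l) \<Rightarrow> h' i l) = unit_vec k) \<or>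
          (\<exists>J\<ge>L. kw J (case z of (i, l) \<Rightarrow> h' i l))"
      proof -
        have "L \<le> J" if "L - 1 < J" for J using that by linarith
        then show ?thesis using t(4) N'(1) unfolding z(1) prod.case by (meson order_trans)
      qed
    qed (use \<theta>p in auto)
    also have "\<dots> \<le> \<theta> L * C + \<theta> L * C + 2 * \<theta> L"
      using mult_right_mono[OF \<theta>_cube_le(2)[of L] C_nonneg] \<theta>le unfolding \<rho>_def by linarith
    finally show ?thesis by (simp add: algebra_simps)
  qed
  have heavy\<alpha>: "(\<Sum>i\<in>I. pr (h i) \<alpha>) \<le> (2 * C + 2) * \<theta> L ^ 3"
    if I: "fam (n (L - 1) + 1) I h st" "\<forall>i\<in>I. L < Jf i \<and> kw (Jf i) (h i)" for I :: "nat set" and h st Jf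
  proof -
    let ?e = "\<lambda>i. (i, 0 :: nat)"
    have fe: "fam (n (L - 1) + 1) (?e ` I) (h \<circ> fst) (st \<circ> fst)"
      by (rule fam_reindex[OF I(1)]) (auto simp: inj_on_def)
    have "(\<Sum>i\<in>I. pr (h i) \<alpha>) = (\<Sum>z\<in>?e ` I. 1 * pr ((h \<circ> fst) z) \<alpha>)"
      by (subst sum.reindex) (auto simp: inj_on_def)
    also have "\<dots> \<le> 0 * C + \<theta> (Suc L) * C + 2 * \<rho>"
    proof (rule ris[OF fe])
      have "n (L - 1) + 1 \<le> (N' + 2) * (n (L - 1) + 1)" by simp
      then show "n (L - 1) + 1 \<le> R" using N'(2) unfolding R_def by linarith
      fix z assume "z \<in> ?e ` I"
      then obtain i where i: "i \<in> I" "z = (i, 0)" by blast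
      have "Suc L \<le> Jf i" "kw (Jf i) (h i)" using I(2) i by auto
      then show "kf ((h \<circ> fst) z)" "(1::real) \<le> 0 \<or> (\<exists>k. (h \<circ> fst) z = unit_vec k) \<or> (\<exists>J\<ge>Suc L. kw J ((h \<circ> fst) z))"
        unfolding i(2) o_def fst_conv using kf_kw by blast+
    qed auto
    also have "\<dots> \<le> \<theta> L ^ 3 * C + 2 * \<theta> L ^ 3"
      using mult_right_mono[OF \<theta>_cube[of L "Suc L"] C_nonneg] L(1) by (simp add: \<rho>_def)
    also have "\<dots> \<le> (2 * C + 2) * \<theta> L ^ 3" using \<theta>p C_nonneg by (simp add: algebra_simps)
    finally show ?thesis .
  qed
  define c where "c k = \<beta> k / \<theta> L" for k
  define U where "U = (\<lambda>x. \<Sum>k=0..<M. c k * a k x)"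
  define W where "W = (\<lambda>x. \<Sum>k=0..<M. c k * b k x)"
  have U: "U = (\<lambda>x. 1 / \<theta> L * \<alpha> x)" by (simp add: U_def \<alpha>_def c_def sum_divide_distrib)
  have "P U W (\<Union>k\<in>{0..<M}. E k) (\<Union>k\<in>{0..<M}. F k)"
    unfolding U_def W_def using \<beta>0 \<theta>p M by (intro P_sum[OF rap Pk Fqp]) (simp add: c_def)
  moreover have "F k \<subseteq> {N..}" for k using Fqp[of k] qN[of k] by auto
  then have "(\<Union>k\<in>{0..<M}. F k) \<subseteq> {N..}" by blast
  moreover have "avg (2 * n (L - 1) + 1) (2 * C + 2) U"
    unfolding avg_def
  proof (intro allI impI)
    fix I :: "nat set" and h st assume "fam (2 * n (L - 1) + 1) I h st \<and> (\<forall>i\<in>I. kf (h i))"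
    then have "1 / \<theta> L * (\<Sum>i\<in>I. pr (h i) \<alpha>) \<le> 1 / \<theta> L * ((2 * C + 2) * \<theta> L)"
      using \<theta>p by (intro mult_left_mono avg\<alpha>) auto
    then show "(\<Sum>i\<in>I. pr (h i) U) \<le> 2 * C + 2" using \<theta>p unfolding U pr_scale_right sum_distrib_left[symmetric] by simp
  qed
  moreover have "heavy (n (L - 1) + 1) L ((2 * C + 2) * \<theta> L ^ 2) U"
    unfolding heavy_def
  proof (intro allI impI)
    fix I :: "nat set" and h st Jf assume "fam (n (L - 1) + 1) I h st \<and> (\<forall>i\<in>I. L < Jf i \<and> kw (Jf i) (h i))"
    then have "1 / \<theta> L * (\<Sum>i\<in>I. pr (h i) \<alpha>) \<le> 1 / \<theta> L * ((2 * C + 2) * \<theta> L ^ 3)"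
      using \<theta>p by (intro mult_left_mono heavy\<alpha>[where Jf=Jf]) auto
    also have "\<dots> = (2 * C + 2) * \<theta> L ^ 2" using \<theta>p by (simp add: power2_eq_square power3_eq_cube)
    finally show "(\<Sum>i\<in>I. pr (h i) U) \<le> (2 * C + 2) * \<theta> L ^ 2"
      unfolding U pr_scale_right sum_distrib_left[symmetric] .
  qed
  moreover have "\<exists>G. kw L G \<and> supp G \<subseteq> (\<Union>k\<in>{0..<M}. E k) \<and> \<delta> \<le> pr G W"
  proof -
    define G where "G = (\<lambda>x. \<theta> L * (\<Sum>k\<in>{0..<M}. rst (E k) (g k) x))"
    have gsup: "supp (rst (E k) (g k)) \<subseteq> {q k..p k}" for k
      using P_sets[OF Pk[of k]] Fqp[of k] by (auto simp: supp_rst)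
    obtain j where j: "L = 2 * j" using L(2) by (elim evenE)
    have "kw L G"
      unfolding G_def j
    proof (rule kw_even_start[where st=q])
      show "kf (rst (E k) (g k))" for k using Qk[of k] by (auto simp: Q_def intro: kf_rst)
      show "disjoint_family_on (\<lambda>k. supp (rst (E k) (g k))) {0..<M}"
        unfolding disjoint_family_on_def using rapid_disjoint[OF rap _ gsup gsup] by blast
      show "q ` {0..<M} \<in> schreier (n (2 * j))" using qSch nL j by simp
      show "supp (rst (E k) (g k)) \<subseteq> {q k..}" for k using gsup[of k] by auto
    qed (use rapid_inj[OF rap] in auto)
    moreover have "supp G \<subseteq> (\<Union>k\<in>{0..<M}. E k)"
      unfolding G_def by (intro subset_trans[OF supp_scale_sum_subset]) (auto simp: supp_rst)
    moreover have "\<delta> \<le> pr G W"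
    proof -
      have "pr (rst (E k) (g k)) W = c k * pr (g k) (b k)" if k: "k \<in> {0..<M}" for k
      proof -
        have "pr (rst (E k) (g k)) W = c k * pr (rst (E k) (g k)) (b k)"
          unfolding W_def by (rule pr_rapid_sum[OF rap bsup k gsup])
        also have "pr (rst (E k) (g k)) (b k) = pr (g k) (b k)"
          using P_sets[OF Pk[of k]] by (intro pr_cong) (auto simp: rst_def)
        finally show ?thesis .
      qed
      then have "pr G W = (\<Sum>k=0..<M. \<beta> k * pr (g k) (b k))"
        using \<theta>p unfolding G_def pr_scale_left pr_sum_left by (simp add: c_def sum_distrib_left)
      also have "\<dots> \<ge> (\<Sum>k=0..<M. \<beta> k * \<delta>)"
        using Qk \<beta>0 by (intro sum_mono mult_left_mono) (auto simp: Q_def)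
      also have "(\<Sum>k=0..<M. \<beta> k * \<delta>) = \<delta>" unfolding sum_distrib_right[symmetric] \<beta>1 by simp
      finally show ?thesis .
    qed
    ultimately show ?thesis by blast
  qed
  ultimately show ?thesis by blast
qed

lemma Sigma_seqs_map:
  assumes "0 < k" "\<And>i. i < k \<Longrightarrow> finite (E i) \<and> E i \<noteq> {} \<and> E i \<subseteq> {1..}" "disjoint_family_on E {..<k}"
    "\<And>i l. i < l \<Longrightarrow> l < k \<Longrightarrow> jj i < jj l" "jj 0 \<in> N1" "\<And>i. 0 < i \<Longrightarrow> i < k \<Longrightarrow> jj i \<in> N2"
  shows "map (\<lambda>i. (E i, jj i)) [0..<k] \<in> Sigma_seqs N1 N2"
  using assms unfolding Sigma_seqs_def
  by (auto simp: disjoint_family_on_def sorted_wrt_map sorted_wrt_iff_nth_less)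

lemma Sigma_seqs_take:
  assumes "s \<in> Sigma_seqs N1 N2" "0 < k" "k \<le> length s"
  shows "take k s \<in> Sigma_seqs N1 N2"
  using assms unfolding Sigma_seqs_def disjoint_family_on_def
  by (auto simp: take_map[symmetric] sorted_wrt_take)

text \<open>A special functional agrees with the special sequence s built below up to some index; its
  children before that index live on the sets E i, where the vectors a k vanish. After that index
  its weights differ from all weights of s, by injectivity of sigma. So it is bad for one index only.\<close>

lemma special_bound:
  assumes j: "1 \<le> j"
  shows "\<delta> \<le> K * ((5 * (2 * C + 2) + 1) * \<theta> (2 * j + 1))"
proof -
  define J0 where "J0 = 2 * j + 1"
  define C1 where "C1 = 2 * C + 2"
  have C1: "2 \<le> C1" using C_nonneg by (simp add: C1_def)
  have \<theta>p: "0 < \<theta> J0" by (rule \<theta>_pos)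
  \<comment> \<open>Beyond \<open>j + 1\<close>, because a special sequence for
    \<open>2 * j + 1\<close> must start with an index satisfying
    \<open>2 * j0 > 2 * j + 2\<close>.\<close>
  obtain j0 where j0: "j0 \<in> N1" "j + 1 < j0"
    using N_infinite(1) infinite_nat_iff_unbounded by blast
  define Q where "Q N j' a b E F g \<longleftrightarrow> P a b E F \<and> F \<subseteq> {N..} \<and> avg (2 * n (2 * j' - 1) + 1) C1 a \<and>
    heavy (n (2 * j' - 1) + 1) (2 * j') (C1 * \<theta> (2 * j') ^ 2) a \<and> kw (2 * j') g \<and> supp g \<subseteq> E \<and> \<delta> \<le> pr g b"
    for N j' a b E F g
  \<comment> \<open>Vacuous for small \<open>j'\<close>, so that the choice functions are total. All
    indices that occur turn out to be at least \<open>j0\<close>.\<close>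
  define Q' where "Q' N j' a b E F g \<longleftrightarrow> (2 \<le> j' \<longrightarrow> Q N j' a b E F g)" for N j' a b E F g
  have "\<exists>a b E F g. Q' N j' a b E F g" for N j'
  proof (cases "2 \<le> j'")
    case True
    then have "3 \<le> 2 * j'" "even (2 * j')" by auto
    from level_one[OF this, of N] show ?thesis unfolding Q'_def Q_def C1_def by blast
  qed (simp add: Q'_def)
  then obtain fa fb fE fF fg where "\<And>N j'. Q' N j' (fa N j') (fb N j') (fE N j') (fF N j') (fg N j')"
    by metis
  then have Q: "\<And>N j'. 2 \<le> j' \<Longrightarrow> Q N j' (fa N j') (fb N j') (fE N j') (fF N j') (fg N j')"
    unfolding Q'_def by blast
  define R where "R = n J0 - 1"
  have nJ0: "Suc R = n J0" using n_ge1[of J0] by (simp add: R_def)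
  define N' where "N' = max 1 (nat \<lceil>2 * real (n J0) * 4 ^ R * C1 / \<theta> J0 ^ 2\<rceil>)"
  have N': "1 \<le> N'" by (simp add: N'_def)
  \<comment> \<open>The next index is forced to be the value of \<open>\<sigma>\<close> on the
    sequence built so far. So the vectors, their sets and the special sequence have to come from one
    recursion.\<close>
  define jn where "jn s = (if s = [] then j0 else \<sigma> s)" for s :: "(nat set \<times> nat) list"
  \<comment> \<open>The recursion is set up before the indices are known to be at least 2. Until
    then \<open>fF\<close> may return any set, hence the guard on finiteness.\<close>
  define p1 where "p1 z = Max (insert (fst z) (if finite (fF (fst z) (jn (snd z))) then fF (fst z) (jn (snd z)) else {}))" for z
  define z where "z = rec_nat (N', []) (\<lambda>_ z. ((p1 z)\<^sup>2 + 1, snd z @ [(fE (fst z) (jn (snd z)), jn (snd z))]))"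
  have z0: "z 0 = (N', [])"
    and zS: "z (Suc k) = ((p1 (z k))\<^sup>2 + 1, snd (z k) @ [(fE (fst (z k)) (jn (snd (z k))), jn (snd (z k)))])" for k
    by (simp_all add: z_def)
  define q where "q k = fst (z k)" for k
  define p where "p k = p1 (z k)" for k
  define s where "s k = snd (z k)" for k
  define jj where "jj k = jn (s k)" for k
  define a where "a k = fa (q k) (jj k)" for k
  define b where "b k = fb (q k) (jj k)" for k
  define E where "E k = fE (q k) (jj k)" for k
  define F where "F k = fF (q k) (jj k)" for k
  define g where "g k = fg (q k) (jj k)" for k
  have Qk: "Q (q k) (jj k) (a k) (b k) (E k) (F k) (g k)" if "2 \<le> jj k" for k
    using Q[OF that, of "q k"] by (simp add: a_def b_def E_def F_def g_def)
  have p: "p k = Max (insert (q k) (if finite (F k) then F k else {}))" for k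
    unfolding p_def p1_def F_def q_def s_def[symmetric] jj_def by simp
  have qp: "q k \<le> p k" for k unfolding p by (rule Max_ge) auto
  have Fp: "F k \<subseteq> {..p k}" if "finite (F k)" for k unfolding p using that Max_ge by auto
  have qS: "q (Suc k) = (p k)\<^sup>2 + 1" and q0: "q 0 = N'" for k by (simp_all add: q_def p_def zS z0)
  have "1 \<le> q k" for k using N' q0 qS by (cases k) auto
  then have rap: "rapid q p" using qp qS by (auto simp: rapid_def)
  have s0: "s 0 = []" and sS: "s (Suc k) = s k @ [(E k, jj k)]" for k
    by (simp_all add: s_def z0 zS E_def jj_def q_def)
  have smap: "s k = map (\<lambda>i. (E i, jj i)) [0..<k]" for k by (induction k) (auto simp: s0 sS)
  have Fqp: "F k \<subseteq> {q k..p k}" if "2 \<le> jj k" for k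
    using Qk[OF that] P_sets[of "a k" "b k" "E k" "F k"] Fp[of k] by (auto simp: Q_def)
  have EF: "finite (E k) \<and> E k \<noteq> {} \<and> E k \<subseteq> {1..} \<and> E k \<subseteq> {q k..p k}" if "2 \<le> jj k" for k
  proof -
    have P: "P (a k) (b k) (E k) (F k)" and g: "supp (g k) \<subseteq> E k" "\<delta> \<le> pr (g k) (b k)"
      using Qk[OF that] by (auto simp: Q_def)
    have "E k \<noteq> {}"
    proof
      assume "E k = {}"
      then have "pr (g k) (b k) = 0" using g(1) by (intro pr_disjoint) auto
      then show False using g(2) \<delta>_pos by simp
    qed
    then show ?thesis using P_sets[OF P] Fqp[OF that] finite_subset by blast
  qed
  have j02: "2 \<le> j0" using j0 j by linarith
  \<comment> \<open>One induction, since the facts feed each other: indices of at least 2 produce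
    genuine pairs, these make the sequence an admissible argument of \<open>\<sigma>\<close>, and
    \<open>\<sigma>_growth_last\<close> then makes the next index larger.\<close>
  have inv: "(\<forall>i\<le>k. j0 \<le> jj i \<and> (0 < i \<longrightarrow> jj i \<in> N2) \<and> (\<forall>l<i. jj l < jj i)) \<and> s (Suc k) \<in> Sigma_seqs N1 N2" for k
  proof (induction k)
    case 0
    have "jj 0 = j0" by (simp add: jj_def jn_def s0)
    then show ?case using EF[of 0] j02 j0 Sigma_seqs_map[of 1 E jj] smap[of 1] by (simp add: disjoint_family_on_def)
  next
    case (Suc k)
    let ?s = "s (Suc k)"
    have ne: "?s \<noteq> []" by (simp add: sS)
    have jS: "jj (Suc k) = \<sigma> ?s" using ne by (simp add: jj_def jn_def)
    have N2: "jj (Suc k) \<in> N2" using Suc.IH \<sigma>_range jS by auto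
    have lastE: "last ?s = (E k, jj k)" by (simp add: sS)
    have "Max (E k) \<in> E k" using EF[of k] Suc.IH j02 by (intro Max_in) (auto intro: le_trans)
    then have "1 \<le> Max (E k)" using EF[of k] Suc.IH j02 by (meson atLeast_iff le_trans order_refl subsetD)
    then have "m (2 * jj k) * 1 \<le> m (2 * jj k) * (Max (E k))\<^sup>2" by (intro mult_left_mono) auto
    also have "\<dots> < m (2 * jj (Suc k))" using \<sigma>_growth_last[of ?s] Suc.IH lastE jS by simp
    finally have lt: "jj k < jj (Suc k)" using m_mono[of "2 * jj (Suc k)" "2 * jj k"] by fastforce
    have all: "j0 \<le> jj i \<and> (0 < i \<longrightarrow> jj i \<in> N2) \<and> (\<forall>l<i. jj l < jj i)" if "i \<le> Suc k" for i
    proof (cases "i = Suc k")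
      case True
      have "jj l < jj (Suc k)" if "l < Suc k" for l
        using Suc.IH lt that by (cases "l = k") (auto intro: less_trans simp: less_Suc_eq)
      moreover have "j0 \<le> jj (Suc k)" using Suc.IH lt by (meson le_trans less_imp_le order_refl)
      ultimately show ?thesis using True N2 by simp
    next
      case False
      then show ?thesis using Suc.IH that by simp
    qed
    have "s (Suc (Suc k)) \<in> Sigma_seqs N1 N2"
      unfolding smap[of "Suc (Suc k)"]
    proof (rule Sigma_seqs_map)
      have two: "2 \<le> jj i" if "i < Suc (Suc k)" for i using all[of i] that j02 by linarith
      show "finite (E i) \<and> E i \<noteq> {} \<and> E i \<subseteq> {1..}" if "i < Suc (Suc k)" for i using EF[OF two[OF that]] by blast
      show "disjoint_family_on E {..<Suc (Suc k)}"
        unfolding disjoint_family_on_def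
      proof (intro ballI impI)
        fix i l assume "i \<in> {..<Suc (Suc k)}" "l \<in> {..<Suc (Suc k)}" "i \<noteq> l"
        then show "E i \<inter> E l = {}" using rapid_disjoint[OF rap, of i l] EF[OF two] by simp
      qed
      show "jj 0 \<in> N1" using j0 by (simp add: jj_def jn_def s0)
    qed (use all in auto)
    then show ?case using all by blast
  qed
  have jj0: "j0 \<le> jj k" and jjN2: "0 < k \<Longrightarrow> jj k \<in> N2" and jjlt: "l < k \<Longrightarrow> jj l < jj k" for k l
    using inv[of k] by auto
  have jjN1: "jj 0 \<in> N1" using j0 by (simp add: jj_def jn_def s0)
  have jj2: "2 \<le> jj k" for k using jj0[of k] j02 by linarith
  have sSig: "s k \<in> Sigma_seqs N1 N2" if "0 < k" for k using inv[of "k - 1"] that by simp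
  have jj\<sigma>: "jj k = \<sigma> (s k)" if "0 < k" for k using that smap[of k] by (simp add: jj_def jn_def)
  note Qk = Qk[OF jj2] and Fqp = Fqp[OF jj2] and EF = EF[OF jj2]
  have Pk: "P (a k) (b k) (E k) (F k)" for k using Qk by (simp add: Q_def)
  have J0L: "J0 + 1 < 2 * jj l" for l using jj0[of l] j0 by (simp add: J0_def)
  \<comment> \<open>Equal weights force equal pasts: an index in \<open>N1\<close> can only stand
    first, and an index in \<open>N2\<close> is the value of \<open>\<sigma>\<close> on its past,
    which injectivity recovers. The entry itself may still carry another set, so only its
    predecessors are known to agree.\<close>
  have agree: "c = l \<and> take l s' = s l"
    if s': "schreier_sigma_special n N1 N2 \<sigma> j s'" "c < length s'" "snd (s' ! c) = jj l" for s' c l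
  proof -
    have S': "s' \<in> Sigma_seqs N1 N2" and sp: "\<And>i. 1 \<le> i \<Longrightarrow> i < length s' \<Longrightarrow> \<sigma> (take i s') = snd (s' ! i)"
      using s'(1) by (auto simp: schreier_sigma_special_def sigma_special_def)
    show ?thesis
    proof (cases "c = 0")
      case True
      then have "jj l \<in> N1" using S' s'(2,3) by (auto simp: Sigma_seqs_def)
      then have "l = 0" using jjN2[of l] N_disjoint by (cases "l = 0") auto
      then show ?thesis using True by (simp add: s0)
    next
      case False
      then have "jj l \<in> N2" using S' s'(2,3) by (auto simp: Sigma_seqs_def)
      then have l: "0 < l" using jjN1 N_disjoint by (cases "l = 0") auto
      have "\<sigma> (take c s') = \<sigma> (s l)" using sp[of c] False s'(2,3) jj\<sigma>[OF l] by simp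
      moreover have "take c s' \<in> Sigma_seqs N1 N2" using False s'(2) by (intro Sigma_seqs_take[OF S']) auto
      ultimately have eq: "take c s' = s l" using \<sigma>_inj sSig[OF l] by (auto dest: inj_onD)
      then have "length (take c s') = length (s l)" by (simp only: eq)
      then have "c = l" using s'(2) by (simp add: smap)
      then show ?thesis using eq by simp
    qed
  qed
  have a0: "0 \<le> a k x" for k x using P_nonneg[OF Pk] by blast
  have asup: "supp (a k) \<subseteq> {q k..p k}" for k using P_sets[OF Pk] Fqp by blast
  have bsup: "supp (b k) \<subseteq> {q k..p k}" for k using P_sets[OF Pk] Fqp by blast
  have aavg: "avg (2 * n (2 * jj k - 1) + 1) C1 (a k)" for k using Qk by (simp add: Q_def)
  have ahvy: "heavy (n (2 * jj k - 1) + 1) (2 * jj k) (C1 * \<theta> (2 * jj k) ^ 2) (a k)" for k using Qk by (simp add: Q_def)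
  obtain M \<beta> where M: "0 < M" and \<beta>0: "\<And>k. (0::real) \<le> \<beta> k" and \<beta>1: "(\<Sum>k=0..<M. \<beta> k) = 1"
    and qSch: "q ` {0..<M} \<in> schreier (Suc R)"
    and small: "\<And>G. G \<subseteq> {0..<M} \<Longrightarrow> Msm R G p \<Longrightarrow> (\<Sum>k\<in>G. \<beta> k) \<le> (real R + 1) / q 0"
    using basic_average[OF rap, of 0 R] by metis
  have eps: "2 * ((real R + 1) / q 0) * (4 ^ R * C1) \<le> \<theta> J0 ^ 2"
  proof -
    have "2 * real (n J0) * 4 ^ R * C1 / \<theta> J0 ^ 2 \<le> real (nat \<lceil>2 * real (n J0) * 4 ^ R * C1 / \<theta> J0 ^ 2\<rceil>)"
      by (rule real_nat_ceiling_ge)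
    also have "\<dots> \<le> q 0" unfolding q0 N'_def of_nat_le_iff by simp
    finally have "2 * real (n J0) * 4 ^ R * C1 \<le> \<theta> J0 ^ 2 * q 0" using \<theta>p by (simp add: divide_simps mult.commute)
    moreover have "real R + 1 = real (n J0)" using nJ0 by linarith
    ultimately show ?thesis using N' q0 by (simp add: divide_simps mult_ac)
  qed
  define X where "X = (\<lambda>x. \<Sum>k=0..<M. \<beta> k * a k x)"
  define Y where "Y = (\<lambda>x. \<Sum>k=0..<M. \<beta> k * b k x)"
  have PXY: "P X Y (\<Union>k\<in>{0..<M}. E k) (\<Union>k\<in>{0..<M}. F k)"
    unfolding X_def Y_def by (rule P_sum[OF rap Pk Fqp \<beta>0 M])
  obtain D where D: "(1/4) ^ D \<le> \<theta> J0 ^ 2" "(D + 2) * (n (J0 - 1) + 1) < n J0"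
    using truncation_depth[of J0] j by (auto simp: J0_def)
  \<comment> \<open>In the constant, \<open>C1\<close> comes from leaves with small coefficient,
    \<open>2 * C1\<close> from weights other than \<open>J0\<close>, \<open>2 * C1\<close> from
    special functionals of index \<open>J0\<close>, and 1 from the exceptional indices.\<close>
  have upper: "pr G X \<le> (5 * C1 + 1) * \<theta> J0 ^ 2" if G: "kf G" for G
  proof -
    obtain I :: "nat set" and \<tau> h st where tree: "fam (D * n (J0 - 1)) I h st \<and>
        (\<forall>i\<in>I. kf (h i) \<and> 0 \<le> \<tau> i \<and> \<tau> i \<le> 1 \<and> supp (h i) \<subseteq> supp G \<and>
          (\<tau> i \<le> (1/4) ^ D \<or> (\<exists>k. h i = unit_vec k) \<or> (\<exists>J>J0 - 1. kw J (h i)))) \<and>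
        G = (\<lambda>k. \<Sum>i\<in>I. \<tau> i * h i k)"
      using truncated_tree[OF G, of D "J0 - 1"] by (elim exE)
    have famI: "fam (D * n (J0 - 1)) I h st"
      and kh: "\<And>i. i \<in> I \<Longrightarrow> kf (h i)" and \<tau>: "\<And>i. i \<in> I \<Longrightarrow> 0 \<le> \<tau> i \<and> \<tau> i \<le> 1"
      and ty: "\<And>i. i \<in> I \<Longrightarrow> \<tau> i \<le> (1/4) ^ D \<or> (\<exists>k. h i = unit_vec k) \<or> (\<exists>J>J0 - 1. kw J (h i))"
      and Geq: "G = (\<lambda>k. \<Sum>i\<in>I. \<tau> i * h i k)"
      using tree by blast+
    have "D * n (J0 - 1) \<le> R"
    proof -
      have "D * n (J0 - 1) \<le> (D + 2) * (n (J0 - 1) + 1)" by (intro mult_mono) auto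
      then show ?thesis using D(2) unfolding R_def by linarith
    qed
    then have famI: "fam R I h st" by (rule fam_mono[OF famI])
    define W where "W i \<longleftrightarrow> (\<exists>J\<ge>J0. kw J (h i))" for i
    define Jf where "Jf i = (SOME J. J0 \<le> J \<and> kw J (h i))" for i
    have Jf: "J0 \<le> Jf i" "kw (Jf i) (h i)" if "W i" for i
      using someI_ex[of "\<lambda>J. J0 \<le> J \<and> kw J (h i)"] that unfolding W_def Jf_def by auto
    define V where "V i \<longleftrightarrow> W i \<and> Jf i = J0" for i
    define Z where "Z i s' c \<longleftrightarrow> schreier_sigma_special n N1 N2 \<sigma> j s' \<and>
        (\<forall>l<length s'. kw (2 * snd (s' ! l)) (c l) \<and> supp (c l) \<subseteq> fst (s' ! l)) \<and>
        h i = (\<lambda>k. \<theta> J0 * (\<Sum>l<length s'. c l k))" for i s' c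
    have "\<exists>s' c. V i \<longrightarrow> Z i s' c" for i
    proof (cases "V i")
      case True
      then have "kw (2 * j + 1) (h i)" using Jf(2)[of i] by (simp add: V_def J0_def)
      from kw_odd_cases[OF this] show ?thesis unfolding Z_def J0_def by blast
    qed simp
    then obtain ss cc where Z: "\<And>i. V i \<Longrightarrow> Z i (ss i) (cc i)" by metis
    have sp: "\<And>i. V i \<Longrightarrow> schreier_sigma_special n N1 N2 \<sigma> j (ss i)"
      and ck: "\<And>i l. V i \<Longrightarrow> l < length (ss i) \<Longrightarrow> kw (2 * snd (ss i ! l)) (cc i l)"
      and cs: "\<And>i l. V i \<Longrightarrow> l < length (ss i) \<Longrightarrow> supp (cc i l) \<subseteq> fst (ss i ! l)"
      and hV: "\<And>i. V i \<Longrightarrow> h i = (\<lambda>k. \<theta> J0 * (\<Sum>l<length (ss i). cc i l k))"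
      using Z unfolding Z_def by blast+
    \<comment> \<open>Bad for \<open>l\<close> is the weight that norms the \<open>l\<close>-th
      partner, and a special functional that uses the index \<open>jj l\<close> with a set other
      than \<open>E l\<close>. The latter occurs only where the functional departs from the
      constructed sequence, hence once.\<close>
    define bad where "bad i l \<longleftrightarrow> (W i \<and> Jf i \<noteq> J0 \<and> Jf i = 2 * jj l) \<or>
      (V i \<and> l < length (ss i) \<and> snd (ss i ! l) = jj l \<and> fst (ss i ! l) \<noteq> E l)" for i l
    have badlt: False if b: "bad i k" "bad i l" "k < l" for i k l
    proof (cases "V i")
      case True
      then have kl: "k < length (ss i)" "l < length (ss i)" "snd (ss i ! l) = jj l" "fst (ss i ! k) \<noteq> E k"
        using b unfolding bad_def V_def by auto
      have "take l (ss i) = s l" using agree[OF sp[OF True] kl(2,3)] by simp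
      then have "ss i ! k = s l ! k" using b(3) by (metis nth_take)
      also have "\<dots> = (E k, jj k)" using b(3) by (simp add: smap)
      finally show False using kl(4) by simp
    next
      case False
      then have "jj k = jj l" using b unfolding bad_def by auto
      then show False using jjlt[OF b(3)] by simp
    qed
    have "(\<Sum>i\<in>I. \<tau> i * pr (h i) (\<lambda>x. \<Sum>k=0..<M. \<beta> k * a k x)) \<le>
        5 * C1 * \<theta> J0 ^ 2 + 2 * ((real R + 1) / q 0) * (4 ^ R * C1)"
    proof (rule core_average[OF rap famI, where bad=bad])
      show "k = l" if "bad i k" "bad i l" for i k l using badlt that by (metis linorder_neqE_nat)
      show "(\<Sum>i\<in>I. pr (h i) (a k)) \<le> 4 ^ R * C1" for k
        using avg_kf[OF aavg] kh by (intro fam_bound[OF famI]) auto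
      show "0 \<le> 5 * C1 * \<theta> J0 ^ 2" using C1 by simp
    next
      fix l J
      assume "l \<in> {0..<M}" and JI: "J \<subseteq> I" and famJ: "fam 1 J (\<lambda>i. rst {q l..} (h i)) (\<lambda>_. q l)"
        and JJ: "\<And>i. i \<in> J \<Longrightarrow> \<not> bad i l \<and> supp (h i) \<inter> {..<q l} \<noteq> {}"
      let ?g = "\<lambda>i. rst {q l..} (h i)"
      let ?f = "\<lambda>i. \<tau> i * pr (?g i) (a l)"
      let ?L = "2 * jj l"
      have J0l: "2 \<le> J0" "J0 < ?L" using J0L[of l] j by (auto simp: J0_def)
      have finJ: "finite J" using fam_finite[OF famJ] .
      have kg: "kf (?g i)" if "i \<in> J" for i using kh JI that by (intro kf_rst) auto
      have \<tau>J: "0 \<le> \<tau> i" "\<tau> i \<le> 1" if "i \<in> J" for i using \<tau> JI that by auto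
      have g0: "0 \<le> pr (?g i) (a l)" if "i \<in> J" for i using kf_nonneg[OF kg[OF that]] a0 by (rule pr_nonneg)
      define P1 where "P1 i \<longleftrightarrow> \<tau> i \<le> (1/4) ^ D \<or> (\<exists>k. h i = unit_vec k)" for i
      define P2 where "P2 i \<longleftrightarrow> W i \<and> Jf i \<noteq> J0" for i
      have "sum ?f J \<le> sum ?f {i\<in>J. P1 i} + sum ?f {i\<in>J. P2 i} + sum ?f {i\<in>J. V i}"
      proof (rule sum_cover3[OF finJ])
        show "P1 i \<or> P2 i \<or> V i" if "i \<in> J" for i
        proof -
          have "J0 \<le> J'" if "J0 - 1 < J'" for J' using that by linarith
          then show ?thesis using ty[of i] JI that unfolding P1_def P2_def V_def W_def by blast
        qed
      qed (use \<tau>J g0 in auto)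
      also have "sum ?f {i\<in>J. P1 i} \<le> \<theta> J0 ^ 2 * C1"
      proof -
        have "?f i \<le> \<theta> J0 ^ 2 * pr (?g i) (a l)" if i: "i \<in> J" "P1 i" for i
        proof (cases "\<tau> i \<le> (1/4) ^ D")
          case True
          then show ?thesis using g0[OF i(1)] D(1) by (intro mult_right_mono) auto
        next
          case False
          then obtain x where x: "h i = unit_vec x" using i by (auto simp: P1_def)
          then have "x < q l" using JJ[OF i(1)] by simp
          then have "pr (?g i) (a l) = 0" using x by (intro pr_disjoint) (auto simp: supp_rst)
          then show ?thesis by simp
        qed
        then have "sum ?f {i\<in>J. P1 i} \<le> \<theta> J0 ^ 2 * (\<Sum>i\<in>{i\<in>J. P1 i}. pr (?g i) (a l))"
          unfolding sum_distrib_left by (intro sum_mono) auto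
        also have "\<dots> \<le> \<theta> J0 ^ 2 * C1"
        proof (rule mult_left_mono[OF avg_fam[OF aavg[of l]]])
          show "fam 1 {i\<in>J. P1 i} ?g (\<lambda>_. q l)" using famJ by (rule fam_subset) auto
        qed (use kg in auto)
        finally show ?thesis .
      qed
      also have "sum ?f {i\<in>J. P2 i} \<le> 2 * C1 * \<theta> J0 ^ 2"
      proof -
        have "sum ?f {i\<in>J. P2 i} \<le> (\<Sum>i\<in>{i\<in>J. P2 i}. pr (?g i) (a l))"
          using \<tau>J g0 by (intro sum_mono mult_left_le_one_le) auto
        also have "\<dots> \<le> 2 * C1 * \<theta> J0 ^ 2"
        proof (rule mixed_weights[OF aavg ahvy a0 J0l, where r=1 and Jf=Jf])
          show "fam 1 {i\<in>J. P2 i} ?g (\<lambda>_. q l)" using famJ by (rule fam_subset) auto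
          show "J0 < Jf i \<and> Jf i \<noteq> ?L \<and> kw (Jf i) (?g i)" if "i \<in> {i\<in>J. P2 i}" for i
            using that Jf[of i] JJ[of i] by (auto simp: P2_def bad_def intro: kw_rst)
        qed simp
        finally show ?thesis .
      qed
      also have "sum ?f {i\<in>J. V i} \<le> 2 * C1 * \<theta> J0 ^ 2"
      proof -
        let ?c = "\<lambda>i k. rst {q l..} (cc i k)"
        let ?S = "Sigma {i\<in>J. V i} (\<lambda>i. {..<length (ss i)})"
        \<comment> \<open>Children of index \<open>jj l\<close> can be left out: since the
          functional is not bad for \<open>l\<close>, they live on \<open>E l\<close>, where
          \<open>a l\<close> vanishes. The other children avoid the index \<open>2 * jj l\<close>,
          as \<open>mixed_weights\<close> demands.\<close>
        let ?S' = "{z\<in>?S. snd (ss (fst z) ! snd z) \<noteq> jj l}"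
        have fS: "fam (1 + n J0) ?S (\<lambda>(i, k). ?c i k) (\<lambda>(i, k). max (q l) (Min (fst (ss i ! k))))"
        proof (rule fam_Sigma)
          show "fam 1 {i\<in>J. V i} ?g (\<lambda>_. q l)" using famJ by (rule fam_subset) auto
          fix i assume "i \<in> {i\<in>J. V i}"
          then have i: "V i" by simp
          show "fam (n J0) {..<length (ss i)} (?c i) (\<lambda>k. Min (fst (ss i ! k)))"
            unfolding J0_def using cs[OF i] by (intro allowable_fam[OF special_entries[OF sp[OF i]]]) (auto simp: supp_rst)
          fix k assume "k \<in> {..<length (ss i)}"
          then have "supp (cc i k) \<subseteq> supp (h i)"
            unfolding hV[OF i] using kf_nonneg[OF kf_kw[OF ck[OF i]]] by (intro supp_child) auto
          then show "supp (?c i k) \<subseteq> supp (?g i)" by (auto simp: supp_rst)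
        qed
        have "sum ?f {i\<in>J. V i} \<le> (\<Sum>i\<in>{i\<in>J. V i}. pr (?g i) (a l))"
          using \<tau>J g0 by (intro sum_mono mult_left_le_one_le) auto
        also have "\<dots> = (\<Sum>i\<in>{i\<in>J. V i}. \<theta> J0 * (\<Sum>k<length (ss i). pr (?c i k) (a l)))"
        proof (rule sum.cong[OF refl])
          fix i assume "i \<in> {i\<in>J. V i}"
          then have i: "V i" by simp
          have "?g i = (\<lambda>x. \<theta> J0 * (\<Sum>k<length (ss i). ?c i k x))"
            unfolding hV[OF i] rst_scale_sum ..
          then show "pr (?g i) (a l) = \<theta> J0 * (\<Sum>k<length (ss i). pr (?c i k) (a l))"
            by (simp add: pr_scale_left pr_sum_left)
        qed
        also have "\<dots> = \<theta> J0 * (\<Sum>z\<in>?S. pr (case z of (i, k) \<Rightarrow> ?c i k) (a l))"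
          using finJ by (simp add: sum_distrib_left[symmetric] sum.Sigma case_prod_unfold)
        also have "(\<Sum>z\<in>?S. pr (case z of (i, k) \<Rightarrow> ?c i k) (a l)) = (\<Sum>z\<in>?S'. pr (case z of (i, k) \<Rightarrow> ?c i k) (a l))"
        proof (rule sum.mono_neutral_right)
          show "finite ?S" using fam_finite[OF fS] .
          show "\<forall>z\<in>?S - ?S'. pr (case z of (i, k) \<Rightarrow> ?c i k) (a l) = 0"
          proof
            fix z assume "z \<in> ?S - ?S'"
            then obtain i k where z: "z = (i, k)" "i \<in> J" "V i" "k < length (ss i)" "snd (ss i ! k) = jj l" by auto
            have "k = l" using agree[OF sp[OF z(3)] z(4,5)] by simp
            then have "fst (ss i ! k) = E l" using JJ[OF z(2)] z unfolding bad_def by auto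
            then have "supp (cc i k) \<subseteq> E l" using cs[OF z(3,4)] by simp
            then have "pr (?c i k) (a l) = 0"
              using P_sets[OF Pk[of l]] by (intro pr_disjoint) (auto simp: supp_rst)
            then show "pr (case z of (i, k) \<Rightarrow> ?c i k) (a l) = 0" using z by simp
          qed
        qed auto
        \<comment> \<open>The factor \<open>\<theta> J0\<close> is given away, because
          \<open>mixed_weights\<close> already provides the square.\<close>
        also have "\<theta> J0 * (\<Sum>z\<in>?S'. pr (case z of (i, k) \<Rightarrow> ?c i k) (a l)) \<le> 1 * (2 * C1 * \<theta> J0 ^ 2)"
        proof (rule mult_mono)
          show "(\<Sum>z\<in>?S'. pr (case z of (i, k) \<Rightarrow> ?c i k) (a l)) \<le> 2 * C1 * \<theta> J0 ^ 2"
          proof (rule mixed_weights[OF aavg ahvy a0 J0l, where r="1 + n J0" and Jf="\<lambda>z. 2 * snd (ss (fst z) ! snd z)"])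
            show "fam (1 + n J0) ?S' (\<lambda>z. case z of (i, k) \<Rightarrow> ?c i k) (\<lambda>(i, k). max (q l) (Min (fst (ss i ! k))))"
              using fS by (rule fam_subset) auto
            show "1 + n J0 \<le> n (?L - 1) + 1" using n_mono[of J0 "?L - 1"] J0l by simp
            fix z assume "z \<in> ?S'"
            then obtain i k where z: "z = (i, k)" "V i" "k < length (ss i)" "snd (ss i ! k) \<noteq> jj l" by auto
            have "snd (ss i ! 0) \<le> snd (ss i ! k)"
            proof (cases "k = 0")
              case False
              have "sorted_wrt (<) (map snd (ss i))"
                using sp[OF z(2)] by (auto simp: schreier_sigma_special_def sigma_special_def Sigma_seqs_def)
              then show ?thesis using False z(3) by (auto simp: sorted_wrt_iff_nth_less intro: less_imp_le)
            qed simp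
            moreover have "2 * j + 2 < 2 * snd (ss i ! 0)" using sp[OF z(2)] by (simp add: schreier_sigma_special_def)
            ultimately show "J0 < 2 * snd (ss (fst z) ! snd z) \<and> 2 * snd (ss (fst z) ! snd z) \<noteq> ?L \<and>
                kw (2 * snd (ss (fst z) ! snd z)) (case z of (i, k) \<Rightarrow> ?c i k)"
              using z ck[OF z(2,3)] by (auto simp: J0_def intro: kw_rst)
          qed
          show "0 \<le> (\<Sum>z\<in>?S'. pr (case z of (i, k) \<Rightarrow> ?c i k) (a l))"
          proof (rule sum_nonneg)
            fix z assume "z \<in> ?S'"
            then obtain i k where z: "z = (i, k)" "V i" "k < length (ss i)" by auto
            then have "kf (?c i k)" using kf_kw[OF ck] by (intro kf_rst) auto
            then show "0 \<le> pr (case z of (i, k) \<Rightarrow> ?c i k) (a l)" using kf_nonneg a0 z by (auto intro: pr_nonneg)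
          qed
        qed (use \<theta>_le[of J0] in auto)
        finally show ?thesis by simp
      qed
      finally show "(\<Sum>i\<in>J. \<tau> i * pr (?g i) (a l)) \<le> 5 * C1 * \<theta> J0 ^ 2" by (simp add: algebra_simps)
    qed (use kf_nonneg kh \<tau> asup a0 \<beta>0 \<beta>1 small in auto)
    then have "(\<Sum>i\<in>I. \<tau> i * pr (h i) X) \<le> (5 * C1 + 1) * \<theta> J0 ^ 2"
      using eps unfolding X_def by (simp add: algebra_simps)
    then show ?thesis unfolding Geq pr_sum_left pr_scale_left .
  qed
  define ls where "ls = s M"
  \<comment> \<open>This functional tests the second vectors: its children \<open>g i\<close> live
    on \<open>E i\<close> and have exactly the weights that \<open>\<sigma>\<close> prescribes. It
    loses only one factor \<open>\<theta> J0\<close>, against the two that \<open>upper\<close>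
    gains.\<close>
  define H where "H = (\<lambda>x. \<theta> J0 * (\<Sum>i<length ls. g i x))"
  have lls: "length ls = M" and lsn: "\<And>i. i < M \<Longrightarrow> ls ! i = (E i, jj i)" by (auto simp: ls_def smap)
  have "kw J0 H"
    unfolding H_def J0_def
  proof (rule kw_odd)
    show "schreier_sigma_special n N1 N2 \<sigma> j ls"
      unfolding schreier_sigma_special_def sigma_special_def
    proof (intro conjI allI impI)
      show "ls \<in> Sigma_seqs N1 N2" unfolding ls_def by (rule sSig[OF M])
      show "2 * j + 2 < 2 * snd (ls ! 0)" using lsn[OF M] jj0[of 0] j0 by simp
      fix i assume i: "1 \<le> i \<and> i < length ls"
      have "take i ls = s i" using i lls unfolding ls_def smap by (simp add: take_map min_def)
      then show "\<sigma> (take i ls) = snd (ls ! i)" using i lls lsn jj\<sigma>[of i] by simp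
    next
      define mn where "mn i = Min (E i)" for i
      have mn: "mn i \<in> E i" for i unfolding mn_def using EF[of i] by (intro Min_in) auto
      have inj: "inj_on mn {0..<M}"
        using rapid_disjoint[OF rap, of _ _ "E _" "E _"] EF mn by (intro inj_onI) (metis disjoint_iff)
      have eq: "(\<lambda>i. Min (fst (ls ! i))) ` {..<length ls} = mn ` {0..<M}"
        using lls lsn by (auto simp: mn_def image_def)
      have "mn ` {0..<M} \<in> schreier (n J0)"
      proof (rule schreier_spread[OF qSch[unfolded nJ0], of _ "q \<circ> inv_into {0..<M} mn"])
        have iv: "inv_into {0..<M} mn (mn i) = i" if "i \<in> {0..<M}" for i by (rule inv_into_f_f[OF inj that])
        show "mn ` {0..<M} \<subseteq> {1..}" using mn EF by blast
        show "(q \<circ> inv_into {0..<M} mn) ` mn ` {0..<M} \<subseteq> q ` {0..<M}" using iv by auto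
        show "inj_on (q \<circ> inv_into {0..<M} mn) (mn ` {0..<M})"
          using rapid_inj[OF rap] iv by (auto simp: inj_on_def)
        show "(q \<circ> inv_into {0..<M} mn) b \<le> b" if "b \<in> mn ` {0..<M}" for b
          using that iv mn EF by fastforce
      qed simp
      then show "(\<lambda>i. Min (fst (ls ! i))) ` {..<length ls} \<in> schreier (n (2 * j + 1))"
        unfolding eq J0_def .
    qed
    show "\<forall>i<length ls. kw (2 * snd (ls ! i)) (g i)" using Qk lls lsn by (auto simp: Q_def)
    show "\<forall>i<length ls. supp (g i) \<subseteq> fst (ls ! i)" using Qk lls lsn by (auto simp: Q_def)
  qed
  then have "kf H" by (rule kf_kw)
  then have "pr H Y \<le> K * ((5 * C1 + 1) * \<theta> J0 ^ 2)"
    using P_bound[OF PXY, of "(5 * C1 + 1) * \<theta> J0 ^ 2" H] upper by blast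
  moreover have "\<theta> J0 * \<delta> \<le> pr H Y"
  proof -
    have "pr (g k) Y = \<beta> k * pr (g k) (b k)" if k: "k \<in> {0..<M}" for k
      unfolding Y_def using Qk[of k] EF[of k] by (intro pr_rapid_sum[OF rap bsup k]) (auto simp: Q_def)
    then have "pr H Y = \<theta> J0 * (\<Sum>k=0..<M. \<beta> k * pr (g k) (b k))"
      unfolding H_def pr_scale_left pr_sum_left lls by (simp add: lessThan_atLeast0)
    also have "\<dots> \<ge> \<theta> J0 * (\<Sum>k=0..<M. \<beta> k * \<delta>)"
      using Qk \<beta>0 \<theta>p by (intro mult_left_mono sum_mono) (auto simp: Q_def)
    also have "(\<Sum>k=0..<M. \<beta> k * \<delta>) = \<delta>" unfolding sum_distrib_right[symmetric] \<beta>1 by simp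
    finally show ?thesis .
  qed
  ultimately have "\<theta> J0 * \<delta> \<le> \<theta> J0 * (K * ((5 * C1 + 1) * \<theta> J0))"
    by (simp add: power2_eq_square algebra_simps)
  then show ?thesis using \<theta>p by (simp add: C1_def J0_def)
qed

text \<open>\<open>\<theta> (2 * j + 1)\<close> tends to 0, while \<open>\<delta>\<close>,
  \<open>C\<close> and \<open>K\<close> do not depend on \<open>j\<close>. So the assumptions of the
  locale are contradictory, and any interpretation of it is a proof by contradiction.\<close>

theorem no_pairs: False
proof -
  have "(\<lambda>j. K * ((5 * (2 * C + 2) + 1) * \<theta> (2 * j + 1))) \<longlonglongrightarrow> K * ((5 * (2 * C + 2) + 1) * 0)"
  proof (intro tendsto_mult tendsto_const)
    have "filterlim (\<lambda>j::nat. 2 * j + 1) at_top sequentially" by (intro filterlim_subseq) (auto simp: strict_mono_def)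
    then show "(\<lambda>j. \<theta> (2 * j + 1)) \<longlonglongrightarrow> 0" by (rule filterlim_compose[OF \<theta>_tendsto])
  qed
  then have "\<delta> \<le> K * ((5 * (2 * C + 2) + 1) * 0)"
    by (rule LIMSEQ_le_const) (use special_bound in blast)
  then show False using \<delta>_pos by simp
qed

end

section \<open>Multipliers on the completion\<close>

lemma dense_extension:
  fixes g :: "'a::real_normed_vector \<Rightarrow> 'b::banach"
  assumes V: "subspace V" "closure V = UNIV"
    and add: "\<And>u v. u \<in> V \<Longrightarrow> v \<in> V \<Longrightarrow> g (u + v) = g u + g v"
    and scale: "\<And>c v. v \<in> V \<Longrightarrow> g (c *\<^sub>R v) = c *\<^sub>R g v"
    and bound: "\<And>v. v \<in> V \<Longrightarrow> norm (g v) \<le> B * norm v"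
  shows "\<exists>f. bounded_linear f \<and> (\<forall>v\<in>V. f v = g v) \<and> (\<forall>z. norm (f z) \<le> B * norm z)"
proof -
  have diff: "g u - g v = g (u - v)" if "u \<in> V" "v \<in> V" for u v
    using add[of u "- v"] scale[of v "-1"] that V(1) by (simp add: subspace_neg)
  have B0: "norm (g u - g v) \<le> \<bar>B\<bar> * norm (u - v)" if "u \<in> V" "v \<in> V" for u v
    using bound[of "u - v"] diff[OF that] that V(1) subspace_diff[of V u v]
    by (smt (verit) mult_right_mono norm_ge_zero)
  have "uniformly_continuous_on V g"
    unfolding uniformly_continuous_on_def
  proof (intro allI impI)
    fix \<epsilon> :: real assume \<epsilon>: "0 < \<epsilon>"
    show "\<exists>d>0. \<forall>x\<in>V. \<forall>x'\<in>V. dist x' x < d \<longrightarrow> dist (g x') (g x) < \<epsilon>"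
    proof (intro exI[of _ "\<epsilon> / (\<bar>B\<bar> + 1)"] conjI ballI impI)
      fix x x' assume x: "x \<in> V" "x' \<in> V" "dist x' x < \<epsilon> / (\<bar>B\<bar> + 1)"
      have "dist (g x') (g x) \<le> \<bar>B\<bar> * dist x' x" using B0[OF x(2,1)] by (simp add: dist_norm)
      also have "\<dots> \<le> (\<bar>B\<bar> + 1) * dist x' x" by (intro mult_right_mono) auto
      also have "\<dots> < \<epsilon>" using x(3) by (simp add: pos_less_divide_eq mult.commute)
      finally show "dist (g x') (g x) < \<epsilon>" .
    qed (use \<epsilon> in auto)
  qed
  then obtain f where f: "uniformly_continuous_on (closure V) f" "\<And>v. v \<in> V \<Longrightarrow> g v = f v"
    by (rule uniformly_continuous_on_extension_on_closure) blast
  have cont: "continuous_on UNIV f" using uniformly_continuous_imp_continuous[OF f(1)] V(2) by simp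
  have lim: "(\<lambda>i. f (s i)) \<longlonglongrightarrow> f z" if "s \<longlonglongrightarrow> z" for s z
    using continuous_on_tendsto_compose[OF cont that] by simp
  have seq: "\<exists>s. (\<forall>i. s i \<in> V) \<and> s \<longlonglongrightarrow> z" for z
    using closure_sequential[of z V] V(2) by simp
  have "bounded_linear f"
  proof (rule bounded_linear_intro[where K=B])
    fix z w
    obtain s t where s: "\<And>i. s i \<in> V" "s \<longlonglongrightarrow> z" and t: "\<And>i. t i \<in> V" "t \<longlonglongrightarrow> w" using seq by metis
    have "(\<lambda>i. f (s i + t i)) \<longlonglongrightarrow> f (z + w)" by (intro lim tendsto_add s(2) t(2))
    moreover have "f (s i + t i) = f (s i) + f (t i)" for i
      using add[OF s(1) t(1)] f(2) s(1) t(1) subspace_add[OF V(1) s(1) t(1)] by metis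
    ultimately have "(\<lambda>i. f (s i) + f (t i)) \<longlonglongrightarrow> f (z + w)" by simp
    moreover have "(\<lambda>i. f (s i) + f (t i)) \<longlonglongrightarrow> f z + f w" by (intro tendsto_add lim s(2) t(2))
    ultimately show "f (z + w) = f z + f w" by (rule LIMSEQ_unique)
  next
    fix r z
    obtain s where s: "\<And>i. s i \<in> V" "s \<longlonglongrightarrow> z" using seq by metis
    have "(\<lambda>i. f (r *\<^sub>R s i)) \<longlonglongrightarrow> f (r *\<^sub>R z)" by (intro lim tendsto_scaleR tendsto_const s(2))
    moreover have "f (r *\<^sub>R s i) = r *\<^sub>R f (s i)" for i
      using scale[OF s(1)] f(2) s(1) subspace_scale[OF V(1) s(1)] by metis
    ultimately have "(\<lambda>i. r *\<^sub>R f (s i)) \<longlonglongrightarrow> f (r *\<^sub>R z)" by simp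
    moreover have "(\<lambda>i. r *\<^sub>R f (s i)) \<longlonglongrightarrow> r *\<^sub>R f z" by (intro tendsto_scaleR tendsto_const lim s(2))
    ultimately show "f (r *\<^sub>R z) = r *\<^sub>R f z" by (rule LIMSEQ_unique)
  next
    fix z
    obtain s where s: "\<And>i. s i \<in> V" "s \<longlonglongrightarrow> z" using seq by metis
    have "norm (f (s i)) \<le> norm (s i) * B" for i
      using bound[OF s(1)] f(2)[OF s(1)] by (simp add: mult.commute)
    then show "norm (f z) \<le> norm z * B"
      by (intro LIMSEQ_le[OF tendsto_norm[OF lim[OF s(2)]] tendsto_mult_right[OF tendsto_norm[OF s(2)]]]) blast
  qed
  moreover have "norm (f z) \<le> B * norm z" for z
  proof -
    obtain s where s: "\<And>i. s i \<in> V" "s \<longlonglongrightarrow> z" using seq by metis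
    have "norm (f (s i)) \<le> norm (s i) * B" for i
      using bound[OF s(1)] f(2)[OF s(1)] by (simp add: mult.commute)
    then have "norm (f z) \<le> norm z * B"
      by (intro LIMSEQ_le[OF tendsto_norm[OF lim[OF s(2)]] tendsto_mult_right[OF tendsto_norm[OF s(2)]]]) blast
    then show ?thesis by (simp add: mult.commute)
  qed
  ultimately show ?thesis using f(2) by metis
qed

section \<open>The embedding of the finitely supported sequences into the completion\<close>

lemma c00_embed_eq: "finite A \<Longrightarrow> supp x \<subseteq> A \<Longrightarrow> c00_embed e x = (\<Sum>i\<in>A. x i *\<^sub>R e i)"
  unfolding c00_embed_def by (intro sum.mono_neutral_left) (auto simp: supp_def)

lemma c00D: "x \<in> c00 \<Longrightarrow> finite (supp x)" "x \<in> c00 \<Longrightarrow> supp x \<subseteq> {1..}"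
  by (auto simp: c00_def)

lemma c00_add: "x \<in> c00 \<Longrightarrow> y \<in> c00 \<Longrightarrow> (\<lambda>k. x k + y k) \<in> c00"
proof -
  assume xy: "x \<in> c00" "y \<in> c00"
  have "supp (\<lambda>k. x k + y k) \<subseteq> supp x \<union> supp y" by (auto simp: supp_def)
  moreover have "finite (supp x \<union> supp y)" using xy by (auto simp: c00_def)
  ultimately have "finite (supp (\<lambda>k. x k + y k))" using finite_subset by blast
  then show ?thesis using xy \<open>supp (\<lambda>k. x k + y k) \<subseteq> supp x \<union> supp y\<close> unfolding c00_def by blast
qed

lemma c00_mult: "x \<in> c00 \<Longrightarrow> (\<lambda>k. c k * x k) \<in> c00"
proof -
  assume x: "x \<in> c00"
  have "supp (\<lambda>k. c k * x k) \<subseteq> supp x" by (auto simp: supp_def)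
  then show ?thesis using x finite_subset unfolding c00_def by blast
qed

lemma c00_embed_add:
  assumes "x \<in> c00" "y \<in> c00"
  shows "c00_embed e (\<lambda>k. x k + y k) = c00_embed e x + c00_embed e y"
proof -
  have "supp (\<lambda>k. x k + y k) \<subseteq> supp x \<union> supp y" by (auto simp: supp_def)
  then show ?thesis
    using c00_embed_eq[of "supp x \<union> supp y" _ e] assms
    by (simp add: c00_def scaleR_left_distrib sum.distrib)
qed

lemma c00_embed_scale:
  assumes "x \<in> c00"
  shows "c00_embed e (\<lambda>k. c * x k) = c *\<^sub>R c00_embed e x"
  using c00_embed_eq[of "supp x" "\<lambda>k. c * x k" e] supp_scale_subset[of c x] assms
  by (simp add: c00_def c00_embed_def[of e x] scaleR_sum_right)

lemma subspace_c00_embed: "subspace (c00_embed e ` c00)"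
  unfolding subspace_def
proof (intro conjI ballI allI)
  have "(\<lambda>_. 0) \<in> c00" "c00_embed e (\<lambda>_. 0) = 0" by (auto simp: c00_def c00_embed_def)
  then show "0 \<in> c00_embed e ` c00" by (metis image_eqI)
  fix u assume u: "u \<in> c00_embed e ` c00"
  then obtain x where x: "x \<in> c00" "u = c00_embed e x" by blast
  show "c *\<^sub>R u \<in> c00_embed e ` c00" for c
    using c00_embed_scale[OF x(1), of e c] c00_mult[OF x(1), of "\<lambda>_. c"] x(2) by (metis image_eqI)
  fix v assume "v \<in> c00_embed e ` c00"
  then obtain y where y: "y \<in> c00" "v = c00_embed e y" by blast
  show "u + v \<in> c00_embed e ` c00"
    using c00_embed_add[OF x(1) y(1), of e] c00_add[OF x(1) y(1)] x(2) y(2) by (metis image_eqI)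
qed

locale wh_space = wh_parameters m n N1 N2 \<sigma>
  for m n :: "nat \<Rightarrow> nat" and N1 N2 :: "nat set" and \<sigma> :: "(nat set \<times> nat) list \<Rightarrow> nat" +
  fixes e :: "nat \<Rightarrow> 'a::banach" and y :: "nat \<Rightarrow> nat \<Rightarrow> real"
  assumes completion: "is_completion_of_c00 (wh_norm m n N1 N2 \<sigma>) e"
    and block: "block_sequence y"
    and normalised: "\<And>k. norm (c00_embed e (y k)) = 1"
begin

abbreviation "emb \<equiv> c00_embed e"

definition u :: "nat \<Rightarrow> 'a" where "u k = emb (y k)"
definition Y :: "'a set" where "Y = closure (span (range u))"

lemma norm_emb: "x \<in> c00 \<Longrightarrow> norm (emb x) = nrm x"
  using completion by (auto simp: is_completion_of_c00_def)

lemma nrm_nonneg: "x \<in> c00 \<Longrightarrow> 0 \<le> nrm x"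
  using norm_emb[of x] norm_ge_zero[of "emb x"] by simp

lemma closure_emb: "closure (emb ` c00) = UNIV"
  using completion by (auto simp: is_completion_of_c00_def)

lemma inj_emb: "inj_on emb c00"
proof (rule inj_onI)
  fix x x' assume x: "x \<in> c00" "x' \<in> c00" "emb x = emb x'"
  define z where "z = (\<lambda>k. x k + -1 * x' k)"
  have c: "(\<lambda>k. -1 * x' k) \<in> c00" using c00_mult[OF x(2), of "\<lambda>_. -1"] .
  have zc: "z \<in> c00" unfolding z_def by (rule c00_add[OF x(1) c])
  have "emb z = 0" unfolding z_def c00_embed_add[OF x(1) c] c00_embed_scale[OF x(2)] using x(3) by simp
  then have "nrm z = 0" using norm_emb[OF zc] by simp
  then have "supp z = {}" using nrm_pos[of z] c00D[OF zc] by fastforce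
  then show "x = x'" by (auto simp: supp_def z_def fun_eq_iff)
qed

lemma nrm_mult_le:
  assumes "x \<in> c00" "\<forall>k. \<bar>c k\<bar> \<le> B"
  shows "nrm (\<lambda>k. c k * x k) \<le> B * nrm x"
proof -
  have B: "0 \<le> B" using assms(2) abs_ge_zero[of "c 0"] order_trans by blast
  have fin: "finite (supp (\<lambda>k. B * x k))" using supp_scale_subset c00D(1)[OF assms(1)] by (rule finite_subset)
  have "nrm (\<lambda>k. c k * x k) \<le> nrm (\<lambda>k. B * x k)"
    using B assms(2) by (intro wh_norm_mono[OF fin]) (auto simp: abs_mult intro: mult_right_mono)
  also have "\<dots> \<le> B * nrm x" using nrm_scale_le[OF c00D(1)[OF assms(1)], of B] B by simp
  finally show ?thesis .
qed

text \<open>By unconditionality, multiplication by bounded coefficients is bounded on the dense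
  image of \<open>c00\<close>, hence extends. Going back through the inverse of \<open>emb\<close>
  is possible because the norm is definite.\<close>

lemma multiplier_exists:
  assumes "\<forall>k. \<bar>c k\<bar> \<le> B"
  shows "\<exists>f. bounded_linear f \<and> (\<forall>x\<in>c00. f (emb x) = emb (\<lambda>k. c k * x k)) \<and>
    (\<forall>z. norm (f z) \<le> B * norm z)"
proof -
  define g where "g v = emb (\<lambda>k. c k * inv_into c00 emb v k)" for v
  have g: "g (emb x) = emb (\<lambda>k. c k * x k)" if "x \<in> c00" for x
    using that inv_into_f_f[OF inj_emb that] by (simp add: g_def)
  have "\<exists>f. bounded_linear f \<and> (\<forall>v\<in>emb ` c00. f v = g v) \<and> (\<forall>z. norm (f z) \<le> B * norm z)"
  proof (rule dense_extension[where g=g and B=B and V="emb ` c00", OF subspace_c00_embed closure_emb])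
    fix u v assume "u \<in> emb ` c00" "v \<in> emb ` c00"
    then obtain x x' where x: "x \<in> c00" "u = emb x" "x' \<in> c00" "v = emb x'" by blast
    have cx: "(\<lambda>k. c k * x k) \<in> c00" "(\<lambda>k. c k * x' k) \<in> c00" using x c00_mult by auto
    have "g (u + v) = emb (\<lambda>k. c k * (x k + x' k))"
      unfolding x(2,4) c00_embed_add[OF x(1,3), symmetric] by (rule g[OF c00_add[OF x(1,3)]])
    also have "\<dots> = emb (\<lambda>k. c k * x k + c k * x' k)" by (simp only: distrib_left)
    also have "\<dots> = g u + g v"
      unfolding x(2,4) g[OF x(1)] g[OF x(3)] by (rule c00_embed_add[OF cx])
    finally show "g (u + v) = g u + g v" .
  next
    fix r v assume "v \<in> emb ` c00"
    then obtain x where x: "x \<in> c00" "v = emb x" by blast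
    have cx: "(\<lambda>k. c k * x k) \<in> c00" and rx: "(\<lambda>k. r * x k) \<in> c00" using x c00_mult by auto
    have "g (r *\<^sub>R v) = emb (\<lambda>k. c k * (r * x k))"
      unfolding x(2) c00_embed_scale[OF x(1), symmetric] by (rule g[OF rx])
    also have "\<dots> = emb (\<lambda>k. r * (c k * x k))" by (simp only: mult.left_commute)
    also have "\<dots> = r *\<^sub>R g v" unfolding x(2) g[OF x(1)] by (rule c00_embed_scale[OF cx])
    finally show "g (r *\<^sub>R v) = r *\<^sub>R g v" .
    show "norm (g v) \<le> B * norm v"
      unfolding x(2) g[OF x(1)] norm_emb[OF x(1)] norm_emb[OF cx] by (rule nrm_mult_le[OF x(1) assms])
  qed
  then show ?thesis using g by (metis image_eqI)
qed

section \<open>Blocks, multipliers and block projections\<close>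

definition blk :: "nat set \<Rightarrow> nat set" where "blk A = (\<Union>k\<in>A. supp (y k))"

lemma y_c00: "y k \<in> c00" and y_ne: "supp (y k) \<noteq> {}"
  using block by (auto simp: block_sequence_def)

lemma y_fin: "finite (supp (y k))"
  using c00D(1)[OF y_c00] .

lemma y_less:
  assumes "k < l" "i \<in> supp (y k)" "i' \<in> supp (y l)"
  shows "i < i'"
proof -
  have ran: "Max (vec_ran (y k)) = Max (supp (y k))" "Min (vec_ran (y k)) = Min (supp (y k))" for k
  proof -
    have "Min (supp (y k)) \<le> Max (supp (y k))" using y_ne y_fin by simp
    then show "Max (vec_ran (y k)) = Max (supp (y k))" "Min (vec_ran (y k)) = Min (supp (y k))"
      unfolding vec_ran_def by (auto intro!: Max_eqI Min_eqI)
  qed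
  have step: "Max (supp (y k)) < Min (supp (y (Suc k)))" for k
    using block ran(1)[of k] ran(2)[of "Suc k"] unfolding block_sequence_def by metis
  have "Max (supp (y k)) < Min (supp (y l))"
    using assms(1)
  proof (induction l)
    case (Suc l)
    show ?case
    proof (cases "k = l")
      case False
      then have "Max (supp (y k)) < Min (supp (y l))" using Suc by simp
      also have "\<dots> \<le> Max (supp (y l))" using y_ne y_fin by simp
      also have "\<dots> < Min (supp (y (Suc l)))" by (rule step)
      finally show ?thesis .
    qed (use step in simp)
  qed simp
  then show ?thesis using Max_ge[OF y_fin assms(2)] Min_le[OF y_fin assms(3)] by linarith
qed

lemma y_disjoint: "i \<in> supp (y k) \<Longrightarrow> i \<in> supp (y l) \<Longrightarrow> k = l"
  using y_less[of k l i i] y_less[of l k i i] by (metis less_irrefl linorder_neqE_nat)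

lemma y_ge: "i \<in> supp (y k) \<Longrightarrow> k < i"
proof (induction k arbitrary: i)
  case 0
  then show ?case using c00D(2)[OF y_c00[of 0]] by auto
next
  case (Suc k)
  obtain i' where i': "i' \<in> supp (y k)" using y_ne[of k] by blast
  then have "k < i'" "i' < i" using Suc.IH y_less[of k "Suc k" i' i] Suc.prems by auto
  then show ?case by linarith
qed

lemma blk_disjoint: "A \<inter> B = {} \<longleftrightarrow> blk A \<inter> blk B = {}"
proof
  assume "A \<inter> B = {}"
  then show "blk A \<inter> blk B = {}" unfolding blk_def using y_disjoint by blast
next
  assume b: "blk A \<inter> blk B = {}"
  show "A \<inter> B = {}"
  proof (rule ccontr)
    assume "A \<inter> B \<noteq> {}"
    then obtain k where "k \<in> A" "k \<in> B" by blast
    then have "supp (y k) \<subseteq> blk A \<inter> blk B" by (auto simp: blk_def)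
    then show False using b y_ne by blast
  qed
qed

lemma blk_finite: "finite A \<Longrightarrow> finite (blk A)"
  using y_fin by (simp add: blk_def)

lemma blk_Un: "blk (A \<union> B) = blk A \<union> blk B"
  by (auto simp: blk_def)

text \<open>Constant on every block. Coordinates outside all blocks are sent to 0, which is
  invisible on \<open>Y\<close>.\<close>

definition coef :: "(nat \<Rightarrow> real) \<Rightarrow> nat \<Rightarrow> real" where
  "coef c i = (if i \<in> blk UNIV then c (THE k. i \<in> supp (y k)) else 0)"

lemma coef_eq: "i \<in> supp (y k) \<Longrightarrow> coef c i = c k"
proof -
  assume i: "i \<in> supp (y k)"
  then have "(THE k. i \<in> supp (y k)) = k" using y_disjoint by blast
  then show ?thesis using i by (auto simp: coef_def blk_def)
qed

lemma coef_bound: "\<forall>k. \<bar>c k\<bar> \<le> B \<Longrightarrow> \<forall>i. \<bar>coef c i\<bar> \<le> B"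
  using abs_ge_zero[of "c 0"] order_trans[of 0 "\<bar>c 0\<bar>" B] by (auto simp: coef_def)

text \<open>The bound is demanded for all \<open>B\<close> at once, so that \<open>Mul c\<close>
  does not depend on the bound used for its existence. One extension serves all bounds because
  extensions agree on a dense set.\<close>

definition Mul :: "(nat \<Rightarrow> real) \<Rightarrow> 'a \<Rightarrow> 'a" where
  "Mul c = (SOME f. bounded_linear f \<and> (\<forall>x\<in>c00. f (emb x) = emb (\<lambda>k. coef c k * x k)) \<and>
    (\<forall>B. (\<forall>k. \<bar>c k\<bar> \<le> B) \<longrightarrow> (\<forall>z. norm (f z) \<le> B * norm z)))"

lemma bounded_linear_eq:
  assumes "bounded_linear f" "bounded_linear g" "\<And>x. x \<in> S \<Longrightarrow> f x = g x" "z \<in> closure S"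
  shows "f z = g z"
proof -
  have "closed {z. f z = g z}"
    using assms(1,2) by (intro closed_Collect_eq linear_continuous_on)
  then have "closure S \<subseteq> {z. f z = g z}" using assms(3) by (intro closure_minimal) auto
  then show ?thesis using assms(4) by auto
qed

lemma Mul:
  assumes "\<forall>k. \<bar>c k\<bar> \<le> B0"
  shows "bounded_linear (Mul c)" "x \<in> c00 \<Longrightarrow> Mul c (emb x) = emb (\<lambda>k. coef c k * x k)"
    "\<forall>k. \<bar>c k\<bar> \<le> B \<Longrightarrow> norm (Mul c z) \<le> B * norm z"
proof -
  obtain f where f: "bounded_linear f" "\<forall>x\<in>c00. f (emb x) = emb (\<lambda>k. coef c k * x k)"
    using multiplier_exists[OF coef_bound[OF assms]] by blast
  have "norm (f z) \<le> B * norm z" if B: "\<forall>k. \<bar>c k\<bar> \<le> B" for B z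
  proof -
    obtain f' where f': "bounded_linear f'" "\<forall>x\<in>c00. f' (emb x) = emb (\<lambda>k. coef c k * x k)"
      "\<forall>z. norm (f' z) \<le> B * norm z"
      using multiplier_exists[OF coef_bound[OF B]] by blast
    have "f z = f' z"
    proof (rule bounded_linear_eq[OF f(1) f'(1)])
      show "f v = f' v" if "v \<in> emb ` c00" for v using that f(2) f'(2) by auto
      show "z \<in> closure (emb ` c00)" by (simp add: closure_emb)
    qed
    then show ?thesis using f'(3) by simp
  qed
  then have ex: "\<exists>f. bounded_linear f \<and> (\<forall>x\<in>c00. f (emb x) = emb (\<lambda>k. coef c k * x k)) \<and>
    (\<forall>B. (\<forall>k. \<bar>c k\<bar> \<le> B) \<longrightarrow> (\<forall>z. norm (f z) \<le> B * norm z))" using f by blast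
  have M: "bounded_linear (Mul c) \<and> (\<forall>x\<in>c00. Mul c (emb x) = emb (\<lambda>k. coef c k * x k)) \<and>
    (\<forall>B. (\<forall>k. \<bar>c k\<bar> \<le> B) \<longrightarrow> (\<forall>z. norm (Mul c z) \<le> B * norm z))"
    unfolding Mul_def by (rule someI_ex[OF ex])
  show "bounded_linear (Mul c)" using M by blast
  show "x \<in> c00 \<Longrightarrow> Mul c (emb x) = emb (\<lambda>k. coef c k * x k)" using M by blast
  show "\<forall>k. \<bar>c k\<bar> \<le> B \<Longrightarrow> norm (Mul c z) \<le> B * norm z" using M by blast
qed

lemma Mul_u:
  assumes "\<forall>k. \<bar>c k\<bar> \<le> B"
  shows "Mul c (u k) = c k *\<^sub>R u k"
proof -
  have "(\<lambda>i. coef c i * y k i) = (\<lambda>i. c k * y k i)"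
    using coef_eq[of _ k c] by (auto simp: fun_eq_iff supp_def)
  then show ?thesis
    unfolding u_def using Mul(2)[OF assms y_c00[of k]] c00_embed_scale[OF y_c00[of k], of e "c k"] by simp
qed

definition Q :: "nat set \<Rightarrow> 'a \<Rightarrow> 'a" where "Q A = Mul (\<lambda>k. if k \<in> A then 1 else 0)"

lemma Q_bl: "bounded_linear (Q A)" and Q_norm: "norm (Q A z) \<le> norm z"
  using Mul(1)[of "\<lambda>k. if k \<in> A then 1 else 0" 1] Mul(3)[of "\<lambda>k. if k \<in> A then 1 else 0" 1 1 z]
  by (auto simp: Q_def)

lemma Q_u: "Q A (u k) = (if k \<in> A then u k else 0)"
  using Mul_u[of "\<lambda>k. if k \<in> A then 1 else 0" 1 k] by (simp add: Q_def)

lemma Q_emb: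
  assumes "x \<in> c00"
  shows "Q A (emb x) = emb (rst (blk A) x)"
proof -
  have "coef (\<lambda>k. if k \<in> A then 1 else 0) i = (if i \<in> blk A then 1 else 0)" for i
  proof (cases "i \<in> blk UNIV")
    case True
    then obtain k where k: "i \<in> supp (y k)" by (auto simp: blk_def)
    then have "i \<in> blk A \<longleftrightarrow> k \<in> A" unfolding blk_def using y_disjoint by blast
    then show ?thesis using coef_eq[OF k] by simp
  qed (auto simp: coef_def blk_def)
  then have "(\<lambda>i. coef (\<lambda>k. if k \<in> A then 1 else 0) i * x i) = rst (blk A) x"
    by (auto simp: rst_def)
  then show ?thesis using Mul(2)[of "\<lambda>k. if k \<in> A then 1 else 0" 1, OF _ assms] by (simp add: Q_def)
qed

lemmas Q_add = bounded_linear.linear[OF Q_bl, THEN linear_add]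
  and Q_scale = bounded_linear.linear[OF Q_bl, THEN linear_scale]
  and Q_diff = bounded_linear.linear[OF Q_bl, THEN linear_diff]
  and Q_zero = bounded_linear.linear[OF Q_bl, THEN linear_0]

lemma subspace_Y: "subspace Y"
  unfolding Y_def subspace_def
proof (intro conjI ballI allI)
  show "0 \<in> closure (span (range u))" by (rule subsetD[OF closure_subset span_zero])
  fix z assume "z \<in> closure (span (range u))"
  then obtain s where s: "\<And>i. s i \<in> span (range u)" "s \<longlonglongrightarrow> z" using closure_sequential by blast
  show "c *\<^sub>R z \<in> closure (span (range u))" for c
    unfolding closure_sequential using s
    by (intro exI[of _ "\<lambda>i. c *\<^sub>R s i"]) (auto intro: span_scale tendsto_intros)
  fix w assume "w \<in> closure (span (range u))"
  then obtain t where t: "\<And>i. t i \<in> span (range u)" "t \<longlonglongrightarrow> w" using closure_sequential by blast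
  show "z + w \<in> closure (span (range u))"
    unfolding closure_sequential using s t
    by (intro exI[of _ "\<lambda>i. s i + t i"]) (auto intro: span_add tendsto_intros)
qed

lemma u_Y: "u k \<in> Y"
  unfolding Y_def by (rule subsetD[OF closure_subset span_base]) simp

text \<open>Identities between multipliers and projections on \<open>Y\<close> are reduced in this
  way to their trivial instances on the vectors \<open>u k\<close>.\<close>

lemma Y_eq:
  assumes "bounded_linear f" "bounded_linear g" "\<And>k. f (u k) = g (u k)" "z \<in> Y"
  shows "f z = g z"
proof (rule bounded_linear_eq[OF assms(1,2)])
  show "z \<in> closure (span (range u))" using assms(4) by (simp add: Y_def)
  show "f v = g v" if "v \<in> span (range u)" for v
    by (rule linear_eq_on_span[OF assms(1,2)[THEN bounded_linear.linear] _ that]) (use assms(3) in auto)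
qed

lemma Mul_span:
  assumes "\<forall>k. \<bar>c k\<bar> \<le> B" "v \<in> span (range u)"
  shows "Mul c v \<in> span (range u)"
proof -
  have lin: "linear (Mul c)" using Mul(1)[OF assms(1)] by (rule bounded_linear.linear)
  have "Mul c v \<in> span (Mul c ` range u)" using linear_span_image[OF lin, of "range u"] assms(2) by blast
  also have "span (Mul c ` range u) \<subseteq> span (range u)"
  proof (intro span_minimal subspace_span subsetI)
    fix w assume "w \<in> Mul c ` range u"
    then obtain k where "w = c k *\<^sub>R u k" using Mul_u[OF assms(1)] by auto
    then show "w \<in> span (range u)" by (simp add: span_scale span_base)
  qed
  finally show ?thesis .
qed

lemma Mul_Y:
  assumes "\<forall>k. \<bar>c k\<bar> \<le> B" "z \<in> Y"
  shows "Mul c z \<in> Y"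
proof -
  have "Mul c ` closure (span (range u)) \<subseteq> closure (span (range u))"
  proof (rule image_closure_subset)
    show "continuous_on (closure (span (range u))) (Mul c)"
      by (rule linear_continuous_on[OF Mul(1)[OF assms(1)]])
    show "Mul c ` span (range u) \<subseteq> closure (span (range u))"
    proof (rule image_subsetI)
      fix v assume "v \<in> span (range u)"
      then show "Mul c v \<in> closure (span (range u))" by (rule subsetD[OF closure_subset Mul_span[OF assms(1)]])
    qed
  qed simp
  then show ?thesis using assms(2) by (auto simp: Y_def)
qed

lemma Q_span: "v \<in> span (range u) \<Longrightarrow> Q A v \<in> span (range u)"
  unfolding Q_def by (rule Mul_span[where B=1]) auto

lemma Q_Y: "z \<in> Y \<Longrightarrow> Q A z \<in> Y"
  unfolding Q_def by (rule Mul_Y[where B=1]) auto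

lemma Q_Q: "z \<in> Y \<Longrightarrow> Q A (Q B z) = Q (A \<inter> B) z"
  by (rule Y_eq[OF bounded_linear_compose[OF Q_bl Q_bl] Q_bl]) (auto simp: Q_u Q_zero)

lemma Q_Un: "z \<in> Y \<Longrightarrow> A \<inter> B = {} \<Longrightarrow> Q (A \<union> B) z = Q A z + Q B z"
  by (rule Y_eq[OF Q_bl bounded_linear_add[OF Q_bl Q_bl]]) (auto simp: Q_u)

lemma Q_empty: "z \<in> Y \<Longrightarrow> Q {} z = 0"
  by (rule Y_eq[OF Q_bl bounded_linear_zero]) (auto simp: Q_u)

lemma Q_sum: "finite A \<Longrightarrow> z \<in> Y \<Longrightarrow> Q A z = (\<Sum>k\<in>A. Q {k} z)"
proof (induction A rule: finite_induct)
  case (insert k A)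
  then show ?case using Q_Un[of z "{k}" A] by simp
qed (simp add: Q_empty)

text \<open>On the span this is read off directly. As \<open>u k\<close> has norm 1, the
  coefficients along an approximating sequence are Cauchy, which carries it to the closure.\<close>

lemma Q_single: "z \<in> Y \<Longrightarrow> \<exists>c. Q {k} z = c *\<^sub>R u k"
proof -
  assume z: "z \<in> Y"
  have uk: "norm (u k) = 1" by (simp add: u_def normalised)
  have sp: "\<exists>c. Q {k} v = c *\<^sub>R u k" if "v \<in> span (range u)" for v
    using that
  proof (induction rule: span_induct_alt)
    case base
    show ?case by (intro exI[of _ 0]) (simp add: Q_zero)
  next
    case (step c v w)
    then obtain l d where "v = u l" "Q {k} w = d *\<^sub>R u k" by auto
    then have "Q {k} (c *\<^sub>R v + w) = ((if l = k then c else 0) + d) *\<^sub>R u k"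
      by (simp add: Q_add Q_scale Q_u scaleR_left_distrib)
    then show ?case by blast
  qed
  obtain s where s: "\<And>i. s i \<in> span (range u)" "s \<longlonglongrightarrow> z" using z closure_sequential unfolding Y_def by blast
  obtain c where c: "\<And>i. Q {k} (s i) = c i *\<^sub>R u k" using sp[OF s(1)] by metis
  have lim: "(\<lambda>i. c i *\<^sub>R u k) \<longlonglongrightarrow> Q {k} z"
    using bounded_linear.tendsto[OF Q_bl s(2), of "{k}"] c by simp
  have "Cauchy c"
  proof (rule metric_CauchyI)
    fix r :: real assume "0 < r"
    then obtain M where "\<And>i l. M \<le> i \<Longrightarrow> M \<le> l \<Longrightarrow> dist (c i *\<^sub>R u k) (c l *\<^sub>R u k) < r"
      using LIMSEQ_imp_Cauchy[OF lim] metric_CauchyD by blast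
    moreover have "dist (c i *\<^sub>R u k) (c l *\<^sub>R u k) = dist (c i) (c l)" for i l
      using uk by (simp add: dist_norm scaleR_left_diff_distrib[symmetric])
    ultimately show "\<exists>M. \<forall>i\<ge>M. \<forall>l\<ge>M. dist (c i) (c l) < r" by auto
  qed
  then obtain d where "c \<longlonglongrightarrow> d" using Cauchy_convergent convergentD by blast
  then have "(\<lambda>i. c i *\<^sub>R u k) \<longlonglongrightarrow> d *\<^sub>R u k" by (intro tendsto_scaleR tendsto_const)
  then show ?thesis using LIMSEQ_unique[OF lim] by blast
qed

text \<open>The finite linear combinations of the \<open>y k\<close> with \<open>k\<close> in
  \<open>I\<close>, kept as coordinate sequences: the estimates are about sequences, whereas the
  operator acts on their images.\<close>

definition Xs :: "nat set \<Rightarrow> (nat \<Rightarrow> real) set" where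
  "Xs I = {x \<in> c00. supp x \<subseteq> blk I \<and> emb x \<in> span (range u)}"

lemma Xs_c00: "x \<in> Xs I \<Longrightarrow> x \<in> c00" and Xs_supp: "x \<in> Xs I \<Longrightarrow> supp x \<subseteq> blk I"
  and Xs_span: "x \<in> Xs I \<Longrightarrow> emb x \<in> span (range u)"
  by (auto simp: Xs_def)

lemma Xs_Y: "x \<in> Xs I \<Longrightarrow> emb x \<in> Y"
  unfolding Y_def by (rule subsetD[OF closure_subset Xs_span])

lemma blk_mono: "I \<subseteq> J \<Longrightarrow> blk I \<subseteq> blk J"
  by (auto simp: blk_def)

lemma Xs_mono: "x \<in> Xs I \<Longrightarrow> I \<subseteq> J \<Longrightarrow> x \<in> Xs J"
  unfolding Xs_def using blk_mono by blast

lemma Xs_add: "x \<in> Xs I \<Longrightarrow> x' \<in> Xs I \<Longrightarrow> (\<lambda>k. x k + x' k) \<in> Xs I"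
proof -
  assume x: "x \<in> Xs I" "x' \<in> Xs I"
  have "supp (\<lambda>k. x k + x' k) \<subseteq> supp x \<union> supp x'" by (auto simp: supp_def)
  then show ?thesis
    using x c00_add[of x x'] c00_embed_add[of x x' e] unfolding Xs_def by (auto simp: span_add)
qed

lemma Xs_scale: "x \<in> Xs I \<Longrightarrow> (\<lambda>k. c * x k) \<in> Xs I"
  unfolding Xs_def using c00_mult[of x "\<lambda>_. c"] c00_embed_scale[of x e c] supp_scale_subset[of c x]
  by (auto simp: span_scale)

lemma rst_c00: "x \<in> c00 \<Longrightarrow> rst A x \<in> c00"
  unfolding c00_def by (auto simp: supp_rst)

lemma Xs_rst: "x \<in> Xs I \<Longrightarrow> rst (blk J) x \<in> Xs J"
  unfolding Xs_def using Q_span[of "emb x" J] Q_emb[of x J] rst_c00 by (auto simp: supp_rst)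

lemma Xs_Q: "x \<in> Xs I \<Longrightarrow> I \<subseteq> J \<Longrightarrow> Q J (emb x) = emb x"
proof -
  assume x: "x \<in> Xs I" "I \<subseteq> J"
  then have "supp x \<subseteq> blk J" using Xs_supp blk_mono by blast
  then have "rst (blk J) x = x" by (auto simp: rst_def supp_def fun_eq_iff)
  then show ?thesis using Q_emb[OF Xs_c00[OF x(1)]] by simp
qed

lemma span_Xs: "v \<in> span (range u) \<Longrightarrow> \<exists>x\<in>Xs UNIV. emb x = v"
proof (induction rule: span_induct_alt)
  case base
  have "(\<lambda>_. 0) \<in> Xs UNIV" by (auto simp: Xs_def c00_def c00_embed_def span_zero)
  then show ?case by (intro bexI[of _ "\<lambda>_. 0"]) (simp_all add: c00_embed_def)
next
  case (step c v w)
  then obtain k x where k: "v = u k" and x: "x \<in> Xs UNIV" "emb x = w" by auto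
  have "emb (y k) \<in> span (range u)" using span_base[of "u k" "range u"] by (simp add: u_def)
  then have yX: "y k \<in> Xs UNIV" using y_c00 by (auto simp: Xs_def blk_def)
  have "(\<lambda>i. c * y k i + x i) \<in> Xs UNIV" using Xs_add[OF Xs_scale[OF yX] x(1)] .
  moreover have "emb (\<lambda>i. c * y k i + x i) = c *\<^sub>R v + w"
    using c00_embed_add[OF Xs_c00[OF Xs_scale[OF yX]] Xs_c00[OF x(1)], of e c]
      c00_embed_scale[OF y_c00[of k], of e c] k x(2) by (simp add: u_def)
  ultimately show ?case by blast
qed

lemma Q_finite:
  assumes "finite A" "z \<in> Y"
  shows "\<exists>x\<in>Xs A. emb x = Q A z"
proof -
  have "Q A z \<in> span (range u)"
    unfolding Q_sum[OF assms]
  proof (rule span_sum)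
    fix k
    obtain c where "Q {k} z = c *\<^sub>R u k" using Q_single[OF assms(2)] by blast
    then show "Q {k} z \<in> span (range u)" by (simp add: span_scale span_base)
  qed
  then obtain x where x: "x \<in> Xs UNIV" "emb x = Q A z" using span_Xs by blast
  have "emb (rst (blk A) x) = Q A (Q A z)" using Q_emb[OF Xs_c00[OF x(1)], of A] x(2) by simp
  also have "\<dots> = Q A z" using Q_Q[OF assms(2), of A A] by simp
  finally show ?thesis using Xs_rst[OF x(1), of A] by blast
qed

lemma Xs_bounded: "x \<in> Xs UNIV \<Longrightarrow> \<exists>M. x \<in> Xs {..<M}"
proof -
  assume x: "x \<in> Xs UNIV"
  define M where "M = Suc (Max (insert 0 (supp x)))"
  have fin: "finite (supp x)" using c00D(1)[OF Xs_c00[OF x]] .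
  have "supp x \<subseteq> blk {..<M}"
  proof
    fix i assume i: "i \<in> supp x"
    then obtain k where k: "i \<in> supp (y k)" using Xs_supp[OF x] by (auto simp: blk_def)
    then have "k < i" by (rule y_ge)
    moreover have "i \<le> Max (insert 0 (supp x))" using fin i by (intro Max_ge) auto
    ultimately show "i \<in> blk {..<M}" using k unfolding blk_def M_def by auto
  qed
  then show ?thesis using x by (auto simp: Xs_def)
qed

lemma Q_tail:
  assumes "z \<in> Y" "0 < \<epsilon>"
  shows "\<exists>M0. \<forall>M\<ge>M0. norm (z - Q {..<M} z) \<le> \<epsilon>"
proof -
  obtain v where v: "v \<in> span (range u)" "norm (z - v) < \<epsilon> / 2"
    using assms closure_approachable[of z "span (range u)"] unfolding Y_def
    by (metis dist_norm half_gt_zero norm_minus_commute)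
  obtain x M0 where x: "x \<in> Xs {..<M0}" "emb x = v" using span_Xs[OF v(1)] Xs_bounded by metis
  have "norm (z - Q {..<M} z) \<le> \<epsilon>" if "M0 \<le> M" for M
  proof -
    have "Q {..<M} v = v" using Xs_Q[OF x(1), of "{..<M}"] that x(2) by auto
    then have "z - Q {..<M} z = (z - v) - Q {..<M} (z - v)" by (simp add: Q_diff)
    also have "norm \<dots> \<le> norm (z - v) + norm (Q {..<M} (z - v))" by (rule norm_triangle_ineq4)
    finally have "norm (z - Q {..<M} z) \<le> norm (z - v) + norm (Q {..<M} (z - v))" .
    then show ?thesis using Q_norm[of "{..<M}" "z - v"] v(2) by linarith
  qed
  then show ?thesis by blast
qed

end

section \<open>Operators with vanishing diagonal\<close>

context wh_space
begin

definition linY :: "real \<Rightarrow> ('a \<Rightarrow> 'a) \<Rightarrow> bool" where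
  "linY K S \<longleftrightarrow> (\<forall>z\<in>Y. S z \<in> Y) \<and> (\<forall>z\<in>Y. \<forall>w\<in>Y. S (z + w) = S z + S w) \<and>
     (\<forall>c. \<forall>z\<in>Y. S (c *\<^sub>R z) = c *\<^sub>R S z) \<and> (\<forall>z\<in>Y. norm (S z) \<le> K * norm z)"

lemma linYD:
  assumes "linY K S"
  shows "z \<in> Y \<Longrightarrow> S z \<in> Y" "z \<in> Y \<Longrightarrow> w \<in> Y \<Longrightarrow> S (z + w) = S z + S w"
    "z \<in> Y \<Longrightarrow> S (c *\<^sub>R z) = c *\<^sub>R S z" "z \<in> Y \<Longrightarrow> norm (S z) \<le> K * norm z"
    "z \<in> Y \<Longrightarrow> S (- z) = - S z" "S 0 = 0" "0 \<le> K" "z \<in> Y \<Longrightarrow> w \<in> Y \<Longrightarrow> S (z - w) = S z - S w"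
proof -
  note S = assms[unfolded linY_def]
  show "z \<in> Y \<Longrightarrow> S z \<in> Y" "z \<in> Y \<Longrightarrow> norm (S z) \<le> K * norm z" using S by auto
  show add: "z \<in> Y \<Longrightarrow> w \<in> Y \<Longrightarrow> S (z + w) = S z + S w" for z w using S by auto
  show sc: "z \<in> Y \<Longrightarrow> S (c *\<^sub>R z) = c *\<^sub>R S z" for z c using S by auto
  show neg: "z \<in> Y \<Longrightarrow> S (- z) = - S z" for z using sc[of z "-1"] by simp
  show "S 0 = 0" using sc[of 0 0] subspace_0[OF subspace_Y] by simp
  have "norm (u 0) = 1" by (simp add: u_def normalised)
  moreover have "norm (S (u 0)) \<le> K * norm (u 0)" using S u_Y by blast
  ultimately have "norm (S (u 0)) \<le> K" by simp
  then show "0 \<le> K" using order_trans[OF norm_ge_zero] by blast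
  show "z \<in> Y \<Longrightarrow> w \<in> Y \<Longrightarrow> S (z - w) = S z - S w"
    using add[of z "- w"] neg[of w] subspace_neg[OF subspace_Y] by simp
qed

lemma linY_sum:
  assumes "linY K S" "finite I" "\<And>i. i \<in> I \<Longrightarrow> f i \<in> Y"
  shows "S (\<Sum>i\<in>I. f i) = (\<Sum>i\<in>I. S (f i))"
  using assms(2,3)
proof (induction I rule: finite_induct)
  case (insert i I)
  then have "(\<Sum>i\<in>I. f i) \<in> Y" by (intro subspace_sum[OF subspace_Y]) auto
  then show ?case using insert linYD(2)[OF assms(1)] by simp
qed (simp add: linYD(6)[OF assms(1)])

lemma sq_add_disjoint: "supp x \<inter> supp x' = {} \<Longrightarrow> sq (\<lambda>k. x k + x' k) = (\<lambda>k. sq x k + sq x' k)"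
proof
  fix k assume "supp x \<inter> supp x' = {}"
  then have "x k = 0 \<or> x' k = 0" by (auto simp: supp_def)
  then show "sq (\<lambda>k. x k + x' k) k = sq x k + sq x' k" by (auto simp: sq_def)
qed

lemma upper_two_estimate:
  assumes "x \<in> c00" "x' \<in> c00" "supp x \<inter> supp x' = {}"
  shows "(nrm (\<lambda>k. x k + x' k))\<^sup>2 \<le> (nrm x)\<^sup>2 + (nrm x')\<^sup>2"
proof -
  have fin: "finite (supp x)" "finite (supp x')" "finite (supp (\<lambda>k. x k + x' k))"
    using c00D(1) c00_add[OF assms(1,2)] assms(1,2) by auto
  note sq = sq_add_disjoint[OF assms(3)]
  have "nrm (\<lambda>k. x k + x' k) \<le> sqrt ((nrm x)\<^sup>2 + (nrm x')\<^sup>2)"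
  proof (rule wh_norm_le[OF fin(3)])
    fix g assume g: "kf g"
    have "pr g (sq (\<lambda>k. x k + x' k)) = pr g (sq x) + pr g (sq x')"
      unfolding sq using fin by (intro pr_add_right) auto
    also have "\<dots> \<le> (nrm x)\<^sup>2 + (nrm x')\<^sup>2"
      using wh_norm_ge(1)[OF fin(1) g] wh_norm_ge(1)[OF fin(2) g] by linarith
    finally show "pr g (sq (\<lambda>k. x k + x' k)) \<le> (sqrt ((nrm x)\<^sup>2 + (nrm x')\<^sup>2))\<^sup>2" by simp
  qed simp
  then have "(nrm (\<lambda>k. x k + x' k))\<^sup>2 \<le> (sqrt ((nrm x)\<^sup>2 + (nrm x')\<^sup>2))\<^sup>2"
    using nrm_nonneg[OF c00_add[OF assms(1,2)]] by (intro power_mono) auto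
  then show ?thesis by simp
qed

text \<open>By the upper 2-estimate the sum of \<open>i\<close> disjoint vectors of norm at most 1
  has norm at most \<open>sqrt i\<close>. If, after a choice of signs, all their images under
  \<open>S\<close> had \<open>l\<close>-th coordinate above \<open>\<epsilon>\<close>, the image of
  the sum would have norm at least \<open>i * \<epsilon>\<close>, which exceeds
  \<open>K * sqrt i\<close> for large \<open>i\<close>.\<close>

lemma coordinate_tail:
  assumes S: "linY K S" and \<epsilon>: "0 < \<epsilon>"
  shows "\<exists>M. \<forall>x\<in>Xs {M..}. nrm x \<le> 1 \<longrightarrow> norm (Q {l} (S (emb x))) \<le> \<epsilon>"
proof (rule ccontr)
  assume no: "\<not> ?thesis"
  define \<phi> where "\<phi> z = (SOME c. Q {l} (S z) = c *\<^sub>R u l)" for z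
  have \<phi>: "Q {l} (S z) = \<phi> z *\<^sub>R u l" if "z \<in> Y" for z
    unfolding \<phi>_def using someI_ex[OF Q_single[OF linYD(1)[OF S that]]] .
  have ul: "norm (u l) = 1" by (simp add: u_def normalised)
  then have ul0: "u l \<noteq> 0" by auto
  have \<phi>n: "norm (Q {l} (S z)) = \<bar>\<phi> z\<bar>" if "z \<in> Y" for z using \<phi>[OF that] ul by simp
  have \<phi>add: "\<phi> (z + w) = \<phi> z + \<phi> w" if "z \<in> Y" "w \<in> Y" for z w
  proof -
    have "\<phi> (z + w) *\<^sub>R u l = (\<phi> z + \<phi> w) *\<^sub>R u l"
      using \<phi>[OF that(1)] \<phi>[OF that(2)] \<phi>[OF subspace_add[OF subspace_Y that]] linYD(2)[OF S that]
      by (simp add: Q_add scaleR_left_distrib)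
    then show ?thesis using ul0 by simp
  qed
  have \<phi>neg: "\<phi> (- z) = - \<phi> z" if "z \<in> Y" for z
  proof -
    have "\<phi> (- z) *\<^sub>R u l = (- \<phi> z) *\<^sub>R u l"
      using \<phi>[OF that] \<phi>[OF subspace_neg[OF subspace_Y that]] linYD(5)[OF S that] Q_scale[of "{l}" "-1" "S z"] by simp
    then show ?thesis using ul0 unfolding scaleR_cancel_right by blast
  qed
  have pos: "\<exists>x\<in>Xs {M..}. nrm x \<le> 1 \<and> \<epsilon> < \<phi> (emb x)" for M
  proof -
    obtain x where x: "x \<in> Xs {M..}" "nrm x \<le> 1" "\<epsilon> < norm (Q {l} (S (emb x)))"
      using no by (meson not_le)
    show ?thesis
    proof (cases "0 \<le> \<phi> (emb x)")
      case True
      then show ?thesis using x \<phi>n[OF Xs_Y[OF x(1)]] by auto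
    next
      case False
      have xc: "x \<in> c00" using Xs_c00[OF x(1)] .
      have "emb (\<lambda>k. -1 * x k) = - emb x" using c00_embed_scale[OF xc, of e "-1"] by simp
      then have "\<epsilon> < \<phi> (emb (\<lambda>k. -1 * x k))"
        using x(3) \<phi>n[OF Xs_Y[OF x(1)]] \<phi>neg[OF Xs_Y[OF x(1)]] False by simp
      moreover have "nrm (\<lambda>k. -1 * x k) \<le> 1" using nrm_scale_le[OF c00D(1)[OF xc], of "-1"] x(2) by simp
      ultimately show ?thesis using Xs_scale[OF x(1), of "-1"] by blast
    qed
  qed
  have claim: "\<exists>x\<in>Xs {M..}. (nrm x)\<^sup>2 \<le> real i \<and> real i * \<epsilon> \<le> \<phi> (emb x)" for i M
  proof (induction i arbitrary: M)
    case 0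
    have z: "(\<lambda>_. 0) \<in> Xs {M..}" by (auto simp: Xs_def c00_def c00_embed_def span_zero)
    have e0: "emb (\<lambda>_. 0) = 0" by (simp add: c00_embed_def)
    then have "nrm (\<lambda>_. 0) = 0" using norm_emb[OF Xs_c00[OF z]] by simp
    moreover have "\<phi> 0 = 0" using \<phi>add[of 0 0] subspace_0[OF subspace_Y] by simp
    ultimately show ?case using z e0 by (intro bexI[of _ "\<lambda>_. 0"]) auto
  next
    case (Suc i)
    obtain x where x: "x \<in> Xs {M..}" "nrm x \<le> 1" "\<epsilon> < \<phi> (emb x)" using pos by blast
    have "x \<in> Xs UNIV" using Xs_mono[OF x(1)] by blast
    then obtain M1 where M1: "x \<in> Xs {..<M1}" using Xs_bounded by blast
    obtain x' where x': "x' \<in> Xs {max M M1..}" "(nrm x')\<^sup>2 \<le> real i" "real i * \<epsilon> \<le> \<phi> (emb x')" using Suc.IH by blast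
    have xc: "x \<in> c00" "x' \<in> c00" using Xs_c00 x(1) x'(1) by auto
    have "blk {..<M1} \<inter> blk {max M M1..} = {}" using blk_disjoint[of "{..<M1}" "{max M M1..}"] by auto
    then have "supp x \<inter> supp x' = {}" using Xs_supp[OF M1] Xs_supp[OF x'(1)] by blast
    then have "(nrm (\<lambda>k. x k + x' k))\<^sup>2 \<le> (nrm x)\<^sup>2 + (nrm x')\<^sup>2" by (rule upper_two_estimate[OF xc])
    also have "\<dots> \<le> 1 + real i"
      using x(2) x'(2) nrm_nonneg[OF xc(1)] power_mono[of "nrm x" 1 2] by (intro add_mono) auto
    finally have "(nrm (\<lambda>k. x k + x' k))\<^sup>2 \<le> real (Suc i)" by simp
    moreover have "real (Suc i) * \<epsilon> \<le> \<phi> (emb (\<lambda>k. x k + x' k))"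
      using c00_embed_add[OF xc, of e] \<phi>add[OF Xs_Y[OF x(1)] Xs_Y[OF x'(1)]] x(3) x'(3) by (simp add: algebra_simps)
    moreover have "(\<lambda>k. x k + x' k) \<in> Xs {M..}" using Xs_add[OF x(1) Xs_mono[OF x'(1)], of] by auto
    ultimately show ?case by blast
  qed
  obtain i where i: "K\<^sup>2 / \<epsilon>\<^sup>2 < real i" using reals_Archimedean2 by blast
  have i0: "0 < real i" using i by (smt (verit) divide_nonneg_nonneg zero_le_power2)
  obtain x where x: "x \<in> Xs {0..}" "(nrm x)\<^sup>2 \<le> real i" "real i * \<epsilon> \<le> \<phi> (emb x)" using claim by blast
  have "real i * \<epsilon> \<le> norm (Q {l} (S (emb x)))" using x(3) \<phi>n[OF Xs_Y[OF x(1)]] by linarith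
  also have "\<dots> \<le> norm (S (emb x))" by (rule Q_norm)
  also have "\<dots> \<le> K * nrm x" using linYD(4)[OF S Xs_Y[OF x(1)]] norm_emb[OF Xs_c00[OF x(1)]] by simp
  finally have "(real i * \<epsilon>)\<^sup>2 \<le> (K * nrm x)\<^sup>2" using \<epsilon> by (intro power_mono) auto
  also have "\<dots> \<le> K\<^sup>2 * real i" using x(2) by (simp add: power_mult_distrib mult_left_mono)
  finally have "real i * (real i * \<epsilon>\<^sup>2) \<le> real i * K\<^sup>2" by (simp add: power2_eq_square mult_ac)
  then have "real i * \<epsilon>\<^sup>2 \<le> K\<^sup>2" using i0 by simp
  then show False using i \<epsilon> by (simp add: pos_divide_less_eq)
qed

lemma initial_tail:
  assumes S: "linY K S"
  shows "0 < \<epsilon> \<Longrightarrow> \<exists>M. \<forall>x\<in>Xs {M..}. nrm x \<le> 1 \<longrightarrow> norm (Q {..<N} (S (emb x))) \<le> \<epsilon>"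
proof (induction N arbitrary: \<epsilon>)
  case 0
  then show ?case using Q_empty[OF linYD(1)[OF S Xs_Y]] by (auto simp: lessThan_0)
next
  case (Suc N)
  obtain M1 where M1: "\<forall>x\<in>Xs {M1..}. nrm x \<le> 1 \<longrightarrow> norm (Q {..<N} (S (emb x))) \<le> \<epsilon> / 2"
    using Suc.IH[of "\<epsilon> / 2"] Suc.prems by auto
  obtain M2 where M2: "\<forall>x\<in>Xs {M2..}. nrm x \<le> 1 \<longrightarrow> norm (Q {N} (S (emb x))) \<le> \<epsilon> / 2"
    using coordinate_tail[OF S, of "\<epsilon> / 2" N] Suc.prems by auto
  have "norm (Q {..<Suc N} (S (emb x))) \<le> \<epsilon>" if x: "x \<in> Xs {max M1 M2..}" "nrm x \<le> 1" for x
  proof -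
    have "Q {..<Suc N} (S (emb x)) = Q {..<N} (S (emb x)) + Q {N} (S (emb x))"
      using Q_Un[OF linYD(1)[OF S Xs_Y[OF x(1)]], of "{..<N}" "{N}"] by (simp add: lessThan_Suc)
    moreover have "x \<in> Xs {M1..}" "x \<in> Xs {M2..}" using Xs_mono[OF x(1)] by auto
    ultimately show ?thesis using M1 M2 x(2) norm_triangle_ineq[of "Q {..<N} (S (emb x))" "Q {N} (S (emb x))"] by fastforce
  qed
  then show ?case by blast
qed

section \<open>Separating input and output blocks, and block diagonal parts\<close>

lemma card_separating_subsets:
  assumes "finite \<Omega>" "i \<in> \<Omega>" "j \<in> \<Omega>" "i \<noteq> j"
  shows "4 * card {A \<in> Pow \<Omega>. i \<in> A \<and> j \<notin> A} = 2 ^ card \<Omega>"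
proof -
  have "{A \<in> Pow \<Omega>. i \<in> A \<and> j \<notin> A} = insert i ` Pow (\<Omega> - {i, j})"
  proof
    show "{A \<in> Pow \<Omega>. i \<in> A \<and> j \<notin> A} \<subseteq> insert i ` Pow (\<Omega> - {i, j})"
    proof
      fix A assume "A \<in> {A \<in> Pow \<Omega>. i \<in> A \<and> j \<notin> A}"
      then show "A \<in> insert i ` Pow (\<Omega> - {i, j})" by (intro image_eqI[of _ _ "A - {i}"]) auto
    qed
  qed (use assms in auto)
  moreover have "inj_on (insert i) (Pow (\<Omega> - {i, j}))" by (auto simp: inj_on_def)
  ultimately have "card {A \<in> Pow \<Omega>. i \<in> A \<and> j \<notin> A} = 2 ^ card (\<Omega> - {i, j})"
    using assms(1) by (simp add: card_image card_Pow)
  moreover have "card \<Omega> = card (\<Omega> - {i, j}) + 2"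
    using assms card_Diff_subset[of "{i, j}" \<Omega>] card_mono[of \<Omega> "{i, j}"] by simp
  ultimately show ?thesis by simp
qed

text \<open>Averaging over all subsets A of Omega: each off-diagonal entry of the matrix of S survives
  with probability 1/4.\<close>

lemma separating_subset:
  assumes S: "linY K S" and diag: "\<And>k. Q {k} (S (u k)) = 0" and \<Omega>: "finite \<Omega>" and x: "x \<in> Xs \<Omega>"
  shows "\<exists>A\<subseteq>\<Omega>. norm (Q \<Omega> (S (emb x))) \<le> 4 * norm (Q A (S (emb (rst (blk (\<Omega> - A)) x))))"
proof (rule ccontr)
  assume no: "\<not> ?thesis"
  define z where "z = emb x"
  have zY: "z \<in> Y" unfolding z_def by (rule Xs_Y[OF x])
  define f where "f i j = Q {i} (S (Q {j} z))" for i j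
  have SY: "S (Q {j} z) \<in> Y" for j using linYD(1)[OF S Q_Y[OF zY]] .
  have fii: "f i i = 0" for i
  proof -
    obtain c where "Q {i} z = c *\<^sub>R u i" using Q_single[OF zY] by blast
    then show ?thesis unfolding f_def using linYD(3)[OF S u_Y] diag by (simp add: Q_scale)
  qed
  have QS: "Q A (S (Q B z)) = (\<Sum>i\<in>A. \<Sum>j\<in>B. f i j)" if "finite A" "finite B" for A B
  proof -
    have "S (Q B z) = (\<Sum>j\<in>B. S (Q {j} z))"
      unfolding Q_sum[OF that(2) zY] by (rule linY_sum[OF S that(2) Q_Y[OF zY]])
    moreover have "(\<Sum>j\<in>B. S (Q {j} z)) \<in> Y" by (intro subspace_sum[OF subspace_Y] SY)
    ultimately have "Q A (S (Q B z)) = (\<Sum>i\<in>A. Q {i} (\<Sum>j\<in>B. S (Q {j} z)))" using Q_sum[OF that(1)] by simp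
    then show ?thesis by (simp add: f_def linear_sum[OF bounded_linear.linear[OF Q_bl]])
  qed
  define v where "v A = Q A (S (Q (\<Omega> - A) z))" for A
  have vlt: "4 * norm (v A) < norm (Q \<Omega> (S z))" if "A \<in> Pow \<Omega>" for A
    using no that Q_emb[OF Xs_c00[OF x], of "\<Omega> - A"] unfolding v_def z_def by (metis PowD not_le)
  have "(\<Sum>A\<in>Pow \<Omega>. v A) = (\<Sum>A\<in>Pow \<Omega>. \<Sum>i\<in>\<Omega>. \<Sum>j\<in>\<Omega>. if i \<in> A \<and> j \<notin> A then f i j else 0)"
  proof (rule sum.cong[OF refl])
    fix A assume A: "A \<in> Pow \<Omega>"
    have "v A = (\<Sum>i\<in>A. \<Sum>j\<in>\<Omega> - A. f i j)" unfolding v_def using A \<Omega> finite_subset by (intro QS) auto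
    also have "\<dots> = (\<Sum>i\<in>A. \<Sum>j\<in>\<Omega>. if i \<in> A \<and> j \<notin> A then f i j else 0)"
      using \<Omega> by (intro sum.cong[OF refl] sum.mono_neutral_cong_left) auto
    also have "\<dots> = (\<Sum>i\<in>\<Omega>. \<Sum>j\<in>\<Omega>. if i \<in> A \<and> j \<notin> A then f i j else 0)"
      using \<Omega> A by (intro sum.mono_neutral_left) auto
    finally show "v A = (\<Sum>i\<in>\<Omega>. \<Sum>j\<in>\<Omega>. if i \<in> A \<and> j \<notin> A then f i j else 0)" .
  qed
  also have "\<dots> = (\<Sum>i\<in>\<Omega>. \<Sum>j\<in>\<Omega>. \<Sum>A\<in>Pow \<Omega>. if i \<in> A \<and> j \<notin> A then f i j else 0)"
    by (subst sum.swap, rule sum.cong[OF refl], rule sum.swap)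
  also have "4 *\<^sub>R \<dots> = (2 ^ card \<Omega>) *\<^sub>R (\<Sum>i\<in>\<Omega>. \<Sum>j\<in>\<Omega>. f i j)"
    unfolding scaleR_sum_right
  proof (intro sum.cong[OF refl])
    fix i j assume ij: "i \<in> \<Omega>" "j \<in> \<Omega>"
    have "(\<Sum>A\<in>Pow \<Omega>. if i \<in> A \<and> j \<notin> A then f i j else 0) = (\<Sum>A\<in>{A \<in> Pow \<Omega>. i \<in> A \<and> j \<notin> A}. f i j)"
      using \<Omega> by (intro sum.inter_filter[symmetric]) auto
    also have "\<dots> = real (card {A \<in> Pow \<Omega>. i \<in> A \<and> j \<notin> A}) *\<^sub>R f i j" by (rule sum_constant_scaleR)
    finally have eq: "(\<Sum>A\<in>Pow \<Omega>. 4 *\<^sub>R (if i \<in> A \<and> j \<notin> A then f i j else 0)) =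
        real (4 * card {A \<in> Pow \<Omega>. i \<in> A \<and> j \<notin> A}) *\<^sub>R f i j"
      unfolding scaleR_sum_right[symmetric] by simp
    show "(\<Sum>A\<in>Pow \<Omega>. 4 *\<^sub>R (if i \<in> A \<and> j \<notin> A then f i j else 0)) = 2 ^ card \<Omega> *\<^sub>R f i j"
    \<comment> \<open>No subset separates a coordinate from itself, so the diagonal entries must
      vanish by assumption; off the diagonal exactly a quarter of the subsets count.\<close>
    proof (cases "i = j")
      case True
      then show ?thesis using fii[of j] by simp
    next
      case False
      then show ?thesis unfolding eq using card_separating_subsets[OF \<Omega> ij] by simp
    qed
  qed
  also have "(\<Sum>i\<in>\<Omega>. \<Sum>j\<in>\<Omega>. f i j) = Q \<Omega> (S z)"
    using QS[OF \<Omega> \<Omega>] Xs_Q[OF x, of \<Omega>] by (simp add: z_def)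
  finally have eq: "4 *\<^sub>R (\<Sum>A\<in>Pow \<Omega>. v A) = (2 ^ card \<Omega>) *\<^sub>R Q \<Omega> (S z)" .
  have "2 ^ card \<Omega> * norm (Q \<Omega> (S z)) = norm (4 *\<^sub>R (\<Sum>A\<in>Pow \<Omega>. v A))" unfolding eq by simp
  also have "\<dots> = 4 * norm (\<Sum>A\<in>Pow \<Omega>. v A)" by simp
  also have "\<dots> \<le> (\<Sum>A\<in>Pow \<Omega>. 4 * norm (v A))" unfolding sum_distrib_left[symmetric] by (intro mult_left_mono norm_sum) auto
  also have "\<dots> < (\<Sum>A\<in>Pow \<Omega>. norm (Q \<Omega> (S z)))" using \<Omega> vlt by (intro sum_strict_mono) auto
  also have "\<dots> = 2 ^ card \<Omega> * norm (Q \<Omega> (S z))" using \<Omega> by (simp add: card_Pow)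
  finally show False by simp
qed

text \<open>Block diagonal parts of S are bounded by the norm bound of S. The flip M changes the sign on
  the first block, so (S + M S M) / 2 has no entries between this block and the others.\<close>

lemma block_diagonal:
  assumes "linY K S" "w0 \<in> Y" "Q B0 w0 = w0"
    "\<And>A B w. (A, B, w) \<in> set L \<Longrightarrow> w \<in> Y \<and> Q B w = w \<and> (A \<union> B) \<inter> (A0 \<union> B0) = {}"
    "sorted_wrt (\<lambda>(A, B, w) (A', B', w'). (A \<union> B) \<inter> (A' \<union> B') = {}) L"
  shows "norm (Q A0 (S w0) + (\<Sum>(A, B, w)\<leftarrow>L. Q A (S w))) \<le> K * norm (w0 + (\<Sum>(A, B, w)\<leftarrow>L. w))"
  using assms
proof (induction L arbitrary: S w0 A0 B0)
  case Nil
  then show ?case using linYD(4)[OF Nil(1,2)] Q_norm[of A0 "S w0"] by simp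
next
  case (Cons t L)
  obtain A B w where t: "t = (A, B, w)" by (cases t)
  define c where "c k = (if k \<in> A \<union> B then -1 else 1 :: real)" for k
  define M where "M = Mul c"
  have c1: "\<forall>k. \<bar>c k\<bar> \<le> 1" by (simp add: c_def)
  have M: "bounded_linear M" "\<And>k. M (u k) = c k *\<^sub>R u k" "\<And>z. norm (M z) \<le> norm z" "\<And>z. z \<in> Y \<Longrightarrow> M z \<in> Y"
    using Mul(1)[OF c1] Mul_u[OF c1] Mul(3)[OF c1 c1] Mul_Y[OF c1] by (auto simp: M_def)
  note Ml = bounded_linear.linear[OF M(1)]
  have inside: "Q C (M z) = - Q C z" "M (Q C z) = - Q C z" if C: "C \<subseteq> A \<union> B" and z: "z \<in> Y" for C z
  proof -
    have ck: "c k = -1" if "k \<in> C" for k using C that by (auto simp: c_def)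
    show "Q C (M z) = - Q C z"
      by (rule Y_eq[OF bounded_linear_compose[OF Q_bl M(1)] bounded_linear_minus[OF Q_bl] _ z])
        (simp add: M(2) Q_u Q_scale ck)
    show "M (Q C z) = - Q C z"
      by (rule Y_eq[OF bounded_linear_compose[OF M(1) Q_bl] bounded_linear_minus[OF Q_bl] _ z])
        (simp add: M(2) Q_u linear_0[OF Ml] ck)
  qed
  have outside: "Q C (M z) = Q C z" "M (Q C z) = Q C z" if C: "C \<inter> (A \<union> B) = {}" and z: "z \<in> Y" for C z
  proof -
    have ck: "c k = 1" if "k \<in> C" for k using C that by (auto simp: c_def)
    show "Q C (M z) = Q C z"
      by (rule Y_eq[OF bounded_linear_compose[OF Q_bl M(1)] Q_bl _ z])
        (simp add: M(2) Q_u Q_scale ck)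
    show "M (Q C z) = Q C z"
      by (rule Y_eq[OF bounded_linear_compose[OF M(1) Q_bl] Q_bl _ z])
        (simp add: M(2) Q_u linear_0[OF Ml] ck)
  qed
  have tY: "w \<in> Y" "Q B w = w" "(A \<union> B) \<inter> (A0 \<union> B0) = {}" using Cons.prems(4)[of A B w] t by auto
  have LY: "w' \<in> Y" "Q B' w' = w'" "(A' \<union> B') \<inter> (A0 \<union> B0) = {}" "(A' \<union> B') \<inter> (A \<union> B) = {}"
    if "(A', B', w') \<in> set L" for A' B' w'
    using Cons.prems(4)[of A' B' w'] Cons.prems(5) that t by fastforce+
  define S' where "S' z = (1/2) *\<^sub>R (S z + M (S (M z)))" for z
  note S = linYD[OF Cons.prems(1)]
  have S': "linY K S'"
    unfolding linY_def
  proof (intro conjI ballI allI)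
    fix z assume z: "z \<in> Y"
    show "S' z \<in> Y" unfolding S'_def using S(1) M(4) z subspace_Y by (intro subspace_scale subspace_add) auto
    show "S' (z + z') = S' z + S' z'" if z': "z' \<in> Y" for z'
      unfolding S'_def using S(2)[OF z z'] S(2)[OF M(4)[OF z] M(4)[OF z']]
      by (simp add: linear_add[OF Ml] scaleR_right_distrib)
    show "S' (r *\<^sub>R z) = r *\<^sub>R S' z" for r
      unfolding S'_def using S(3)[OF z] S(3)[OF M(4)[OF z]]
      by (simp add: linear_scale[OF Ml] scaleR_right_distrib)
    have "norm (M (S (M z))) \<le> norm (S (M z))" by (rule M(3))
    also have "\<dots> \<le> K * norm (M z)" by (rule S(4)[OF M(4)[OF z]])
    also have "\<dots> \<le> K * norm z" using M(3) S(7) by (intro mult_left_mono)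
    finally have "norm (S z + M (S (M z))) \<le> K * norm z + K * norm z"
      using norm_triangle_ineq[of "S z" "M (S (M z))"] S(4)[OF z] by linarith
    then show "norm (S' z) \<le> K * norm z" by (simp add: S'_def)
  qed
  have Mw: "M w = - w" using inside(2)[of B w] tY by simp
  have Mout: "M w' = w'" if "w' \<in> Y" "Q B' w' = w'" "B' \<inter> (A \<union> B) = {}" for w' B'
    using outside(2)[OF that(3,1)] that(2) by simp
  have Mw0: "M w0 = w0" using Mout[OF Cons.prems(2,3)] tY(3) by blast
  have SY: "S w \<in> Y" "S w0 \<in> Y" using S(1) tY(1) Cons.prems(2) by auto
  have QA: "Q A (S' w) = Q A (S w)" "Q A (S' w0) = 0"
    unfolding S'_def Mw Mw0 using inside(1)[of A] SY S(5)[OF tY(1)] inside(1)[OF _ SY(1), of A]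
    by (auto simp: Q_scale Q_add Q_diff linear_neg[OF Ml] linear_neg[OF bounded_linear.linear[OF Q_bl]] scaleR_2[symmetric])
  have QM0: "Q A0 (M z) = Q A0 z" if "z \<in> Y" for z using outside(1)[OF _ that, of A0] tY(3) by blast
  have QA0: "Q A0 (S' w0) = Q A0 (S w0)" "Q A0 (S' w) = 0"
    unfolding S'_def Mw Mw0 using QM0 SY S(5)[OF tY(1)]
    by (auto simp: Q_scale Q_add Q_diff linear_neg[OF Ml] linear_neg[OF bounded_linear.linear[OF Q_bl]] scaleR_2[symmetric])
  have QL: "Q A' (S' w') = Q A' (S w')" if "(A', B', w') \<in> set L" for A' B' w'
  proof -
    have "M w' = w'" using Mout[OF LY(1,2)[OF that]] LY(4)[OF that] by blast
    moreover have "Q A' (M (S w')) = Q A' (S w')"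
      using outside(1)[OF _ S(1)[OF LY(1)[OF that]], of A'] LY(4)[OF that] by blast
    ultimately show ?thesis unfolding S'_def by (simp add: Q_scale Q_add scaleR_2[symmetric])
  qed
  have disjA: "A0 \<inter> A = {}" using tY(3) by blast
  \<comment> \<open>As \<open>S'\<close> has no entries between them, the first block of
    \<open>L\<close> can be merged with the block \<open>(A0, B0, w0)\<close> carried along. The
    list becomes shorter, and \<open>S'\<close> has the same bound \<open>K\<close> as
    \<open>S\<close>.\<close>
  have "norm (Q (A0 \<union> A) (S' (w0 + w)) + (\<Sum>(A', B', w')\<leftarrow>L. Q A' (S' w'))) \<le> K * norm ((w0 + w) + (\<Sum>(A', B', w')\<leftarrow>L. w'))"
  proof (rule Cons.IH[OF S', where ?B0.0="B0 \<union> B"])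
    show "w0 + w \<in> Y" using tY(1) Cons.prems(2) subspace_Y by (intro subspace_add) auto
    have "Q (B0 \<union> B) w0 = w0" using Q_Q[OF Cons.prems(2), of "B0 \<union> B" B0] Cons.prems(3) by (simp add: Int_absorb1)
    moreover have "Q (B0 \<union> B) w = w" using Q_Q[OF tY(1), of "B0 \<union> B" B] tY(2) by (simp add: Int_absorb1)
    ultimately show "Q (B0 \<union> B) (w0 + w) = w0 + w" by (simp add: Q_add)
    show "w' \<in> Y \<and> Q B' w' = w' \<and> (A' \<union> B') \<inter> (A0 \<union> A \<union> (B0 \<union> B)) = {}" if "(A', B', w') \<in> set L" for A' B' w'
      using LY[OF that] by blast
    show "sorted_wrt (\<lambda>(A, B, w) (A', B', w'). (A \<union> B) \<inter> (A' \<union> B') = {}) L" using Cons.prems(5) by simp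
  qed
  also have "Q (A0 \<union> A) (S' (w0 + w)) = Q A0 (S w0) + Q A (S w)"
  proof -
    have "S' (w0 + w) \<in> Y" using linYD(1)[OF S'] tY(1) Cons.prems(2) subspace_Y by (simp add: subspace_add)
    then have "Q (A0 \<union> A) (S' (w0 + w)) = Q A0 (S' (w0 + w)) + Q A (S' (w0 + w))" using disjA by (rule Q_Un)
    then show ?thesis using linYD(2)[OF S' Cons.prems(2) tY(1)] QA QA0 by (simp add: Q_add)
  qed
  also have "(\<Sum>(A', B', w')\<leftarrow>L. Q A' (S' w')) = (\<Sum>(A', B', w')\<leftarrow>L. Q A' (S w'))"
    using QL by (intro arg_cong[where f=sum_list] map_cong) auto
  finally show ?case by (simp add: t add.assoc)
qed

end

section \<open>Strict singularity\<close>

context wh_space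
begin

text \<open>\<open>Q {..<N}\<close> maps \<open>Y\<close> into the span of \<open>N\<close> vectors,
  so it cannot be injective on the span of \<open>N + 1\<close> independent vectors of
  \<open>Z\<close>.\<close>

lemma kernel_vector:
  assumes Z: "subspace Z" "Z \<subseteq> Y" "infinite_dimensional Z"
  shows "\<exists>z\<in>Z. norm z = 1 \<and> Q {..<N} z = 0"
proof (rule ccontr)
  assume no: "\<not> ?thesis"
  have ker: "z = 0" if "z \<in> Z" "Q {..<N} z = 0" for z
  proof (rule ccontr)
    assume "z \<noteq> 0"
    then have "norm ((1 / norm z) *\<^sub>R z) = 1" "Q {..<N} ((1 / norm z) *\<^sub>R z) = 0"
      using that(2) by (auto simp: Q_scale)
    then show False using no subspace_scale[OF Z(1) that(1)] by blast
  qed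
  obtain B where B: "B \<subseteq> Z" "independent B" "Z \<subseteq> span B" by (rule maximal_independent_subset)
  have "infinite B" using Z(3) B(3) unfolding infinite_dimensional_def by blast
  then obtain B' where B': "B' \<subseteq> B" "finite B'" "card B' = Suc N" using infinite_arbitrarily_large by blast
  have ind: "independent B'" using B(2) B'(1) independent_mono by blast
  have spZ: "span B' \<subseteq> Z" using B(1) B'(1) Z(1) by (intro span_minimal) auto
  note lin = bounded_linear.linear[OF Q_bl, of "{..<N}"]
  have inj: "inj_on (Q {..<N}) (span B')"
  proof (rule inj_onI)
    fix a b assume ab: "a \<in> span B'" "b \<in> span B'" "Q {..<N} a = Q {..<N} b"
    then have "a - b \<in> Z" using spZ span_diff by blast
    moreover have "Q {..<N} (a - b) = 0" using ab(3) by (simp add: Q_diff)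
    ultimately show "a = b" using ker by fastforce
  qed
  have "independent (Q {..<N} ` B')" by (rule linear_independent_injective_image[OF lin ind inj])
  moreover have "Q {..<N} ` B' \<subseteq> span (u ` {..<N})"
  proof (rule image_subsetI)
    fix b assume "b \<in> B'"
    then have bY: "b \<in> Y" using B(1) B'(1) Z(2) by blast
    show "Q {..<N} b \<in> span (u ` {..<N})"
      unfolding Q_sum[OF finite_lessThan bY]
    proof (rule span_sum)
      fix k assume k: "k \<in> {..<N}"
      obtain c where "Q {k} b = c *\<^sub>R u k" using Q_single[OF bY] by blast
      then show "Q {k} b \<in> span (u ` {..<N})" using k by (simp add: span_scale span_base)
    qed
  qed
  ultimately have "card (Q {..<N} ` B') \<le> card (u ` {..<N})"
    using independent_span_bound[of "u ` {..<N}" "Q {..<N} ` B'"] by simp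
  also have "\<dots> \<le> N" using card_image_le[of "{..<N}" u] by simp
  finally have "card (Q {..<N} ` B') \<le> N" .
  moreover have "card (Q {..<N} ` B') = card B'"
    using inj span_superset[of B'] by (intro card_image) (rule inj_on_subset)
  ultimately show False using B'(3) by simp
qed

lemma gliding_hump:
  assumes Z: "subspace Z" "Z \<subseteq> Y" "infinite_dimensional Z" and \<epsilon>: "0 < \<epsilon>"
  shows "\<exists>z x M. z \<in> Z \<and> norm z = 1 \<and> x \<in> Xs {N..<M} \<and> norm (z - emb x) \<le> \<epsilon> \<and> N < M"
proof -
  obtain z where z: "z \<in> Z" "norm z = 1" "Q {..<N} z = 0" using kernel_vector[OF Z] by blast
  have zY: "z \<in> Y" using z(1) Z(2) by blast
  obtain M0 where M0: "\<forall>M\<ge>M0. norm (z - Q {..<M} z) \<le> \<epsilon>" using Q_tail[OF zY \<epsilon>] by blast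
  define M where "M = max M0 (Suc N)"
  have "{..<M} = {..<N} \<union> {N..<M}" by (auto simp: M_def)
  then have "Q {..<M} z = Q {N..<M} z" using Q_Un[OF zY, of "{..<N}" "{N..<M}"] z(3) by fastforce
  moreover obtain x where "x \<in> Xs {N..<M}" "emb x = Q {N..<M} z" using Q_finite[OF _ zY, of "{N..<M}"] by auto
  moreover have "norm (z - Q {..<M} z) \<le> \<epsilon>" "N < M" using M0 by (auto simp: M_def)
  ultimately show ?thesis using z by metis
qed

text \<open>Unit vectors \<open>z k\<close> of \<open>Z\<close> are replaced by nearby
  \<open>w k\<close> that are finite combinations on successive sets of blocks. \<open>V\<close>
  consists of coordinate sequences instead of vectors, as \<open>average_exists\<close>
  requires.\<close>

lemma perturbed_subspace:
  assumes Z: "subspace Z" "Z \<subseteq> Y" "infinite_dimensional Z" and S: "linY K S"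
    and \<delta>: "0 < \<delta>" "\<And>z. z \<in> Z \<Longrightarrow> \<delta> * norm z \<le> norm (S z)"
  shows "\<exists>V. (\<forall>x\<in>V. x \<in> Xs UNIV \<and> \<delta> / 2 * nrm x \<le> norm (S (emb x))) \<and>
    (\<forall>x\<in>V. \<forall>c. (\<lambda>k. c * x k) \<in> V) \<and> (\<forall>x\<in>V. \<forall>x'\<in>V. (\<lambda>k. x k + x' k) \<in> V) \<and>
    (\<forall>N. \<exists>x\<in>V. supp x \<noteq> {} \<and> x \<in> Xs {N..})"
proof -
  have K: "0 \<le> K" using linYD(7)[OF S] .
  \<comment> \<open>With errors \<open>\<epsilon> * (1/2) ^ k\<close> and coefficients up to
    \<open>2 * norm v\<close>, a combination \<open>v\<close> moves by at most
    \<open>4 * \<epsilon> * norm v\<close>. The two bounds on \<open>\<epsilon>\<close> make this at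
    most \<open>norm v / 4\<close>, and at most \<open>\<delta> / 4 * norm v\<close> after applying
    \<open>S\<close>; this leaves \<open>3/4 - 1/4 = 1/2\<close> of \<open>\<delta>\<close>.\<close>
  define \<epsilon> where "\<epsilon> = min (1/16) (\<delta> / (16 * (K + 1)))"
  have \<epsilon>: "0 < \<epsilon>" "\<epsilon> \<le> 1/16" "16 * K * \<epsilon> \<le> \<delta>"
  proof -
    show "0 < \<epsilon>" using \<delta> K by (simp add: \<epsilon>_def)
    show "\<epsilon> \<le> 1/16" unfolding \<epsilon>_def by (rule min.cobounded1)
    have "16 * K * \<epsilon> \<le> 16 * K * (\<delta> / (16 * (K + 1)))" using K by (intro mult_left_mono) (auto simp: \<epsilon>_def)
    also have "\<dots> = \<delta> * (K / (K + 1))" using K by (simp add: divide_simps)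
    also have "\<dots> \<le> \<delta> * 1" using K \<delta> by (intro mult_left_mono) auto
    finally show "16 * K * \<epsilon> \<le> \<delta>" by simp
  qed
  define G where "G N k z x M \<longleftrightarrow> z \<in> Z \<and> norm z = 1 \<and> x \<in> Xs {N..<M} \<and> norm (z - emb x) \<le> \<epsilon> * (1/2) ^ k \<and> N < M"
    for N k :: nat and z x M
  have "\<exists>z x M. G N k z x M" for N k unfolding G_def using \<epsilon> by (intro gliding_hump[OF Z]) auto
  then obtain fz fx fM where G: "\<And>N k. G N k (fz N k) (fx N k) (fM N k)" by metis
  define q where "q = rec_nat 0 (\<lambda>k N. fM N k)"
  have qS: "q (Suc k) = fM (q k) k" for k by (simp add: q_def)
  define z where "z k = fz (q k) k" for k
  define x where "x k = fx (q k) k" for k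
  define w where "w k = emb (x k)" for k
  have Gk: "G (q k) k (z k) (x k) (q (Suc k))" for k using G[of "q k" k] by (simp add: z_def x_def qS)
  have qlt: "q k < q (Suc k)" for k using Gk by (simp add: G_def)
  have qmono: "q i \<le> q j" if "i \<le> j" for i j using lift_Suc_mono_le[of q i j] qlt that less_imp_le by blast
  have qge: "k \<le> q k" for k by (induction k) (use qlt in \<open>auto intro: Suc_leI le_less_trans\<close>)
  have xX: "x k \<in> Xs {q k..<q (Suc k)}" for k using Gk by (simp add: G_def)
  have wY: "w k \<in> Y" for k unfolding w_def by (rule Xs_Y[OF xX])
  have zw: "norm (z k - w k) \<le> \<epsilon> * (1/2) ^ k" for k using Gk by (simp add: G_def w_def)
  have zZ: "z k \<in> Z" "norm (z k) = 1" for k using Gk by (auto simp: G_def)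
  have wn: "1/2 \<le> norm (w k)" for k
  proof -
    have "\<epsilon> * (1/2) ^ k \<le> \<epsilon> * 1" using \<epsilon>(1) by (intro mult_left_mono power_le_one) auto
    then have "norm (z k - w k) \<le> 1/2" using zw[of k] \<epsilon>(2) by linarith
    then show ?thesis using norm_triangle_ineq2[of "z k" "w k"] zZ(2)[of k] by linarith
  qed
  have Qw: "Q {q k..<q (Suc k)} (w l) = (if k = l then w l else 0)" for k l
  proof (cases "k = l")
    case True
    then show ?thesis unfolding w_def using Xs_Q[OF xX[of l]] by simp
  next
    case False
    then consider "Suc k \<le> l" | "Suc l \<le> k" by linarith
    then have disj: "{q k..<q (Suc k)} \<inter> {q l..<q (Suc l)} = {}" using qmono[of "Suc k" l] qmono[of "Suc l" k] by cases auto
    have "Q {q k..<q (Suc k)} (w l) = Q {q k..<q (Suc k)} (Q {q l..<q (Suc l)} (w l))"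
      unfolding w_def using Xs_Q[OF xX[of l]] by simp
    also have "\<dots> = 0" unfolding Q_Q[OF wY[of l]] disj by (rule Q_empty[OF wY])
    finally show ?thesis using False by simp
  qed
  define comb where "comb c M = (\<lambda>i. \<Sum>k<M. c k * x k i)" for c :: "nat \<Rightarrow> real" and M
  \<comment> \<open>Since \<open>c\<close> vanishes from \<open>M\<close> on, two combinations can
    be rewritten with a common \<open>M\<close>.\<close>
  define V where "V = {comb c M |c M. \<forall>k\<ge>M. c k = 0}"
  have combX: "comb c M \<in> Xs UNIV \<and> emb (comb c M) = (\<Sum>k<M. c k *\<^sub>R w k)" for c M
  proof (induction M)
    case 0
    show ?case by (simp add: comb_def Xs_def c00_def c00_embed_def span_zero)
  next
    case (Suc M)
    have xU: "x M \<in> Xs UNIV" using Xs_mono[OF xX] by blast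
    have eq: "comb c (Suc M) = (\<lambda>i. comb c M i + c M * x M i)" by (simp add: comb_def)
    have "emb (comb c (Suc M)) = emb (comb c M) + c M *\<^sub>R w M"
      unfolding eq w_def using c00_embed_add[OF Xs_c00[OF conjunct1[OF Suc.IH]] Xs_c00[OF Xs_scale[OF xU, of "c M"]], of e]
        c00_embed_scale[OF Xs_c00[OF xU], of e "c M"] by simp
    moreover have "comb c (Suc M) \<in> Xs UNIV" unfolding eq using Suc.IH xU by (intro Xs_add Xs_scale) auto
    ultimately show ?case using Suc.IH by simp
  qed
  have comb_ext: "comb c M = comb c M'" if "\<forall>k\<ge>M. c k = 0" "M \<le> M'" for c M M'
    unfolding comb_def using that by (intro ext sum.mono_neutral_left) auto
  have lower: "\<delta> / 2 * norm v \<le> norm (S v)" if v: "v = (\<Sum>k<M. c k *\<^sub>R w k)" for v c M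
  proof -
    have vY: "v \<in> Y" unfolding v using wY subspace_Y by (intro subspace_sum subspace_scale) auto
    \<comment> \<open>The projection onto one set of blocks is a contraction and picks out a single
      term \<open>c k *\<^sub>R w k\<close>, where \<open>w k\<close> has norm at least 1/2.\<close>
    have ck: "\<bar>c k\<bar> \<le> 2 * norm v" if "k < M" for k
    proof -
      have "Q {q k..<q (Suc k)} v = (\<Sum>l<M. c l *\<^sub>R Q {q k..<q (Suc k)} (w l))"
        unfolding v by (simp add: linear_sum[OF bounded_linear.linear[OF Q_bl]] Q_scale)
      also have "\<dots> = (\<Sum>l<M. if k = l then c l *\<^sub>R w l else 0)" unfolding Qw by (intro sum.cong) auto
      also have "\<dots> = c k *\<^sub>R w k" using that by simp
      finally have "\<bar>c k\<bar> * norm (w k) \<le> norm v" using Q_norm[of "{q k..<q (Suc k)}" v] by simp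
      moreover have "\<bar>c k\<bar> * (1/2) \<le> \<bar>c k\<bar> * norm (w k)" using wn by (intro mult_left_mono) auto
      ultimately show ?thesis by linarith
    qed
    define v' where "v' = (\<Sum>k<M. c k *\<^sub>R z k)"
    have v'Z: "v' \<in> Z" unfolding v'_def using zZ Z(1) by (intro subspace_sum subspace_scale) auto
    then have v'Y: "v' \<in> Y" using Z(2) by blast
    have "norm (v' - v) = norm (\<Sum>k<M. c k *\<^sub>R (z k - w k))"
      unfolding v v'_def by (simp add: sum_subtractf scaleR_right_diff_distrib)
    also have "\<dots> \<le> (\<Sum>k<M. 2 * norm v * (\<epsilon> * (1/2) ^ k))"
      using ck zw by (intro order_trans[OF norm_sum] sum_mono) (auto intro!: mult_mono)
    also have "\<dots> = 2 * norm v * \<epsilon> * (\<Sum>k<M. (1/2) ^ k)" by (simp add: sum_distrib_left mult.assoc)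
    also have "\<dots> \<le> 2 * norm v * \<epsilon> * 2"
    proof (rule mult_left_mono)
      show "(\<Sum>k<M. (1/2::real) ^ k) \<le> 2" by (simp add: sum_gp_strict)
    qed (use \<epsilon> in auto)
    finally have d: "norm (v' - v) \<le> 4 * \<epsilon> * norm v" by (simp add: mult_ac)
    have "norm (S v' - S v) \<le> K * norm (v' - v)"
      using linYD(4)[OF S subspace_diff[OF subspace_Y v'Y vY]] linYD(8)[OF S v'Y vY] by simp
    also have "\<dots> \<le> K * (4 * \<epsilon> * norm v)" using d K by (rule mult_left_mono)
    also have "\<dots> = (16 * K * \<epsilon>) * norm v / 4" by simp
    also have "\<dots> \<le> \<delta> * norm v / 4" using \<epsilon>(3) by (intro divide_right_mono mult_right_mono) auto
    finally have 1: "norm (S v' - S v) \<le> \<delta> * norm v / 4" .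
    have "4 * \<epsilon> * norm v \<le> (1/4) * norm v" using \<epsilon>(2) by (intro mult_right_mono) auto
    then have "3/4 * norm v \<le> norm v'" using d norm_triangle_ineq2[of v v'] by (simp add: norm_minus_commute)
    then have "\<delta> * (3/4 * norm v) \<le> \<delta> * norm v'" using \<delta>(1) by (intro mult_left_mono) auto
    also have "\<dots> \<le> norm (S v')" by (rule \<delta>(2)[OF v'Z])
    finally show ?thesis using 1 norm_triangle_ineq2[of "S v'" "S v"] by (simp add: algebra_simps)
  qed
  show ?thesis
  proof (intro exI[of _ V] conjI ballI allI)
    fix v assume "v \<in> V"
    then obtain c M where c: "v = comb c M" "\<forall>k\<ge>M. c k = 0" unfolding V_def by blast
    show "v \<in> Xs UNIV" using combX c(1) by blast
    show "\<delta> / 2 * nrm v \<le> norm (S (emb v))"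
      using lower[OF conjunct2[OF combX], of c M] norm_emb[OF Xs_c00[OF conjunct1[OF combX]], of c M] c(1) by simp
    show "(\<lambda>k. r * v k) \<in> V" for r
    proof -
      have "(\<lambda>k. r * v k) = comb (\<lambda>k. r * c k) M" unfolding c(1) comb_def by (simp add: sum_distrib_left mult.assoc)
      moreover have "\<forall>k\<ge>M. r * c k = 0" using c(2) by simp
      ultimately show ?thesis unfolding V_def by blast
    qed
    show "(\<lambda>k. v k + v' k) \<in> V" if v': "v' \<in> V" for v'
    proof -
      obtain c' M' where c': "v' = comb c' M'" "\<forall>k\<ge>M'. c' k = 0" using v' unfolding V_def by blast
      define N where "N = max M M'"
      have "v = comb c N" "v' = comb c' N"
        using c c' comb_ext[of M c N] comb_ext[of M' c' N] by (auto simp: N_def)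
      then have "(\<lambda>k. v k + v' k) = comb (\<lambda>k. c k + c' k) N"
        by (simp add: comb_def sum.distrib distrib_right)
      moreover have "\<forall>k\<ge>N. c k + c' k = 0" using c(2) c'(2) by (simp add: N_def)
      ultimately show ?thesis unfolding V_def by blast
    qed
  next
    fix N
    have "x N = comb (\<lambda>k. if k = N then 1 else 0) (Suc N)"
      unfolding comb_def by (intro ext) (simp add: if_distrib[of "\<lambda>c. c * _"] cong: if_cong)
    moreover have "\<forall>k\<ge>Suc N. (if k = N then 1 else 0 :: real) = 0" by simp
    ultimately have "x N \<in> V" unfolding V_def by blast
    moreover have "supp (x N) \<noteq> {}"
    proof
      assume "supp (x N) = {}"
      then have "w N = 0" by (simp add: w_def c00_embed_def)
      then show False using wn[of N] by simp
    qed
    moreover have "{q N..<q (Suc N)} \<subseteq> {N..}" using qge[of N] by auto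
    then have "x N \<in> Xs {N..}" by (rule Xs_mono[OF xX])
    ultimately show "\<exists>x\<in>V. supp x \<noteq> {} \<and> x \<in> Xs {N..}" by blast
  qed
qed

text \<open>The image of a normalised average has norm at least \<open>\<delta> / 2\<close>. Its
  parts before \<open>N\<close> and from \<open>M\<close> on cost \<open>\<delta> / 8\<close> each
  and \<open>separating_subset\<close> costs a factor 4, which leaves \<open>\<delta> / 16\<close>.
  Restricting the average to the remaining blocks only decreases squares, so it stays an
  average.\<close>

lemma separated_pair:
  assumes S: "linY K S" and diag: "\<And>k. Q {k} (S (u k)) = 0" and \<delta>: "0 < \<delta>"
    and V: "\<And>x. x \<in> V \<Longrightarrow> x \<in> Xs UNIV \<and> \<delta> / 2 * nrm x \<le> norm (S (emb x))"
      "\<And>x c. x \<in> V \<Longrightarrow> (\<lambda>k. c * x k) \<in> V" "\<And>x x'. x \<in> V \<Longrightarrow> x' \<in> V \<Longrightarrow> (\<lambda>k. x k + x' k) \<in> V"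
      "\<And>N. \<exists>x\<in>V. supp x \<noteq> {} \<and> x \<in> Xs {N..}"
  shows "\<exists>A B x v. finite A \<and> finite B \<and> A \<inter> B = {} \<and> A \<union> B \<subseteq> {N..} \<and> x \<in> Xs B \<and> v \<in> Xs A \<and>
    emb v = Q A (S (emb x)) \<and> avg (n J + 1) 20 (sq x) \<and> \<delta> / 16 \<le> nrm v"
proof -
  obtain M0 where M0: "\<forall>x\<in>Xs {M0..}. nrm x \<le> 1 \<longrightarrow> norm (Q {..<N} (S (emb x))) \<le> \<delta> / 8"
    using initial_tail[OF S, of "\<delta> / 8" N] \<delta> by auto
  define M1 where "M1 = max M0 N"
  \<comment> \<open>Translates blocks into coordinates: \<open>average_exists\<close> places a
    vector beyond a coordinate, \<open>initial_tail\<close> wants it beyond a block.\<close>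
  define N0 where "N0 = Suc (Max (insert 0 (blk {..<M1})))"
  have xfar: "x \<in> Xs {M1..}" if xU: "x \<in> Xs UNIV" and xN: "supp x \<subseteq> {N0..}" for x
  proof -
    have "supp x \<subseteq> blk {M1..}"
    proof
      fix i assume i: "i \<in> supp x"
      then obtain k where k: "i \<in> supp (y k)" using Xs_supp[OF xU] by (auto simp: blk_def)
      have "\<not> k < M1"
      proof
        assume "k < M1"
        then have "i \<in> blk {..<M1}" using k by (auto simp: blk_def)
        then have "i \<le> Max (insert 0 (blk {..<M1}))" using blk_finite[of "{..<M1}"] by (intro Max_ge) auto
        then show False using xN i by (auto simp: N0_def)
      qed
      then show "i \<in> blk {M1..}" using k by (auto simp: blk_def)
    qed
    then show ?thesis using xU by (auto simp: Xs_def)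
  qed
  have "\<exists>x\<in>V. supp x \<subseteq> {N0..} \<and> nrm x = 1 \<and> avg (n J + 1) 20 (sq x)"
  proof (rule average_exists)
    show "finite (supp x) \<and> supp x \<subseteq> {1..}" if "x \<in> V" for x using V(1)[OF that] c00D Xs_c00 by blast
    show "\<exists>x\<in>V. supp x \<noteq> {} \<and> supp x \<subseteq> {N..}" for N
    proof -
      obtain x where x: "x \<in> V" "supp x \<noteq> {}" "x \<in> Xs {N..}" using V(4) by blast
      have "blk {N..} \<subseteq> {N..}" unfolding blk_def using y_ge by fastforce
      then show ?thesis using x Xs_supp[OF x(3)] by blast
    qed
  qed (use V in auto)
  then obtain x where x: "x \<in> V" "supp x \<subseteq> {N0..}" "nrm x = 1" "avg (n J + 1) 20 (sq x)" by blast
  have xU: "x \<in> Xs UNIV" using V(1)[OF x(1)] by blast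
  have xM: "x \<in> Xs {M1..}" by (rule xfar[OF xU x(2)])
  obtain M2 where M2: "x \<in> Xs {..<M2}" using Xs_bounded[OF xU] by blast
  define z where "z = S (emb x)"
  have zY: "z \<in> Y" unfolding z_def by (rule linYD(1)[OF S Xs_Y[OF xU]])
  obtain M3 where M3: "\<forall>M\<ge>M3. norm (z - Q {..<M} z) \<le> \<delta> / 8" using Q_tail[OF zY, of "\<delta> / 8"] \<delta> by auto
  define M where "M = max (max M2 M3) N"
  define \<Omega> where "\<Omega> = {N..<M}"
  have x\<Omega>: "x \<in> Xs \<Omega>"
  proof -
    have "supp x \<subseteq> blk {M1..} \<inter> blk {..<M2}" using Xs_supp[OF xM] Xs_supp[OF M2] by blast
    also have "\<dots> \<subseteq> blk \<Omega>" unfolding blk_def \<Omega>_def M_def M1_def using y_disjoint by fastforce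
    finally show ?thesis using xU by (auto simp: Xs_def)
  qed
  have "\<delta> / 2 \<le> norm z" using V(1)[OF x(1)] x(3) by (simp add: z_def)
  moreover have "norm (z - Q {..<M} z) \<le> \<delta> / 8" using M3 by (simp add: M_def)
  moreover have "norm (Q {..<N} z) \<le> \<delta> / 8"
    using M0 Xs_mono[OF xM, of "{M0..}"] x(3) by (simp add: z_def M1_def)
  moreover have "Q {..<M} z = Q {..<N} z + Q \<Omega> z"
  proof -
    have "{..<M} = {..<N} \<union> \<Omega>" by (auto simp: \<Omega>_def M_def)
    moreover have "{..<N} \<inter> \<Omega> = {}" by (auto simp: \<Omega>_def)
    ultimately show ?thesis using Q_Un[OF zY, of "{..<N}" \<Omega>] by simp
  qed
  ultimately have big: "\<delta> / 4 \<le> norm (Q \<Omega> z)"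
    using norm_triangle_ineq[of "z - Q {..<M} z" "Q {..<M} z"] norm_triangle_ineq[of "Q {..<N} z" "Q \<Omega> z"] by simp
  have fin\<Omega>: "finite \<Omega>" by (simp add: \<Omega>_def)
  obtain A where A: "A \<subseteq> \<Omega>" "norm (Q \<Omega> z) \<le> 4 * norm (Q A (S (emb (rst (blk (\<Omega> - A)) x))))"
    using separating_subset[OF S diag fin\<Omega> x\<Omega>] unfolding z_def by blast
  define x' where "x' = rst (blk (\<Omega> - A)) x"
  have x': "x' \<in> Xs (\<Omega> - A)" unfolding x'_def by (rule Xs_rst[OF xU])
  have finA: "finite A" using A(1) fin\<Omega> finite_subset by blast
  obtain v where v: "v \<in> Xs A" "emb v = Q A (S (emb x'))"
    using Q_finite[OF finA linYD(1)[OF S Xs_Y[OF x']]] by blast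
  have "\<delta> / 16 \<le> nrm v" using big A(2) v(2) norm_emb[OF Xs_c00[OF v(1)]] by (simp add: x'_def)
  moreover have "avg (n J + 1) 20 (sq x')"
  proof (rule avg_le[OF x(4)])
    show "finite (supp (sq x))" using c00D(1)[OF Xs_c00[OF xU]] by simp
  qed (auto simp: x'_def sq_def rst_def)
  moreover have "A \<union> (\<Omega> - A) \<subseteq> {N..}" using A(1) by (auto simp: \<Omega>_def)
  ultimately show ?thesis using finA fin\<Omega> x' v by (intro exI[of _ A] exI[of _ "\<Omega> - A"] exI[of _ x'] exI[of _ v]) auto
qed

section \<open>Lists of separated pieces, and the final contradiction\<close>

definition vsum :: "(nat set \<times> nat set \<times> (nat \<Rightarrow> real) \<times> (nat \<Rightarrow> real)) list \<Rightarrow> nat \<Rightarrow> real" where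
  "vsum L = (\<lambda>k. \<Sum>(A, B, x, v)\<leftarrow>L. x k)"

definition wsum :: "(nat set \<times> nat set \<times> (nat \<Rightarrow> real) \<times> (nat \<Rightarrow> real)) list \<Rightarrow> nat \<Rightarrow> real" where
  "wsum L = (\<lambda>k. \<Sum>(A, B, x, v)\<leftarrow>L. v k)"

text \<open>The pieces are kept in a list because \<open>wsum L\<close> is not the image of
  \<open>vsum L\<close> under one operator \<open>Q A\<close> after \<open>S\<close>: every piece is
  cut by its own \<open>A\<close>. \<open>block_diagonal\<close> needs the separate entries, and
  adding two pairs is concatenation.\<close>

definition good :: "('a \<Rightarrow> 'a) \<Rightarrow> (nat set \<times> nat set \<times> (nat \<Rightarrow> real) \<times> (nat \<Rightarrow> real)) list \<Rightarrow> bool" where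
  "good S L \<longleftrightarrow> (\<forall>(A, B, x, v)\<in>set L. finite A \<and> finite B \<and> A \<inter> B = {} \<and> x \<in> Xs B \<and> v \<in> Xs A \<and>
       emb v = Q A (S (emb x))) \<and>
     sorted_wrt (\<lambda>(A, B, x, v) (A', B', x', v'). (A \<union> B) \<inter> (A' \<union> B') = {}) L"

definition ixA :: "(nat set \<times> nat set \<times> (nat \<Rightarrow> real) \<times> (nat \<Rightarrow> real)) list \<Rightarrow> nat set" where
  "ixA L = (\<Union>(A, B, x, v)\<in>set L. A)"

definition ixB :: "(nat set \<times> nat set \<times> (nat \<Rightarrow> real) \<times> (nat \<Rightarrow> real)) list \<Rightarrow> nat set" where
  "ixB L = (\<Union>(A, B, x, v)\<in>set L. B)"

lemma good_sums:
  assumes "good S L"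
  shows "vsum L \<in> Xs (ixB L) \<and> wsum L \<in> Xs (ixA L) \<and> emb (vsum L) = (\<Sum>(A, B, w)\<leftarrow>map (\<lambda>(A, B, x, v). (A, B, emb x)) L. w) \<and>
    emb (wsum L) = (\<Sum>(A, B, w)\<leftarrow>map (\<lambda>(A, B, x, v). (A, B, emb x)) L. Q A (S w)) \<and> finite (ixA L) \<and> finite (ixB L) \<and> ixA L \<inter> ixB L = {}"
  using assms
proof (induction L)
  case Nil
  then show ?case
    by (simp add: vsum_def wsum_def ixA_def ixB_def Xs_def c00_def c00_embed_def span_zero)
next
  case (Cons t L)
  obtain A B x v where t: "t = (A, B, x, v)" by (cases t)
  have IH: "vsum L \<in> Xs (ixB L)" "wsum L \<in> Xs (ixA L)"
    "emb (vsum L) = (\<Sum>(A, B, w)\<leftarrow>map (\<lambda>(A, B, x, v). (A, B, emb x)) L. w)"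
    "emb (wsum L) = (\<Sum>(A, B, w)\<leftarrow>map (\<lambda>(A, B, x, v). (A, B, emb x)) L. Q A (S w))"
    "finite (ixA L)" "finite (ixB L)" "ixA L \<inter> ixB L = {}"
    using Cons by (auto simp: good_def)
  have tt: "finite A" "finite B" "A \<inter> B = {}" "x \<in> Xs B" "v \<in> Xs A" "emb v = Q A (S (emb x))"
    using Cons.prems t by (auto simp: good_def)
  have disj: "(A \<union> B) \<inter> (ixA L \<union> ixB L) = {}"
    using Cons.prems t unfolding good_def ixA_def ixB_def by fastforce
  have ix: "ixA (t # L) = A \<union> ixA L" "ixB (t # L) = B \<union> ixB L" by (simp_all add: ixA_def ixB_def t)
  have vs: "vsum (t # L) = (\<lambda>k. x k + vsum L k)" "wsum (t # L) = (\<lambda>k. v k + wsum L k)"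
    by (simp_all add: vsum_def wsum_def t)
  have "vsum (t # L) \<in> Xs (ixB (t # L))" unfolding vs ix
    by (intro Xs_add Xs_mono[OF tt(4)] Xs_mono[OF IH(1)]) auto
  moreover have "wsum (t # L) \<in> Xs (ixA (t # L))" unfolding vs ix
    by (intro Xs_add Xs_mono[OF tt(5)] Xs_mono[OF IH(2)]) auto
  moreover have "emb (vsum (t # L)) = emb x + emb (vsum L)"
    unfolding vs by (rule c00_embed_add[OF Xs_c00[OF tt(4)] Xs_c00[OF IH(1)]])
  moreover have "emb (wsum (t # L)) = emb v + emb (wsum L)"
    unfolding vs by (rule c00_embed_add[OF Xs_c00[OF tt(5)] Xs_c00[OF IH(2)]])
  moreover have "ixA (t # L) \<inter> ixB (t # L) = {}" unfolding ix using disj tt(3) IH(7) by blast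
  ultimately show ?case using IH(3-6) tt(1,2,6) ix by (simp add: t)
qed

lemma good_bound:
  assumes S: "linY K S" and L: "good S L"
  shows "nrm (wsum L) \<le> K * nrm (vsum L)"
proof -
  let ?L = "map (\<lambda>(A, B, x, v). (A, B, emb x)) L"
  note g = good_sums[OF L]
  have "norm (Q {} (S 0) + (\<Sum>(A, B, w)\<leftarrow>?L. Q A (S w))) \<le> K * norm (0 + (\<Sum>(A, B, w)\<leftarrow>?L. w))"
  proof (rule block_diagonal[OF S, where ?B0.0="{}"])
    show "(0::'a) \<in> Y" by (rule subspace_0[OF subspace_Y])
    show "Q {} 0 = 0" by (rule Q_zero)
    show "w \<in> Y \<and> Q B w = w \<and> (A \<union> B) \<inter> ({} \<union> {}) = {}" if "(A, B, w) \<in> set ?L" for A B w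
    proof -
      obtain x v where x: "(A, B, x, v) \<in> set L" "w = emb x" using \<open>(A, B, w) \<in> set ?L\<close> by auto
      then have "x \<in> Xs B" using L by (auto simp: good_def)
      then show ?thesis using Xs_Y Xs_Q[of x B B] x(2) by auto
    qed
    show "sorted_wrt (\<lambda>(A, B, w) (A', B', w'). (A \<union> B) \<inter> (A' \<union> B') = {}) ?L"
      using L unfolding good_def sorted_wrt_map by (auto elim!: sorted_wrt_mono_rel[rotated])
  qed
  moreover have "Q {} (S 0) = 0" using linYD(6)[OF S] Q_zero by simp
  ultimately have "norm (emb (wsum L)) \<le> K * norm (emb (vsum L))" using g by simp
  then show ?thesis using g norm_emb Xs_c00 by metis
qed

theorem not_bounded_below:
  assumes S: "linY K S" and diag: "\<And>k. Q {k} (S (u k)) = 0"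
    and Z: "subspace Z" "Z \<subseteq> Y" "infinite_dimensional Z"
    and \<delta>: "0 < \<delta>" "\<And>z. z \<in> Z \<Longrightarrow> \<delta> * norm z \<le> norm (S z)"
  shows False
proof -
  obtain V where V: "\<forall>x\<in>V. x \<in> Xs UNIV \<and> \<delta> / 2 * nrm x \<le> norm (S (emb x))"
    "\<forall>x\<in>V. \<forall>c. (\<lambda>k. c * x k) \<in> V" "\<forall>x\<in>V. \<forall>x'\<in>V. (\<lambda>k. x k + x' k) \<in> V"
    "\<forall>N. \<exists>x\<in>V. supp x \<noteq> {} \<and> x \<in> Xs {N..}"
    using perturbed_subspace[OF Z S \<delta>] by blast
  define P where "P a b E F \<longleftrightarrow> (\<exists>L. good S L \<and> a = sq (vsum L) \<and> b = sq (wsum L) \<and> E = blk (ixA L) \<and>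
      F = blk (ixA L \<union> ixB L))" for a b E F
  \<comment> \<open>The constants refer to squares of norms: 20 comes from
    \<open>average_exists\<close>, the bound \<open>K\<close> is squared, and some functional
    attains at least half of the squared norm of \<open>v\<close>, which is at least
    \<open>(\<delta> / 16)\<^sup>2\<close>.\<close>
  interpret wh_pairs m n N1 N2 \<sigma> P 20 "(\<delta> / 16)\<^sup>2 / 2" "K\<^sup>2"
  proof unfold_locales
    fix a b E F assume "P a b E F"
    then obtain L where L: "good S L" "a = sq (vsum L)" "b = sq (wsum L)" "E = blk (ixA L)"
      "F = blk (ixA L \<union> ixB L)" unfolding P_def by blast
    note g = good_sums[OF L(1)]
    have sv: "supp (vsum L) \<subseteq> blk (ixB L)" "supp (wsum L) \<subseteq> blk (ixA L)" using g Xs_supp by auto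
    have disj: "blk (ixA L) \<inter> blk (ixB L) = {}" using g blk_disjoint by blast
    show "0 \<le> a k \<and> 0 \<le> b k" for k by (simp add: L sq_def)
    have "finite F" unfolding L(5) using g by (intro blk_finite) auto
    moreover have "F \<subseteq> {1..}" unfolding L(5) blk_def using c00D(2)[OF y_c00] by blast
    ultimately show "finite F \<and> F \<subseteq> {1..} \<and> E \<subseteq> F \<and> supp a \<subseteq> F - E \<and> supp b \<subseteq> E"
      unfolding L(2-5) blk_Un supp_sq using sv disj by blast
    show "P (\<lambda>k. c * a k) (\<lambda>k. c * b k) E F" if c: "0 \<le> c" for c
    proof -
      \<comment> \<open>Pairs consist of squares, so a factor \<open>c\<close> means scaling the
        vectors by \<open>sqrt c\<close>.\<close>
      define L' where "L' = map (\<lambda>(A, B, x, v). (A, B, \<lambda>k. sqrt c * x k, \<lambda>k. sqrt c * v k)) L"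
      have "good S L'"
        unfolding good_def
      proof
        show "\<forall>(A, B, x, v)\<in>set L'. finite A \<and> finite B \<and> A \<inter> B = {} \<and> x \<in> Xs B \<and> v \<in> Xs A \<and> emb v = Q A (S (emb x))"
        proof
          fix t assume "t \<in> set L'"
          then obtain A B x v where t: "t = (A, B, \<lambda>k. sqrt c * x k, \<lambda>k. sqrt c * v k)" "(A, B, x, v) \<in> set L"
            unfolding L'_def by auto
          have p: "finite A" "finite B" "A \<inter> B = {}" "x \<in> Xs B" "v \<in> Xs A" "emb v = Q A (S (emb x))"
            using L(1) t(2) by (auto simp: good_def)
          have "emb (\<lambda>k. sqrt c * v k) = sqrt c *\<^sub>R emb v" by (rule c00_embed_scale[OF Xs_c00[OF p(5)]])
          also have "\<dots> = Q A (S (sqrt c *\<^sub>R emb x))" using p(6) linYD(3)[OF S Xs_Y[OF p(4)]] by (simp add: Q_scale)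
          also have "sqrt c *\<^sub>R emb x = emb (\<lambda>k. sqrt c * x k)" by (rule c00_embed_scale[OF Xs_c00[OF p(4)], symmetric])
          finally have "emb (\<lambda>k. sqrt c * v k) = Q A (S (emb (\<lambda>k. sqrt c * x k)))" .
          then show "case t of (A, B, x, v) \<Rightarrow> finite A \<and> finite B \<and> A \<inter> B = {} \<and> x \<in> Xs B \<and> v \<in> Xs A \<and> emb v = Q A (S (emb x))"
            using p Xs_scale t(1) by simp
        qed
        show "sorted_wrt (\<lambda>(A, B, x, v) (A', B', x', v'). (A \<union> B) \<inter> (A' \<union> B') = {}) L'"
          using L(1) unfolding good_def L'_def sorted_wrt_map by (auto elim!: sorted_wrt_mono_rel[rotated])
      qed
      moreover have "vsum L' = (\<lambda>k. sqrt c * vsum L k)" "wsum L' = (\<lambda>k. sqrt c * wsum L k)"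
        unfolding vsum_def wsum_def L'_def
        by (simp_all add: sum_list_const_mult[symmetric] comp_def case_prod_unfold)
      then have "sq (vsum L') = (\<lambda>k. c * a k)" "sq (wsum L') = (\<lambda>k. c * b k)"
        using c by (simp_all add: sq_scale L)
      moreover have "ixA L' = ixA L" "ixB L' = ixB L" unfolding ixA_def ixB_def L'_def by (auto simp: case_prod_unfold)
      ultimately show ?thesis unfolding P_def L(4,5) by metis
    qed
    show "pr g b \<le> K\<^sup>2 * c" if c: "\<And>g. kf g \<Longrightarrow> pr g a \<le> c" and gk: "kf g" for c g
    proof -
      have fin: "finite (supp (vsum L))" "finite (supp (wsum L))" using g c00D(1) Xs_c00 by blast+
      have c0: "0 \<le> c" using c[OF kf_zero] by (simp add: pr_def)
      have "nrm (vsum L) \<le> sqrt c" using c c0 L(2) by (intro wh_norm_le[OF fin(1)]) auto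
      then have "(nrm (vsum L))\<^sup>2 \<le> c" using c0 wh_norm_ge(2)[OF fin(1) kf_zero] power_mono[of "nrm (vsum L)" "sqrt c" 2] by simp
      have "pr g b \<le> (nrm (wsum L))\<^sup>2" unfolding L(3) by (rule wh_norm_ge(1)[OF fin(2) gk])
      also have "\<dots> \<le> (K * nrm (vsum L))\<^sup>2"
        using good_bound[OF S L(1)] wh_norm_ge(2)[OF fin(2) kf_zero] by (intro power_mono)
      also have "\<dots> \<le> K\<^sup>2 * c" using \<open>(nrm (vsum L))\<^sup>2 \<le> c\<close> by (simp add: power_mult_distrib mult_left_mono)
      finally show ?thesis .
    qed
    show "P (\<lambda>k. a k + a' k) (\<lambda>k. b k + b' k) (E \<union> E') (F \<union> F')" if "P a' b' E' F'" and FF: "F \<inter> F' = {}" for a' b' E' F'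
    proof -
      obtain L' where L': "good S L'" "a' = sq (vsum L')" "b' = sq (wsum L')" "E' = blk (ixA L')"
        "F' = blk (ixA L' \<union> ixB L')" using \<open>P a' b' E' F'\<close> unfolding P_def by blast
      note g' = good_sums[OF L'(1)]
      have dj: "(ixA L \<union> ixB L) \<inter> (ixA L' \<union> ixB L') = {}" using FF unfolding L(5) L'(5) blk_disjoint[symmetric] .
      have "good S (L @ L')"
        unfolding good_def sorted_wrt_append set_append
      proof (intro conjI ballI)
        fix t t' assume tt: "t \<in> set L" "t' \<in> set L'"
        obtain A B x v A' B' x' v' where t: "t = (A, B, x, v)" "t' = (A', B', x', v')"
          by (cases t; cases t')
        have "A \<union> B \<subseteq> ixA L \<union> ixB L" "A' \<union> B' \<subseteq> ixA L' \<union> ixB L'"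
          using tt unfolding t ixA_def ixB_def by auto
        then show "(case t of (A, B, x, v) \<Rightarrow> \<lambda>(A', B', x', v'). (A \<union> B) \<inter> (A' \<union> B') = {}) t'"
          unfolding t prod.case using dj by blast
      qed (use L(1) L'(1) in \<open>auto simp: good_def\<close>)
      moreover have "ixA (L @ L') = ixA L \<union> ixA L'" "ixB (L @ L') = ixB L \<union> ixB L'" by (auto simp: ixA_def ixB_def)
      moreover have "vsum (L @ L') = (\<lambda>k. vsum L k + vsum L' k)" "wsum (L @ L') = (\<lambda>k. wsum L k + wsum L' k)"
        by (simp_all add: vsum_def wsum_def)
      moreover have "supp (vsum L) \<inter> supp (vsum L') = {}" "supp (wsum L) \<inter> supp (wsum L') = {}"
      proof -
        have "supp (vsum L') \<subseteq> F'" "supp (wsum L') \<subseteq> F'"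
          using Xs_supp[of "vsum L'" "ixB L'"] Xs_supp[of "wsum L'" "ixA L'"] g' unfolding L'(5) blk_Un by auto
        moreover have "supp (vsum L) \<subseteq> F" "supp (wsum L) \<subseteq> F" using sv unfolding L(5) blk_Un by auto
        ultimately show "supp (vsum L) \<inter> supp (vsum L') = {}" "supp (wsum L) \<inter> supp (wsum L') = {}"
          using FF by blast+
      qed
      ultimately show ?thesis
        unfolding P_def L(2-5) L'(2-5) by (intro exI[of _ "L @ L'"]) (simp add: sq_add_disjoint blk_Un Un_ac)
    qed
  next
    show "0 < (\<delta> / 16)\<^sup>2 / 2" using \<delta> by simp
    show "\<exists>a b E F. P a b E F \<and> F \<subseteq> {N..} \<and> avg (n J + 1) 20 a \<and> (\<exists>g. kf g \<and> (\<delta> / 16)\<^sup>2 / 2 \<le> pr g b)" for N J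
    proof -
      obtain A B x v where *: "finite A" "finite B" "A \<inter> B = {}" "A \<union> B \<subseteq> {N..}" "x \<in> Xs B" "v \<in> Xs A"
        "emb v = Q A (S (emb x))" "avg (n J + 1) 20 (sq x)" "\<delta> / 16 \<le> nrm v"
      proof -
        have "\<exists>A B x v. finite A \<and> finite B \<and> A \<inter> B = {} \<and> A \<union> B \<subseteq> {N..} \<and> x \<in> Xs B \<and> v \<in> Xs A \<and>
            emb v = Q A (S (emb x)) \<and> avg (n J + 1) 20 (sq x) \<and> \<delta> / 16 \<le> nrm v"
          by (rule separated_pair[OF S diag \<delta>(1), of V]) (use V in blast)+
        then show thesis by (elim exE conjE) (rule that)
      qed
      have "good S [(A, B, x, v)]" using * by (simp add: good_def)
      then have "P (sq x) (sq v) (blk A) (blk (A \<union> B))"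
        unfolding P_def by (intro exI[of _ "[(A, B, x, v)]"]) (simp add: vsum_def wsum_def ixA_def ixB_def)
      moreover have "blk (A \<union> B) \<subseteq> {N..}"
      proof
        fix i assume "i \<in> blk (A \<union> B)"
        then obtain k where "k \<in> A \<union> B" "i \<in> supp (y k)" by (auto simp: blk_def)
        then show "i \<in> {N..}" using *(4) y_ge[of i k] by fastforce
      qed
      moreover have "\<exists>g. kf g \<and> (\<delta> / 16)\<^sup>2 / 2 \<le> pr g (sq v)"
      proof -
        have "0 < nrm v" using *(9) \<delta>(1) by linarith
        then obtain g where "kf g" "(nrm v)\<^sup>2 / 2 \<le> pr g (sq v)"
          using nrm_attained_half[OF c00D(1)[OF Xs_c00[OF *(6)]]] by blast
        moreover have "(\<delta> / 16)\<^sup>2 \<le> (nrm v)\<^sup>2" using *(9) \<delta>(1) by (intro power_mono) auto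
        ultimately show ?thesis by (intro exI[of _ g]) auto
      qed
      ultimately show ?thesis using *(8) by blast
    qed
  qed
  show False by (rule no_pairs)
qed

lemma diagonal_part:
  assumes T: "bounded_operator_on Y T"
  shows "\<exists>D S. diagonal_operator_on Y u D \<and> strictly_singular_on Y S \<and> (\<forall>z\<in>Y. T z = D z + S z)"
proof -
  obtain K where K: "\<And>z. z \<in> Y \<Longrightarrow> norm (T z) \<le> K * norm z"
    using T unfolding bounded_operator_on_def by blast
  have TY: "T z \<in> Y" if "z \<in> Y" for z using T that by (auto simp: bounded_operator_on_def)
  have Tadd: "T (z + w) = T z + T w" if "z \<in> Y" "w \<in> Y" for z w using T that by (auto simp: bounded_operator_on_def)
  have Tsc: "T (c *\<^sub>R z) = c *\<^sub>R T z" if "z \<in> Y" for c z using T that by (auto simp: bounded_operator_on_def)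
  have un: "norm (u k) = 1" for k by (simp add: u_def normalised)
  define \<mu> where "\<mu> k = (SOME c. Q {k} (T (u k)) = c *\<^sub>R u k)" for k
  have \<mu>: "Q {k} (T (u k)) = \<mu> k *\<^sub>R u k" for k
    unfolding \<mu>_def using someI_ex[OF Q_single[OF TY[OF u_Y]]] .
  have \<mu>b: "\<forall>k. \<bar>\<mu> k\<bar> \<le> K"
  proof
    fix k
    have "\<bar>\<mu> k\<bar> = norm (Q {k} (T (u k)))" unfolding \<mu> using un by simp
    also have "\<dots> \<le> norm (T (u k))" by (rule Q_norm)
    also have "\<dots> \<le> K" using K[OF u_Y, of k] un by simp
    finally show "\<bar>\<mu> k\<bar> \<le> K" .
  qed
  define D where "D = Mul \<mu>"
  have Dlin: "linear D" unfolding D_def by (rule bounded_linear.linear[OF Mul(1)[OF \<mu>b]])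
  have Du: "D (u k) = \<mu> k *\<^sub>R u k" for k unfolding D_def by (rule Mul_u[OF \<mu>b])
  have DY: "D z \<in> Y" if "z \<in> Y" for z unfolding D_def by (rule Mul_Y[OF \<mu>b that])
  have Dn: "norm (D z) \<le> K * norm z" for z unfolding D_def by (rule Mul(3)[OF \<mu>b \<mu>b])
  have "bounded_operator_on Y D"
    unfolding bounded_operator_on_def using DY Dn by (auto simp: linear_add[OF Dlin] linear_scale[OF Dlin])
  then have "diagonal_operator_on Y u D" unfolding diagonal_operator_on_def using Du by blast
  moreover define S where "S z = T z - D z" for z
  have S: "linY (2 * K) S"
    unfolding linY_def
  proof (intro conjI ballI allI)
    fix z assume z: "z \<in> Y"
    show "S z \<in> Y" unfolding S_def using TY[OF z] DY[OF z] by (rule subspace_diff[OF subspace_Y])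
    show "S (z + w) = S z + S w" if "w \<in> Y" for w
      unfolding S_def Tadd[OF z that] linear_add[OF Dlin] by simp
    show "S (c *\<^sub>R z) = c *\<^sub>R S z" for c
      unfolding S_def Tsc[OF z] linear_scale[OF Dlin] by (simp add: scaleR_right_diff_distrib)
    show "norm (S z) \<le> 2 * K * norm z"
      unfolding S_def using norm_triangle_ineq4[of "T z" "D z"] K[OF z] Dn[of z] by linarith
  qed
  have diag: "Q {k} (S (u k)) = 0" for k
    unfolding S_def by (simp add: Q_diff \<mu> Du Q_scale Q_u)
  have "strictly_singular_on Y S"
    unfolding strictly_singular_on_def
  proof (intro conjI allI impI)
    show "bounded_operator_on Y S" using S unfolding linY_def bounded_operator_on_def by blast
    fix Z assume Z: "subspace Z \<and> Z \<subseteq> Y \<and> infinite_dimensional Z"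
    show "\<not> (\<exists>R. homeomorphism Z (S ` Z) S R)"
    proof
      assume "\<exists>R. homeomorphism Z (S ` Z) S R"
      then obtain R where R: "continuous_on (S ` Z) R" "\<And>z. z \<in> Z \<Longrightarrow> R (S z) = z"
        by (auto simp: homeomorphism_def)
      have S0: "S 0 = 0" by (rule linYD(6)[OF S])
      have Z0: "0 \<in> Z" using Z subspace_0 by blast
      have "R 0 = 0" "0 \<in> S ` Z" using R(2)[OF Z0] S0 Z0 by (metis, metis image_eqI)
      \<comment> \<open>Continuity of the inverse at 0 with tolerance 1 gives a lower bound for
        \<open>S\<close> on \<open>Z\<close> by homogeneity: a unit vector \<open>z'\<close> with
        \<open>norm (S z') < \<eta>\<close> would satisfy \<open>norm (R (S z')) < 1\<close>,
        although \<open>R (S z') = z'\<close>.\<close>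
      then obtain \<eta> where \<eta>: "0 < \<eta>" "\<And>v. v \<in> S ` Z \<Longrightarrow> norm v < \<eta> \<Longrightarrow> norm (R v) < 1"
        using R(1) unfolding continuous_on_iff by (metis dist_0_norm dist_commute zero_less_one)
      have "\<eta> * norm z \<le> norm (S z)" if z: "z \<in> Z" for z
      proof (rule ccontr)
        assume "\<not> ?thesis"
        then have lt: "norm (S z) < \<eta> * norm z" by simp
        then have nz: "0 < norm z" using norm_ge_zero[of "S z"] \<eta>(1) by (metis mult_zero_right norm_ge_zero order_le_less_trans order_less_le)
        define z' where "z' = (1 / norm z) *\<^sub>R z"
        have z': "z' \<in> Z" "norm z' = 1" unfolding z'_def using z nz Z subspace_scale by auto
        have zY: "z \<in> Y" using z Z by blast
        have "S z' = (1 / norm z) *\<^sub>R S z" unfolding z'_def by (rule linYD(3)[OF S zY])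
        then have "norm (S z') = norm (S z) / norm z" by simp
        also have "\<dots> < \<eta>" using lt nz by (simp add: pos_divide_less_eq)
        finally have "norm (R (S z')) < 1" using \<eta>(2) z'(1) by blast
        then show False using R(2)[OF z'(1)] z'(2) by simp
      qed
      then show False using not_bounded_below[OF S diag _ _ _ \<eta>(1), of Z] Z by blast
    qed
  qed
  moreover have "\<forall>z\<in>Y. T z = D z + S z" by (simp add: S_def)
  ultimately show ?thesis by blast
qed

end

theorem proposition7p6:
  fixes m n :: "nat \<Rightarrow> nat"
    and N1 N2 :: "nat set"
    and \<sigma> :: "(nat set \<times> nat) list \<Rightarrow> nat"
    and e :: "nat \<Rightarrow> 'a::banach"
    and y :: "nat \<Rightarrow> nat \<Rightarrow> real"
    and Y :: "'a set"
    and T :: "'a \<Rightarrow> 'a"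
  assumes "wh_parameters m n N1 N2 \<sigma>"
    and "is_completion_of_c00 (wh_norm m n N1 N2 \<sigma>) e"
    and "block_sequence y"
    and "\<And>k. norm (c00_embed e (y k)) = 1"
    and "Y = closure (span (range (\<lambda>k. c00_embed e (y k))))"
    and "bounded_operator_on Y T"
  shows "\<exists>D S. diagonal_operator_on Y (\<lambda>k. c00_embed e (y k)) D \<and>
               strictly_singular_on Y S \<and>
               (\<forall>u\<in>Y. T u = D u + S u)"
proof -
  interpret wh: wh_space m n N1 N2 \<sigma> e y
    using assms(1-4) by (simp add: wh_space_def wh_space_axioms_def)
  have u: "wh.u = (\<lambda>k. c00_embed e (y k))" by (simp add: wh.u_def fun_eq_iff)
  then have "wh.Y = Y" using assms(5) by (simp add: wh.Y_def)
  then show ?thesis using wh.diagonal_part[of T] assms(6) u by simp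
qed

end
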